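(* Let $\lambda,\mu,\theta\in(0,\infty)$, $T\in(0,\infty)$, and let $(X^n,Y^n)$, $n\in\mathbb{N}$, be the rescaled number-in-system and reneging-count processes on $[0,T]$ of the $n$-th M/M/1+M system defined in the context, with $(X^n(0),Y^n(0))=(x_n,0)$ and $x_n\to x_0$ as $n\to\infty$. Then the sequence $\{(X^n,Y^n)\}_{n\in\mathbb{N}}$ satisfies a large deviation principle (with speed $n$) on $\mathcal{D}([0,T]:\mathbb{R}_+^2)$ with rate function $I_T$ defined in the context.
   Context: $\mathcal{D}([0,T]:\mathbb{R}^d)$ (resp. $\mathcal{C}([0,T]:\mathbb{R}^d)$) is the space of right continuous functions with left limits (resp. continuous functions) from $[0,T]$ to $\mathbb{R}^d$, with the Skorohod (resp. uniform) topology. A function $I:\mathcal{E}\to[0,\infty]$ on a Polish space $\mathcal{E}$ is called a rate function if $\{x: I(x)\le m\}$ is compact for every $m<\infty$. Processes. For each $n$ let $N_1^n,N_2^n,N_3^n$ be mutually independent Poisson random measures on $[0,T]$, $[0,T]$, $[0,T]\times\mathbb{R}_+$ with intensities $n\lambda\,ds$, $n\mu\,ds$, $n\theta\,ds\,dy$ respectively. Let $x_n\ge 0$ with $nx_n\in\mathbb{Z}_+$, and $x_n\to x_0\in\mathbb{R}_+$. The processes $(X^n,Y^n)$ are given by $$X^{n}(t)=x_{n}+\frac1n\int_{[0,t]}N_{1}^{n}(ds)-\frac1n\int_{[0,t]}\mathbf{1}_{\{X^{n}(s-)\neq 0\}}N_{2}^{n}(ds)-Y^n(t),$$ $$Y^{n}(t)=\frac1n\int_{[0,t]\times\mathbb{R}_+}\mathbf{1}_{[0,(X^{n}(s-)-\frac1n)^{+}]}(y)\,N_{3}^{n}(ds\,dy),\quad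 t\in[0,T].$$ (That is, $nX^n$ is the number of customers in a single server queue with arrival rate $\lambda n$, service rate $\mu n$ and per-customer reneging rate $\theta$ for customers waiting in the queue; $nY^n$ is the cumulative number of reneging customers.) Rate function. Let $\ell(x)=x\log x-x+1$ for $x\ge 0$ (with $\ell(0)=1$), and let $\Gamma$ be the one-dimensional Skorohod map $\Gamma(\psi)(t)=\psi(t)-\inf_{0\le s\le t}[\psi(s)\wedge 0]$. For $(\xi,\zeta)\in\mathcal{C}([0,T]:\mathbb{R}_+^2)$ let $\mathcal{U}(\xi,\zeta)$ be the collection of all $\varphi=(\varphi_1,\varphi_2,\varphi_3)$ of measurable maps $\varphi_i:[0,T]\to\mathbb{R}_+$ such that for all $t\in[0,T]$ $$\xi(t)=\Gamma\Big(x_0+\lambda\int_0^{\cdot}\varphi_1(s)ds-\mu\int_0^{\cdot}\varphi_2(s)ds-\theta\int_0^{\cdot}\varphi_3(s)\xi(s)ds\Big)(t),\qquad \zeta(t)=\theta\int_0^t\varphi_3(s)\xi(s)ds.$$ Define $$I_T(\xi,\zeta)=\inf_{\varphi\in\mathcal{U}(\xi,\zeta)}\Big\{\lambda\int_0^T\ell(\varphi_1(s))ds+\mu\int_0^T\ell(\varphi_2(s))ds+\theta\int_0^T\xi(s)\ell(\varphi_3(s))ds\Big\},$$ with $I_T(\xi,\zeta)=\infty$ if $\mathcal{U}(\xi,\zeta)=\emptyset$ or $(\xi,\zeta)\in\mathcal{D}([0,T]:\mathbb{R}_+^2)\setminus\mathcal{C}([0,T]:\mathbb{R}_+^2)$.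 *)

theory Defs
  imports "HOL-Probability.Probability"
begin

section \<open>Cadlag paths and the Skorohod topology\<close>

text \<open>Paths on \<open>[0,T]\<close> are extensional functions, so that equality of paths is equality of
  functions.\<close>

definition cadlag_space :: "real \<Rightarrow> 'a::topological_space set \<Rightarrow> (real \<Rightarrow> 'a) set" where
  "cadlag_space T S =
     {f \<in> {0..T} \<rightarrow>\<^sub>E S.
        (\<forall>t\<in>{0..<T}. (f \<longlongrightarrow> f t) (at_right t)) \<and>
        (\<forall>t\<in>{0<..T}. \<exists>l\<in>S. (f \<longlongrightarrow> l) (at_left t))}"

text \<open>Monotone surjections of an interval are automatically continuous.\<close>

definition time_changes :: "real \<Rightarrow> (real \<Rightarrow> real) set" where
  "time_changes T = {\<gamma>. strict_mono_on {0..T} \<gamma> \<and> \<gamma> ` {0..T} = {0..T}}"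

text \<open>Skorohod's \<open>J\<^sub>1\<close> metric (the incomplete version): the infimum over time changes \<open>\<gamma>\<close> of
  the larger of the sup distances of \<open>\<gamma>\<close> from the identity and of \<open>f\<close> from \<open>g \<circ> \<gamma>\<close>.\<close>

definition skorohod_edist :: "real \<Rightarrow> (real \<Rightarrow> 'a::metric_space) \<Rightarrow> (real \<Rightarrow> 'a) \<Rightarrow> ennreal" where
  "skorohod_edist T f g =
     (INF \<gamma>\<in>time_changes T. SUP t\<in>{0..T}. ennreal (max \<bar>\<gamma> t - t\<bar> (dist (f t) (g (\<gamma> t)))))"

definition skorohod_dist :: "real \<Rightarrow> (real \<Rightarrow> 'a::metric_space) \<Rightarrow> (real \<Rightarrow> 'a) \<Rightarrow> real" where
  "skorohod_dist T f g = enn2real (skorohod_edist T f g)"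

definition skorohod_topology :: "real \<Rightarrow> 'a::metric_space set \<Rightarrow> (real \<Rightarrow> 'a) topology" where
  "skorohod_topology T S = Metric_space.mtopology (cadlag_space T S) (skorohod_dist T)"

lemma id_time_change: "(\<lambda>t. t) \<in> time_changes T"
  by (auto simp: time_changes_def strict_mono_on_def)

lemma time_change_mem: "\<gamma> \<in> time_changes T \<Longrightarrow> t \<in> {0..T} \<Longrightarrow> \<gamma> t \<in> {0..T}"
  by (auto simp: time_changes_def)

lemma time_change_comp:
  assumes "\<gamma> \<in> time_changes T" "\<delta> \<in> time_changes T"
  shows "(\<lambda>t. \<gamma> (\<delta> t)) \<in> time_changes T"
proof -
  have "strict_mono_on {0..T} (\<lambda>t. \<gamma> (\<delta> t))"
  proof (rule strict_mono_onI)
    fix r s assume rs: "r \<in> {0..T}" "s \<in> {0..T}" "r < s"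
    have "\<delta> r < \<delta> s"
      using assms(2) rs unfolding time_changes_def by (blast dest: strict_mono_onD)
    then show "\<gamma> (\<delta> r) < \<gamma> (\<delta> s)"
      using assms(1) time_change_mem[OF assms(2) rs(1)] time_change_mem[OF assms(2) rs(2)]
      unfolding time_changes_def by (blast dest: strict_mono_onD)
  qed
  moreover have "(\<lambda>t. \<gamma> (\<delta> t)) ` {0..T} = {0..T}"
    using assms image_image[of \<gamma> \<delta> "{0..T}"] by (simp add: time_changes_def)
  ultimately show ?thesis by (simp add: time_changes_def)
qed

lemma time_change_inv:
  assumes "\<gamma> \<in> time_changes T"
  shows "inv_into {0..T} \<gamma> \<in> time_changes T"
    and "\<And>t. t \<in> {0..T} \<Longrightarrow> \<gamma> (inv_into {0..T} \<gamma> t) = t"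
    and "\<And>t. t \<in> {0..T} \<Longrightarrow> inv_into {0..T} \<gamma> (\<gamma> t) = t"
proof -
  have sm: "strict_mono_on {0..T} \<gamma>" and im: "\<gamma> ` {0..T} = {0..T}"
    using assms by (auto simp: time_changes_def)
  have inj: "inj_on \<gamma> {0..T}"
    using sm by (rule strict_mono_on_imp_inj_on)
  show r: "\<gamma> (inv_into {0..T} \<gamma> t) = t" if "t \<in> {0..T}" for t
    using that im by (intro f_inv_into_f) auto
  show l: "inv_into {0..T} \<gamma> (\<gamma> t) = t" if "t \<in> {0..T}" for t
    using that inj by (rule inv_into_f_f[rotated])
  have mem: "inv_into {0..T} \<gamma> t \<in> {0..T}" if "t \<in> {0..T}" for t
    using that im by (intro inv_into_into) auto
  have "inv_into {0..T} \<gamma> s < inv_into {0..T} \<gamma> t"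
    if "s \<in> {0..T}" "t \<in> {0..T}" "s < t" for s t
  proof (rule ccontr)
    assume "\<not> ?thesis"
    then have "inv_into {0..T} \<gamma> t \<le> inv_into {0..T} \<gamma> s" by simp
    then have "\<gamma> (inv_into {0..T} \<gamma> t) \<le> \<gamma> (inv_into {0..T} \<gamma> s)"
      using sm mem[OF that(1)] mem[OF that(2)]
      by (metis strict_mono_on_leD)
    then show False using r that by simp
  qed
  then have "strict_mono_on {0..T} (inv_into {0..T} \<gamma>)"
    by (auto simp: strict_mono_on_def)
  moreover have "inv_into {0..T} \<gamma> ` {0..T} = {0..T}"
  proof
    show "inv_into {0..T} \<gamma> ` {0..T} \<subseteq> {0..T}" using mem by blast
    show "{0..T} \<subseteq> inv_into {0..T} \<gamma> ` {0..T}"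
    proof
      fix t assume "t \<in> {0..T}"
      then show "t \<in> inv_into {0..T} \<gamma> ` {0..T}"
        using l[of t] time_change_mem[OF assms, of t] by (metis image_eqI)
    qed
  qed
  ultimately show "inv_into {0..T} \<gamma> \<in> time_changes T"
    by (simp add: time_changes_def)
qed

lemma skorohod_edist_lessE:
  assumes "skorohod_edist T f g < ennreal e"
  obtains \<gamma> where "\<gamma> \<in> time_changes T"
    "\<And>t. t \<in> {0..T} \<Longrightarrow> \<bar>\<gamma> t - t\<bar> < e" "\<And>t. t \<in> {0..T} \<Longrightarrow> dist (f t) (g (\<gamma> t)) < e"
proof -
  obtain \<gamma> where g: "\<gamma> \<in> time_changes T"
    and l: "(SUP t\<in>{0..T}. ennreal (max \<bar>\<gamma> t - t\<bar> (dist (f t) (g (\<gamma> t))))) < ennreal e"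
    using assms unfolding skorohod_edist_def INF_less_iff by blast
  have "max \<bar>\<gamma> t - t\<bar> (dist (f t) (g (\<gamma> t))) < e" if "t \<in> {0..T}" for t
  proof -
    have "ennreal (max \<bar>\<gamma> t - t\<bar> (dist (f t) (g (\<gamma> t)))) < ennreal e"
      using l that by (meson SUP_upper le_less_trans)
    then show ?thesis by (subst (asm) ennreal_less_iff) auto
  qed
  with g show ?thesis by (intro that[of \<gamma>]) auto
qed

lemma skorohod_edist_leI:
  assumes "\<gamma> \<in> time_changes T"
    "\<And>t. t \<in> {0..T} \<Longrightarrow> \<bar>\<gamma> t - t\<bar> \<le> e" "\<And>t. t \<in> {0..T} \<Longrightarrow> dist (f t) (g (\<gamma> t)) \<le> e"
  shows "skorohod_edist T f g \<le> ennreal e"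
  unfolding skorohod_edist_def
  by (rule INF_lower2[OF assms(1)]) (auto intro!: SUP_least ennreal_leI assms(2,3))

lemma skorohod_edist_le_swap: "skorohod_edist T f g \<le> skorohod_edist T g f"
proof -
  have "skorohod_edist T f g \<le>
      (SUP t\<in>{0..T}. ennreal (max \<bar>\<gamma> t - t\<bar> (dist (g t) (f (\<gamma> t)))))" (is "_ \<le> ?S")
    if g: "\<gamma> \<in> time_changes T" for \<gamma>
    unfolding skorohod_edist_def
  proof (rule INF_lower2[OF time_change_inv(1)[OF g]], rule SUP_least)
    fix t assume t: "t \<in> {0..T}"
    let ?s = "inv_into {0..T} \<gamma> t"
    have s: "?s \<in> {0..T}" using time_change_mem[OF time_change_inv(1)[OF g] t] .
    have "ennreal (max \<bar>\<gamma> ?s - ?s\<bar> (dist (g ?s) (f (\<gamma> ?s)))) \<le> ?S"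
      using s by (intro SUP_upper)
    then show "ennreal (max \<bar>?s - t\<bar> (dist (f t) (g ?s))) \<le> ?S"
      using time_change_inv(2)[OF g t] by (simp add: dist_commute abs_minus_commute)
  qed
  then show ?thesis
    unfolding skorohod_edist_def[of T g f] by (intro INF_greatest)
qed

lemma cadlag_bounded:
  fixes f :: "real \<Rightarrow> 'a::metric_space"
  assumes f: "f \<in> cadlag_space T S" and T: "0 \<le> T"
  shows "bounded (f ` {0..T})"
proof -
  have "bounded (f ` ({0..T} \<inter> {0..T}))"
    using T
  proof (induction rule: Bolzano[where P="\<lambda>a b. bounded (f ` ({a..b} \<inter> {0..T}))"])
    case (trans a b c)
    have "f ` ({a..c} \<inter> {0..T}) \<subseteq> f ` ({a..b} \<inter> {0..T}) \<union> f ` ({b..c} \<inter> {0..T})"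
      unfolding image_Un[symmetric] by (rule image_mono) auto
    then show ?case using trans(1,2) bounded_subset bounded_Un by metis
  next
    case (local x)
    obtain d1 where d1: "d1 > 0" "\<And>s. s \<in> {0..T} \<Longrightarrow> x < s \<Longrightarrow> s < x + d1 \<Longrightarrow> dist (f s) (f x) < 1"
    proof (cases "x < T")
      case True
      then have "(f \<longlongrightarrow> f x) (at_right x)" using f local by (auto simp: cadlag_space_def)
      then have "\<forall>\<^sub>F s in at_right x. dist (f s) (f x) < 1" by (rule tendstoD) simp
      then obtain b where "b > x" "\<And>s. x < s \<Longrightarrow> s < b \<Longrightarrow> dist (f s) (f x) < 1"
        unfolding eventually_at_right_field by auto
      then show ?thesis by (intro that[of "b - x"]) auto
    qed (use that[of 1] in auto)
    obtain d2 l where d2: "d2 > 0" "\<And>s. s \<in> {0..T} \<Longrightarrow> s < x \<Longrightarrow> x - d2 < s \<Longrightarrow> dist (f s) l < 1"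
    proof (cases "0 < x")
      case True
      then have "x \<in> {0<..T}" using local by simp
      then obtain l where "(f \<longlongrightarrow> l) (at_left x)" using f unfolding cadlag_space_def by blast
      then have "\<forall>\<^sub>F s in at_left x. dist (f s) l < 1" by (rule tendstoD) simp
      then obtain b where "b < x" "\<And>s. b < s \<Longrightarrow> s < x \<Longrightarrow> dist (f s) l < 1"
        unfolding eventually_at_left_field by auto
      then show ?thesis by (intro that[of "x - b" l]) auto
    qed (use that[of 1] in auto)
    show ?case
    proof (intro exI[of _ "min d1 d2"] conjI allI impI)
      show "0 < min d1 d2" using d1 d2 by simp
      fix a b assume ab: "a \<le> x \<and> x \<le> b \<and> b - a < min d1 d2"
      have "f ` ({a..b} \<inter> {0..T}) \<subseteq> ball (f x) 1 \<union> ball l 1 \<union> {f x}"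
      proof
        fix y assume "y \<in> f ` ({a..b} \<inter> {0..T})"
        then obtain s where s: "y = f s" "a \<le> s" "s \<le> b" "s \<in> {0..T}" by auto
        consider "s < x" | "s = x" | "x < s" by linarith
        then show "y \<in> ball (f x) 1 \<union> ball l 1 \<union> {f x}"
        proof cases
          case 1 then show ?thesis using d2(2)[of s] ab s by (auto simp: dist_commute)
        next
          case 3 then show ?thesis using d1(2)[of s] ab s by (auto simp: dist_commute)
        qed (use s in auto)
      qed
      then show "bounded (f ` ({a..b} \<inter> {0..T}))"
        by (rule bounded_subset[rotated]) simp
    qed
  qed
  then show ?thesis by simp
qed

lemma skorohod_edist_finite:
  assumes "f \<in> cadlag_space T S" "g \<in> cadlag_space T S" "0 \<le> T"
  shows "skorohod_edist T f g < \<infinity>"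
proof -
  have "bounded (f ` {0..T} \<union> g ` {0..T})"
    using assms by (simp add: cadlag_bounded)
  then obtain e where e: "\<And>x y. x \<in> f ` {0..T} \<union> g ` {0..T} \<Longrightarrow> y \<in> f ` {0..T} \<union> g ` {0..T} \<Longrightarrow> dist x y \<le> e"
    unfolding bounded_two_points by blast
  have "skorohod_edist T f g \<le> ennreal (max 0 e)"
    by (rule skorohod_edist_leI[OF id_time_change]) (auto intro!: e max.coboundedI2)
  then show ?thesis by (simp add: le_less_trans)
qed

lemma Metric_space_skorohod:
  assumes T: "0 \<le> T"
  shows "Metric_space (cadlag_space T S) (skorohod_dist T)"
proof
  fix f g :: "real \<Rightarrow> 'a"
  show "0 \<le> skorohod_dist T f g" by (simp add: skorohod_dist_def)
  show "skorohod_dist T f g = skorohod_dist T g f"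
    by (simp add: skorohod_dist_def antisym[OF skorohod_edist_le_swap skorohod_edist_le_swap])
next
  fix f g assume f: "f \<in> cadlag_space T S" and g: "g \<in> cadlag_space T S"
  show "skorohod_dist T f g = 0 \<longleftrightarrow> f = g"
  proof
    assume "f = g"
    then have "skorohod_edist T f g \<le> ennreal 0"
      by (intro skorohod_edist_leI[OF id_time_change]) auto
    then show "skorohod_dist T f g = 0" by (simp add: skorohod_dist_def)
  next
    assume "skorohod_dist T f g = 0"
    then have z: "skorohod_edist T f g = 0"
      using skorohod_edist_finite[OF f g T] by (auto simp: skorohod_dist_def enn2real_eq_0_iff)
    have near: "\<exists>\<gamma>\<in>time_changes T. (\<forall>t\<in>{0..T}. \<bar>\<gamma> t - t\<bar> < e \<and> dist (f t) (g (\<gamma> t)) < e)"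
      if "e > 0" for e
      using skorohod_edist_lessE[of T f g e] z that by (metis ennreal_less_zero_iff)
    have eq: "f t = g t" if t: "t \<in> {0..<T}" for t
    proof -
      have "dist (f t) (g t) \<le> e" if e: "e > 0" for e
      proof -
        have "(f \<longlongrightarrow> f t) (at_right t)" "(g \<longlongrightarrow> g t) (at_right t)"
          using f g t by (auto simp: cadlag_space_def)
        then have "\<forall>\<^sub>F s in at_right t. dist (f s) (f t) < e/3" "\<forall>\<^sub>F s in at_right t. dist (g s) (g t) < e/3"
          using e by (simp_all only: tendsto_iff divide_pos_pos zero_less_numeral)
        then have "\<forall>\<^sub>F s in at_right t. dist (f s) (f t) < e/3 \<and> dist (g s) (g t) < e/3"
          by (rule eventually_conj)
        then obtain b where b: "b > t" "\<And>s. t < s \<Longrightarrow> s < b \<Longrightarrow> dist (f s) (f t) < e/3 \<and> dist (g s) (g t) < e/3"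
          unfolding eventually_at_right_field by auto
        define d where "d = (min b T - t) / 2"
        have d: "d > 0" using b t by (auto simp: d_def)
        have s: "t < t + d" "t + d < b" "t + d \<in> {0..T}" "t + 2 * d \<le> b"
          using b t by (auto simp: d_def min_def field_simps split: if_splits)
        obtain \<gamma> where ga: "\<bar>\<gamma> (t+d) - (t+d)\<bar> < min d (e/3)" "dist (f (t+d)) (g (\<gamma> (t+d))) < min d (e/3)"
        proof -
          have "0 < min d (e/3)" using d e by simp
          then show ?thesis using near[of "min d (e/3)"] s(3) that by blast
        qed
        have "t < \<gamma> (t+d)" "\<gamma> (t+d) < b" using ga(1) s by (auto simp: abs_less_iff)
        then have "dist (g (\<gamma> (t+d))) (g t) < e/3" using b by blast
        moreover have "dist (f (t+d)) (f t) < e/3" using b(2) s by blast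
        ultimately show ?thesis
          using ga(2) dist_triangle[of "f t" "g t" "g (\<gamma> (t+d))"]
            dist_triangle[of "f t" "g (\<gamma> (t+d))" "f (t+d)"]
          by (simp add: dist_commute)
      qed
      then show ?thesis using field_le_epsilon[of "dist (f t) (g t)" 0] by simp
    qed
    have eqT: "f T = g T"
    proof -
      have "\<gamma> T = T" if ch: "\<gamma> \<in> time_changes T" for \<gamma>
      proof -
        obtain s where s: "s \<in> {0..T}" "\<gamma> s = T"
          using time_change_inv(2)[OF ch, of T] time_change_mem[OF time_change_inv(1)[OF ch], of T] T
          by (meson atLeastAtMost_iff order_refl)
        have "\<gamma> s \<le> \<gamma> T"
          using ch s T by (auto simp: time_changes_def intro: strict_mono_on_leD)
        then show ?thesis using s time_change_mem[OF ch, of T] T by auto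
      qed
      then have "dist (f T) (g T) \<le> e" if "e > 0" for e
        using near[OF that] T by (metis atLeastAtMost_iff less_imp_le order_refl)
      then show ?thesis using field_le_epsilon[of "dist (f T) (g T)" 0] by simp
    qed
    show "f = g"
    proof
      fix t show "f t = g t"
      proof (cases "t \<in> {0..T}")
        case True then show ?thesis using eq[of t] eqT by (cases "t = T") auto
      next
        case False
        have "f \<in> extensional {0..T}" "g \<in> extensional {0..T}"
          using f g by (auto simp: cadlag_space_def PiE_def)
        then show ?thesis using False by (simp add: extensional_def)
      qed
    qed
  qed
next
  fix f g h assume fgh: "f \<in> cadlag_space T S" "g \<in> cadlag_space T S" "h \<in> cadlag_space T S"
  have fin: "skorohod_edist T f g < \<infinity>" "skorohod_edist T g h < \<infinity>"
    by (rule skorohod_edist_finite[OF fgh(1,2) T], rule skorohod_edist_finite[OF fgh(2,3) T])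
  have lt: "skorohod_edist T u v < ennreal (skorohod_dist T u v + e)"
    if "skorohod_edist T u v < \<infinity>" "e > 0" for u v :: "real \<Rightarrow> 'a" and e
  proof -
    have "skorohod_edist T u v = ennreal (skorohod_dist T u v)"
      using that by (simp add: skorohod_dist_def less_top)
    then show ?thesis using that by (simp add: ennreal_less_iff skorohod_dist_def)
  qed
  show "skorohod_dist T f h \<le> skorohod_dist T f g + skorohod_dist T g h"
  proof (rule field_le_epsilon)
    fix e :: real assume e: "e > 0"
    let ?a = "skorohod_dist T f g + e/2" and ?b = "skorohod_dist T g h + e/2"
    obtain \<gamma> where \<gamma>: "\<gamma> \<in> time_changes T" "\<And>t. t \<in> {0..T} \<Longrightarrow> \<bar>\<gamma> t - t\<bar> < ?a"
        "\<And>t. t \<in> {0..T} \<Longrightarrow> dist (f t) (g (\<gamma> t)) < ?a"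
      by (rule skorohod_edist_lessE[OF lt[OF fin(1) half_gt_zero[OF e]]]) blast
    obtain \<delta> where \<delta>: "\<delta> \<in> time_changes T" "\<And>t. t \<in> {0..T} \<Longrightarrow> \<bar>\<delta> t - t\<bar> < ?b"
        "\<And>t. t \<in> {0..T} \<Longrightarrow> dist (g t) (h (\<delta> t)) < ?b"
      by (rule skorohod_edist_lessE[OF lt[OF fin(2) half_gt_zero[OF e]]]) blast
    have "skorohod_edist T f h \<le> ennreal (?a + ?b)"
    proof (rule skorohod_edist_leI[OF time_change_comp[OF \<delta>(1) \<gamma>(1)]])
      fix t assume t: "t \<in> {0..T}"
      have t': "\<gamma> t \<in> {0..T}" using time_change_mem[OF \<gamma>(1) t] .
      show "\<bar>\<delta> (\<gamma> t) - t\<bar> \<le> ?a + ?b" using \<gamma>(2)[OF t] \<delta>(2)[OF t'] by linarith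
      show "dist (f t) (h (\<delta> (\<gamma> t))) \<le> ?a + ?b"
        using \<gamma>(3)[OF t] \<delta>(3)[OF t'] dist_triangle[of "f t" "h (\<delta> (\<gamma> t))" "g (\<gamma> t)"] by linarith
    qed
    then have "skorohod_dist T f h \<le> ?a + ?b"
      unfolding skorohod_dist_def[of T f h]
      using e by (intro enn2real_leI) (auto simp: skorohod_dist_def)
    then show "skorohod_dist T f h \<le> skorohod_dist T f g + skorohod_dist T g h + e" by simp
  qed
qed

section \<open>Large deviation principles\<close>

definition borel_of :: "'a topology \<Rightarrow> 'a measure" where
  "borel_of X = sigma (topspace X) {U. openin X U}"

definition rate_function :: "'a topology \<Rightarrow> ('a \<Rightarrow> ennreal) \<Rightarrow> bool" where
  "rate_function X I \<longleftrightarrow> (\<forall>m<\<infinity>. compactin X {x \<in> topspace X. I x \<le> m})"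

text \<open>The logarithm of a probability; note that \<^term>\<open>ln (0::real) = 0\<close> in the library.\<close>

definition elog :: "real \<Rightarrow> ereal" where
  "elog p = (if p = 0 then - \<infinity> else ereal (ln p))"

text \<open>Speed \<open>n\<close>. The random elements \<open>Z n\<close> may live on different probability spaces \<open>M n\<close>; only
  indices \<open>n \<ge> 1\<close> matter.\<close>

definition large_deviation_principle ::
  "'a topology \<Rightarrow> (nat \<Rightarrow> 'w measure) \<Rightarrow> (nat \<Rightarrow> 'w \<Rightarrow> 'a) \<Rightarrow> ('a \<Rightarrow> ennreal) \<Rightarrow> bool" where
  "large_deviation_principle X M Z I \<longleftrightarrow>
     rate_function X I \<and>
     (\<forall>F. closedin X F \<longrightarrow>
        limsup (\<lambda>n. ereal (1 / real n) * elog (measure (M n) {\<omega> \<in> space (M n). Z n \<omega> \<in> F}))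
          \<le> - (INF x\<in>F. enn2ereal (I x))) \<and>
     (\<forall>G. openin X G \<longrightarrow>
        - (INF x\<in>G. enn2ereal (I x))
          \<le> liminf (\<lambda>n. ereal (1 / real n) * elog (measure (M n) {\<omega> \<in> space (M n). Z n \<omega> \<in> G})))"

section \<open>Poisson random measures\<close>

definition poisson_random_measure :: "'w measure \<Rightarrow> 'a measure \<Rightarrow> ('w \<Rightarrow> 'a measure) \<Rightarrow> bool" where
  "poisson_random_measure M \<nu> N \<longleftrightarrow>
     (\<forall>\<omega>\<in>space M. sets (N \<omega>) = sets \<nu>) \<and>
     (\<forall>A\<in>sets \<nu>. (\<lambda>\<omega>. emeasure (N \<omega>) A) \<in> borel_measurable M) \<and>
     (\<forall>A\<in>sets \<nu>. emeasure \<nu> A < \<infinity> \<longrightarrow>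
        (\<forall>k::nat. measure M {\<omega> \<in> space M. emeasure (N \<omega>) A = of_nat k} =
           measure \<nu> A ^ k / fact k * exp (- measure \<nu> A))) \<and>
     (\<forall>(J::nat set) A. finite J \<longrightarrow> A ` J \<subseteq> sets \<nu> \<longrightarrow> disjoint_family_on A J \<longrightarrow>
        prob_space.indep_vars M (\<lambda>_. borel) (\<lambda>j \<omega>. emeasure (N \<omega>) (A j)) J)"

text \<open>The \<open>\<sigma>\<close>-algebra generated by a random measure with values in the measures on the
  measurable space of \<open>\<nu>\<close>.\<close>

definition random_measure_events :: "'w measure \<Rightarrow> 'a measure \<Rightarrow> ('w \<Rightarrow> 'a measure) \<Rightarrow> 'w set set" where
  "random_measure_events M \<nu> N =
     sigma_sets (space M) {{\<omega> \<in> space M. emeasure (N \<omega>) A \<in> B} | A B. A \<in> sets \<nu> \<and> B \<in> sets borel}"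

section \<open>The M/M/1+M queue\<close>

definition time_intensity :: "real \<Rightarrow> real \<Rightarrow> real measure" where
  "time_intensity c T = scale_measure (ennreal c) (restrict_space lborel {0..T})"

definition time_mark_intensity :: "real \<Rightarrow> real \<Rightarrow> (real \<times> real) measure" where
  "time_mark_intensity c T = scale_measure (ennreal c) (restrict_space lborel ({0..T} \<times> {0..}))"

definition mm1m_noise ::
  "'w measure \<Rightarrow> real \<Rightarrow> real \<Rightarrow> real \<Rightarrow> real \<Rightarrow> nat \<Rightarrow>
   ('w \<Rightarrow> real measure) \<Rightarrow> ('w \<Rightarrow> real measure) \<Rightarrow> ('w \<Rightarrow> (real \<times> real) measure) \<Rightarrow> bool" where
  "mm1m_noise M lam mu th T n N1 N2 N3 \<longleftrightarrow>
     poisson_random_measure M (time_intensity (real n * lam) T) N1 \<and>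
     poisson_random_measure M (time_intensity (real n * mu) T) N2 \<and>
     poisson_random_measure M (time_mark_intensity (real n * th) T) N3 \<and>
     prob_space.indep_sets M
       (\<lambda>i. [random_measure_events M (time_intensity (real n * lam) T) N1,
             random_measure_events M (time_intensity (real n * mu) T) N2,
             random_measure_events M (time_mark_intensity (real n * th) T) N3] ! i) {..<3}"

text \<open>The value at time \<open>0\<close> is a convention; the Poisson random measures almost surely do not charge
  that time.\<close>

definition left_limit :: "(real \<Rightarrow> real) \<Rightarrow> real \<Rightarrow> real" where
  "left_limit f s = (if s \<le> 0 then f 0 else Lim (at_left s) f)"

definition path_pair :: "real \<Rightarrow> (real \<Rightarrow> real) \<Rightarrow> (real \<Rightarrow> real) \<Rightarrow> real \<Rightarrow> real \<times> real" where
  "path_pair T f g = (\<lambda>t\<in>{0..T}. (f t, g t))"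

text \<open>The pathwise evolution equations; \<open>\<nu>1\<close>, \<open>\<nu>2\<close>, \<open>\<nu>3\<close> are realisations of the driving random
  measures and \<open>f\<close>, \<open>g\<close> the corresponding paths of \<open>X\<^sup>n\<close>, \<open>Y\<^sup>n\<close>.\<close>

definition mm1m_equations ::
  "real \<Rightarrow> nat \<Rightarrow> real \<Rightarrow> real measure \<Rightarrow> real measure \<Rightarrow> (real \<times> real) measure \<Rightarrow>
   (real \<Rightarrow> real) \<Rightarrow> (real \<Rightarrow> real) \<Rightarrow> bool" where
  "mm1m_equations T n xn \<nu>1 \<nu>2 \<nu>3 f g \<longleftrightarrow>
     (\<forall>t\<in>{0..T}.
        f t = xn + 1 / real n * (LINT s:{0..t}|\<nu>1. 1)
                 - 1 / real n * (LINT s:{0..t}|\<nu>2. indicator {s. left_limit f s \<noteq> 0} s) - g t \<and>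
        g t = 1 / real n * (LINT p:{0..t} \<times> {0..}|\<nu>3.
                 indicator {0..max 0 (left_limit f (fst p) - 1 / real n)} (snd p)))"

section \<open>The rate function\<close>

definition ell :: "real \<Rightarrow> real" where
  "ell x = x * ln x - x + 1"

lemma ell_0: "ell 0 = 1"
  by (simp add: ell_def)

definition skorohod_map :: "(real \<Rightarrow> real) \<Rightarrow> real \<Rightarrow> real" where
  "skorohod_map \<psi> t = \<psi> t - (INF s\<in>{0..t}. min (\<psi> s) 0)"

text \<open>The integrability conditions say that the integrals in the defining equations are meaningful;
  they must be explicit because the Bochner integral of a non-integrable function is \<open>0\<close>.\<close>

definition controls ::
  "real \<Rightarrow> real \<Rightarrow> real \<Rightarrow> real \<Rightarrow> real \<Rightarrow> (real \<Rightarrow> real) \<Rightarrow> (real \<Rightarrow> real) \<Rightarrow>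
   ((real \<Rightarrow> real) \<times> (real \<Rightarrow> real) \<times> (real \<Rightarrow> real)) set" where
  "controls lam mu th x0 T \<xi> \<zeta> =
     {(\<phi>1, \<phi>2, \<phi>3).
        (\<forall>\<phi>\<in>{\<phi>1, \<phi>2, \<phi>3}. \<phi> \<in> borel_measurable (restrict_space borel {0..T}) \<and> (\<forall>s\<in>{0..T}. 0 \<le> \<phi> s)) \<and>
        set_integrable lborel {0..T} \<phi>1 \<and>
        set_integrable lborel {0..T} \<phi>2 \<and>
        set_integrable lborel {0..T} (\<lambda>s. \<phi>3 s * \<xi> s) \<and>
        (\<forall>t\<in>{0..T}.
           \<xi> t = skorohod_map (\<lambda>r. x0 + lam * (LINT s:{0..r}|lborel. \<phi>1 s)
                                     - mu * (LINT s:{0..r}|lborel. \<phi>2 s)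
                                     - th * (LINT s:{0..r}|lborel. \<phi>3 s * \<xi> s)) t \<and>
           \<zeta> t = th * (LINT s:{0..t}|lborel. \<phi>3 s * \<xi> s))}"

definition control_cost ::
  "real \<Rightarrow> real \<Rightarrow> real \<Rightarrow> real \<Rightarrow> (real \<Rightarrow> real) \<Rightarrow>
   (real \<Rightarrow> real) \<times> (real \<Rightarrow> real) \<times> (real \<Rightarrow> real) \<Rightarrow> ennreal" where
  "control_cost lam mu th T \<xi> = (\<lambda>(\<phi>1, \<phi>2, \<phi>3).
     ennreal lam * (\<integral>\<^sup>+s\<in>{0..T}. ennreal (ell (\<phi>1 s)) \<partial>lborel) +
     ennreal mu * (\<integral>\<^sup>+s\<in>{0..T}. ennreal (ell (\<phi>2 s)) \<partial>lborel) +
     ennreal th * (\<integral>\<^sup>+s\<in>{0..T}. ennreal (\<xi> s * ell (\<phi>3 s)) \<partial>lborel))"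

definition mm1m_rate ::
  "real \<Rightarrow> real \<Rightarrow> real \<Rightarrow> real \<Rightarrow> real \<Rightarrow> (real \<Rightarrow> real \<times> real) \<Rightarrow> ennreal" where
  "mm1m_rate lam mu th x0 T z =
     (let \<xi> = (\<lambda>t. fst (z t)); \<zeta> = (\<lambda>t. snd (z t)) in
      if continuous_on {0..T} z
      then (INF \<phi>\<in>controls lam mu th x0 T \<xi> \<zeta>. control_cost lam mu th T \<xi> \<phi>)
      else \<infinity>)"

end

theory Submission
  imports Defs "HOL-Complex_Analysis.Great_Picard" "HOL-Real_Asymp.Real_Asymp"
begin

text \<open>
  \<open>X\<close> is the Skorohod reflection of \<open>x + A - S - Y\<close>, where \<open>A\<close>, \<open>S\<close>, \<open>Y\<close> are nondecreasing, and the cost of a path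
  is, by convex duality, the supremum over dyadic partitions of the relative entropies of the increments of
  \<open>(A, S, Y)\<close> with respect to \<open>(\<lambda> dt, \<mu> dt, \<theta> \<xi> dt)\<close>. A bound on these entropies makes the paths equicontinuous,
  passes to limits, and yields densities: the exponentials of minus one half of the dyadic densities are
  Cauchy in \<open>L\<^sup>2\<close> because the entropies increase along the partitions.

  Upper bound: the numbers of Poisson points in the cells of a space-time grid are independent, and the probability
  that their total entropy exceeds \<open>m\<close> is at most a power of \<open>n\<close> times \<open>exp (- n m)\<close>. Outside this event the
  path is close to a path of cost at most \<open>m\<close>, by compactness.

  Lower bound: prescribe the number of points in every cell, using only the marks below the target path when it is
  not small and forbidding all marks in a thin strip above. Where the target is small no customer reneges, which
  loses little reneging mass and can only push the queue upwards by that amount.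
\<close>

text \<open>At \<open>w = 0\<close> this has the right value only for \<open>x = 0\<close>, since \<open>x / 0 = 0\<close> and \<open>ln 0 = 0\<close>.\<close>

definition relent :: "real \<Rightarrow> real \<Rightarrow> real" where
  "relent x w = x * ln (x / w) - x + w"

lemma relent_ge_dual:
  assumes "0 \<le> x" "0 \<le> w" "w = 0 \<Longrightarrow> x = 0"
  shows "b * x - (exp b - 1) * w \<le> relent x w"
proof (cases "x = 0")
  case True
  then show ?thesis using assms by (simp add: relent_def algebra_simps)
next
  case False
  then have "0 < x" "0 < w" using assms by (auto simp: less_le)
  define r where "r = ln (x / w)"
  have "w * exp b = x * exp (b - r)"
    using \<open>0 < x\<close> \<open>0 < w\<close> by (simp add: r_def exp_diff)
  moreover have "x * (1 + (b - r)) \<le> x * exp (b - r)"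
    using \<open>0 < x\<close> by (intro mult_left_mono exp_ge_add_one_self) auto
  ultimately show ?thesis
    by (simp add: relent_def r_def[symmetric] algebra_simps)
qed

lemma relent_nonneg: "0 \<le> x \<Longrightarrow> 0 < w \<Longrightarrow> 0 \<le> relent x w"
  using relent_ge_dual[of x w 0] by simp

lemma relent_eq_ell: "0 \<le> x \<Longrightarrow> 0 < w \<Longrightarrow> relent x w = w * ell (x / w)"
  by (simp add: relent_def ell_def field_simps)

section \<open>Poisson estimates\<close>

text \<open>Unlike \<open>poisson_pmf\<close> this allows the intensity \<open>0\<close>.\<close>

definition poisson_weight :: "real \<Rightarrow> nat \<Rightarrow> real" where
  "poisson_weight c k = c ^ k / fact k * exp (- c)"

lemma poisson_weight_nonneg: "0 \<le> c \<Longrightarrow> 0 \<le> poisson_weight c k"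
  by (simp add: poisson_weight_def)

lemma poisson_weight_sums: "poisson_weight c sums 1"
  using sums_mult2[OF exp_converges[of c], of "exp (- c)"]
  by (simp add: poisson_weight_def[abs_def] exp_minus divide_inverse mult.commute)

lemma ln_fact_le: "ln (fact k) \<le> real k * ln k - k + ln k + 1"
proof (induction k)
  case (Suc k)
  show ?case
  proof (cases "k = 0")
    case False
    have "ln (real k / (real k + 1)) \<le> real k / (real k + 1) - 1"
      using False by (intro ln_le_minus_one) auto
    then have "ln (real k) - ln (real k + 1) \<le> - 1 / (real k + 1)"
      using False by (simp add: ln_div field_simps)
    then have "(real k + 1) * (ln (real k) - ln (real k + 1)) \<le> (real k + 1) * (- 1 / (real k + 1))"
      by (intro mult_left_mono) auto
    then have "(real k + 1) * ln (real k) + 1 \<le> (real k + 1) * ln (real k + 1)"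
      by (simp add: algebra_simps)
    moreover have "ln (fact (Suc k)) = ln (real k + 1) + ln (fact k :: real)"
      by (simp add: ln_mult add.commute)
    ultimately show ?thesis using Suc.IH by (simp add: algebra_simps)
  qed simp
qed simp

lemma power_div_fact_le_exp: "real k ^ k / fact k \<le> exp (real k)"
proof -
  have exp_series: "(\<lambda>i. real k ^ i /\<^sub>R fact i) sums exp (real k)" by (rule exp_converges)
  have "(\<Sum>i\<in>{k}. real k ^ i /\<^sub>R fact i) \<le> (\<Sum>i. real k ^ i /\<^sub>R fact i)"
    using exp_series by (intro sum_le_suminf) (auto simp: sums_iff)
  then show ?thesis using exp_series by (simp add: sums_iff divide_inverse mult.commute)
qed

lemma poisson_weight_le_exp_relent:
  assumes "0 < n" "0 < \<nu>"
  shows "poisson_weight (real n * \<nu>) k \<le> exp (- (real n * relent (real k / n) \<nu>))"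
proof (cases "k = 0")
  case True then show ?thesis by (simp add: poisson_weight_def relent_def)
next
  case False
  let ?c = "real n * \<nu>"
  have "0 < ?c" using assms by simp
  have "poisson_weight ?c k = (?c / real k) ^ k * (real k ^ k / fact k) * exp (- ?c)"
    using False by (simp add: poisson_weight_def power_divide)
  also have "\<dots> \<le> (?c / real k) ^ k * exp (real k) * exp (- ?c)"
    using \<open>0 < ?c\<close> by (intro mult_right_mono mult_left_mono power_div_fact_le_exp) auto
  also have "(?c / real k) ^ k = exp (real k * ln (?c / real k))"
    using \<open>0 < ?c\<close> False by (subst exp_of_nat_mult) simp
  also have "ln (?c / real k) = - ln (real k / n / \<nu>)"
    using assms False \<open>0 < ?c\<close> by (simp add: ln_div ln_mult)
  also have "exp (real k * - ln (real k / n / \<nu>)) * exp (real k) * exp (- ?c) =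
      exp (- (real n * relent (real k / n) \<nu>))"
    unfolding relent_def exp_add[symmetric] using assms by (simp add: field_simps)
  finally show ?thesis .
qed

lemma poisson_weight_ge_exp_relent:
  assumes "0 < n" "0 < \<nu>"
  shows "exp (- (real n * relent (real k / n) \<nu>) - ln k - 1) \<le> poisson_weight (real n * \<nu>) k"
proof -
  let ?c = "real n * \<nu>"
  have "0 < ?c" using assms by simp
  then have weight_pos: "0 < poisson_weight ?c k" by (simp add: poisson_weight_def)
  have "- (real n * relent (real k / n) \<nu>) - ln k - 1 = real k * ln ?c - (real k * ln k - k + ln k + 1) - ?c"
    using assms by (cases "k = 0") (auto simp: relent_def ln_div ln_mult field_simps)
  also have "\<dots> \<le> real k * ln ?c - ln (fact k) - ?c"
    using ln_fact_le[of k] by simp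
  also have "\<dots> = ln (poisson_weight ?c k)"
    using assms by (simp add: poisson_weight_def ln_mult ln_div ln_realpow)
  finally show ?thesis using weight_pos by (simp add: ln_ge_iff)
qed

lemma poisson_weight_le_geometric:
  assumes "0 < n" "0 < \<nu>" and N: "real n * (m + 2 * \<nu>) \<le> real N"
  shows "poisson_weight (real n * \<nu>) (k + Suc N) \<le> exp (- (real n * m)) * (1 / 2) ^ Suc k"
proof -
  let ?x = "real (k + Suc N) / n"
  have "?x - 2 * \<nu> \<le> ?x - \<nu> * (exp 1 - 1)"
    using assms(2) mult_left_mono[of "exp 1 - 1" 2 \<nu>] exp_le by simp
  also have "\<dots> \<le> relent ?x \<nu>" using relent_ge_dual[of ?x \<nu> 1] assms(2) by (simp add: mult.commute)
  finally have "real n * (?x - 2 * \<nu>) \<le> real n * relent ?x \<nu>" using assms(1) by simp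
  moreover have "real n * (?x - 2 * \<nu>) = real (k + Suc N) - real n * (2 * \<nu>)"
    using assms(1) by (simp add: right_diff_distrib)
  ultimately have "real n * m + real (Suc k) \<le> real n * relent ?x \<nu>"
    using N by (simp add: algebra_simps)
  then have "exp (- (real n * relent ?x \<nu>)) \<le> exp (- (real n * m) - real (Suc k))" by simp
  also have "\<dots> = exp (- (real n * m)) * exp (- 1) ^ Suc k"
    by (simp only: exp_of_nat_mult[symmetric] exp_add[symmetric]) simp
  also have "\<dots> \<le> exp (- (real n * m)) * (1 / 2) ^ Suc k"
    using exp_ge_add_one_self[of "1::real"]
    by (intro mult_left_mono power_mono) (auto simp: exp_minus field_simps)
  finally show ?thesis
    using poisson_weight_le_exp_relent[OF assms(1,2), of "k + Suc N"] by linarith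
qed

lemma poisson_tail_le:
  assumes "0 < n" "0 < \<nu>" "real n * (m + 2 * \<nu>) \<le> real N"
  shows "1 - (\<Sum>k\<le>N. poisson_weight (real n * \<nu>) k) \<le> exp (- (real n * m))"
proof -
  let ?p = "poisson_weight (real n * \<nu>)"
  have p: "summable ?p" "suminf ?p = 1"
    using poisson_weight_sums[of "real n * \<nu>"] by (auto simp: sums_iff)
  have half: "(\<lambda>k. exp (- (real n * m)) * (1 / 2 :: real) ^ Suc k) sums (exp (- (real n * m)) * 1)"
    by (intro sums_mult power_half_series)
  have "1 - (\<Sum>k\<le>N. ?p k) = (\<Sum>k. ?p (k + Suc N))"
    using suminf_split_initial_segment[OF p(1), of "Suc N"] p(2) by (simp add: lessThan_Suc_atMost)
  also have "\<dots> \<le> (\<Sum>k. exp (- (real n * m)) * (1 / 2) ^ Suc k)"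
    using poisson_weight_le_geometric[OF assms] half summable_ignore_initial_segment[OF p(1), of "Suc N"]
    by (intro suminf_le) (auto simp: sums_iff)
  also have "\<dots> = exp (- (real n * m))" using half by (simp add: sums_iff)
  finally show ?thesis .
qed

locale poisson_counts = prob_space M for M :: "'a measure" +
  fixes J :: "'i set" and K :: "'i \<Rightarrow> 'a \<Rightarrow> real" and n :: nat and \<nu> :: "'i \<Rightarrow> real"
  assumes finite_index: "finite J" and scale_pos: "0 < n"
    and intensity_pos: "\<And>j. j \<in> J \<Longrightarrow> 0 < \<nu> j"
    and measurable_count: "\<And>j. j \<in> J \<Longrightarrow> K j \<in> borel_measurable M"
    and joint_law: "\<And>I \<kappa>. I \<subseteq> J \<Longrightarrow>
      prob {\<omega> \<in> space M. \<forall>j\<in>I. K j \<omega> = real (\<kappa> j)} = (\<Prod>j\<in>I. poisson_weight (real n * \<nu> j) (\<kappa> j))"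
begin

abbreviation total_relent :: "('i \<Rightarrow> real) \<Rightarrow> real" where
  "total_relent x \<equiv> \<Sum>j\<in>J. relent (x j / real n) (\<nu> j)"

definition counts_event :: "('i \<Rightarrow> nat) \<Rightarrow> 'a set" where
  "counts_event \<kappa> = {\<omega> \<in> space M. \<forall>j\<in>J. K j \<omega> = real (\<kappa> j)}"

definition count_exceeds :: "nat \<Rightarrow> 'i \<Rightarrow> 'a set" where
  "count_exceeds N j = {\<omega> \<in> space M. \<forall>k\<le>N. K j \<omega> \<noteq> real k}"

lemma sets_count_eq: "j \<in> J \<Longrightarrow> {\<omega> \<in> space M. K j \<omega> = real k} \<in> events"
  using measurable_count[of j] by measurable

lemma sets_counts_event: "counts_event \<kappa> \<in> events"
  unfolding counts_event_def by (intro sets.sets_Collect_finite_All sets_count_eq finite_index)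

lemma sets_count_exceeds: "j \<in> J \<Longrightarrow> count_exceeds N j \<in> events"
  unfolding count_exceeds_def using measurable_count[of j] by measurable

lemma prob_counts_event_le: "prob (counts_event \<kappa>) \<le> exp (- (real n * total_relent \<kappa>))"
proof -
  have "prob (counts_event \<kappa>) = (\<Prod>j\<in>J. poisson_weight (real n * \<nu> j) (\<kappa> j))"
    unfolding counts_event_def by (rule joint_law) simp
  also have "\<dots> \<le> (\<Prod>j\<in>J. exp (- (real n * relent (real (\<kappa> j) / n) (\<nu> j))))"
    using scale_pos intensity_pos
    by (intro prod_mono conjI poisson_weight_le_exp_relent poisson_weight_nonneg) (auto intro: less_imp_le)
  finally show ?thesis
    using finite_index by (simp add: exp_sum[symmetric] sum_negf sum_distrib_left)
qed

lemma prob_counts_event_ge: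
  "exp (- (real n * total_relent \<kappa>) - (\<Sum>j\<in>J. ln (real (\<kappa> j)) + 1)) \<le> prob (counts_event \<kappa>)"
proof -
  have "(\<Prod>j\<in>J. exp (- (real n * relent (real (\<kappa> j) / n) (\<nu> j)) - ln (\<kappa> j) - 1))
      \<le> (\<Prod>j\<in>J. poisson_weight (real n * \<nu> j) (\<kappa> j))"
    using scale_pos intensity_pos by (intro prod_mono conjI poisson_weight_ge_exp_relent) auto
  also have "\<dots> = prob (counts_event \<kappa>)"
    unfolding counts_event_def by (rule joint_law[symmetric]) simp
  finally show ?thesis
    using finite_index
    by (simp add: exp_sum[symmetric] sum_subtractf sum_negf sum.distrib sum_distrib_left algebra_simps)
qed

lemma prob_count_exceeds_le:
  assumes "j \<in> J" "real n * (m + 2 * \<nu> j) \<le> real N"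
  shows "prob (count_exceeds N j) \<le> exp (- (real n * m))"
proof -
  have "count_exceeds N j = space M - (\<Union>k\<le>N. {\<omega> \<in> space M. K j \<omega> = real k})"
    by (auto simp: count_exceeds_def)
  then have "prob (count_exceeds N j) = 1 - prob (\<Union>k\<le>N. {\<omega> \<in> space M. K j \<omega> = real k})"
    using sets_count_eq[OF assms(1)] by (simp add: prob_compl)
  also have "prob (\<Union>k\<le>N. {\<omega> \<in> space M. K j \<omega> = real k}) = (\<Sum>k\<le>N. prob {\<omega> \<in> space M. K j \<omega> = real k})"
    using sets_count_eq[OF assms(1)] by (intro finite_measure_finite_Union) (auto simp: disjoint_family_on_def)
  also have "\<dots> = (\<Sum>k\<le>N. poisson_weight (real n * \<nu> j) k)"
  proof (intro sum.cong refl)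
    fix k
    show "prob {\<omega> \<in> space M. K j \<omega> = real k} = poisson_weight (real n * \<nu> j) k"
      using joint_law[of "{j}" "\<lambda>_. k"] assms(1) by simp
  qed
  finally show ?thesis using poisson_tail_le[OF scale_pos intensity_pos assms(2)] assms(1) by simp
qed

lemma total_relent_event_subset:
  "{\<omega> \<in> space M. m \<le> total_relent (\<lambda>j. K j \<omega>)} \<subseteq>
    (\<Union>j\<in>J. count_exceeds N j) \<union> (\<Union>\<kappa>\<in>{\<kappa> \<in> J \<rightarrow>\<^sub>E {..N}. m \<le> total_relent \<kappa>}. counts_event \<kappa>)"
proof
  fix \<omega> assume \<omega>: "\<omega> \<in> {\<omega> \<in> space M. m \<le> total_relent (\<lambda>j. K j \<omega>)}"
  show "\<omega> \<in> (\<Union>j\<in>J. count_exceeds N j) \<union> (\<Union>\<kappa>\<in>{\<kappa> \<in> J \<rightarrow>\<^sub>E {..N}. m \<le> total_relent \<kappa>}. counts_event \<kappa>)"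
  proof (cases "\<omega> \<in> (\<Union>j\<in>J. count_exceeds N j)")
    case False
    then have "\<forall>j\<in>J. \<exists>k\<le>N. K j \<omega> = real k" using \<omega> by (auto simp: count_exceeds_def)
    then obtain \<kappa> where \<kappa>: "\<And>j. j \<in> J \<Longrightarrow> \<kappa> j \<le> N \<and> K j \<omega> = real (\<kappa> j)" by metis
    have "restrict \<kappa> J \<in> {\<kappa> \<in> J \<rightarrow>\<^sub>E {..N}. m \<le> total_relent \<kappa>}" using \<kappa> \<omega> by auto
    moreover have "\<omega> \<in> counts_event (restrict \<kappa> J)" using \<kappa> \<omega> by (auto simp: counts_event_def)
    ultimately show ?thesis by blast
  qed simp
qed

theorem prob_total_relent_ge_le:
  "prob {\<omega> \<in> space M. m \<le> total_relent (\<lambda>j. K j \<omega>)} \<le>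
    (card J + (real n * (\<bar>m\<bar> + 2 * sum \<nu> J) + 2) ^ card J) * exp (- (real n * m))"
proof -
  define C where "C = \<bar>m\<bar> + 2 * sum \<nu> J"
  define N where "N = nat \<lceil>real n * C\<rceil>"
  define P where "P = {\<kappa> \<in> J \<rightarrow>\<^sub>E {..N}. m \<le> total_relent \<kappa>}"
  have "0 \<le> C" unfolding C_def
    using intensity_pos by (intro add_nonneg_nonneg mult_nonneg_nonneg sum_nonneg) (auto intro: less_imp_le)
  then have N: "real n * C \<le> real N" "real N + 1 \<le> real n * C + 2"
    unfolding N_def using scale_pos by simp_all linarith
  have exceeds_bound: "real n * (m + 2 * \<nu> j) \<le> real N" if "j \<in> J" for j
  proof -
    have "\<nu> j \<le> sum \<nu> J" using that finite_index intensity_pos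
      by (intro member_le_sum) (auto intro: less_imp_le)
    then have "real n * (m + 2 * \<nu> j) \<le> real n * C" by (intro mult_left_mono) (auto simp: C_def)
    then show ?thesis using N(1) by linarith
  qed
  have "finite P" unfolding P_def using finite_index by (simp add: finite_PiE)
  have "card P \<le> card (J \<rightarrow>\<^sub>E {..N})"
    unfolding P_def using finite_index by (intro card_mono) (auto simp: finite_PiE)
  then have "card P \<le> (N + 1) ^ card J" using finite_index by (simp add: card_PiE)
  then have "real (card P) \<le> real ((N + 1) ^ card J)" unfolding of_nat_le_iff .
  also have "\<dots> \<le> (real n * C + 2) ^ card J" unfolding of_nat_power using N(2) by (intro power_mono) auto
  finally have card_P: "real (card P) \<le> (real n * C + 2) ^ card J" .
  have "prob {\<omega> \<in> space M. m \<le> total_relent (\<lambda>j. K j \<omega>)} \<le>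
      prob ((\<Union>j\<in>J. count_exceeds N j) \<union> (\<Union>\<kappa>\<in>P. counts_event \<kappa>))"
    using total_relent_event_subset[of m N] finite_index \<open>finite P\<close> sets_count_exceeds sets_counts_event
    unfolding P_def by (intro finite_measure_mono sets.Un sets.finite_UN) auto
  also have "\<dots> \<le> prob (\<Union>j\<in>J. count_exceeds N j) + prob (\<Union>\<kappa>\<in>P. counts_event \<kappa>)"
    using finite_index \<open>finite P\<close> sets_count_exceeds sets_counts_event
    by (intro measure_Un_le sets.finite_UN) auto
  also have "\<dots> \<le> (\<Sum>j\<in>J. prob (count_exceeds N j)) + (\<Sum>\<kappa>\<in>P. prob (counts_event \<kappa>))"
    using finite_index \<open>finite P\<close> sets_count_exceeds sets_counts_event
    by (intro add_mono measure_UNION_le) auto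
  also have "\<dots> \<le> (\<Sum>j\<in>J. exp (- (real n * m))) + (\<Sum>\<kappa>\<in>P. exp (- (real n * m)))"
    using exceeds_bound prob_counts_event_le
    by (intro add_mono sum_mono prob_count_exceeds_le order_trans[OF prob_counts_event_le])
      (auto simp: P_def intro!: mult_left_mono)
  also have "\<dots> = (card J + real (card P)) * exp (- (real n * m))" by (simp add: distrib_right)
  also have "\<dots> \<le> (card J + (real n * C + 2) ^ card J) * exp (- (real n * m))"
    using card_P by (intro mult_right_mono) auto
  finally show ?thesis by (simp add: C_def)
qed

end

section \<open>Counts of Poisson random measures\<close>

context prob_space
begin

lemma measurable_random_measure:
  "poisson_random_measure M \<nu> N \<Longrightarrow> A \<in> sets \<nu> \<Longrightarrow> (\<lambda>\<omega>. emeasure (N \<omega>) A) \<in> borel_measurable M"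
  by (simp add: poisson_random_measure_def)

lemma random_measure_counts_event:
  assumes "finite J" and A: "\<And>j. j \<in> J \<Longrightarrow> A j \<in> sets \<nu>"
  shows "{\<omega> \<in> space M. \<forall>j\<in>J. emeasure (N \<omega>) (A j) = of_nat (\<kappa> j)} \<in> random_measure_events M \<nu> N"
proof -
  interpret N: sigma_algebra "space M" "random_measure_events M \<nu> N"
    unfolding random_measure_events_def by (rule sigma_algebra_sigma_sets) auto
  have "{\<omega> \<in> space M. emeasure (N \<omega>) (A j) \<in> {of_nat (\<kappa> j)}} \<in> random_measure_events M \<nu> N" if "j \<in> J" for j
    unfolding random_measure_events_def using A[OF that]
    by (intro sigma_sets.Basic CollectI exI[of _ "A j"] exI[of _ "{of_nat (\<kappa> j)}"]) auto
  then show ?thesis using \<open>finite J\<close> by (intro N.sets_Collect_finite_All) auto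
qed

lemma prob_random_measure_eq:
  assumes "poisson_random_measure M \<nu> N" "A \<in> sets \<nu>" "emeasure \<nu> A < \<infinity>"
  shows "prob {\<omega> \<in> space M. emeasure (N \<omega>) A = of_nat k} = poisson_weight (measure \<nu> A) k"
  using assms by (simp add: poisson_random_measure_def poisson_weight_def)

lemma poisson_random_measure_joint:
  fixes A :: "'i \<Rightarrow> 'b set"
  assumes N: "poisson_random_measure M \<nu> N" and J: "finite J" "disjoint_family_on A J"
    and A: "\<And>j. j \<in> J \<Longrightarrow> A j \<in> sets \<nu>" "\<And>j. j \<in> J \<Longrightarrow> emeasure \<nu> (A j) < \<infinity>"
  shows "prob {\<omega> \<in> space M. \<forall>j\<in>J. emeasure (N \<omega>) (A j) = of_nat (\<kappa> j)} =
    (\<Prod>j\<in>J. poisson_weight (measure \<nu> (A j)) (\<kappa> j))"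
proof (cases "J = {}")
  case False
  define e where "e = to_nat_on J"
  define A' where "A' = (\<lambda>i. A (the_inv_into J e i))"
  define E where "E = (\<lambda>j. {\<omega> \<in> space M. emeasure (N \<omega>) (A j) = of_nat (\<kappa> j)})"
  have inj: "inj_on e J" unfolding e_def using J(1) by (intro inj_on_to_nat_on countable_finite)
  then have A'_e: "A' (e j) = A j" if "j \<in> J" for j using that by (simp add: A'_def the_inv_into_f_f)
  have "disjoint_family_on A' (e ` J)"
    using J(2) inj A'_e by (auto simp: disjoint_family_on_def inj_on_eq_iff)
  moreover have "A' ` e ` J \<subseteq> sets \<nu>" using A A'_e by auto
  moreover have "finite (e ` J)" using J(1) by simp
  ultimately have indep: "indep_vars (\<lambda>_. borel) (\<lambda>i \<omega>. emeasure (N \<omega>) (A' i)) (e ` J)"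
    using N unfolding poisson_random_measure_def by blast
  let ?E' = "\<lambda>i. (\<lambda>\<omega>. emeasure (N \<omega>) (A' i)) -` {of_nat (\<kappa> (the_inv_into J e i))} \<inter> space M"
  have E'_e: "?E' (e j) = E j" if "j \<in> J" for j
    using that inj A'_e by (auto simp: E_def the_inv_into_f_f)
  have "{\<omega> \<in> space M. \<forall>j\<in>J. emeasure (N \<omega>) (A j) = of_nat (\<kappa> j)} = (\<Inter>j\<in>J. E j)"
    using False by (auto simp: E_def)
  also have "\<dots> = (\<Inter>i\<in>e ` J. ?E' i)" unfolding image_image by (intro INF_cong refl E'_e[symmetric])
  finally have "prob {\<omega> \<in> space M. \<forall>j\<in>J. emeasure (N \<omega>) (A j) = of_nat (\<kappa> j)} = prob (\<Inter>i\<in>e ` J. ?E' i)"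
    by simp
  also have "\<dots> = (\<Prod>i\<in>e ` J. prob (?E' i))"
    using J(1) False by (intro indep_varsD[OF indep]) auto
  also have "\<dots> = (\<Prod>j\<in>J. prob (E j))" using inj E'_e by (simp add: prod.reindex)
  finally show ?thesis using prob_random_measure_eq[OF N A] by (simp add: E_def)
qed (simp add: prob_space)

lemma AE_random_measure_nat:
  assumes N: "poisson_random_measure M \<nu> N" and A: "A \<in> sets \<nu>" "emeasure \<nu> A < \<infinity>"
  shows "AE \<omega> in M. \<exists>k::nat. emeasure (N \<omega>) A = of_nat k"
proof -
  note [measurable] = measurable_random_measure[OF N A(1)]
  have "(\<lambda>k. prob {\<omega> \<in> space M. emeasure (N \<omega>) A = of_nat k}) sums
      prob (\<Union>k. {\<omega> \<in> space M. emeasure (N \<omega>) A = of_nat k})"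
    by (intro finite_measure_UNION) (auto simp: disjoint_family_on_def)
  then have "prob (\<Union>k. {\<omega> \<in> space M. emeasure (N \<omega>) A = of_nat k}) = 1"
    using sums_unique2 poisson_weight_sums[of "measure \<nu> A"]
    unfolding prob_random_measure_eq[OF assms] by blast
  then have "AE \<omega> in M. \<omega> \<in> (\<Union>k. {\<omega> \<in> space M. emeasure (N \<omega>) A = of_nat k})"
    by (intro AE_prob_1) auto
  then show ?thesis by eventually_elim auto
qed

lemma AE_random_measure_null:
  assumes N: "poisson_random_measure M \<nu> N" and A: "A \<in> sets \<nu>" "emeasure \<nu> A = 0"
  shows "AE \<omega> in M. emeasure (N \<omega>) A = 0"
proof -
  note [measurable] = measurable_random_measure[OF N A(1)]
  have "prob {\<omega> \<in> space M. emeasure (N \<omega>) A = of_nat 0} = 1"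
    using prob_random_measure_eq[OF N A(1), of 0] A(2) by (simp add: measure_def poisson_weight_def)
  then have "AE \<omega> in M. \<omega> \<in> {\<omega> \<in> space M. emeasure (N \<omega>) A = 0}"
    by (intro AE_prob_1) auto
  then show ?thesis by eventually_elim auto
qed

lemma mm1m_noise_joint:
  fixes lam mu th T :: real and n :: nat
    and A1 :: "'i \<Rightarrow> real set" and A2 :: "'j \<Rightarrow> real set" and A3 :: "'k \<Rightarrow> (real \<times> real) set"
  defines "\<nu>1 \<equiv> time_intensity (real n * lam) T" and "\<nu>2 \<equiv> time_intensity (real n * mu) T"
    and "\<nu>3 \<equiv> time_mark_intensity (real n * th) T"
  assumes noise: "mm1m_noise M lam mu th T n N1 N2 N3"
    and arrivals: "finite J1" "disjoint_family_on A1 J1" "\<And>j. j \<in> J1 \<Longrightarrow> A1 j \<in> sets \<nu>1" "\<And>j. j \<in> J1 \<Longrightarrow> emeasure \<nu>1 (A1 j) < \<infinity>"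
    and services: "finite J2" "disjoint_family_on A2 J2" "\<And>j. j \<in> J2 \<Longrightarrow> A2 j \<in> sets \<nu>2" "\<And>j. j \<in> J2 \<Longrightarrow> emeasure \<nu>2 (A2 j) < \<infinity>"
    and renegings: "finite J3" "disjoint_family_on A3 J3" "\<And>j. j \<in> J3 \<Longrightarrow> A3 j \<in> sets \<nu>3" "\<And>j. j \<in> J3 \<Longrightarrow> emeasure \<nu>3 (A3 j) < \<infinity>"
  shows "prob {\<omega> \<in> space M. (\<forall>j\<in>J1. emeasure (N1 \<omega>) (A1 j) = of_nat (\<kappa>1 j)) \<and>
       (\<forall>j\<in>J2. emeasure (N2 \<omega>) (A2 j) = of_nat (\<kappa>2 j)) \<and> (\<forall>j\<in>J3. emeasure (N3 \<omega>) (A3 j) = of_nat (\<kappa>3 j))} =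
    (\<Prod>j\<in>J1. poisson_weight (measure \<nu>1 (A1 j)) (\<kappa>1 j)) * (\<Prod>j\<in>J2. poisson_weight (measure \<nu>2 (A2 j)) (\<kappa>2 j)) *
    (\<Prod>j\<in>J3. poisson_weight (measure \<nu>3 (A3 j)) (\<kappa>3 j))"
proof -
  let ?E1 = "{\<omega> \<in> space M. \<forall>j\<in>J1. emeasure (N1 \<omega>) (A1 j) = of_nat (\<kappa>1 j)}"
  let ?E2 = "{\<omega> \<in> space M. \<forall>j\<in>J2. emeasure (N2 \<omega>) (A2 j) = of_nat (\<kappa>2 j)}"
  let ?E3 = "{\<omega> \<in> space M. \<forall>j\<in>J3. emeasure (N3 \<omega>) (A3 j) = of_nat (\<kappa>3 j)}"
  let ?E = "\<lambda>i. [?E1, ?E2, ?E3] ! i"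
  let ?F = "\<lambda>i. [random_measure_events M \<nu>1 N1, random_measure_events M \<nu>2 N2, random_measure_events M \<nu>3 N3] ! i"
  have N: "poisson_random_measure M \<nu>1 N1" "poisson_random_measure M \<nu>2 N2" "poisson_random_measure M \<nu>3 N3"
    and indep: "indep_sets ?F {..<3}"
    using noise by (auto simp: mm1m_noise_def \<nu>1_def \<nu>2_def \<nu>3_def)
  have index: "{..<3} = {0, 1, 2::nat}" by auto
  have "prob (\<Inter>i\<in>{..<3}. ?E i) = (\<Prod>i\<in>{..<3}. prob (?E i))"
    using arrivals services renegings by (intro indep_setsD[OF indep]) (auto simp: index intro!: random_measure_counts_event)
  moreover have "(\<Inter>i\<in>{..<3}. ?E i) = {\<omega> \<in> space M. (\<forall>j\<in>J1. emeasure (N1 \<omega>) (A1 j) = of_nat (\<kappa>1 j)) \<and>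
       (\<forall>j\<in>J2. emeasure (N2 \<omega>) (A2 j) = of_nat (\<kappa>2 j)) \<and> (\<forall>j\<in>J3. emeasure (N3 \<omega>) (A3 j) = of_nat (\<kappa>3 j))}"
    by (auto simp: index)
  moreover have "(\<Prod>i\<in>{..<3}. prob (?E i)) = prob ?E1 * prob ?E2 * prob ?E3"
    by (simp add: index)
  ultimately show ?thesis
    using poisson_random_measure_joint[OF N(1) arrivals] poisson_random_measure_joint[OF N(2) services]
      poisson_random_measure_joint[OF N(3) renegings] by simp
qed

end

section \<open>Dyadic grids\<close>

definition tgrid :: "real \<Rightarrow> nat \<Rightarrow> nat \<Rightarrow> real" where
  "tgrid T q k = real k * T / 2 ^ q"

definition time_cell :: "real \<Rightarrow> nat \<Rightarrow> nat \<Rightarrow> real set" where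
  "time_cell T q k = {tgrid T q k<..tgrid T q (Suc k)}"

definition cell_index :: "real \<Rightarrow> nat \<Rightarrow> real \<Rightarrow> nat" where
  "cell_index T q t = nat (\<lceil>t * 2 ^ q / T\<rceil> - 1)"

definition incr :: "real \<Rightarrow> (real \<Rightarrow> real) \<Rightarrow> nat \<Rightarrow> nat \<Rightarrow> real" where
  "incr T a q k = a (tgrid T q (Suc k)) - a (tgrid T q k)"

definition cell_integral :: "real \<Rightarrow> (real \<Rightarrow> real) \<Rightarrow> nat \<Rightarrow> nat \<Rightarrow> real" where
  "cell_integral T v q k = integral {tgrid T q k..tgrid T q (Suc k)} v"

lemma tgrid_0 [simp]: "tgrid T q 0 = 0"
  by (simp add: tgrid_def)

lemma tgrid_top [simp]: "tgrid T q (2 ^ q) = T"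
  by (simp add: tgrid_def)

lemma tgrid_refine: "tgrid T (q + d) (k * 2 ^ d) = tgrid T q k"
  by (simp add: tgrid_def power_add)

lemma tgrid_Suc: "tgrid T q (Suc k) = tgrid T q k + T / 2 ^ q"
  by (simp add: tgrid_def add_divide_distrib ring_distribs)

lemma tgrid_mono: "0 < T \<Longrightarrow> j \<le> k \<Longrightarrow> tgrid T q j \<le> tgrid T q k"
  by (simp add: tgrid_def divide_right_mono)

lemma tgrid_mem: "0 < T \<Longrightarrow> k \<le> 2 ^ q \<Longrightarrow> tgrid T q k \<in> {0..T}"
  using tgrid_mono[of T 0 k q] tgrid_mono[of T k "2^q" q] by simp

lemma tgrid_cell:
  assumes "0 < T" "k < 2 ^ q"
  shows "tgrid T q k \<in> {0..T}" "tgrid T q (Suc k) \<in> {0..T}" "tgrid T q k \<le> tgrid T q (Suc k)"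
  using assms tgrid_mem[of T k q] tgrid_mem[of T "Suc k" q] tgrid_mono[of T k "Suc k" q] by auto

lemma time_cell_subset: "0 < T \<Longrightarrow> k < 2 ^ q \<Longrightarrow> time_cell T q k \<subseteq> {0<..T}"
  using tgrid_cell[of T k q] by (auto simp: time_cell_def)

lemma time_cell_disjoint: "0 < T \<Longrightarrow> j \<noteq> k \<Longrightarrow> time_cell T q j \<inter> time_cell T q k = {}"
  using tgrid_mono[of T "Suc j" k q] tgrid_mono[of T "Suc k" j q]
  by (cases "j < k") (auto simp: time_cell_def)

lemma mesh_tendsto_0: "(\<lambda>q. T / 2 ^ q) \<longlonglongrightarrow> (0::real)"
  by real_asymp

lemma cell_index_bounds:
  assumes "0 < T" "0 \<le> t"
  shows "tgrid T q (cell_index T q t) \<le> t" "t \<le> tgrid T q (Suc (cell_index T q t))"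
proof -
  define u where "u = t * 2 ^ q / T"
  have "real (cell_index T q t) \<le> u \<and> u \<le> real (cell_index T q t) + 1"
    unfolding cell_index_def u_def[symmetric] using assms by (cases "u = 0") (simp_all add: u_def, linarith?)
  then show "tgrid T q (cell_index T q t) \<le> t" "t \<le> tgrid T q (Suc (cell_index T q t))"
    using assms by (auto simp: tgrid_def u_def field_simps)
qed

lemma mem_time_cell_index:
  assumes "0 < T" "0 < t"
  shows "t \<in> time_cell T q (cell_index T q t)"
proof -
  define u where "u = t * 2 ^ q / T"
  have "0 < u" using assms by (simp add: u_def)
  then have "real (cell_index T q t) = of_int \<lceil>u\<rceil> - 1" unfolding cell_index_def u_def[symmetric] by simp
  then have "real (cell_index T q t) < u" by linarith
  then have "tgrid T q (cell_index T q t) < t" using assms by (auto simp: tgrid_def u_def field_simps)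
  then show ?thesis using cell_index_bounds[of T t q] assms by (simp add: time_cell_def)
qed

lemma mem_time_cell_iff:
  assumes "0 < T" "0 < t"
  shows "t \<in> time_cell T q k \<longleftrightarrow> k = cell_index T q t"
  using mem_time_cell_index[OF assms] time_cell_disjoint[OF assms(1)] by blast

lemma cell_index_less:
  assumes "0 < T" "t \<in> {0..T}"
  shows "cell_index T q t < 2 ^ q"
proof -
  have "t * 2 ^ q / T \<le> 2 ^ q" using assms by (simp add: field_simps)
  then have "\<lceil>t * 2 ^ q / T\<rceil> \<le> 2 ^ q" by (simp add: ceiling_le_iff)
  then show ?thesis using nat_mono_iff[of "2 ^ q" "\<lceil>t * 2 ^ q / T\<rceil> - 1"] by (simp add: cell_index_def nat_power_eq)
qed

lemma time_cellE:
  assumes "0 < T" "t \<in> {0<..T}"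
  obtains k where "k < 2 ^ q" "t \<in> time_cell T q k"
  using that cell_index_less[of T t q] mem_time_cell_index[of T t q] assms by auto

lemma UN_time_cell:
  assumes "0 < T"
  shows "(\<Union>k<2 ^ q. time_cell T q k) = {0<..T}"
proof
  show "(\<Union>k<2 ^ q. time_cell T q k) \<subseteq> {0<..T}"
    using time_cell_subset[OF assms] by (intro UN_least) simp
  show "{0<..T} \<subseteq> (\<Union>k<2 ^ q. time_cell T q k)"
  proof
    fix t assume "t \<in> {0<..T}"
    then obtain k where "k < 2 ^ q" "t \<in> time_cell T q k" by (rule time_cellE[OF assms])
    then show "t \<in> (\<Union>k<2 ^ q. time_cell T q k)" by auto
  qed
qed

lemma closed_time_cellE:
  assumes "0 < T" "t \<in> {0..T}"
  obtains k where "k < 2 ^ q" "tgrid T q k \<le> t" "t \<le> tgrid T q (Suc k)"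
  using that cell_index_less[of T t q] cell_index_bounds[of T t q] assms by auto

lemma cell_index_div:
  assumes "0 < T" "0 < t"
  shows "cell_index T q t = cell_index T (q + d) t div 2 ^ d"
proof -
  let ?j = "cell_index T (q + d) t"
  have "tgrid T (q + d) (?j div 2 ^ d * 2 ^ d) \<le> tgrid T (q + d) ?j"
    by (intro tgrid_mono assms) simp
  moreover have "tgrid T (q + d) (Suc ?j) \<le> tgrid T (q + d) (Suc (?j div 2 ^ d) * 2 ^ d)"
    by (intro tgrid_mono assms Suc_leI) (simp add: dividend_less_div_times)
  ultimately have "t \<in> time_cell T q (?j div 2 ^ d)"
    using mem_time_cell_index[OF assms, of "q + d"] unfolding tgrid_refine by (auto simp: time_cell_def)
  then show ?thesis using mem_time_cell_iff[OF assms] by simp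
qed

lemma measurable_cell_index [measurable]: "cell_index T q \<in> borel \<rightarrow>\<^sub>M count_space UNIV"
  unfolding cell_index_def by measurable

definition block_sum :: "nat \<Rightarrow> (nat \<Rightarrow> real) \<Rightarrow> nat \<Rightarrow> real" where
  "block_sum d y k = (\<Sum>j\<in>{k * 2 ^ d..<k * 2 ^ d + 2 ^ d}. y j)"

lemma sum_block_mult: "(\<Sum>j<2 ^ (q + d). g (j div 2 ^ d) * y j) = (\<Sum>k<2 ^ q. g k * block_sum d y k)"
proof -
  have "j div 2 ^ d = k" if "j \<in> {k * 2 ^ d..<k * 2 ^ d + 2 ^ d}" for j k :: nat
    using that by (intro div_nat_eqI) (auto simp: mult.commute)
  then have "(\<Sum>j\<in>{k * 2 ^ d..<k * 2 ^ d + 2 ^ d}. g (j div 2 ^ d) * y j) = g k * block_sum d y k" for k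
    by (simp add: block_sum_def sum_distrib_left)
  then show ?thesis
    using sum.nat_group[of "\<lambda>j. g (j div 2 ^ d) * y j" "2 ^ d" "2 ^ q"] by (simp add: power_add)
qed

lemma dyadic_block_less: "k < 2 ^ q \<Longrightarrow> j \<in> {k * 2 ^ d..<k * 2 ^ d + 2 ^ d} \<Longrightarrow> j < (2::nat) ^ (q + d)"
  using mult_le_mono1[of "Suc k" "2 ^ q" "2 ^ d"] by (simp add: power_add)

lemma block_sum_cong:
  "k < 2 ^ q \<Longrightarrow> (\<And>j. j < 2 ^ (q + d) \<Longrightarrow> y j = y' j) \<Longrightarrow> block_sum d y k = block_sum d y' k"
  unfolding block_sum_def by (intro sum.cong refl) (auto dest: dyadic_block_less)

lemma block_sum_dist_le:
  assumes "k < 2 ^ q" "\<And>j. j < 2 ^ (q + d) \<Longrightarrow> \<bar>y j - y' j\<bar> \<le> e j"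
  shows "\<bar>block_sum d y k - block_sum d y' k\<bar> \<le> block_sum d e k"
  unfolding block_sum_def sum_subtractf[symmetric]
  using dyadic_block_less[OF assms(1)] assms(2) by (intro order_trans[OF sum_abs] sum_mono) auto

lemma block_sum_le_sum:
  assumes "k < 2 ^ q" "\<And>j. j < 2 ^ (q + d) \<Longrightarrow> 0 \<le> y j"
  shows "block_sum d y k \<le> (\<Sum>j<2 ^ (q + d). y j)"
  unfolding block_sum_def using dyadic_block_less[OF assms(1)] assms(2) by (intro sum_mono2) auto

lemma block_sum_mesh: "block_sum d (\<lambda>_. c * (T / 2 ^ (q + d))) k = c * (T / 2 ^ q)"
  by (simp add: block_sum_def power_add)

lemma incr_block: "block_sum d (incr T a (q + d)) k = incr T a q k"
proof -
  have "block_sum d (incr T a (q + d)) k = a (tgrid T (q + d) (k * 2 ^ d + 2 ^ d)) - a (tgrid T (q + d) (k * 2 ^ d))"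
    unfolding block_sum_def incr_def by (rule sum_Suc_diff') simp
  also have "tgrid T (q + d) (k * 2 ^ d + 2 ^ d) = tgrid T q (Suc k)"
    using tgrid_refine[of T q d "Suc k"] by (simp add: add.commute)
  finally show ?thesis unfolding tgrid_refine incr_def[of T a q k] .
qed

lemma incr_refine: "(\<Sum>j<2 ^ (q + d). g (j div 2 ^ d) * incr T a (q + d) j) = (\<Sum>k<2 ^ q. g k * incr T a q k)"
  by (simp add: sum_block_mult incr_block)

lemma mesh_refine:
  fixes g :: "nat \<Rightarrow> real" and T :: real
  shows "(\<Sum>j<2 ^ (q + d). g (j div 2 ^ d) * (T / 2 ^ (q + d))) = (\<Sum>k<2 ^ q. g k * (T / 2 ^ q))"
  using incr_refine[of g d T "\<lambda>t. t" q] by (simp add: incr_def tgrid_Suc)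

lemma incr_nonneg: "mono_on {0..T} a \<Longrightarrow> 0 < T \<Longrightarrow> k < 2 ^ q \<Longrightarrow> 0 \<le> incr T a q k"
  unfolding incr_def using tgrid_cell[of T k q] by (auto intro: mono_onD)

lemma sum_incr: "(\<Sum>j<k. incr T a q j) = a (tgrid T q k) - a 0"
  using sum_lessThan_telescope[of "\<lambda>k. a (tgrid T q k)" k] by (simp add: incr_def)

lemma cell_integral_eq_incr:
  assumes "0 < T" "continuous_on {0..T} v" "k < 2 ^ q"
  shows "cell_integral T v q k = incr T (\<lambda>t. integral {0..t} v) q k"
proof -
  note cell = tgrid_cell[OF assms(1,3)]
  have "integral {0..tgrid T q k} v + cell_integral T v q k = integral {0..tgrid T q (Suc k)} v"
    unfolding cell_integral_def using cell
    by (intro Henstock_Kurzweil_Integration.integral_combine integrable_continuous_real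
        continuous_on_subset[OF assms(2)]) auto
  then show ?thesis by (simp add: incr_def)
qed

lemma cell_integral_block:
  assumes "0 < T" "continuous_on {0..T} v" "k < 2 ^ q"
  shows "block_sum d (cell_integral T v (q + d)) k = cell_integral T v q k"
proof -
  have "block_sum d (cell_integral T v (q + d)) k = block_sum d (incr T (\<lambda>t. integral {0..t} v) (q + d)) k"
    using assms by (intro block_sum_cong[OF assms(3)] cell_integral_eq_incr)
  then show ?thesis using cell_integral_eq_incr[OF assms] by (simp add: incr_block)
qed

lemma cell_integral_const: "0 < T \<Longrightarrow> cell_integral T (\<lambda>_. c) q k = c * (T / 2 ^ q)"
  using tgrid_mono[of T k "Suc k" q] by (simp add: cell_integral_def tgrid_Suc)

lemma cell_integral_dist_le:
  assumes "0 < T" "k < 2 ^ q" and cont: "continuous_on {0..T} f" "continuous_on {0..T} g"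
    and dist: "\<And>t. t \<in> {tgrid T q k..tgrid T q (Suc k)} \<Longrightarrow> \<bar>f t - g t\<bar> \<le> e"
  shows "\<bar>cell_integral T f q k - cell_integral T g q k\<bar> \<le> e * (T / 2 ^ q)"
proof -
  let ?I = "{tgrid T q k..tgrid T q (Suc k)}"
  note cell = tgrid_cell[OF assms(1,2)]
  have cont_cell: "continuous_on ?I f" "continuous_on ?I g"
    using cell by (auto intro!: continuous_on_subset[OF cont(1)] continuous_on_subset[OF cont(2)])
  have "norm (integral ?I (\<lambda>t. f t - g t)) \<le> e * (tgrid T q (Suc k) - tgrid T q k)"
    using cell(3) dist cont_cell by (intro integral_bound continuous_intros) auto
  moreover have "integral ?I (\<lambda>t. f t - g t) = cell_integral T f q k - cell_integral T g q k"
    unfolding cell_integral_def using cont_cell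
    by (intro Henstock_Kurzweil_Integration.integral_diff integrable_continuous_real)
  ultimately show ?thesis by (simp add: tgrid_Suc)
qed

lemma cell_integral_approx:
  assumes "0 < T" "k < 2 ^ q" "continuous_on {0..T} f"
    and "\<And>t. t \<in> {tgrid T q k..tgrid T q (Suc k)} \<Longrightarrow> \<bar>f t - y\<bar> \<le> e"
  shows "\<bar>cell_integral T f q k - y * (T / 2 ^ q)\<bar> \<le> e * (T / 2 ^ q)"
  using cell_integral_dist_le[OF assms(1-3) continuous_on_const assms(4)] cell_integral_const[OF assms(1)] by simp

lemma cell_integral_nonneg:
  assumes "0 < T" "k < 2 ^ q" and nonneg: "\<And>t. t \<in> {0..T} \<Longrightarrow> 0 \<le> v t"
  shows "0 \<le> cell_integral T v q k"
  unfolding cell_integral_def using tgrid_cell[OF assms(1,2)]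
  by (cases "v integrable_on {tgrid T q k..tgrid T q (Suc k)}")
    (auto intro!: Henstock_Kurzweil_Integration.integral_nonneg nonneg simp: not_integrable_integral)

lemma cell_integral_le:
  assumes "0 < T" "continuous_on {0..T} v" "k < 2 ^ q" and bound: "\<And>t. t \<in> {0..T} \<Longrightarrow> v t \<le> V"
  shows "cell_integral T v q k \<le> V * (T / 2 ^ q)"
proof -
  note cell = tgrid_cell[OF assms(1,3)]
  have "cell_integral T v q k \<le> cell_integral T (\<lambda>_. V) q k"
    unfolding cell_integral_def using cell
    by (intro integral_le integrable_continuous_real continuous_on_subset[OF assms(2)] bound) auto
  then show ?thesis using cell_integral_const[OF assms(1)] by simp
qed

lemma cell_integral_cmult: "cell_integral T (\<lambda>t. c * v t) q k = c * cell_integral T v q k"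
  by (simp add: cell_integral_def)

section \<open>Dual costs\<close>

definition dual_sum :: "nat \<Rightarrow> (nat \<Rightarrow> real) \<Rightarrow> (nat \<Rightarrow> real) \<Rightarrow> (nat \<Rightarrow> real) \<Rightarrow> real" where
  "dual_sum q \<beta> y w = (\<Sum>k<2 ^ q. \<beta> k * y k - (exp (\<beta> k) - 1) * w k)"

definition dual_cost :: "real \<Rightarrow> (real \<Rightarrow> real) \<Rightarrow> (real \<Rightarrow> real) \<Rightarrow> nat \<Rightarrow> (nat \<Rightarrow> real) \<Rightarrow> real" where
  "dual_cost T a v q \<beta> = dual_sum q \<beta> (incr T a q) (cell_integral T v q)"

lemma dual_sum_0 [simp]: "dual_sum q (\<lambda>_. 0) y w = 0"
  by (simp add: dual_sum_def)

lemma dual_cost_0 [simp]: "dual_cost T a v q (\<lambda>_. 0) = 0"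
  by (simp add: dual_cost_def)

lemma dual_sum_single:
  assumes "k < 2 ^ q"
  shows "dual_sum q (\<lambda>j. if j = k then b else 0) y w = b * y k - (exp b - 1) * w k"
proof -
  have "dual_sum q (\<lambda>j. if j = k then b else 0) y w = (\<Sum>j<2 ^ q. if j = k then b * y k - (exp b - 1) * w k else 0)"
    unfolding dual_sum_def by (intro sum.cong) auto
  then show ?thesis using assms by simp
qed

lemma dual_sum_cong:
  "(\<And>k. k < 2 ^ q \<Longrightarrow> y k = y' k) \<Longrightarrow> (\<And>k. k < 2 ^ q \<Longrightarrow> w k = w' k) \<Longrightarrow> dual_sum q \<beta> y w = dual_sum q \<beta> y' w'"
  by (simp add: dual_sum_def)

lemma tendsto_dual_sum:
  assumes "\<And>k. k < 2 ^ q \<Longrightarrow> (\<lambda>i. y i k) \<longlonglongrightarrow> y' k" "\<And>k. k < 2 ^ q \<Longrightarrow> (\<lambda>i. w i k) \<longlonglongrightarrow> w' k"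
  shows "(\<lambda>i. dual_sum q \<beta> (y i) (w i)) \<longlonglongrightarrow> dual_sum q \<beta> y' w'"
  unfolding dual_sum_def using assms by (intro tendsto_intros) auto

lemma dual_sum_refine: "dual_sum (q + d) (\<lambda>j. \<beta> (j div 2 ^ d)) y w = dual_sum q \<beta> (block_sum d y) (block_sum d w)"
  unfolding dual_sum_def sum_subtractf
  using sum_block_mult[of \<beta> d y q] sum_block_mult[of "\<lambda>k. exp (\<beta> k) - 1" d w q] by simp

lemma dual_cost_refine:
  assumes "0 < T" "continuous_on {0..T} v"
  shows "dual_cost T a v (q + d) (\<lambda>j. \<beta> (j div 2 ^ d)) = dual_cost T a v q \<beta>"
  unfolding dual_cost_def dual_sum_refine by (intro dual_sum_cong incr_block cell_integral_block[OF assms])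

lemma mult_le_of_dual_bound:
  fixes b y w c :: real
  assumes "b * y - (exp b - 1) * w \<le> c" "0 \<le> b" "0 \<le> w'" "w \<le> w'"
  shows "b * y \<le> c + exp b * w'"
proof -
  have "(exp b - 1) * w \<le> (exp b - 1) * w'" using assms(2,4) by (intro mult_left_mono) auto
  also have "\<dots> \<le> exp b * w'" using assms(3) by (intro mult_right_mono) auto
  finally show ?thesis using assms(1) by simp
qed

text \<open>In an inequality \<open>b y \<le> c + e\<^sup>b w\<close> valid for all \<open>b\<close>, one first takes \<open>b\<close> large and then \<open>w\<close> small.\<close>

lemma ex_slope_dual_bound_less:
  fixes c e :: real
  assumes "0 < e" "0 \<le> c"
  obtains b where "0 < b" "\<And>w :: nat \<Rightarrow> real. w \<longlonglongrightarrow> 0 \<Longrightarrow> \<forall>\<^sub>F p in sequentially. c + exp b * w p < b * e"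
proof -
  define b where "b = (c + 1) / e"
  have b: "0 < b" "b * e = c + 1" using assms by (auto simp: b_def)
  have "\<forall>\<^sub>F p in sequentially. c + exp b * w p < b * e" if w: "w \<longlonglongrightarrow> 0" for w :: "nat \<Rightarrow> real"
  proof -
    have "(\<lambda>p. exp b * w p) \<longlonglongrightarrow> exp b * 0" by (intro tendsto_intros w)
    then have "\<forall>\<^sub>F p in sequentially. exp b * w p < 1" by (rule order_tendstoD) simp
    then show ?thesis unfolding b(2) by eventually_elim simp
  qed
  with b(1) show thesis by (rule that)
qed

lemma tendsto_0_of_dual_bound:
  fixes f w :: "nat \<Rightarrow> real"
  assumes nonneg: "\<And>p. 0 \<le> f p" and bound: "\<And>p b. 0 < b \<Longrightarrow> b * f p \<le> c + exp b * w p"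
    and "w \<longlonglongrightarrow> 0" "0 \<le> c"
  shows "f \<longlonglongrightarrow> 0"
proof (rule order_tendstoI)
  fix e :: real assume "0 < e"
  then obtain b where b: "0 < b" "\<forall>\<^sub>F p in sequentially. c + exp b * w p < b * e"
    using ex_slope_dual_bound_less[OF _ \<open>0 \<le> c\<close>] \<open>w \<longlonglongrightarrow> 0\<close> by metis
  from b(2) show "\<forall>\<^sub>F p in sequentially. f p < e"
  proof eventually_elim
    case (elim p)
    then have "b * f p < b * e" using bound[OF b(1), of p] by simp
    then show ?case using b(1) by simp
  qed
next
  fix e :: real assume "e < 0"
  then show "\<forall>\<^sub>F p in sequentially. e < f p" using nonneg by (intro always_eventually) (auto intro: less_le_trans)
qed

section \<open>Monotone functions on a dyadic grid\<close>

lemma mono_modulus_of_incr: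
  assumes T: "0 < T" and mono: "mono_on {0..T} a" and incr_le: "\<And>k. k < 2 ^ q \<Longrightarrow> incr T a q k \<le> e"
    and near: "s \<in> {0..T}" "t \<in> {0..T}" "\<bar>t - s\<bar> \<le> T / 2 ^ q"
  shows "\<bar>a t - a s\<bar> \<le> 2 * e"
  using near
proof (induction s t rule: linorder_wlog)
  case (sym s t)
  then show ?case by (simp add: abs_minus_commute)
next
  case (le s t)
  have "0 \<le> e" using incr_nonneg[OF mono T, of 0 q] incr_le[of 0] by simp
  obtain k where k: "k < 2 ^ q" "tgrid T q k \<le> s" "s \<le> tgrid T q (Suc k)"
    using closed_time_cellE[OF T le.prems(1)] .
  note cell = tgrid_cell[OF T k(1)]
  have "a (tgrid T q k) \<le> a s" "a s \<le> a t" using cell k le by (auto intro!: mono_onD[OF mono])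
  moreover have "a t \<le> a (tgrid T q k) + 2 * e"
  proof (cases "t \<le> tgrid T q (Suc k)")
    case True
    then have "a t \<le> a (tgrid T q (Suc k))" using cell le by (intro mono_onD[OF mono]) auto
    then show ?thesis using incr_le[OF k(1)] \<open>0 \<le> e\<close> by (simp add: incr_def)
  next
    case False
    then have "Suc k \<noteq> 2 ^ q" using le.prems(2) tgrid_top[of T q] by auto
    then have next_cell: "Suc k < 2 ^ q" using k by simp
    have "t \<le> tgrid T q (Suc (Suc k))" using le k by (simp add: tgrid_Suc)
    then have "a t \<le> a (tgrid T q (Suc (Suc k)))"
      using tgrid_cell[OF T next_cell] le by (intro mono_onD[OF mono]) auto
    then show ?thesis using incr_le[OF k(1)] incr_le[OF next_cell] by (simp add: incr_def)
  qed
  ultimately show ?case by simp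
qed

lemma mono_dist_le_of_grid:
  fixes F h :: "real \<Rightarrow> real"
  assumes T: "0 < T" and mono: "mono_on {0..T} F" "mono_on {0..T} h"
    and grid: "\<And>k. k \<le> 2 ^ q \<Longrightarrow> \<bar>F (tgrid T q k) - h (tgrid T q k)\<bar> \<le> d"
    and incr_le: "\<And>k. k < 2 ^ q \<Longrightarrow> incr T h q k \<le> e" and t: "t \<in> {0..T}"
  shows "\<bar>F t - h t\<bar> \<le> d + e"
proof -
  obtain k where k: "k < 2 ^ q" "tgrid T q k \<le> t" "t \<le> tgrid T q (Suc k)" using closed_time_cellE[OF T t] .
  have "F (tgrid T q k) \<le> F t" "F t \<le> F (tgrid T q (Suc k))" "h (tgrid T q k) \<le> h t" "h t \<le> h (tgrid T q (Suc k))"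
    using tgrid_cell[OF T k(1)] k t by (auto intro!: mono_onD[OF mono(1)] mono_onD[OF mono(2)])
  moreover have "h (tgrid T q (Suc k)) - h (tgrid T q k) \<le> e" using incr_le[OF k(1)] by (simp add: incr_def)
  ultimately show ?thesis using grid[of k] grid[of "Suc k"] k by auto
qed

lemma grid_dist_le_of_incr:
  fixes F h :: "real \<Rightarrow> real"
  assumes start: "F 0 = h 0" and close: "\<And>k. k < 2 ^ q \<Longrightarrow> \<bar>incr T F q k - incr T h q k\<bar> \<le> e" and k: "k \<le> 2 ^ q"
  shows "\<bar>F (tgrid T q k) - h (tgrid T q k)\<bar> \<le> 2 ^ q * e"
proof -
  have "0 \<le> e" using close[of 0] by simp
  have "\<bar>F (tgrid T q k) - h (tgrid T q k)\<bar> = \<bar>\<Sum>j<k. incr T F q j - incr T h q j\<bar>"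
    using sum_incr[of T F q k] sum_incr[of T h q k] start by (simp add: sum_subtractf)
  also have "\<dots> \<le> (\<Sum>j<k. e)" using k close by (intro order_trans[OF sum_abs] sum_mono) auto
  also have "\<dots> = real k * e" by simp
  also have "real k \<le> 2 ^ q" using k by (metis of_nat_le_iff of_nat_numeral of_nat_power)
  finally show ?thesis using \<open>0 \<le> e\<close> by (simp add: mult_right_mono)
qed

lemma mono_eq_of_tgrid:
  fixes G a :: "real \<Rightarrow> real"
  assumes T: "0 < T" and mono: "mono_on {0..T} G" and cont: "continuous_on {0..T} a"
    and grid: "\<And>q k. k \<le> 2 ^ q \<Longrightarrow> G (tgrid T q k) = a (tgrid T q k)" and t: "t \<in> {0..T}"
  shows "G t = a t"
proof -
  let ?l = "\<lambda>q. tgrid T q (cell_index T q t)" and ?u = "\<lambda>q. tgrid T q (Suc (cell_index T q t))"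
  have cell: "?l q \<in> {0..T}" "?u q \<in> {0..T}" for q
    using tgrid_cell[OF T cell_index_less[OF T t]] by auto
  have between: "?l q \<le> t" "t \<le> ?u q" for q using cell_index_bounds[OF T, of t] t by auto
  have "?l \<longlonglongrightarrow> t"
  proof (rule real_tendsto_sandwich[of "\<lambda>q. t - T / 2 ^ q" _ _ "\<lambda>_. t"])
    show "\<forall>\<^sub>F q in sequentially. t - T / 2 ^ q \<le> ?l q"
      using between(2) by (intro always_eventually) (simp add: tgrid_Suc diff_le_eq)
    show "(\<lambda>q. t - T / 2 ^ q) \<longlonglongrightarrow> t" using tendsto_diff[OF tendsto_const mesh_tendsto_0, of t T] by simp
  qed (use between(1) in auto)
  then have "(\<lambda>q. a (?l q)) \<longlonglongrightarrow> a t" using cell t by (intro continuous_on_tendsto_compose[OF cont]) auto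
  moreover have "a (?l q) \<le> G t" for q
    using grid[OF less_imp_le[OF cell_index_less[OF T t]], of q] mono_onD[OF mono cell(1)[of q] t between(1)] by simp
  ultimately have "a t \<le> G t" using LIMSEQ_le_const2[of "\<lambda>q. a (?l q)" "a t" "G t"] by blast
  have "?u \<longlonglongrightarrow> t"
  proof (rule real_tendsto_sandwich[of "\<lambda>_. t" _ _ "\<lambda>q. t + T / 2 ^ q"])
    show "\<forall>\<^sub>F q in sequentially. ?u q \<le> t + T / 2 ^ q"
      using between(1) by (intro always_eventually) (simp add: tgrid_Suc)
    show "(\<lambda>q. t + T / 2 ^ q) \<longlonglongrightarrow> t" using tendsto_add[OF tendsto_const mesh_tendsto_0, of t T] by simp
  qed (use between(2) in auto)
  then have "(\<lambda>q. a (?u q)) \<longlonglongrightarrow> a t" using cell t by (intro continuous_on_tendsto_compose[OF cont]) auto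
  moreover have "G t \<le> a (?u q)" for q
    using grid[OF Suc_leI[OF cell_index_less[OF T t]], of q] mono_onD[OF mono t cell(2)[of q] between(2)] by simp
  ultimately have "G t \<le> a t" using LIMSEQ_le_const[of "\<lambda>q. a (?u q)" "a t" "G t"] by blast
  with \<open>a t \<le> G t\<close> show ?thesis by simp
qed

lemma cell_oscillation_le:
  fixes f :: "real \<Rightarrow> 'b::metric_space"
  assumes T: "0 < T" and cont: "continuous_on {0..T} f" and "0 < e"
  shows "\<forall>\<^sub>F q in sequentially. \<forall>s\<in>{0..T}. \<forall>t\<in>{0..T}. \<bar>t - s\<bar> \<le> T / 2 ^ q \<longrightarrow> dist (f t) (f s) < e"
proof -
  have "uniformly_continuous_on {0..T} f" using cont by (intro compact_uniformly_continuous) auto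
  then obtain d where d: "0 < d" "\<And>s t. s \<in> {0..T} \<Longrightarrow> t \<in> {0..T} \<Longrightarrow> dist t s < d \<Longrightarrow> dist (f t) (f s) < e"
    unfolding uniformly_continuous_on_def using \<open>0 < e\<close> by blast
  have "\<forall>\<^sub>F q in sequentially. T / 2 ^ q < d" using mesh_tendsto_0 d(1) by (rule order_tendstoD)
  then show ?thesis by eventually_elim (auto intro!: d(2) simp: dist_real_def)
qed

section \<open>Densities of paths with finite dual cost\<close>

definition cell_mean :: "real \<Rightarrow> nat \<Rightarrow> (nat \<Rightarrow> real) \<Rightarrow> nat \<Rightarrow> real" where
  "cell_mean T q y k = y k * 2 ^ q / T"

definition cell_density :: "real \<Rightarrow> (real \<Rightarrow> real) \<Rightarrow> nat \<Rightarrow> real \<Rightarrow> real" where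
  "cell_density T a q t = cell_mean T q (incr T a q) (cell_index T q t)"

lemma cell_mean_mult: "0 < T \<Longrightarrow> cell_mean T q y k * (T / 2 ^ q) = y k"
  by (simp add: cell_mean_def)

lemma measurable_cell_density [measurable]: "cell_density T a q \<in> borel_measurable borel"
  unfolding cell_density_def by measurable

lemma has_bochner_integral_cell_step:
  fixes g :: "nat \<Rightarrow> real"
  assumes T: "0 < T"
  shows "has_bochner_integral (restrict_space lborel {0<..T}) (\<lambda>t. g (cell_index T q t)) (\<Sum>k<2 ^ q. g k * (T / 2 ^ q))"
proof -
  let ?M = "restrict_space lborel {0<..T}"
  have cell: "emeasure ?M (time_cell T q k) = ennreal (T / 2 ^ q)" "time_cell T q k \<in> sets ?M" if "k < 2 ^ q" for k
  proof -
    have "emeasure lborel (time_cell T q k) = ennreal (T / 2 ^ q)"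
      using tgrid_cell(3)[OF T that] by (simp add: time_cell_def tgrid_Suc)
    then show "emeasure ?M (time_cell T q k) = ennreal (T / 2 ^ q)" "time_cell T q k \<in> sets ?M"
      using time_cell_subset[OF T that] by (auto simp: emeasure_restrict_space sets_restrict_space_iff time_cell_def)
  qed
  have "has_bochner_integral ?M (\<lambda>t. \<Sum>k<2 ^ q. g k * indicator (time_cell T q k) t)
      (\<Sum>k<2 ^ q. g k * measure ?M (time_cell T q k))"
    using cell by (intro has_bochner_integral_sum has_bochner_integral_mult_right has_bochner_integral_real_indicator)
      auto
  also have "(\<Sum>k<2 ^ q. g k * measure ?M (time_cell T q k)) = (\<Sum>k<2 ^ q. g k * (T / 2 ^ q))"
    using cell T by (intro sum.cong refl) (simp add: measure_def)
  finally have sum_form: "has_bochner_integral ?M (\<lambda>t. \<Sum>k<2 ^ q. g k * indicator (time_cell T q k) t) \<dots>" .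
  have "(\<Sum>k<2 ^ q. g k * indicator (time_cell T q k) t) = g (cell_index T q t)" if "t \<in> space ?M" for t
  proof -
    have t: "0 < t" "t \<in> {0..T}" using that by (auto simp: space_restrict_space)
    have "(\<Sum>k<2 ^ q. g k * indicator (time_cell T q k) t) = (\<Sum>k<2 ^ q. if k = cell_index T q t then g k else 0)"
      using mem_time_cell_iff[OF T t(1)] by (intro sum.cong refl) (simp add: indicator_def)
    then show ?thesis using cell_index_less[OF T t(2), of q] by simp
  qed
  then show ?thesis using sum_form by (subst has_bochner_integral_cong[OF refl _ refl]) auto
qed

lemmas integrable_cell_step = has_bochner_integral_cell_step[THEN integrable.intros]
lemmas integral_cell_step = has_bochner_integral_cell_step[THEN has_bochner_integral_integral_eq]

lemma has_bochner_integral_cell_density_prefix: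
  assumes T: "0 < T" and k: "k \<le> 2 ^ q" and "q \<le> p"
  shows "has_bochner_integral (restrict_space lborel {0<..T})
    (\<lambda>t. indicator {0<..tgrid T q k} t * cell_density T a p t) (a (tgrid T q k) - a 0)"
proof -
  let ?M = "restrict_space lborel {0<..T}"
  obtain d where p: "p = q + d" using \<open>q \<le> p\<close> le_Suc_ex by blast
  define g where "g j = of_bool (j div 2 ^ d < k) * cell_mean T p (incr T a p) j" for j
  have "(\<Sum>j<2 ^ p. g j * (T / 2 ^ p)) = (\<Sum>j<2 ^ (q + d). of_bool (j div 2 ^ d < k) * incr T a (q + d) j)"
    unfolding p[symmetric] g_def mult.assoc cell_mean_mult[OF T] ..
  also have "\<dots> = (\<Sum>j<2 ^ q. of_bool (j < k) * incr T a q j)" by (rule incr_refine)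
  also have "\<dots> = (\<Sum>j<k. incr T a q j)" using k by (intro sum.mono_neutral_cong_right) auto
  also have "\<dots> = a (tgrid T q k) - a 0" by (rule sum_incr)
  finally have "has_bochner_integral ?M (\<lambda>t. g (cell_index T p t)) (a (tgrid T q k) - a 0)"
    using has_bochner_integral_cell_step[OF T, of g p] by simp
  moreover have "indicator {0<..tgrid T q k} t * cell_density T a p t = g (cell_index T p t)" if "t \<in> space ?M" for t
  proof -
    have t: "0 < t" using that by (auto simp: space_restrict_space)
    have "cell_index T q t < k \<longleftrightarrow> t \<le> tgrid T q k"
      using tgrid_mono[OF T, of "Suc (cell_index T q t)" k q] tgrid_mono[OF T, of k "cell_index T q t" q]
        mem_time_cell_index[OF T t, of q] by (cases "cell_index T q t < k") (auto simp: time_cell_def)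
    then show ?thesis using t by (simp add: g_def cell_density_def p cell_index_div[OF T t, of q d] indicator_def)
  qed
  ultimately show ?thesis by (subst has_bochner_integral_cong[OF refl _ refl]) auto
qed

lemma cell_integral_mean_tendsto:
  assumes T: "0 < T" and cont: "continuous_on {0..T} v" and t: "t \<in> {0..T}"
  shows "(\<lambda>q. cell_mean T q (cell_integral T v q) (cell_index T q t)) \<longlonglongrightarrow> v t"
proof (rule tendstoI)
  fix e :: real assume "0 < e"
  then have "\<forall>\<^sub>F q in sequentially. \<forall>s\<in>{0..T}. \<forall>t\<in>{0..T}. \<bar>t - s\<bar> \<le> T / 2 ^ q \<longrightarrow> dist (v t) (v s) < e / 2"
    by (intro cell_oscillation_le[OF T cont]) simp
  then show "\<forall>\<^sub>F q in sequentially. dist (cell_mean T q (cell_integral T v q) (cell_index T q t)) (v t) < e"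
  proof eventually_elim
    case (elim q)
    let ?k = "cell_index T q t"
    have k: "?k < 2 ^ q" using cell_index_less[OF T t] .
    have "\<bar>cell_integral T v q ?k - v t * (T / 2 ^ q)\<bar> \<le> e / 2 * (T / 2 ^ q)"
    proof (rule cell_integral_approx[OF T k cont])
      fix s assume s: "s \<in> {tgrid T q ?k..tgrid T q (Suc ?k)}"
      then have "s \<in> {0..T}" "\<bar>s - t\<bar> \<le> T / 2 ^ q"
        using tgrid_cell[OF T k] cell_index_bounds[OF T, of t q] t by (auto simp: tgrid_Suc abs_le_iff)
      then show "\<bar>v s - v t\<bar> \<le> e / 2" using elim t by (force simp: dist_real_def)
    qed
    then have "\<bar>(cell_mean T q (cell_integral T v q) ?k - v t) * (T / 2 ^ q)\<bar> \<le> e / 2 * (T / 2 ^ q)"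
      unfolding left_diff_distrib cell_mean_mult[OF T] .
    then have "\<bar>cell_mean T q (cell_integral T v q) ?k - v t\<bar> \<le> e / 2"
      unfolding abs_mult using T by (simp add: mult_le_cancel_right del: times_divide_eq_right)
    then show ?case using \<open>0 < e\<close> by (simp add: dist_real_def)
  qed
qed

lemma exp_half_gap:
  fixes x y :: real
  shows "(exp (- x / 2) - exp (- y / 2))\<^sup>2 \<le> exp (- y) - exp (- x) + exp (- x) * (y - x)"
proof -
  have "exp (- x) * (1 + (x - y) / 2) \<le> exp (- x) * exp ((x - y) / 2)"
    by (intro mult_left_mono exp_ge_add_one_self) auto
  also have "\<dots> = exp (- x / 2) * exp (- y / 2)"
    by (simp add: exp_add[symmetric] field_simps)
  finally have "2 * (exp (- x) * (1 + (x - y) / 2)) \<le> 2 * (exp (- x / 2) * exp (- y / 2))" by simp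
  moreover have "(exp (- x / 2) - exp (- y / 2))\<^sup>2 = exp (- x) + exp (- y) - 2 * (exp (- x / 2) * exp (- y / 2))"
    by (simp add: power2_diff flip: exp_double)
  moreover have "2 * (exp (- x) * (1 + (x - y) / 2)) = 2 * exp (- x) - exp (- x) * (y - x)"
    by (simp add: field_simps)
  ultimately show ?thesis by linarith
qed

lemma AM_GM_abs:
  fixes y :: real
  assumes "0 < \<delta>"
  shows "\<bar>y\<bar> \<le> \<delta> + y\<^sup>2 / \<delta>"
proof -
  have "0 \<le> \<bar>y\<bar> * \<delta>" using assms by simp
  then have "\<bar>y\<bar> * \<delta> \<le> \<delta>\<^sup>2 + \<bar>y\<bar>\<^sup>2"
    using zero_le_power2[of "\<bar>y\<bar> - \<delta>"] unfolding power2_diff by linarith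
  then show ?thesis using assms by (simp add: field_simps power2_eq_square)
qed

lemma relent_le_of_dual_bound:
  assumes x: "0 \<le> x" and w: "0 \<le> w" and bound: "\<And>b. b * x - (exp b - 1) * w \<le> h"
  shows "w = 0 \<Longrightarrow> x = 0" and "relent x w \<le> h"
proof -
  show weight_0: "x = 0" if "w = 0"
  proof (rule ccontr)
    assume "x \<noteq> 0"
    then show False using bound[of "(h + 1) / x"] that by simp
  qed
  show "relent x w \<le> h"
  proof (cases "x = 0")
    case True
    have "((\<lambda>b. (1 - exp b) * w) \<longlongrightarrow> (1 - 0) * w) at_bot"
      by (intro tendsto_intros exp_at_bot)
    moreover have "(1 - exp b) * w \<le> h" for b using bound[of b] True by (simp add: left_diff_distrib)
    ultimately have "w \<le> h" using tendsto_upperbound[of "\<lambda>b. (1 - exp b) * w" w at_bot h] by simp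
    then show ?thesis using True by (simp add: relent_def)
  next
    case False
    then have "0 < x" "0 < w" using x w weight_0 by (auto simp: less_le)
    then have "(exp (ln (x / w)) - 1) * w = x - w" by (simp add: left_diff_distrib)
    then show ?thesis using bound[of "ln (x / w)"] by (simp add: relent_def mult.commute)
  qed
qed

lemma relent_scale: "0 < s \<Longrightarrow> relent (x * s) (w * s) = relent x w * s"
  by (simp add: relent_def algebra_simps)

lemma tendsto_of_half_exp:
  fixes x :: "nat \<Rightarrow> real"
  assumes nonneg: "\<And>i. 0 \<le> x i" and lim: "(\<lambda>i. exp (- x i / 2)) \<longlonglongrightarrow> u"
    and finite: "liminf (\<lambda>i. ennreal (x i)) \<noteq> \<infinity>"
  shows "x \<longlonglongrightarrow> max 0 (- 2 * ln u)"
proof -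
  have u: "0 \<le> u" "u \<le> 1"
    using LIMSEQ_le_const[OF lim, of 0] LIMSEQ_le_const2[OF lim, of 1] nonneg by auto
  have "u \<noteq> 0"
  proof
    assume "u = 0"
    then have "filterlim (\<lambda>i. exp (- x i / 2)) (at_right 0) sequentially"
      using lim by (simp add: filterlim_at)
    then have "filterlim (\<lambda>i. ln (exp (- x i / 2))) at_bot sequentially"
      by (rule filterlim_compose[OF ln_at_0])
    then have "filterlim (\<lambda>i. 2 * (x i / 2)) at_top sequentially"
      by (intro filterlim_tendsto_pos_mult_at_top[OF tendsto_const]) (auto simp: filterlim_uminus_at_bot)
    then have "(\<lambda>i. ennreal (x i)) \<longlonglongrightarrow> \<infinity>"
      by (simp add: ennreal_tendsto_top_eq_at_top)
    then show False using finite lim_imp_Liminf[OF sequentially_bot] by blast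
  qed
  with lim have "(\<lambda>i. - 2 * ln (exp (- x i / 2))) \<longlonglongrightarrow> - 2 * ln u" by (intro tendsto_intros)
  moreover have "ln u \<le> 0" using u \<open>u \<noteq> 0\<close> by simp
  ultimately show ?thesis by (simp add: max_def)
qed

locale finite_dual_cost =
  fixes T :: real and a v :: "real \<Rightarrow> real" and c :: real
  assumes T_pos: "0 < T" and mono_path: "mono_on {0..T} a" and cont_path: "continuous_on {0..T} a"
    and cont_weight: "continuous_on {0..T} v" and weight_nonneg: "\<And>t. t \<in> {0..T} \<Longrightarrow> 0 \<le> v t"
    and dual_cost_le: "\<And>q \<beta>. dual_cost T a v q \<beta> \<le> c"
begin

abbreviation time_measure :: "real measure" where
  "time_measure \<equiv> restrict_space lborel {0<..T}"

abbreviation slope :: "nat \<Rightarrow> nat \<Rightarrow> real" where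
  "slope q \<equiv> cell_mean T q (incr T a q)"

lemma time_measureD: "t \<in> space time_measure \<Longrightarrow> 0 < t \<and> t \<in> {0..T}"
  by (auto simp: space_restrict_space)

lemma finite_time_measure: "finite_measure time_measure"
  using T_pos by (intro finite_measureI) (simp add: space_restrict_space emeasure_restrict_space)

lemma cost_nonneg: "0 \<le> c"
  using dual_cost_le[of 0 "\<lambda>_. 0"] by simp

lemma slope_nonneg: "k < 2 ^ q \<Longrightarrow> 0 \<le> slope q k"
  using incr_nonneg[OF mono_path T_pos, of k q] T_pos by (simp add: cell_mean_def)

lemma cell_density_nonneg: "t \<in> {0..T} \<Longrightarrow> 0 \<le> cell_density T a q t"
  unfolding cell_density_def by (intro slope_nonneg cell_index_less T_pos)

lemma integrable_cell_density [simp]: "integrable time_measure (cell_density T a q)"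
  unfolding cell_density_def by (intro integrable_cell_step T_pos)

definition exp_moment :: "nat \<Rightarrow> real" where
  "exp_moment q = (\<Sum>k<2 ^ q. exp (- slope q k) * (T / 2 ^ q))"

abbreviation half_exp :: "nat \<Rightarrow> real \<Rightarrow> real" where
  "half_exp q t \<equiv> exp (- cell_density T a q t / 2)"

lemma integrable_half_exp: "integrable time_measure (half_exp q)"
  unfolding cell_density_def
  using integrable_cell_step[OF T_pos, of "\<lambda>k. exp (- slope q k / 2)" q] by simp

lemma half_exp_gap_le:
  shows "(LINT t|time_measure. (half_exp q t - half_exp (q + d) t)\<^sup>2) \<le> exp_moment (q + d) - exp_moment q"
    and "integrable time_measure (\<lambda>t. (half_exp q t - half_exp (q + d) t)\<^sup>2)"
proof -
  define h where "h = T / 2 ^ (q + d)"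
  define x where "x j = slope q (j div 2 ^ d)" for j
  define y where "y j = slope (q + d) j" for j
  define z where "z j = (exp (- x j / 2) - exp (- y j / 2))\<^sup>2" for j
  have y_h: "y j * h = incr T a (q + d) j" for j unfolding y_def h_def by (rule cell_mean_mult[OF T_pos])
  have square_eq: "(half_exp q t - half_exp (q + d) t)\<^sup>2 = z (cell_index T (q + d) t)" if "t \<in> space time_measure" for t
    using time_measureD[OF that] cell_index_div[OF T_pos, of t q d]
    by (simp add: z_def x_def y_def cell_density_def)
  show "integrable time_measure (\<lambda>t. (half_exp q t - half_exp (q + d) t)\<^sup>2)"
    using integrable_cell_step[OF T_pos, of z "q + d"]
    by (rule Bochner_Integration.integrable_cong[OF refl, THEN iffD1, rotated]) (rule square_eq[symmetric])
  have "(LINT t|time_measure. (half_exp q t - half_exp (q + d) t)\<^sup>2) = (LINT t|time_measure. z (cell_index T (q + d) t))"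
    by (intro Bochner_Integration.integral_cong refl square_eq)
  also have "\<dots> = (\<Sum>j<2 ^ (q + d). z j * h)" unfolding h_def by (rule integral_cell_step[OF T_pos])
  also have "\<dots> \<le> (\<Sum>j<2 ^ (q + d). (exp (- y j) - exp (- x j) + exp (- x j) * (y j - x j)) * h)"
    unfolding z_def h_def using T_pos by (intro sum_mono mult_right_mono exp_half_gap) auto
  also have "\<dots> = (\<Sum>j<2 ^ (q + d). exp (- y j) * h - exp (- x j) * h
      + (exp (- x j) * incr T a (q + d) j - (exp (- x j) * x j) * h))"
    unfolding y_h[symmetric] by (simp add: algebra_simps)
  also have "\<dots> = exp_moment (q + d) - (\<Sum>j<2 ^ (q + d). exp (- x j) * h)
      + ((\<Sum>j<2 ^ (q + d). exp (- x j) * incr T a (q + d) j) - (\<Sum>j<2 ^ (q + d). (exp (- x j) * x j) * h))"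
    unfolding exp_moment_def y_def h_def by (simp only: sum.distrib sum_subtractf)
  also have "(\<Sum>j<2 ^ (q + d). exp (- x j) * h) = exp_moment q"
    unfolding x_def h_def exp_moment_def by (rule mesh_refine)
  also have "(\<Sum>j<2 ^ (q + d). exp (- x j) * incr T a (q + d) j) = (\<Sum>k<2 ^ q. exp (- slope q k) * incr T a q k)"
    unfolding x_def by (rule incr_refine)
  also have "(\<Sum>j<2 ^ (q + d). (exp (- x j) * x j) * h) = (\<Sum>k<2 ^ q. (exp (- slope q k) * slope q k) * (T / 2 ^ q))"
    unfolding x_def h_def by (rule mesh_refine)
  also have "\<dots> = (\<Sum>k<2 ^ q. exp (- slope q k) * incr T a q k)"
    by (simp only: mult.assoc cell_mean_mult[OF T_pos])
  finally show "(LINT t|time_measure. (half_exp q t - half_exp (q + d) t)\<^sup>2) \<le> exp_moment (q + d) - exp_moment q"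
    by simp
qed

lemma Cauchy_exp_moment: "Cauchy exp_moment"
proof -
  have "exp_moment q \<le> exp_moment (q + d)" for q d
  proof -
    have "0 \<le> (LINT t|time_measure. (half_exp q t - half_exp (q + d) t)\<^sup>2)"
      by (intro Bochner_Integration.integral_nonneg) simp
    then show ?thesis using half_exp_gap_le(1)[of q d] by linarith
  qed
  then have "incseq exp_moment" by (auto simp: incseq_def le_iff_add)
  moreover have "exp_moment q \<le> T" for q
  proof -
    have "exp_moment q \<le> (\<Sum>k<2 ^ q::nat. 1 * (T / 2 ^ q))"
      unfolding exp_moment_def using T_pos slope_nonneg by (intro sum_mono mult_right_mono) auto
    then show ?thesis by simp
  qed
  ultimately obtain l where "exp_moment \<longlonglongrightarrow> l" using incseq_convergent[of exp_moment T] by blast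
  then show ?thesis by (rule LIMSEQ_imp_Cauchy)
qed

lemma half_exp_dist_le:
  assumes "0 < \<delta>"
  shows "(LINT t|time_measure. \<bar>half_exp q t - half_exp (q + d) t\<bar>) \<le> \<delta> * T + (exp_moment (q + d) - exp_moment q) / \<delta>"
proof -
  interpret finite_measure time_measure by (rule finite_time_measure)
  have "(LINT t|time_measure. \<bar>half_exp q t - half_exp (q + d) t\<bar>)
      \<le> (LINT t|time_measure. \<delta> + (half_exp q t - half_exp (q + d) t)\<^sup>2 / \<delta>)"
    using half_exp_gap_le(2) integrable_half_exp
    by (intro integral_mono AM_GM_abs assms integrable_abs Bochner_Integration.integrable_diff
        Bochner_Integration.integrable_add integrable_divide) auto
  also have "\<dots> = \<delta> * T + (LINT t|time_measure. (half_exp q t - half_exp (q + d) t)\<^sup>2) / \<delta>"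
    using half_exp_gap_le(2) T_pos
    by (subst Bochner_Integration.integral_add)
      (auto simp: measure_restrict_space space_restrict_space)
  also have "\<dots> \<le> \<delta> * T + (exp_moment (q + d) - exp_moment q) / \<delta>"
    using half_exp_gap_le(1) assms by (intro add_left_mono divide_right_mono) auto
  finally show ?thesis .
qed

lemma half_exp_Cauchy_L1:
  assumes "0 < e"
  shows "\<exists>N. \<forall>i\<ge>N. \<forall>j\<ge>N. (LINT t|time_measure. norm (half_exp i t - half_exp j t)) < e"
proof -
  define \<delta> where "\<delta> = e / (2 * (T + 1))"
  have \<delta>: "0 < \<delta>" "\<delta> * T < e / 2" using assms T_pos by (auto simp: \<delta>_def field_simps)
  have "0 < \<delta> * e / 2" using \<delta> assms by simp
  then obtain N where N: "\<And>i j. N \<le> i \<Longrightarrow> N \<le> j \<Longrightarrow> \<bar>exp_moment i - exp_moment j\<bar> < \<delta> * e / 2"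
    using Cauchy_exp_moment unfolding Cauchy_def dist_real_def by meson
  have ordered: "(LINT t|time_measure. \<bar>half_exp q t - half_exp (q + d) t\<bar>) < e" if "N \<le> q" for q d
  proof -
    have "\<bar>exp_moment (q + d) - exp_moment q\<bar> < \<delta> * e / 2" using that by (intro N) auto
    then have "exp_moment (q + d) - exp_moment q < \<delta> * e / 2" by linarith
    then have "(exp_moment (q + d) - exp_moment q) / \<delta> < e / 2"
      using \<delta>(1) by (simp add: field_simps)
    then show ?thesis using half_exp_dist_le[OF \<delta>(1), of q d] \<delta>(2) by linarith
  qed
  have "(LINT t|time_measure. norm (half_exp i t - half_exp j t)) < e" if "N \<le> i" "N \<le> j" for i j
    using ordered[of i "j - i"] ordered[of j "i - j"] that by (cases "i \<le> j") (auto simp: abs_minus_commute)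
  then show ?thesis by blast
qed

lemma excess_cell_le:
  assumes k: "k < 2 ^ q" and "0 < B" "0 < K" "0 \<le> V" and V: "\<And>t. t \<in> {0..T} \<Longrightarrow> v t \<le> V"
  defines "\<beta> \<equiv> if K < slope q k then B else 0"
  shows "B * (max 0 (slope q k - K) * (T / 2 ^ q)) \<le>
    (\<beta> * incr T a q k - (exp \<beta> - 1) * cell_integral T v q k) + exp B * V * (incr T a q k / K)"
proof (cases "K < slope q k")
  case True
  define h where "h = T / 2 ^ q"
  have "0 < h" using T_pos by (simp add: h_def)
  have slope_h: "slope q k * h = incr T a q k" unfolding h_def by (rule cell_mean_mult[OF T_pos])
  have "(exp B - 1) * cell_integral T v q k \<le> (exp B - 1) * (V * h)"
    unfolding h_def using \<open>0 < B\<close> by (intro mult_left_mono cell_integral_le[OF T_pos cont_weight k V]) auto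
  also have "\<dots> \<le> exp B * (V * h)" using \<open>0 \<le> V\<close> \<open>0 < h\<close> by (intro mult_right_mono) auto
  also have "h \<le> slope q k * h / K" using True \<open>0 < h\<close> \<open>0 < K\<close> by (simp add: field_simps)
  finally have "(exp B - 1) * cell_integral T v q k \<le> exp B * V * (incr T a q k / K)"
    using \<open>0 \<le> V\<close> by (simp add: mult.assoc mult_left_mono slope_h)
  moreover have "B * ((slope q k - K) * h) \<le> B * incr T a q k"
    using \<open>0 < B\<close> \<open>0 < K\<close> \<open>0 < h\<close> by (simp add: left_diff_distrib slope_h)
  ultimately show ?thesis using True by (simp add: \<beta>_def h_def)
next
  case False
  then show ?thesis using assms(3,4) incr_nonneg[OF mono_path T_pos k] by (simp add: \<beta>_def)
qed

lemma integral_excess_le: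
  assumes "0 < B" "0 < K" "0 \<le> V" and V: "\<And>t. t \<in> {0..T} \<Longrightarrow> v t \<le> V"
  shows "B * (LINT t|time_measure. max 0 (cell_density T a q t - K)) \<le> c + exp B * V * (a T - a 0) / K"
proof -
  define \<beta> where "\<beta> k = (if K < slope q k then B else 0)" for k
  have "(LINT t|time_measure. max 0 (cell_density T a q t - K)) = (\<Sum>k<2 ^ q. max 0 (slope q k - K) * (T / 2 ^ q))"
    unfolding cell_density_def by (rule integral_cell_step[OF T_pos])
  then have "B * (LINT t|time_measure. max 0 (cell_density T a q t - K))
        = B * (\<Sum>k<2 ^ q. max 0 (slope q k - K) * (T / 2 ^ q))"
    by simp
  also have "\<dots> \<le> dual_cost T a v q \<beta> + (\<Sum>k<2 ^ q. exp B * V * (incr T a q k / K))"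
    unfolding dual_cost_def dual_sum_def sum_distrib_left sum.distrib[symmetric] \<beta>_def
    by (intro sum_mono excess_cell_le assms) auto
  also have "(\<Sum>k<2 ^ q. exp B * V * (incr T a q k / K)) = exp B * V * (a T - a 0) / K"
    using sum_incr[of T a q "2 ^ q"] by (simp add: sum_distrib_left[symmetric] sum_divide_distrib[symmetric])
  finally show ?thesis using dual_cost_le[of q \<beta>] by linarith
qed

lemma uniformly_small_excess:
  assumes "0 < e"
  obtains K where "0 < K" "\<And>q. (LINT t|time_measure. max 0 (cell_density T a q t - K)) \<le> e"
proof -
  have "bounded (v ` {0..T})" using cont_weight by (intro compact_imp_bounded compact_continuous_image) auto
  then obtain V where V: "0 < V" "\<And>t. t \<in> {0..T} \<Longrightarrow> v t \<le> V"
    unfolding bounded_pos by (auto simp: abs_le_iff)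
  define B where "B = 2 * (c + 1) / e"
  define K where "K = 2 * (exp B * V * (a T - a 0) + 1) / (B * e)"
  have "0 \<le> a T - a 0" using mono_path T_pos by (auto intro: mono_onD)
  then have B: "0 < B" "c \<le> B * e / 2" and K: "0 < K" "exp B * V * (a T - a 0) \<le> K * (B * e / 2)"
    using cost_nonneg assms V(1) by (auto simp: B_def K_def intro!: divide_pos_pos mult_pos_pos add_nonneg_pos)
  have "B * (LINT t|time_measure. max 0 (cell_density T a q t - K)) \<le> B * e" for q
  proof -
    have "exp B * V * (a T - a 0) / K \<le> B * e / 2" using K by (simp add: field_simps)
    then show ?thesis using integral_excess_le[OF B(1) K(1) less_imp_le[OF V(1)] V(2), of q] B(2) by linarith
  qed
  then show thesis using that[OF K(1)] B(1) by simp
qed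

lemma ae_convergent_half_exp:
  obtains r U where "strict_mono (r :: nat \<Rightarrow> nat)" "U \<in> borel_measurable borel"
    "AE t in time_measure. (\<lambda>i. half_exp (r i) t) \<longlonglongrightarrow> U t"
proof -
  obtain r where r: "strict_mono r" "AE t in time_measure. Cauchy (\<lambda>i. half_exp (r i) t)"
    using cauchy_L1_AE_cauchy_subseq[OF integrable_half_exp half_exp_Cauchy_L1] by blast
  define U where "U t = lim (\<lambda>i. half_exp (r i) t)" for t
  have "U \<in> borel_measurable borel"
    unfolding U_def by (rule borel_measurable_lim_metric) measurable
  moreover have "AE t in time_measure. (\<lambda>i. half_exp (r i) t) \<longlonglongrightarrow> U t"
    using r(2) unfolding U_def
    by eventually_elim (simp add: Cauchy_convergent convergent_LIMSEQ_iff[symmetric])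
  ultimately show thesis using r(1) that by blast
qed

lemma nn_integral_cell_density: "(\<integral>\<^sup>+ t. ennreal (cell_density T a q t) \<partial>time_measure) = ennreal (a T - a 0)"
proof -
  have "has_bochner_integral time_measure (\<lambda>t. indicator {0<..tgrid T 0 1} t * cell_density T a q t)
      (a (tgrid T 0 1) - a 0)"
    by (rule has_bochner_integral_cell_density_prefix[OF T_pos]) auto
  then have "has_bochner_integral time_measure (cell_density T a q) (a T - a 0)"
    by (subst (asm) has_bochner_integral_cong[where g="cell_density T a q"])
      (auto simp: tgrid_def indicator_def dest!: time_measureD)
  then show ?thesis
    using cell_density_nonneg
    by (subst nn_integral_eq_integral) (auto simp: has_bochner_integral_iff intro!: AE_I2 dest: time_measureD)
qed

lemma ae_finite_liminf_cell_density:
  "AE t in time_measure. liminf (\<lambda>i. ennreal (cell_density T a (r i) t)) \<noteq> \<infinity>"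
proof (rule nn_integral_noteq_infinite)
  have "(\<integral>\<^sup>+ t. liminf (\<lambda>i. ennreal (cell_density T a (r i) t)) \<partial>time_measure)
      \<le> liminf (\<lambda>i. \<integral>\<^sup>+ t. ennreal (cell_density T a (r i) t) \<partial>time_measure)"
    by (intro nn_integral_liminf measurable_restrict_space1) simp
  also have "\<dots> = ennreal (a T - a 0)" by (simp add: nn_integral_cell_density Liminf_const)
  finally show "(\<integral>\<^sup>+ t. liminf (\<lambda>i. ennreal (cell_density T a (r i) t)) \<partial>time_measure) \<noteq> \<infinity>"
    by (auto simp: top_unique)
qed (intro measurable_restrict_space1, simp)

lemma ae_convergent_cell_density:
  obtains r F where "strict_mono (r :: nat \<Rightarrow> nat)" "F \<in> borel_measurable borel" "\<And>t. 0 \<le> F t"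
    "AE t in time_measure. (\<lambda>i. cell_density T a (r i) t) \<longlonglongrightarrow> F t"
proof -
  obtain r U where r: "strict_mono (r :: nat \<Rightarrow> nat)" and [measurable]: "U \<in> borel_measurable borel"
    and U: "AE t in time_measure. (\<lambda>i. half_exp (r i) t) \<longlonglongrightarrow> U t"
    by (rule ae_convergent_half_exp)
  have "AE t in time_measure. (\<lambda>i. cell_density T a (r i) t) \<longlonglongrightarrow> max 0 (- 2 * ln (U t))"
    using U ae_finite_liminf_cell_density[of r] AE_space
  proof eventually_elim
    case (elim t)
    then show ?case by (intro tendsto_of_half_exp cell_density_nonneg) (auto dest: time_measureD)
  qed
  then show thesis by (intro that[OF r]) auto
qed

lemma weight_0_incr_0:
  assumes "k < 2 ^ q" "cell_integral T v q k = 0"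
  shows "incr T a q k = 0"
proof (rule relent_le_of_dual_bound(1)[OF incr_nonneg[OF mono_path T_pos assms(1)]])
  show "b * incr T a q k - (exp b - 1) * cell_integral T v q k \<le> c" for b
    using dual_cost_le[of q "\<lambda>j. if j = k then b else 0"] dual_sum_single[OF assms(1)] by (simp add: dual_cost_def)
qed (use assms in auto)

lemma sum_relent_le: "(\<Sum>k<2 ^ q. relent (incr T a q k) (cell_integral T v q k)) \<le> c"
proof -
  let ?x = "incr T a q" and ?w = "cell_integral T v q"
  define \<beta> where "\<beta> b k = (if ?x k = 0 then b else ln (?x k / ?w k))" for b k
  have "((\<lambda>b. \<beta> b k * ?x k - (exp (\<beta> b k) - 1) * ?w k) \<longlongrightarrow> relent (?x k) (?w k)) at_bot" if k: "k < 2 ^ q" for k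
  proof (cases "?x k = 0")
    case True
    have "((\<lambda>b. 0 - (exp b - 1) * ?w k) \<longlongrightarrow> 0 - (0 - 1) * ?w k) at_bot"
      by (intro tendsto_intros exp_at_bot)
    then show ?thesis using True by (simp add: \<beta>_def relent_def)
  next
    case False
    then have "0 < ?x k" "0 < ?w k"
      using incr_nonneg[OF mono_path T_pos k] weight_0_incr_0[OF k] cell_integral_nonneg[OF T_pos k weight_nonneg]
      by (auto simp: less_le)
    then have "\<beta> b k * ?x k - (exp (\<beta> b k) - 1) * ?w k = relent (?x k) (?w k)" for b
      by (simp add: \<beta>_def relent_def field_simps)
    then show ?thesis by simp
  qed
  then have "((\<lambda>b. dual_cost T a v q (\<beta> b)) \<longlongrightarrow> (\<Sum>k<2 ^ q. relent (?x k) (?w k))) at_bot"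
    unfolding dual_cost_def dual_sum_def by (intro tendsto_sum) auto
  then show ?thesis using dual_cost_le by (intro tendsto_upperbound) auto
qed

abbreviation weight_density :: "nat \<Rightarrow> real \<Rightarrow> real" where
  "weight_density q t \<equiv> cell_mean T q (cell_integral T v q) (cell_index T q t)"

lemma nn_integral_relent_cell_density_le:
  "(\<integral>\<^sup>+ t. ennreal (relent (cell_density T a q t) (weight_density q t)) \<partial>time_measure) \<le> ennreal c"
proof -
  define g where "g k = relent (slope q k) (cell_mean T q (cell_integral T v q) k)" for k
  have g_mesh: "g k * (T / 2 ^ q) = relent (incr T a q k) (cell_integral T v q k)" for k
    unfolding g_def using T_pos by (subst relent_scale[symmetric])
      (auto simp: cell_mean_mult[OF T_pos] simp del: times_divide_eq_right)
  have "0 \<le> g k * (T / 2 ^ q)" if k: "k < 2 ^ q" for k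
    unfolding g_mesh
    using relent_ge_dual[of "incr T a q k" "cell_integral T v q k" 0] weight_0_incr_0[OF k]
      incr_nonneg[OF mono_path T_pos k] cell_integral_nonneg[OF T_pos k weight_nonneg] by auto
  moreover have "0 < T / 2 ^ q" using T_pos by simp
  ultimately have "0 \<le> g k" if "k < 2 ^ q" for k using that by (meson mult_neg_pos not_less)
  then have "(\<integral>\<^sup>+ t. ennreal (g (cell_index T q t)) \<partial>time_measure) = ennreal (\<Sum>k<2 ^ q. g k * (T / 2 ^ q))"
    using has_bochner_integral_cell_step[OF T_pos, of g q] cell_index_less[OF T_pos]
    by (subst nn_integral_eq_integral) (auto simp: has_bochner_integral_iff intro!: AE_I2 dest!: time_measureD)
  also have "\<dots> \<le> ennreal c" unfolding g_mesh by (intro ennreal_leI sum_relent_le)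
  finally show ?thesis by (simp add: g_def cell_density_def)
qed

end

locale cell_density_limit = finite_dual_cost +
  fixes r :: "nat \<Rightarrow> nat" and F :: "real \<Rightarrow> real"
  assumes subseq: "strict_mono r" and measurable_limit [measurable]: "F \<in> borel_measurable borel"
    and limit_nonneg: "\<And>t. 0 \<le> F t"
    and ae_limit: "AE t in time_measure. (\<lambda>i. cell_density T a (r i) t) \<longlonglongrightarrow> F t"
begin

lemma truncated_prefix_tendsto:
  assumes "0 \<le> K"
  shows "(\<lambda>i. LINT t|time_measure. indicator {0<..s} t * min (cell_density T a (r i) t) K)
    \<longlonglongrightarrow> (LINT t|time_measure. indicator {0<..s} t * min (F t) K)"
proof (rule integral_dominated_convergence[where w="\<lambda>_. K"])
  interpret finite_measure time_measure by (rule finite_time_measure)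
  show "integrable time_measure (\<lambda>_. K)" by simp
  show "AE t in time_measure. (\<lambda>i. indicator {0<..s} t * min (cell_density T a (r i) t) K)
      \<longlonglongrightarrow> indicator {0<..s} t * min (F t) K"
    using ae_limit by eventually_elim (intro tendsto_intros)
  show "AE t in time_measure. norm (indicator {0<..s} t * min (cell_density T a (r i) t) K) \<le> K" for i
    using cell_density_nonneg assms by (intro AE_I2) (auto simp: indicator_def min_def dest!: time_measureD)
qed (auto intro!: measurable_restrict_space1)

lemma integrable_prefix:
  fixes f :: "real \<Rightarrow> real"
  assumes "integrable time_measure f"
  shows "integrable time_measure (\<lambda>t. indicator {0<..s} t * f t)"
proof (rule Bochner_Integration.integrable_bound[OF assms])
  show "(\<lambda>t. indicator {0<..s} t * f t) \<in> borel_measurable time_measure"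
    using borel_measurable_integrable[OF assms]
    by (intro borel_measurable_times[OF measurable_restrict_space1]) auto
qed (auto simp: indicator_def)

lemma truncated_prefix_bounds:
  assumes "0 \<le> K" and excess: "\<And>q. (LINT t|time_measure. max 0 (cell_density T a q t - K)) \<le> e"
    and s: "s = tgrid T q k" "k \<le> 2 ^ q"
  shows "(LINT t|time_measure. indicator {0<..s} t * min (F t) K) \<in> {a s - a 0 - e..a s - a 0}"
proof -
  interpret finite_measure time_measure by (rule finite_time_measure)
  let ?g = "\<lambda>i. cell_density T a (r i)"
  have between: "(LINT t|time_measure. indicator {0<..s} t * min (?g i t) K) \<in> {a s - a 0 - e..a s - a 0}" if "q \<le> i"
      for i
  proof -
    have truncated: "integrable time_measure (\<lambda>t. indicator {0<..s} t * min (?g i t) K)"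
      by (intro integrable_prefix integrable_min) auto
    have excess_integrable: "integrable time_measure (\<lambda>t. max 0 (?g i t - K))" by (intro integrable_max) auto
    have "q \<le> r i" using seq_suble[OF subseq, of i] that by simp
    then have total: "(LINT t|time_measure. indicator {0<..s} t * ?g i t) = a s - a 0"
      unfolding s(1) using has_bochner_integral_cell_density_prefix[OF T_pos s(2)]
        by (simp add: has_bochner_integral_iff)
    have "(LINT t|time_measure. indicator {0<..s} t * min (?g i t) K)
          \<le> (LINT t|time_measure. indicator {0<..s} t * ?g i t)"
      using truncated by (intro integral_mono integrable_prefix) (auto simp: indicator_def)
    moreover have "(LINT t|time_measure. indicator {0<..s} t * ?g i t)
        \<le> (LINT t|time_measure. indicator {0<..s} t * min (?g i t) K + max 0 (?g i t - K))"
      using truncated excess_integrable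
      by (intro integral_mono integrable_prefix Bochner_Integration.integrable_add) (auto simp: indicator_def)
    moreover have "\<dots> = (LINT t|time_measure. indicator {0<..s} t * min (?g i t) K)
          + (LINT t|time_measure. max 0 (?g i t - K))"
      using truncated excess_integrable by (rule Bochner_Integration.integral_add)
    ultimately show ?thesis using excess[of "r i"] total by auto
  qed
  have lim: "(\<lambda>i. LINT t|time_measure. indicator {0<..s} t * min (?g i t) K)
      \<longlonglongrightarrow> (LINT t|time_measure. indicator {0<..s} t * min (F t) K)"
    by (rule truncated_prefix_tendsto[OF \<open>0 \<le> K\<close>])
  show ?thesis
    by (rule Lim_in_closed_set[OF _ _ _ lim]) (auto intro!: eventually_sequentiallyI[of q] dest: between)
qed

lemma has_bochner_integral_prefix:
  assumes s: "s = tgrid T q k" "k \<le> 2 ^ q"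
  shows "has_bochner_integral time_measure (\<lambda>t. indicator {0<..s} t * F t) (a s - a 0)"
proof (rule has_bochner_integral_monotone_convergence)
  interpret finite_measure time_measure by (rule finite_time_measure)
  let ?f = "\<lambda>i t. indicator {0<..s} t * min (F t) (real i)"
  show integrable: "integrable time_measure (?f i)" for i
    by (rule integrable_const_bound[of _ "real i"])
      (use limit_nonneg in \<open>auto simp: indicator_def intro!: measurable_restrict_space1\<close>)
  show "AE t in time_measure. mono (\<lambda>i. ?f i t)"
    by (intro AE_I2) (auto simp: mono_def indicator_def intro: min.mono)
  show "AE t in time_measure. (\<lambda>i. ?f i t) \<longlonglongrightarrow> indicator {0<..s} t * F t"
  proof (intro AE_I2 tendsto_eventually)
    fix t
    obtain N where "F t \<le> real N" using real_arch_simple by blast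
    then show "\<forall>\<^sub>F i in sequentially. ?f i t = indicator {0<..s} t * F t"
      by (intro eventually_sequentiallyI[of N]) (simp add: min_absorb1 order_trans)
  qed
  show "(\<lambda>i. integral\<^sup>L time_measure (?f i)) \<longlonglongrightarrow> a s - a 0"
  proof (rule LIMSEQ_I)
    fix e :: real assume "0 < e"
    then obtain K where K: "0 < K" "\<And>q. (LINT t|time_measure. max 0 (cell_density T a q t - K)) \<le> e / 2"
      using uniformly_small_excess[of "e / 2"] by auto
    obtain N where N: "K \<le> real N" using real_arch_simple by blast
    have "norm (integral\<^sup>L time_measure (?f i) - (a s - a 0)) < e" if "N \<le> i" for i
    proof -
      have "K \<le> real i" using N that by simp
      then have "(LINT t|time_measure. max 0 (cell_density T a p t - real i))
            \<le> (LINT t|time_measure. max 0 (cell_density T a p t - K))" for p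
        by (intro integral_mono integrable_max Bochner_Integration.integrable_diff) auto
      then have "(LINT t|time_measure. max 0 (cell_density T a p t - real i)) \<le> e / 2" for p
        using K(2)[of p] by (rule order_trans)
      then have "integral\<^sup>L time_measure (?f i) \<in> {a s - a 0 - e / 2..a s - a 0}"
        by (intro truncated_prefix_bounds[OF _ _ s]) auto
      then show ?thesis using \<open>0 < e\<close> by simp
    qed
    then show "\<exists>N. \<forall>i\<ge>N. norm (integral\<^sup>L time_measure (?f i) - (a s - a 0)) < e" by blast
  qed
qed (intro measurable_restrict_space1, measurable)

lemma integrable_limit: "integrable time_measure F"
  using has_bochner_integral_prefix[of T 0 1]
  by (intro Bochner_Integration.integrable_cong[OF refl, THEN iffD1, OF _ integrable.intros])
    (auto simp: tgrid_def indicator_def dest!: time_measureD)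

lemma set_integral_limit_eq_prefix:
  assumes "t \<in> {0..T}"
  shows "(LINT s:{0..t}|lborel. F s) = (LINT s|time_measure. indicator {0<..t} s * F s)"
proof -
  have "(LINT s|time_measure. indicator {0<..t} s * F s)
        = (LINT s|lborel. indicator {0<..T} s *\<^sub>R (indicator {0<..t} s * F s))"
    by (subst integral_restrict_space) auto
  also have "\<dots> = (LINT s|lborel. indicator {0..t} s *\<^sub>R F s)"
    using AE_lborel_singleton[of 0] assms by (intro integral_cong_AE) (auto simp: indicator_def)
  finally show ?thesis by (simp add: set_lebesgue_integral_def)
qed

lemma set_integrable_limit: "set_integrable lborel {0..T} F"
proof -
  have "integrable lborel (\<lambda>s. indicator {0<..T} s *\<^sub>R F s)"
    using integrable_limit by (subst (asm) integrable_restrict_space) auto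
  then show ?thesis
    unfolding set_integrable_def using AE_lborel_singleton[of 0]
    by (subst integrable_cong_AE) (auto simp: indicator_def)
qed

lemma set_integral_limit:
  assumes t: "t \<in> {0..T}"
  shows "(LINT s:{0..t}|lborel. F s) = a t - a 0"
proof -
  have "(LINT s|time_measure. indicator {0<..t} s * F s) = a t - a 0"
  proof (rule mono_eq_of_tgrid[OF T_pos _ _ _ t])
    show "mono_on {0..T} (\<lambda>t. LINT s|time_measure. indicator {0<..t} s * F s)"
      using limit_nonneg
      by (intro mono_onI integral_mono integrable_prefix integrable_limit) (auto simp: indicator_def)
    show "continuous_on {0..T} (\<lambda>t. a t - a 0)" using cont_path by (intro continuous_intros)
    show "(LINT s|time_measure. indicator {0<..tgrid T q k} s * F s) = a (tgrid T q k) - a 0" if "k \<le> 2 ^ q" for q k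
      using has_bochner_integral_prefix[OF refl that] by (rule has_bochner_integral_integral_eq)
  qed
  then show ?thesis using set_integral_limit_eq_prefix[OF t] by simp
qed

definition entropy_liminf :: "real \<Rightarrow> ennreal" where
  "entropy_liminf t = liminf (\<lambda>i. ennreal (relent (cell_density T a (r i) t) (weight_density (r i) t)))"

lemma measurable_entropy_liminf [measurable]: "entropy_liminf \<in> borel_measurable borel"
  unfolding entropy_liminf_def relent_def by measurable

lemma nn_integral_entropy_liminf_le: "(\<integral>\<^sup>+ t. entropy_liminf t \<partial>time_measure) \<le> ennreal c"
proof -
  have "(\<integral>\<^sup>+ t. entropy_liminf t \<partial>time_measure) \<le>
      liminf (\<lambda>i. \<integral>\<^sup>+ t. ennreal (relent (cell_density T a (r i) t) (weight_density (r i) t)) \<partial>time_measure)"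
    unfolding entropy_liminf_def relent_def by (intro nn_integral_liminf measurable_restrict_space1) measurable
  also have "\<dots> \<le> liminf (\<lambda>i. ennreal c)"
    by (intro Liminf_mono always_eventually allI nn_integral_relent_cell_density_le)
  finally show ?thesis by (simp add: Liminf_const)
qed

lemma dual_le_entropy_liminf:
  assumes lim: "(\<lambda>i. cell_density T a (r i) t) \<longlonglongrightarrow> F t" and t: "t \<in> {0..T}"
  shows "ennreal (b * F t - (exp b - 1) * v t) \<le> entropy_liminf t"
proof -
  have "(\<lambda>i. weight_density (r i) t) \<longlonglongrightarrow> v t"
    using LIMSEQ_subseq_LIMSEQ[OF cell_integral_mean_tendsto[OF T_pos cont_weight t] subseq] by (simp add: comp_def)
  then have "(\<lambda>i. ennreal (b * cell_density T a (r i) t - (exp b - 1) * weight_density (r i) t))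
      \<longlonglongrightarrow> ennreal (b * F t - (exp b - 1) * v t)"
    by (intro tendsto_ennrealI tendsto_intros lim)
  then have "ennreal (b * F t - (exp b - 1) * v t) =
      liminf (\<lambda>i. ennreal (b * cell_density T a (r i) t - (exp b - 1) * weight_density (r i) t))"
    by (intro lim_imp_Liminf[symmetric]) auto
  also have "\<dots> \<le> entropy_liminf t"
    unfolding entropy_liminf_def
  proof (intro Liminf_mono always_eventually allI ennreal_leI relent_ge_dual cell_density_nonneg[OF t])
    fix i
    have k: "cell_index T (r i) t < 2 ^ r i" by (rule cell_index_less[OF T_pos t])
    show "0 \<le> weight_density (r i) t"
      using cell_integral_nonneg[OF T_pos k weight_nonneg] T_pos by (simp add: cell_mean_def)
    show "weight_density (r i) t = 0 \<Longrightarrow> cell_density T a (r i) t = 0"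
      using weight_0_incr_0[OF k] T_pos by (simp add: cell_mean_def cell_density_def)
  qed
  finally show ?thesis .
qed

lemma ae_relent_le_entropy_liminf:
  "AE t in time_measure. ennreal (relent (F t) (v t)) \<le> entropy_liminf t \<and> (v t = 0 \<longrightarrow> F t = 0)"
proof -
  have "AE t in time_measure. entropy_liminf t \<noteq> \<infinity>"
    using nn_integral_entropy_liminf_le
    by (intro nn_integral_noteq_infinite measurable_restrict_space1) (auto simp: top_unique)
  then show ?thesis using ae_limit AE_space
  proof eventually_elim
    case (elim t)
    then have t: "t \<in> {0..T}" by (auto dest: time_measureD)
    have entropy: "entropy_liminf t = ennreal (enn2real (entropy_liminf t))" using elim(1) by (simp add: less_top)
    have "b * F t - (exp b - 1) * v t \<le> enn2real (entropy_liminf t)" for b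
      using dual_le_entropy_liminf[OF elim(2) t, of b] by (subst (asm) entropy) (simp add: ennreal_le_iff)
    from relent_le_of_dual_bound[OF limit_nonneg weight_nonneg[OF t] this]
    show ?case by (metis entropy ennreal_leI)
  qed
qed

lemma ae_lborel_relent_le:
  "AE t in lborel. t \<in> {0..T} \<longrightarrow> ennreal (relent (F t) (v t)) \<le> entropy_liminf t * indicator {0<..T} t
        \<and> (v t = 0 \<longrightarrow> F t = 0)"
proof -
  have "AE t in lborel. t \<in> {0<..T} \<longrightarrow> ennreal (relent (F t) (v t)) \<le> entropy_liminf t \<and> (v t = 0 \<longrightarrow> F t = 0)"
    using ae_relent_le_entropy_liminf by (subst (asm) AE_restrict_space_iff) auto
  then show ?thesis using AE_lborel_singleton[of 0] by eventually_elim (auto simp: indicator_def)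
qed

end

theorem (in finite_dual_cost) obtain_control:
  obtains \<phi> where "\<phi> \<in> borel_measurable borel" "\<And>t. 0 \<le> \<phi> t" "set_integrable lborel {0..T} (\<lambda>t. \<phi> t * v t)"
    "\<And>t. t \<in> {0..T} \<Longrightarrow> (LINT s:{0..t}|lborel. \<phi> s * v s) = a t - a 0"
    "(\<integral>\<^sup>+ t\<in>{0..T}. ennreal (v t * ell (\<phi> t)) \<partial>lborel) \<le> ennreal c"
proof -
  obtain r F where "strict_mono (r :: nat \<Rightarrow> nat)" "F \<in> borel_measurable borel" "\<And>t. 0 \<le> F t"
    "AE t in time_measure. (\<lambda>i. cell_density T a (r i) t) \<longlonglongrightarrow> F t"
    by (rule ae_convergent_cell_density) blast
  then interpret limit: cell_density_limit T a v c r F by unfold_locales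
  define w where "w t = v (max 0 (min T t))" for t
  have [measurable]: "w \<in> borel_measurable borel"
    unfolding w_def using T_pos
    by (intro borel_measurable_continuous_onI continuous_on_compose2[OF cont_weight]) (auto intro!: continuous_intros)
  have w: "w t = v t" if "t \<in> {0..T}" for t using that by (simp add: w_def)
  have w_nonneg: "0 \<le> w t" for t unfolding w_def using T_pos by (intro weight_nonneg) auto
  define \<phi> where "\<phi> t = F t / w t" for t
  have measurable_\<phi> [measurable]: "\<phi> \<in> borel_measurable borel" unfolding \<phi>_def by measurable
  have product: "AE t in lborel. t \<in> {0..T} \<longrightarrow> \<phi> t * w t = F t"
    using limit.ae_lborel_relent_le by eventually_elim (auto simp: \<phi>_def w)
  have integral_eq: "(LINT s:{0..t}|lborel. \<phi> s * v s) = (LINT s:{0..t}|lborel. F s)" if t: "t \<in> {0..T}" for t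
  proof -
    have "(LINT s:{0..t}|lborel. \<phi> s * v s) = (LINT s:{0..t}|lborel. \<phi> s * w s)"
      using t w by (intro set_lebesgue_integral_cong) auto
    also have "\<dots> = (LINT s:{0..t}|lborel. F s)"
      unfolding set_lebesgue_integral_def using product t by (intro integral_cong_AE) (auto simp: indicator_def)
    finally show ?thesis .
  qed
  have "set_integrable lborel {0..T} (\<lambda>t. \<phi> t * w t)"
    using limit.set_integrable_limit product unfolding set_integrable_def
    by (subst integrable_cong_AE[where g="\<lambda>t. indicator {0..T} t *\<^sub>R F t"]) (auto simp: indicator_def)
  then have integrable: "set_integrable lborel {0..T} (\<lambda>t. \<phi> t * v t)"
    by (rule set_integrable_cong[THEN iffD1, rotated -1]) (auto simp: w)
  have "(\<integral>\<^sup>+ t\<in>{0..T}. ennreal (v t * ell (\<phi> t)) \<partial>lborel) \<le> (\<integral>\<^sup>+ t. limit.entropy_liminf t * indicator {0<..T} t \<partial>lborel)"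
  proof (intro nn_integral_mono_AE, use limit.ae_lborel_relent_le in eventually_elim)
    fix t assume relent: "t \<in> {0..T} \<longrightarrow> ennreal (relent (F t) (v t)) \<le> limit.entropy_liminf t * indicator {0<..T} t
          \<and> (v t = 0 \<longrightarrow> F t = 0)"
    have "v t * ell (\<phi> t) = relent (F t) (v t)" if "t \<in> {0..T}"
      using that relent w[OF that] weight_nonneg[OF that] limit.limit_nonneg[of t] relent_eq_ell[of "F t" "v t"]
      by (cases "v t = 0") (auto simp: \<phi>_def relent_def less_le)
    then show "ennreal (v t * ell (\<phi> t)) * indicator {0..T} t \<le> limit.entropy_liminf t * indicator {0<..T} t"
      using relent by (cases "t \<in> {0..T}") auto
  qed
  also have "\<dots> = (\<integral>\<^sup>+ t. limit.entropy_liminf t \<partial>time_measure)" by (subst nn_integral_restrict_space) auto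
  also have "\<dots> \<le> ennreal c" by (rule limit.nn_integral_entropy_liminf_le)
  finally show thesis
    using measurable_\<phi> integrable integral_eq limit.set_integral_limit limit.limit_nonneg w_nonneg
    by (intro that[of \<phi>]) (auto simp: \<phi>_def)
qed

section \<open>The Skorohod map\<close>

lemma skorohod_map_cong: "(\<And>s. s \<in> {0..t} \<Longrightarrow> \<psi> s = \<psi>' s) \<Longrightarrow> 0 \<le> t \<Longrightarrow> skorohod_map \<psi> t = skorohod_map \<psi>' t"
  unfolding skorohod_map_def by (auto intro!: INF_cong)

lemma bdd_below_min_0:
  fixes b :: real
  shows "(\<And>s. s \<in> A \<Longrightarrow> b \<le> \<psi> s) \<Longrightarrow> bdd_below ((\<lambda>s. min (\<psi> s) 0) ` A)"
  by (rule bdd_belowI[of _ "min b 0"]) (auto simp: min_le_iff_disj)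

lemma skorohod_map_nonneg:
  assumes "0 \<le> t" "\<And>s. s \<in> {0..t} \<Longrightarrow> b \<le> \<psi> s"
  shows "0 \<le> skorohod_map \<psi> t"
proof -
  have "(INF s\<in>{0..t}. min (\<psi> s) 0) \<le> min (\<psi> t) 0"
    using assms by (intro cINF_lower bdd_below_min_0[of _ b]) auto
  then show ?thesis by (simp add: skorohod_map_def)
qed

lemma skorohod_map_le:
  assumes "0 \<le> t" and bound: "\<And>s. s \<in> {0..t} \<Longrightarrow> \<psi> t - min (\<psi> s) 0 \<le> B"
  shows "skorohod_map \<psi> t \<le> B"
proof -
  have "\<psi> t - B \<le> (INF s\<in>{0..t}. min (\<psi> s) 0)"
    using \<open>0 \<le> t\<close> bound
      by (intro cINF_greatest) (auto simp: diff_le_eq add.commute simp del: min_less_iff_conj min.bounded_iff)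
  then show ?thesis by (simp add: skorohod_map_def)
qed

lemma INF_min_0_le:
  fixes \<psi> \<psi>' :: "real \<Rightarrow> real"
  assumes "0 \<le> t" and bounded: "\<And>s. s \<in> {0..t} \<Longrightarrow> b \<le> \<psi> s"
    and below: "\<And>s. s \<in> {0..t} \<Longrightarrow> \<psi> s \<le> \<psi>' s + \<delta>" and "0 \<le> \<delta>"
  shows "(INF s\<in>{0..t}. min (\<psi> s) 0) \<le> (INF s\<in>{0..t}. min (\<psi>' s) 0) + \<delta>"
proof -
  have "(INF s\<in>{0..t}. min (\<psi> s) 0) - \<delta> \<le> (INF s\<in>{0..t}. min (\<psi>' s) 0)"
  proof (rule cINF_greatest)
    fix s assume s: "s \<in> {0..t}"
    have "(INF s\<in>{0..t}. min (\<psi> s) 0) \<le> min (\<psi> s) 0"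
      using s bounded by (intro cINF_lower bdd_below_min_0[of _ b]) auto
    then show "(INF s\<in>{0..t}. min (\<psi> s) 0) - \<delta> \<le> min (\<psi>' s) 0" using below[OF s] \<open>0 \<le> \<delta>\<close> by simp
  qed (use \<open>0 \<le> t\<close> in auto)
  then show ?thesis by simp
qed

lemma skorohod_map_lipschitz:
  assumes "0 \<le> t" and bounded: "\<And>s. s \<in> {0..t} \<Longrightarrow> b \<le> \<psi> s"
    and close: "\<And>s. s \<in> {0..t} \<Longrightarrow> \<bar>\<psi> s - \<psi>' s\<bar> \<le> \<delta>"
  shows "\<bar>skorohod_map \<psi> t - skorohod_map \<psi>' t\<bar> \<le> 2 * \<delta>"
proof -
  have "0 \<le> \<delta>" using close[of t] \<open>0 \<le> t\<close> by simp
  have near: "\<psi> s \<le> \<psi>' s + \<delta>" "\<psi>' s \<le> \<psi> s + \<delta>" "b - \<delta> \<le> \<psi>' s" if "s \<in> {0..t}" for s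
    using bounded[OF that] close[OF that] by auto
  have "(INF s\<in>{0..t}. min (\<psi> s) 0) \<le> (INF s\<in>{0..t}. min (\<psi>' s) 0) + \<delta>"
    by (rule INF_min_0_le[OF \<open>0 \<le> t\<close> bounded near(1) \<open>0 \<le> \<delta>\<close>])
  moreover have "(INF s\<in>{0..t}. min (\<psi>' s) 0) \<le> (INF s\<in>{0..t}. min (\<psi> s) 0) + \<delta>"
    by (rule INF_min_0_le[OF \<open>0 \<le> t\<close> near(3,2) \<open>0 \<le> \<delta>\<close>])
  ultimately show ?thesis using close[of t] \<open>0 \<le> t\<close> unfolding skorohod_map_def by auto
qed

lemma skorohod_map_add_mono:
  assumes "0 \<le> t" and bounded: "\<And>s. s \<in> {0..t} \<Longrightarrow> b \<le> \<psi> s"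
    and D: "\<And>s. s \<in> {0..t} \<Longrightarrow> 0 \<le> D s" "\<And>s. s \<in> {0..t} \<Longrightarrow> D s \<le> D t"
  shows "skorohod_map \<psi> t \<le> skorohod_map (\<lambda>r. \<psi> r + D r) t"
proof -
  have "(INF s\<in>{0..t}. min (\<psi> s + D s) 0) \<le> (INF s\<in>{0..t}. min (\<psi> s) 0) + D t"
    using bounded D \<open>0 \<le> t\<close> by (intro INF_min_0_le[of _ b]) (auto simp: add_increasing2)
  then show ?thesis by (simp add: skorohod_map_def)
qed

lemma continuous_on_bounded_below:
  fixes \<psi> :: "real \<Rightarrow> real"
  assumes "continuous_on {0..T} \<psi>"
  obtains b where "\<And>t. t \<in> {0..T} \<Longrightarrow> b \<le> \<psi> t"
proof -
  have "bounded (\<psi> ` {0..T})" using assms by (intro compact_imp_bounded compact_continuous_image) auto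
  then obtain B where "\<And>t. t \<in> {0..T} \<Longrightarrow> - B \<le> \<psi> t"
    unfolding bounded_iff by (metis abs_le_iff image_eqI minus_le_iff real_norm_def)
  then show thesis by (rule that)
qed

lemma continuous_on_running_min:
  fixes \<psi> :: "real \<Rightarrow> real"
  assumes cont: "continuous_on {0..T} \<psi>"
  shows "continuous_on {0..T} (\<lambda>t. INF s\<in>{0..t}. min (\<psi> s) 0)"
proof -
  let ?m = "\<lambda>t. INF s\<in>{0..t}. min (\<psi> s) 0"
  obtain b where b: "\<And>s. s \<in> {0..T} \<Longrightarrow> b \<le> \<psi> s"
    using continuous_on_bounded_below[OF cont] by blast
  have uniform: "uniformly_continuous_on {0..T} \<psi>" using cont by (intro compact_uniformly_continuous) auto
  have close: "\<bar>?m t - ?m s\<bar> \<le> e"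
    if near: "s \<in> {0..T}" "t \<in> {0..T}" "\<bar>t - s\<bar> < d"
      and d: "\<And>s t. s \<in> {0..T} \<Longrightarrow> t \<in> {0..T} \<Longrightarrow> dist t s < d \<Longrightarrow> dist (\<psi> t) (\<psi> s) < e" and "0 < e" for s t d e
    using near
  proof (induction s t rule: linorder_wlog)
    case (le s t)
    have lower: "?m s \<le> min (\<psi> r) 0" if "r \<in> {0..s}" for r
      using that le b by (intro cINF_lower bdd_below_min_0[of _ b]) auto
    have "?m t \<le> ?m s" using le b by (intro cINF_superset_mono bdd_below_min_0[of _ b]) auto
    moreover have "?m s - e \<le> ?m t"
    proof (rule cINF_greatest)
      fix r assume r: "r \<in> {0..t}"
      show "?m s - e \<le> min (\<psi> r) 0"
      proof (cases "r \<le> s")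
        case True
        then show ?thesis using lower[of r] r \<open>0 < e\<close> by simp
      next
        case False
        then have "\<bar>\<psi> r - \<psi> s\<bar> < e" using r le d[of s r] by (simp add: dist_real_def)
        then show ?thesis using lower[of s] le \<open>0 < e\<close> by auto
      qed
    qed (use le in auto)
    ultimately show ?case by simp
  qed (simp add: abs_minus_commute)
  have "uniformly_continuous_on {0..T} ?m"
  proof (unfold uniformly_continuous_on_def, intro allI impI)
    fix e :: real assume "0 < e"
    then obtain d where d: "0 < d" "\<And>s t. s \<in> {0..T} \<Longrightarrow> t \<in> {0..T} \<Longrightarrow> dist t s < d \<Longrightarrow> dist (\<psi> t) (\<psi> s) < e / 2"
      using uniform unfolding uniformly_continuous_on_def by (meson half_gt_zero)
    have "dist (?m t) (?m s) < e" if "s \<in> {0..T}" "t \<in> {0..T}" "dist t s < d" for s t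
      using close[of s t d "e / 2", OF that(1,2) _ d(2)] that(3) \<open>0 < e\<close> by (simp add: dist_real_def)
    with d(1) show "\<exists>d>0. \<forall>s\<in>{0..T}. \<forall>t\<in>{0..T}. dist t s < d \<longrightarrow> dist (?m t) (?m s) < e" by blast
  qed
  then show ?thesis by (rule uniformly_continuous_imp_continuous)
qed

lemma continuous_on_skorohod_map:
  "continuous_on {0..T} \<psi> \<Longrightarrow> continuous_on {0..T} (skorohod_map \<psi>)"
  unfolding skorohod_map_def[abs_def] by (intro continuous_on_diff continuous_on_running_min)

lemma skorohod_map_nonneg_continuous:
  assumes "continuous_on {0..T} \<psi>" "t \<in> {0..T}"
  shows "0 \<le> skorohod_map \<psi> t"
proof -
  obtain b where "\<And>s. s \<in> {0..T} \<Longrightarrow> b \<le> \<psi> s"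
    using continuous_on_bounded_below[OF assms(1)] by blast
  then show ?thesis using assms(2) by (intro skorohod_map_nonneg[of _ b]) auto
qed

lemma uniform_limit_skorohod_map:
  assumes lim: "uniform_limit {0..T} \<psi> \<psi>' F" and cont: "continuous_on {0..T} \<psi>'"
  shows "uniform_limit {0..T} (\<lambda>i. skorohod_map (\<psi> i)) (skorohod_map \<psi>') F"
proof (rule uniform_limitI)
  fix e :: real assume "0 < e"
  obtain b where b: "\<And>s. s \<in> {0..T} \<Longrightarrow> b \<le> \<psi>' s"
    using continuous_on_bounded_below[OF cont] by blast
  have "\<forall>\<^sub>F i in F. \<forall>t\<in>{0..T}. dist (\<psi> i t) (\<psi>' t) < e / 3"
    using \<open>0 < e\<close> by (intro uniform_limitD[OF lim]) simp
  then show "\<forall>\<^sub>F i in F. \<forall>t\<in>{0..T}. dist (skorohod_map (\<psi> i) t) (skorohod_map \<psi>' t) < e"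
  proof eventually_elim
    case (elim i)
    have "\<bar>skorohod_map \<psi>' t - skorohod_map (\<psi> i) t\<bar> \<le> 2 * (e / 3)" if "t \<in> {0..T}" for t
      using that elim b
      by (intro skorohod_map_lipschitz[of _ b]) (force simp: dist_real_def abs_minus_commute)+
    then show ?case using \<open>0 < e\<close> by (force simp: dist_real_def abs_minus_commute)
  qed
qed

section \<open>Compactness of monotone paths\<close>

locale tight_monotone =
  fixes T :: real and F :: "nat \<Rightarrow> real \<Rightarrow> real"
  assumes T_pos: "0 < T" and mono: "\<And>p. mono_on {0..T} (F p)" and start: "(\<lambda>p. F p 0) \<longlonglongrightarrow> 0"
    and small_incr: "\<And>e. 0 < e \<Longrightarrow> \<exists>q. \<forall>\<^sub>F p in sequentially. \<forall>k<2 ^ q. incr T (F p) q k \<le> e"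
begin

lemma tight_subseq: "strict_mono r \<Longrightarrow> tight_monotone T (\<lambda>i. F (r i))"
proof (unfold_locales, goal_cases)
  case (4 e)
  then obtain q where "\<forall>\<^sub>F p in sequentially. \<forall>k<2 ^ q. incr T (F p) q k \<le> e" using small_incr by blast
  then show ?case using eventually_subseq[OF 4(1)] by blast
qed (use T_pos mono LIMSEQ_subseq_LIMSEQ[OF start] in \<open>auto simp: comp_def\<close>)

lemma eventually_bounded: "\<exists>B. \<forall>\<^sub>F p in sequentially. \<forall>t\<in>{0..T}. \<bar>F p t\<bar> \<le> B"
proof -
  obtain q where "\<forall>\<^sub>F p in sequentially. \<forall>k<2 ^ q. incr T (F p) q k \<le> 1" using small_incr[of 1] by auto
  moreover have "\<forall>\<^sub>F p in sequentially. F p 0 < 1" "\<forall>\<^sub>F p in sequentially. - 1 < F p 0"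
    using order_tendstoD[OF start] by auto
  ultimately have "\<forall>\<^sub>F p in sequentially. \<forall>t\<in>{0..T}. \<bar>F p t\<bar> \<le> 2 ^ q + 1"
  proof eventually_elim
    case (elim p)
    have "F p T - F p 0 \<le> (\<Sum>k<2 ^ q::nat. 1)"
      using sum_mono[of "{..<2 ^ q}" "incr T (F p) q" "\<lambda>_. 1"] elim(1) sum_incr[of T "F p" q "2 ^ q"] by simp
    then show ?case
      using elim(2,3) mono_onD[OF mono, of 0 _ p] mono_onD[OF mono, of _ T p] T_pos by (force simp: abs_le_iff)
  qed
  then show ?thesis by blast
qed

lemma ex_subseq_convergent_on_grid:
  obtains r where "strict_mono (r :: nat \<Rightarrow> nat)" "\<And>q k. k \<le> 2 ^ q \<Longrightarrow> convergent (\<lambda>i. F (r i) (tgrid T q k))"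
proof -
  obtain B P where B: "\<And>p t. P \<le> p \<Longrightarrow> t \<in> {0..T} \<Longrightarrow> \<bar>F p t\<bar> \<le> B"
    using eventually_bounded unfolding eventually_sequentially by blast
  define D where "D = (\<lambda>(q, k). tgrid T q k) ` (SIGMA q:UNIV. {..2 ^ q})"
  have "countable D" unfolding D_def by (intro countable_image) auto
  moreover have "norm (F (i + P) t) \<le> B" if "t \<in> D" for i t
    using that tgrid_mem[OF T_pos] by (auto simp: D_def intro!: B)
  ultimately obtain r where r: "strict_mono (r :: nat \<Rightarrow> nat)" "\<And>t. t \<in> D \<Longrightarrow> \<exists>l. (\<lambda>i. F (r i + P) t) \<longlonglongrightarrow> l"
    by (rule function_convergent_subsequence[of D "\<lambda>i. F (i + P)"]) auto
  have "strict_mono (\<lambda>i. r i + P)" using r(1) by (auto simp: strict_mono_def)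
  moreover have "convergent (\<lambda>i. F (r i + P) (tgrid T q k))" if "k \<le> 2 ^ q" for q k
    using r(2)[of "tgrid T q k"] that by (auto simp: D_def convergent_def)
  ultimately show thesis by (rule that)
qed

lemma uniformly_Cauchy_of_grid:
  assumes grid: "\<And>q k. k \<le> 2 ^ q \<Longrightarrow> convergent (\<lambda>i. F i (tgrid T q k))"
  shows "uniformly_Cauchy_on {0..T} F"
  unfolding uniformly_Cauchy_on_def
proof (intro allI impI)
  fix e :: real assume "0 < e"
  obtain q N where incr_le: "\<And>i k. N \<le> i \<Longrightarrow> k < 2 ^ q \<Longrightarrow> incr T (F i) q k \<le> e / 3"
    using small_incr[of "e / 3"] \<open>0 < e\<close> unfolding eventually_sequentially by (meson divide_pos_pos zero_less_numeral)
  have "\<exists>N. \<forall>i\<ge>N. \<forall>j\<ge>N. \<bar>F i (tgrid T q k) - F j (tgrid T q k)\<bar> < e / 3" if "k \<le> 2 ^ q" for k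
    using CauchyD[OF convergent_Cauchy[OF grid[OF that]], of "e / 3"] \<open>0 < e\<close> by simp
  then obtain N' where close: "\<And>k i j. k \<le> 2 ^ q \<Longrightarrow> N' k \<le> i \<Longrightarrow> N' k \<le> j \<Longrightarrow>
      \<bar>F i (tgrid T q k) - F j (tgrid T q k)\<bar> < e / 3"
    by metis
  define K where "K = Max (insert N (N' ` {..2 ^ q}))"
  have K: "N \<le> K" "\<And>k. k \<le> 2 ^ q \<Longrightarrow> N' k \<le> K" unfolding K_def by (intro Max_ge; simp)+
  have "\<bar>F i t - F j t\<bar> \<le> e / 3 + e / 3" if "K \<le> i" "K \<le> j" "t \<in> {0..T}" for i j t
  proof (rule mono_dist_le_of_grid[OF T_pos mono mono _ _ that(3)])
    show "\<bar>F i (tgrid T q k) - F j (tgrid T q k)\<bar> \<le> e / 3" if k: "k \<le> 2 ^ q" for k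
      using close[OF k] K(2)[OF k] \<open>K \<le> i\<close> \<open>K \<le> j\<close> by (meson le_trans less_imp_le)
    show "incr T (F j) q k \<le> e / 3" if "k < 2 ^ q" for k
      using that K(1) \<open>K \<le> j\<close> by (intro incr_le) auto
  qed
  then show "\<exists>K. \<forall>t\<in>{0..T}. \<forall>i\<ge>K. \<forall>j\<ge>K. dist (F i t) (F j t) < e"
    using \<open>0 < e\<close> by (intro exI[of _ K]) (force simp: dist_real_def)
qed

lemma uniform_limit_properties:
  assumes lim: "uniform_limit {0..T} F G sequentially"
  shows "continuous_on {0..T} G" "mono_on {0..T} G" "G 0 = 0"
proof -
  note pointwise = tendsto_uniform_limitI[OF lim]
  show mono_G: "mono_on {0..T} G"
  proof (rule mono_onI)
    fix s t assume ordered: "s \<in> {0..T}" "t \<in> {0..T}" "s \<le> t"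
    then show "G s \<le> G t" by (intro LIMSEQ_le[OF pointwise pointwise]) (auto intro!: mono_onD[OF mono])
  qed
  show "G 0 = 0" using LIMSEQ_unique[OF pointwise start] T_pos by simp
  show "continuous_on {0..T} G"
    unfolding continuous_on_iff
  proof (intro ballI allI impI)
    fix s and e :: real assume s: "s \<in> {0..T}" and "0 < e"
    then obtain q where small: "\<forall>\<^sub>F p in sequentially. \<forall>k<2 ^ q. incr T (F p) q k \<le> e / 3"
      using small_incr[of "e / 3"] by auto
    have "incr T G q k \<le> e / 3" if k: "k < 2 ^ q" for k
    proof (rule tendsto_upperbound)
      show "(\<lambda>p. incr T (F p) q k) \<longlonglongrightarrow> incr T G q k"
        unfolding incr_def using tgrid_cell[OF T_pos k] by (intro tendsto_diff pointwise)
      show "\<forall>\<^sub>F p in sequentially. incr T (F p) q k \<le> e / 3" using small k by (auto elim: eventually_mono)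
    qed simp
    then have "\<bar>G t - G s\<bar> \<le> 2 * (e / 3)" if "t \<in> {0..T}" "\<bar>t - s\<bar> \<le> T / 2 ^ q" for t
      by (rule mono_modulus_of_incr[OF T_pos mono_G _ s that])
    then show "\<exists>d>0. \<forall>t\<in>{0..T}. dist t s < d \<longrightarrow> dist (G t) (G s) < e"
      using T_pos \<open>0 < e\<close> by (intro exI[of _ "T / 2 ^ q"]) (force simp: dist_real_def)
  qed
qed

lemma ex_uniformly_convergent_subseq:
  obtains r G where "strict_mono (r :: nat \<Rightarrow> nat)" "uniform_limit {0..T} (\<lambda>i. F (r i)) G sequentially"
proof -
  obtain r where r: "strict_mono (r :: nat \<Rightarrow> nat)" "\<And>q k. k \<le> 2 ^ q \<Longrightarrow> convergent (\<lambda>i. F (r i) (tgrid T q k))"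
    using ex_subseq_convergent_on_grid by blast
  interpret subseq: tight_monotone T "\<lambda>i. F (r i)" by (rule tight_subseq[OF r(1)])
  have "uniformly_convergent_on {0..T} (\<lambda>i. F (r i))"
    using r(2) by (intro Cauchy_uniformly_convergent subseq.uniformly_Cauchy_of_grid)
  then show thesis using that[OF r(1)] by (auto simp: uniformly_convergent_on_def)
qed

end

section \<open>Controls and entropy\<close>

definition has_control_within ::
  "real \<Rightarrow> real \<Rightarrow> real \<Rightarrow> real \<Rightarrow> real \<Rightarrow> (real \<Rightarrow> real) \<Rightarrow> (real \<Rightarrow> real) \<Rightarrow> real \<Rightarrow> bool" where
  "has_control_within lam mu th x0 T \<xi> \<zeta> c \<longleftrightarrow>
    (\<exists>\<phi>\<in>controls lam mu th x0 T \<xi> \<zeta>. control_cost lam mu th T \<xi> \<phi> \<le> ennreal c)"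

definition net_input :: "real \<Rightarrow> (real \<Rightarrow> real) \<Rightarrow> (real \<Rightarrow> real) \<Rightarrow> (real \<Rightarrow> real) \<Rightarrow> real \<Rightarrow> real" where
  "net_input x0 a s y t = x0 + a t - s t - y t"

lemma nn_integral_cmult_interval:
  fixes f :: "real \<Rightarrow> real"
  assumes "0 \<le> C" and "f \<in> borel_measurable (restrict_space borel {0..T})"
  shows "ennreal C * (\<integral>\<^sup>+ t\<in>{0..T}. ennreal (f t) \<partial>lborel) = (\<integral>\<^sup>+ t\<in>{0..T}. ennreal (C * f t) \<partial>lborel)"
proof -
  have "(\<lambda>t. ennreal (f t)) \<in> borel_measurable (restrict_space borel {0..T})"
    using assms(2) by measurable
  then have "(\<lambda>t. ennreal (f t) * indicator {0..T} t) \<in> borel_measurable borel"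
    by (subst (asm) borel_measurable_restrict_space_iff_ennreal) auto
  then show ?thesis
    using assms(1) by (subst nn_integral_cmult[symmetric]) (auto simp: ennreal_mult' mult.assoc)
qed

lemma measurable_ell [measurable]: "ell \<in> borel_measurable borel"
  unfolding ell_def[abs_def] by measurable

locale queue_rates =
  fixes lam mu th T :: real
  assumes lam_pos: "0 < lam" and mu_pos: "0 < mu" and th_pos: "0 < th" and T_pos: "0 < T"

locale entropy_path = queue_rates +
  fixes x0 c :: real and a s \<xi> \<zeta> :: "real \<Rightarrow> real"
  assumes mono_a: "mono_on {0..T} a" and mono_s: "mono_on {0..T} s" and mono_\<zeta>: "mono_on {0..T} \<zeta>"
    and cont_a: "continuous_on {0..T} a" and cont_s: "continuous_on {0..T} s" and cont_\<zeta>: "continuous_on {0..T} \<zeta>"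
    and start: "a 0 = 0" "s 0 = 0" "\<zeta> 0 = 0"
    and reflected: "\<And>t. t \<in> {0..T} \<Longrightarrow> \<xi> t = skorohod_map (net_input x0 a s \<zeta>) t"
    and joint_cost: "\<And>q b1 b2 b3. dual_cost T a (\<lambda>_. lam) q b1 + dual_cost T s (\<lambda>_. mu) q b2
      + dual_cost T \<zeta> (\<lambda>t. th * \<xi> t) q b3 \<le> c"
begin

lemma cont_net_input: "continuous_on {0..T} (net_input x0 a s \<zeta>)"
  unfolding net_input_def[abs_def] by (intro continuous_intros cont_a cont_s cont_\<zeta>)

lemma cont_\<xi>: "continuous_on {0..T} \<xi>"
  using continuous_on_skorohod_map[OF cont_net_input] by (rule continuous_on_eq) (simp add: reflected)

lemma \<xi>_nonneg: "t \<in> {0..T} \<Longrightarrow> 0 \<le> \<xi> t"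
  using skorohod_map_nonneg_continuous[OF cont_net_input] reflected by simp

lemma \<zeta>_nonneg: "t \<in> {0..T} \<Longrightarrow> 0 \<le> \<zeta> t"
  using mono_onD[OF mono_\<zeta>, of 0 t] start by auto

lemma cont_reneging_weight: "continuous_on {0..T} (\<lambda>t. th * \<xi> t)"
  by (intro continuous_intros cont_\<xi>)

lemma separate_costs:
  obtains c1 c2 c3 where "c1 + c2 + c3 \<le> c" "finite_dual_cost T a (\<lambda>_. lam) c1"
    "finite_dual_cost T s (\<lambda>_. mu) c2" "finite_dual_cost T \<zeta> (\<lambda>t. th * \<xi> t) c3"
proof -
  let ?A = "\<lambda>(q, b). dual_cost T a (\<lambda>_. lam) q b" and ?S = "\<lambda>(q, b). dual_cost T s (\<lambda>_. mu) q b"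
    and ?Z = "\<lambda>(q, b). dual_cost T \<zeta> (\<lambda>t. th * \<xi> t) q b"
  have sum_le: "?A i + ?S j + ?Z k \<le> c" for i j k
  proof -
    obtain q1 b1 q2 b2 q3 b3 where ijk: "i = (q1, b1)" "j = (q2, b2)" "k = (q3, b3)" by (cases i; cases j; cases k)
    have "?A i = dual_cost T a (\<lambda>_. lam) (q1 + (q2 + q3)) (\<lambda>j. b1 (j div 2 ^ (q2 + q3)))"
      "?S j = dual_cost T s (\<lambda>_. mu) (q2 + (q1 + q3)) (\<lambda>j. b2 (j div 2 ^ (q1 + q3)))"
      "?Z k = dual_cost T \<zeta> (\<lambda>t. th * \<xi> t) (q3 + (q1 + q2)) (\<lambda>j. b3 (j div 2 ^ (q1 + q2)))"
      by (simp_all add: ijk dual_cost_refine[OF T_pos] cont_reneging_weight)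
    moreover have "q2 + (q1 + q3) = q1 + (q2 + q3)" "q3 + (q1 + q2) = q1 + (q2 + q3)" by auto
    ultimately show ?thesis using joint_cost[of "q1 + (q2 + q3)"] by simp
  qed
  have zero: "?A (0, \<lambda>_. 0) = 0" "?S (0, \<lambda>_. 0) = 0" "?Z (0, \<lambda>_. 0) = 0" by simp_all
  define c1 where "c1 = (SUP i. ?A i)"
  define c2 where "c2 = (SUP j. ?S j)"
  have arrival_cost_le: "?A i \<le> c1" for i
    unfolding c1_def using sum_le[of _ "(0, \<lambda>_. 0)" "(0, \<lambda>_. 0)"] zero by (intro cSUP_upper bdd_aboveI2[of _ _ c]) auto
  have service_cost_le: "?S j \<le> c2" for j
    unfolding c2_def using sum_le[of "(0, \<lambda>_. 0)" _ "(0, \<lambda>_. 0)"] zero by (intro cSUP_upper bdd_aboveI2[of _ _ c]) auto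
  have reneging_cost_le: "?Z k \<le> c - c1 - c2" for k
  proof -
    have "c1 \<le> c - ?S j - ?Z k" for j
      unfolding c1_def using sum_le[of _ j k] by (intro cSUP_least) (auto simp: algebra_simps)
    then have "c2 \<le> c - c1 - ?Z k" unfolding c2_def by (intro cSUP_least) (auto simp: algebra_simps)
    then show ?thesis by simp
  qed
  show thesis
  proof (rule that)
    show "finite_dual_cost T a (\<lambda>_. lam) c1"
      using arrival_cost_le lam_pos by unfold_locales (auto simp: T_pos mono_a cont_a)
    show "finite_dual_cost T s (\<lambda>_. mu) c2"
      using service_cost_le mu_pos by unfold_locales (auto simp: T_pos mono_s cont_s)
    show "finite_dual_cost T \<zeta> (\<lambda>t. th * \<xi> t) (c - c1 - c2)"
      using reneging_cost_le th_pos \<xi>_nonneg by unfold_locales (auto simp: T_pos mono_\<zeta> cont_\<zeta> cont_reneging_weight)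
  qed simp
qed

lemma control_of_densities:
  assumes nonneg: "\<And>t. 0 \<le> \<phi>1 t" "\<And>t. 0 \<le> \<phi>2 t" "\<And>t. 0 \<le> \<phi>3 t"
    and measurable: "\<phi>1 \<in> borel_measurable borel" "\<phi>2 \<in> borel_measurable borel" "\<phi>3 \<in> borel_measurable borel"
    and integrable: "set_integrable lborel {0..T} (\<lambda>t. \<phi>1 t * lam)" "set_integrable lborel {0..T} (\<lambda>t. \<phi>2 t * mu)"
      "set_integrable lborel {0..T} (\<lambda>t. \<phi>3 t * (th * \<xi> t))"
    and integrals: "\<And>t. t \<in> {0..T} \<Longrightarrow> (LINT s:{0..t}|lborel. \<phi>1 s * lam) = a t"
      "\<And>t. t \<in> {0..T} \<Longrightarrow> (LINT u:{0..t}|lborel. \<phi>2 u * mu) = s t"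
      "\<And>t. t \<in> {0..T} \<Longrightarrow> (LINT s:{0..t}|lborel. \<phi>3 s * (th * \<xi> s)) = \<zeta> t"
  shows "(\<phi>1, \<phi>2, \<phi>3) \<in> controls lam mu th x0 T \<xi> \<zeta>"
proof -
  have "set_integrable lborel {0..T} (\<lambda>t. (\<phi>3 t * (th * \<xi> t)) / th)"
    using integrable(3) by (rule set_integrable_divide)
  then have integrable3: "set_integrable lborel {0..T} (\<lambda>t. \<phi>3 t * \<xi> t)" using th_pos by simp
  have \<zeta>_eq: "th * (LINT s:{0..t}|lborel. \<phi>3 s * \<xi> s) = \<zeta> t" if "t \<in> {0..T}" for t
    unfolding integrals(3)[OF that, symmetric] by (simp flip: set_integral_mult_right add: mult.left_commute)
  have inputs: "lam * (LINT s:{0..t}|lborel. \<phi>1 s) = a t" "mu * (LINT s:{0..t}|lborel. \<phi>2 s) = s t" if "t \<in> {0..T}"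
      for t
    using integrals(1,2)[OF that] by (simp_all add: mult.commute)
  have "skorohod_map (\<lambda>r. x0 + lam * (LINT s:{0..r}|lborel. \<phi>1 s) - mu * (LINT s:{0..r}|lborel. \<phi>2 s)
      - th * (LINT s:{0..r}|lborel. \<phi>3 s * \<xi> s)) t = \<xi> t" if t: "t \<in> {0..T}" for t
    unfolding reflected[OF t] using t \<zeta>_eq inputs by (intro skorohod_map_cong) (auto simp: net_input_def)
  moreover have "set_integrable lborel {0..T} \<phi>1" "set_integrable lborel {0..T} \<phi>2"
    using integrable(1,2) lam_pos mu_pos by (simp_all add: set_integrable_mult_left_iff)
  ultimately show ?thesis
    using nonneg measurable integrable3 \<zeta>_eq
    by (auto simp: controls_def intro!: measurable_restrict_space1)
qed

theorem has_control: "has_control_within lam mu th x0 T \<xi> \<zeta> c"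
proof -
  obtain c1 c2 c3 where costs: "c1 + c2 + c3 \<le> c" "finite_dual_cost T a (\<lambda>_. lam) c1"
    "finite_dual_cost T s (\<lambda>_. mu) c2" "finite_dual_cost T \<zeta> (\<lambda>t. th * \<xi> t) c3"
    using separate_costs .
  note cost_nonneg = costs(2-4)[THEN finite_dual_cost.cost_nonneg]
  obtain \<phi>1 where \<phi>1: "\<phi>1 \<in> borel_measurable borel" "\<And>t. 0 \<le> \<phi>1 t" "set_integrable lborel {0..T} (\<lambda>t. \<phi>1 t * lam)"
    "\<And>t. t \<in> {0..T} \<Longrightarrow> (LINT s:{0..t}|lborel. \<phi>1 s * lam) = a t - a 0"
    "(\<integral>\<^sup>+ t\<in>{0..T}. ennreal (lam * ell (\<phi>1 t)) \<partial>lborel) \<le> ennreal c1"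
    by (rule finite_dual_cost.obtain_control[OF costs(2)]) blast
  obtain \<phi>2 where \<phi>2: "\<phi>2 \<in> borel_measurable borel" "\<And>t. 0 \<le> \<phi>2 t" "set_integrable lborel {0..T} (\<lambda>t. \<phi>2 t * mu)"
    "\<And>t. t \<in> {0..T} \<Longrightarrow> (LINT u:{0..t}|lborel. \<phi>2 u * mu) = s t - s 0"
    "(\<integral>\<^sup>+ t\<in>{0..T}. ennreal (mu * ell (\<phi>2 t)) \<partial>lborel) \<le> ennreal c2"
    by (rule finite_dual_cost.obtain_control[OF costs(3)]) blast
  obtain \<phi>3 where \<phi>3: "\<phi>3 \<in> borel_measurable borel" "\<And>t. 0 \<le> \<phi>3 t"
      "set_integrable lborel {0..T} (\<lambda>t. \<phi>3 t * (th * \<xi> t))"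
    "\<And>t. t \<in> {0..T} \<Longrightarrow> (LINT s:{0..t}|lborel. \<phi>3 s * (th * \<xi> s)) = \<zeta> t - \<zeta> 0"
    "(\<integral>\<^sup>+ t\<in>{0..T}. ennreal (th * \<xi> t * ell (\<phi>3 t)) \<partial>lborel) \<le> ennreal c3"
    by (rule finite_dual_cost.obtain_control[OF costs(4)]) blast
  have control: "(\<phi>1, \<phi>2, \<phi>3) \<in> controls lam mu th x0 T \<xi> \<zeta>"
    using \<phi>1 \<phi>2 \<phi>3 start by (intro control_of_densities) auto
  have "\<xi> \<in> borel_measurable (restrict_space borel {0..T})"
    by (rule borel_measurable_continuous_on_restrict[OF cont_\<xi>])
  moreover have "(\<lambda>t. ell (\<phi> t)) \<in> borel_measurable (restrict_space borel {0..T})" if "\<phi> \<in> borel_measurable borel" for \<phi>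
    using measurable_compose[OF that measurable_ell] by (rule measurable_restrict_space1)
  ultimately have "control_cost lam mu th T \<xi> (\<phi>1, \<phi>2, \<phi>3) \<le> ennreal c1 + ennreal c2 + ennreal c3"
    unfolding control_cost_def prod.case using \<phi>1(1,5) \<phi>2(1,5) \<phi>3(1,5) lam_pos mu_pos th_pos
    by (intro add_mono) (simp_all add: nn_integral_cmult_interval flip: mult.assoc)
  also have "\<dots> \<le> ennreal c" using costs(1) cost_nonneg by (simp add: ennreal_leI flip: ennreal_plus)
  finally show ?thesis using control by (auto simp: has_control_within_def)
qed

end

lemma ell_ge_dual: "0 \<le> x \<Longrightarrow> b * x - (exp b - 1) \<le> ell x"
  using relent_ge_dual[of x 1 b] by (simp add: relent_def ell_def)

lemma set_integral_Ioc_eq_diff: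
  fixes h :: "real \<Rightarrow> real"
  assumes h: "set_integrable lborel {0..T} h" and ordered: "0 \<le> s" "s \<le> t" "t \<le> T"
  shows "(LINT u:{s<..t}|lborel. h u) = (LINT u:{0..t}|lborel. h u) - (LINT u:{0..s}|lborel. h u)"
proof -
  have "(LINT u:{0..s} \<union> {s<..t}|lborel. h u) = (LINT u:{0..s}|lborel. h u) + (LINT u:{s<..t}|lborel. h u)"
    using ordered by (intro set_integral_Un set_integrable_subset[OF h]) auto
  moreover have "{0..s} \<union> {s<..t} = {0..t}" using ordered by auto
  ultimately show ?thesis by simp
qed

lemma incr_set_integral:
  fixes h :: "real \<Rightarrow> real"
  assumes "0 < T" "k < 2 ^ q" "set_integrable lborel {0..T} h"
  shows "incr T (\<lambda>t. LINT u:{0..t}|lborel. h u) q k = (LINT u:time_cell T q k|lborel. h u)"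
  unfolding incr_def time_cell_def using tgrid_cell[OF assms(1,2)]
  by (intro set_integral_Ioc_eq_diff[OF assms(3), symmetric]) auto

lemma cell_integral_eq_set_integral:
  assumes "0 < T" "k < 2 ^ q" "continuous_on {0..T} v"
  shows "cell_integral T v q k = (LINT u:time_cell T q k|lborel. v u)"
proof -
  have "integral {0..t} v = (LINT u:{0..t}|lborel. v u)" if "t \<in> {0..T}" for t
    using that by (intro set_borel_integral_eq_integral(2)[symmetric] borel_integrable_atLeastAtMost'
        continuous_on_subset[OF assms(3)]) auto
  then have "cell_integral T v q k = incr T (\<lambda>t. LINT u:{0..t}|lborel. v u) q k"
    using cell_integral_eq_incr[OF assms(1,3,2)] tgrid_cell[OF assms(1,2)] by (simp add: incr_def)
  then show ?thesis
    using incr_set_integral[OF assms(1,2)] borel_integrable_atLeastAtMost'[OF assms(3)] by simp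
qed

lemma mono_on_set_integral:
  fixes h :: "real \<Rightarrow> real"
  assumes h: "set_integrable lborel {0..T} h" "\<And>t. t \<in> {0..T} \<Longrightarrow> 0 \<le> h t"
  shows "mono_on {0..T} (\<lambda>t. LINT u:{0..t}|lborel. h u)"
proof (rule mono_onI)
  fix s t assume ordered: "s \<in> {0..T}" "t \<in> {0..T}" "s \<le> t"
  have "0 \<le> (LINT u:{s<..t}|lborel. h u)"
    unfolding set_lebesgue_integral_def using ordered h(2)
    by (intro Bochner_Integration.integral_nonneg) (auto simp: indicator_def)
  then show "(LINT u:{0..s}|lborel. h u) \<le> (LINT u:{0..t}|lborel. h u)"
    using set_integral_Ioc_eq_diff[OF h(1), of s t] ordered by auto
qed

lemma continuous_on_set_integral:
  fixes h :: "real \<Rightarrow> real"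
  assumes h: "set_integrable lborel {0..T} h"
  shows "continuous_on {0..T} (\<lambda>t. LINT u:{0..t}|lborel. h u)"
proof -
  have "integral {0..t} h = (LINT u:{0..t}|lborel. h u)" if "t \<in> {0..T}" for t
    using that by (intro set_borel_integral_eq_integral(2)[symmetric] set_integrable_subset[OF h]) auto
  with indefinite_integral_continuous_1[OF set_borel_integral_eq_integral(1)[OF h]] show ?thesis
    by (rule continuous_on_eq)
qed

lemma set_integral_singleton:
  fixes h :: "real \<Rightarrow> real"
  shows "(LINT u:{x}|lborel. h u) = 0"
  unfolding set_lebesgue_integral_def
  by (rule integral_eq_zero_AE, rule AE_mp[OF AE_lborel_singleton[of x]]) (auto simp: indicator_def)

lemma dual_cost_set_integral:
  fixes h v :: "real \<Rightarrow> real"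
  assumes T: "0 < T" and v: "continuous_on {0..T} v" and h: "set_integrable lborel {0..T} h"
  shows "dual_cost T (\<lambda>t. LINT u:{0..t}|lborel. h u) v q \<beta> =
    (LINT t:{0<..T}|lborel. \<beta> (cell_index T q t) * h t - (exp (\<beta> (cell_index T q t)) - 1) * v t)"
proof -
  let ?I = "time_cell T q"
  define G where "G t = \<beta> (cell_index T q t) * h t - (exp (\<beta> (cell_index T q t)) - 1) * v t" for t
  have G_eq: "G t = \<beta> k * h t - (exp (\<beta> k) - 1) * v t" if "k < 2 ^ q" "t \<in> ?I k" for k t
    using that mem_time_cell_iff[OF T] time_cell_subset[OF T that(1)] by (auto simp: G_def)
  have sets: "?I k \<in> sets lborel" for k by (simp add: time_cell_def)
  have v_integrable: "set_integrable lborel {0..T} v" by (rule borel_integrable_atLeastAtMost'[OF v])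
  have cell_integrable: "set_integrable lborel (?I k) h" "set_integrable lborel (?I k) v" if "k < 2 ^ q" for k
    using time_cell_subset[OF T that] sets
    by (auto intro!: set_integrable_subset[OF h] set_integrable_subset[OF v_integrable])
  have G_integrable: "set_integrable lborel (?I k) G" if "k < 2 ^ q" for k
  proof -
    have "set_integrable lborel (?I k) G = set_integrable lborel (?I k) (\<lambda>t. \<beta> k * h t - (exp (\<beta> k) - 1) * v t)"
      using G_eq[OF that] by (intro set_integrable_cong refl)
    moreover have "set_integrable lborel (?I k) (\<lambda>t. \<beta> k * h t - (exp (\<beta> k) - 1) * v t)"
      using cell_integrable[OF that] by (intro set_integral_diff(1) set_integrable_mult_right)
    ultimately show ?thesis by simp
  qed
  have union: "(\<Union>k<2 ^ q. ?I k) = {0<..T}" by (rule UN_time_cell[OF T])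
  have "dual_cost T (\<lambda>t. LINT u:{0..t}|lborel. h u) v q \<beta> =
      (\<Sum>k<2 ^ q. \<beta> k * (LINT u:?I k|lborel. h u) - (exp (\<beta> k) - 1) * (LINT u:?I k|lborel. v u))"
    unfolding dual_cost_def dual_sum_def
    using incr_set_integral[OF T _ h] cell_integral_eq_set_integral[OF T _ v] by simp
  also have "\<dots> = (\<Sum>k<2 ^ q. LINT u:?I k|lborel. G u)"
  proof (intro sum.cong refl)
    fix k :: nat assume "k \<in> {..<2 ^ q}"
    then have k: "k < 2 ^ q" by simp
    have "(LINT u:?I k|lborel. G u) = (LINT u:?I k|lborel. \<beta> k * h u - (exp (\<beta> k) - 1) * v u)"
      using G_eq[OF k] sets by (intro set_lebesgue_integral_cong) auto
    then show "\<beta> k * (LINT u:?I k|lborel. h u) - (exp (\<beta> k) - 1) * (LINT u:?I k|lborel. v u)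
          = (LINT u:?I k|lborel. G u)"
      using cell_integrable[OF k] by (simp add: set_integral_diff)
  qed
  also have "\<dots> = (LINT u:{0<..T}|lborel. G u)"
    unfolding union[symmetric] using G_integrable sets time_cell_disjoint[OF T]
    by (intro set_integral_finite_Union[symmetric]) (auto simp: disjoint_family_on_def)
  finally show ?thesis by (simp add: G_def)
qed

lemma dual_cost_set_integral_le:
  fixes \<phi> v :: "real \<Rightarrow> real"
  assumes T: "0 < T" and v: "continuous_on {0..T} v" "\<And>t. t \<in> {0..T} \<Longrightarrow> 0 \<le> v t"
    and \<phi>: "set_integrable lborel {0..T} (\<lambda>t. v t * \<phi> t)" "\<And>t. t \<in> {0..T} \<Longrightarrow> 0 \<le> \<phi> t"
    and cost: "(\<integral>\<^sup>+ t\<in>{0..T}. ennreal (v t * ell (\<phi> t)) \<partial>lborel) \<le> ennreal C" "0 \<le> C"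
  shows "dual_cost T (\<lambda>t. LINT u:{0..t}|lborel. v u * \<phi> u) v q \<beta> \<le> C"
  unfolding dual_cost_set_integral[OF T v(1) \<phi>(1)]
proof (subst set_lebesgue_integral_def, rule integral_real_bounded[OF cost(2)])
  let ?G = "\<lambda>t. \<beta> (cell_index T q t) * (v t * \<phi> t) - (exp (\<beta> (cell_index T q t)) - 1) * v t"
  have "?G t \<le> v t * ell (\<phi> t)" if "t \<in> {0..T}" for t
    using mult_left_mono[OF ell_ge_dual[OF \<phi>(2)[OF that], of "\<beta> (cell_index T q t)"] v(2)[OF that]]
    by (simp add: algebra_simps)
  then have "(\<integral>\<^sup>+ t. ennreal (indicator {0<..T} t *\<^sub>R ?G t) \<partial>lborel) \<le> (\<integral>\<^sup>+ t\<in>{0..T}. ennreal (v t * ell (\<phi> t)) \<partial>lborel)"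
    by (intro nn_integral_mono) (auto simp: indicator_def intro: ennreal_leI)
  then show "(\<integral>\<^sup>+ t. ennreal (indicator {0<..T} t *\<^sub>R ?G t) \<partial>lborel) \<le> ennreal C" using cost(1) by (rule order_trans)
qed

lemma controls_eq_net_input:
  assumes "(\<phi>1, \<phi>2, \<phi>3) \<in> controls lam mu th x0 T \<xi> \<zeta>" "t \<in> {0..T}"
  shows "\<zeta> t = th * (LINT u:{0..t}|lborel. \<xi> u * \<phi>3 u)"
    "\<xi> t = skorohod_map (net_input x0 (\<lambda>t. lam * (LINT u:{0..t}|lborel. \<phi>1 u))
      (\<lambda>t. mu * (LINT u:{0..t}|lborel. \<phi>2 u)) \<zeta>) t" (is "_ = ?reflected")
proof -
  have \<zeta>_eq: "\<zeta> t = th * (LINT u:{0..t}|lborel. \<xi> u * \<phi>3 u)" if "t \<in> {0..T}" for t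
    using assms(1) that by (auto simp: controls_def mult.commute)
  then show "\<zeta> t = th * (LINT u:{0..t}|lborel. \<xi> u * \<phi>3 u)" using assms(2) .
  have "\<xi> t = skorohod_map (\<lambda>r. x0 + lam * (LINT u:{0..r}|lborel. \<phi>1 u) - mu * (LINT u:{0..r}|lborel. \<phi>2 u)
     - th * (LINT u:{0..r}|lborel. \<phi>3 u * \<xi> u)) t" using assms by (auto simp: controls_def)
  also have "\<dots> = ?reflected"
    using assms(2) \<zeta>_eq by (intro skorohod_map_cong) (auto simp: net_input_def mult.commute)
  finally show "\<xi> t = ?reflected" .
qed

lemma ennreal_add3_leE:
  assumes "x + y + z \<le> ennreal c" "0 \<le> c"
  obtains a b d where "x = ennreal a" "y = ennreal b" "z = ennreal d" "0 \<le> a" "0 \<le> b" "0 \<le> d" "a + b + d \<le> c"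
proof -
  have "x \<noteq> \<top> \<and> y \<noteq> \<top> \<and> z \<noteq> \<top>" using assms by (auto simp: top_unique)
  then obtain a b d where abd: "x = ennreal a" "y = ennreal b" "z = ennreal d" "0 \<le> a" "0 \<le> b" "0 \<le> d"
    by (cases x; cases y; cases z) auto
  then have "ennreal (a + b + d) \<le> ennreal c" using assms(1) by (simp add: ennreal_plus)
  then show thesis using that[OF abd] assms(2) by (simp add: ennreal_le_iff)
qed

context queue_rates
begin

lemma finite_dual_cost_of_control:
  fixes \<phi> v F :: "real \<Rightarrow> real"
  assumes "0 \<le> C" and v: "continuous_on {0..T} v" "\<And>t. t \<in> {0..T} \<Longrightarrow> 0 \<le> v t"
    and \<phi>: "set_integrable lborel {0..T} (\<lambda>t. v t * \<phi> t)" "\<And>t. t \<in> {0..T} \<Longrightarrow> 0 \<le> \<phi> t"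
      "\<phi> \<in> borel_measurable (restrict_space borel {0..T})"
    and cost: "ennreal C * (\<integral>\<^sup>+ t\<in>{0..T}. ennreal (v t * ell (\<phi> t)) \<partial>lborel) \<le> ennreal c" "0 \<le> c"
    and F: "\<And>t. t \<in> {0..T} \<Longrightarrow> F t = C * (LINT u:{0..t}|lborel. v u * \<phi> u)"
  shows "finite_dual_cost T F (\<lambda>t. C * v t) c"
proof -
  define G where "G t = (LINT u:{0..t}|lborel. (C * v u) * \<phi> u)" for t
  have G: "F t = G t" if "t \<in> {0..T}" for t using F[OF that] by (simp add: G_def mult.assoc)
  have integrable: "set_integrable lborel {0..T} (\<lambda>t. (C * v t) * \<phi> t)"
    using set_integrable_mult_right[of C lborel "{0..T}" "\<lambda>t. v t * \<phi> t"] \<phi>(1) by (simp add: mult.assoc)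
  have cont_weight: "continuous_on {0..T} (\<lambda>t. C * v t)" by (intro continuous_intros v(1))
  have "(\<lambda>t. v t * ell (\<phi> t)) \<in> borel_measurable (restrict_space borel {0..T})"
    using borel_measurable_continuous_on_restrict[OF v(1)] measurable_compose[OF \<phi>(3) measurable_ell] by simp
  then have "(\<integral>\<^sup>+ t\<in>{0..T}. ennreal ((C * v t) * ell (\<phi> t)) \<partial>lborel) \<le> ennreal c"
    using cost(1) \<open>0 \<le> C\<close> by (simp add: nn_integral_cmult_interval mult.assoc)
  then have "dual_cost T G (\<lambda>t. C * v t) q \<beta> \<le> c" for q \<beta>
    unfolding G_def using integrable \<phi>(2) v(2) \<open>0 \<le> C\<close> \<open>0 \<le> c\<close>
    by (intro dual_cost_set_integral_le[OF T_pos cont_weight]) auto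
  moreover have "dual_cost T F (\<lambda>t. C * v t) q \<beta> = dual_cost T G (\<lambda>t. C * v t) q \<beta>" for q \<beta>
    unfolding dual_cost_def incr_def using G tgrid_cell[OF T_pos] by (intro dual_sum_cong) auto
  moreover have "mono_on {0..T} G"
    unfolding G_def using \<phi>(2) v(2) \<open>0 \<le> C\<close> by (intro mono_on_set_integral integrable) auto
  then have "mono_on {0..T} F" using G by (simp add: mono_on_def)
  moreover have "continuous_on {0..T} F"
    using continuous_on_set_integral[OF integrable] by (rule continuous_on_eq) (simp add: G G_def)
  ultimately show ?thesis
    using T_pos cont_weight v(2) \<open>0 \<le> C\<close> by (simp add: finite_dual_cost_def)
qed

lemma entropy_path_of_finite_dual_costs:
  assumes a: "finite_dual_cost T a (\<lambda>_. lam) c1" "a 0 = 0" and s: "finite_dual_cost T s (\<lambda>_. mu) c2" "s 0 = 0"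
    and \<zeta>: "finite_dual_cost T \<zeta> (\<lambda>t. th * \<xi> t) c3" "\<zeta> 0 = 0" and "c1 + c2 + c3 \<le> c"
    and reflected: "\<And>t. t \<in> {0..T} \<Longrightarrow> \<xi> t = skorohod_map (net_input x0 a s \<zeta>) t"
  shows "entropy_path lam mu th T x0 c a s \<xi> \<zeta>"
proof unfold_locales
  fix q b1 b2 b3
  have "dual_cost T a (\<lambda>_. lam) q b1 + dual_cost T s (\<lambda>_. mu) q b2 + dual_cost T \<zeta> (\<lambda>t. th * \<xi> t) q b3 \<le> c1 + c2 + c3"
    by (intro add_mono finite_dual_cost.dual_cost_le[OF a(1)] finite_dual_cost.dual_cost_le[OF s(1)]
        finite_dual_cost.dual_cost_le[OF \<zeta>(1)])
  then show "dual_cost T a (\<lambda>_. lam) q b1 + dual_cost T s (\<lambda>_. mu) q b2 + dual_cost T \<zeta> (\<lambda>t. th * \<xi> t) q b3 \<le> c"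
    using \<open>c1 + c2 + c3 \<le> c\<close> by simp
qed (use assms in \<open>simp_all add: finite_dual_cost_def\<close>)

lemma has_control_within_imp_entropy_path:
  assumes "has_control_within lam mu th x0 T \<xi> \<zeta> c" "0 \<le> c"
  obtains a s where "entropy_path lam mu th T x0 c a s \<xi> \<zeta>"
proof -
  obtain \<phi>1 \<phi>2 \<phi>3 where control: "(\<phi>1, \<phi>2, \<phi>3) \<in> controls lam mu th x0 T \<xi> \<zeta>"
    and cost: "control_cost lam mu th T \<xi> (\<phi>1, \<phi>2, \<phi>3) \<le> ennreal c"
    using assms(1) unfolding has_control_within_def by auto
  have measurable: "\<phi> \<in> borel_measurable (restrict_space borel {0..T})" and nonneg: "\<And>t. t \<in> {0..T} \<Longrightarrow> 0 \<le> \<phi> t"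
    if "\<phi> \<in> {\<phi>1, \<phi>2, \<phi>3}" for \<phi> using control that by (auto simp: controls_def)
  have integrable: "set_integrable lborel {0..T} \<phi>1" "set_integrable lborel {0..T} \<phi>2"
      "set_integrable lborel {0..T} (\<lambda>s. \<xi> s * \<phi>3 s)"
    using control by (auto simp: controls_def mult.commute)
  define a where "a t = lam * (LINT u:{0..t}|lborel. \<phi>1 u)" for t
  define s where "s t = mu * (LINT u:{0..t}|lborel. \<phi>2 u)" for t
  note \<zeta>_eq = controls_eq_net_input(1)[OF control]
    and reflected = controls_eq_net_input(2)[OF control, folded a_def[abs_def] s_def[abs_def]]
  have "continuous_on {0..T} (\<lambda>t. net_input x0 a s (\<lambda>t. th * (LINT s:{0..t}|lborel. \<xi> s * \<phi>3 s)) t)"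
    unfolding net_input_def a_def s_def
    by (intro continuous_on_diff continuous_on_add continuous_on_mult continuous_on_const continuous_on_set_integral
      integrable)
  then have "continuous_on {0..T} (net_input x0 a s \<zeta>)"
    by (rule continuous_on_eq) (simp add: net_input_def \<zeta>_eq)
  note cont_\<xi> = continuous_on_eq[OF continuous_on_skorohod_map[OF this] reflected[symmetric]]
    and \<xi>_nonneg = skorohod_map_nonneg_continuous[OF this]
  obtain c1 c2 c3 where costs: "ennreal lam * (\<integral>\<^sup>+t\<in>{0..T}. ennreal (ell (\<phi>1 t)) \<partial>lborel) = ennreal c1"
    "ennreal mu * (\<integral>\<^sup>+t\<in>{0..T}. ennreal (ell (\<phi>2 t)) \<partial>lborel) = ennreal c2"
    "ennreal th * (\<integral>\<^sup>+t\<in>{0..T}. ennreal (\<xi> t * ell (\<phi>3 t)) \<partial>lborel) = ennreal c3"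
    "0 \<le> c1" "0 \<le> c2" "0 \<le> c3" "c1 + c2 + c3 \<le> c"
    using cost assms(2) unfolding control_cost_def prod.case by (rule ennreal_add3_leE)
  have "finite_dual_cost T a (\<lambda>_. lam * 1) c1"
    using lam_pos integrable(1) costs(1,4) measurable[of \<phi>1] nonneg[of \<phi>1]
    by (intro finite_dual_cost_of_control[where v = "\<lambda>_. 1" and \<phi> = \<phi>1]) (simp_all add: a_def)
  moreover have "finite_dual_cost T s (\<lambda>_. mu * 1) c2"
    using mu_pos integrable(2) costs(2,5) measurable[of \<phi>2] nonneg[of \<phi>2]
    by (intro finite_dual_cost_of_control[where v = "\<lambda>_. 1" and \<phi> = \<phi>2]) (simp_all add: s_def)
  moreover have "finite_dual_cost T \<zeta> (\<lambda>t. th * \<xi> t) c3"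
    using th_pos integrable(3) costs(3,6) measurable[of \<phi>3] nonneg[of \<phi>3] \<xi>_nonneg reflected \<zeta>_eq
    by (intro finite_dual_cost_of_control[where v = \<xi> and \<phi> = \<phi>3] cont_\<xi>) simp_all
  ultimately show thesis
    using costs(7) reflected \<zeta>_eq[of 0] T_pos
    by (intro that[of a s] entropy_path_of_finite_dual_costs) (auto simp: a_def s_def set_integral_singleton)
qed

end

section \<open>Limits of paths with bounded entropy\<close>

lemma tight_monotone_of_dual_bound:
  assumes T: "0 < T" and mono: "\<And>p. mono_on {0..T} (F p)" and start: "(\<lambda>p. F p 0) \<longlonglongrightarrow> 0"
    and count: "\<And>q k. k < 2 ^ q \<Longrightarrow> (\<lambda>p. y p q k - incr T (F p) q k) \<longlonglongrightarrow> 0"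
    and weight: "\<And>q. \<forall>\<^sub>F p in sequentially. \<forall>k<2 ^ q. w p q k \<le> V * (T / 2 ^ q)"
    and dual: "\<And>q. \<forall>\<^sub>F p in sequentially. \<forall>b. dual_sum q b (y p q) (w p q) \<le> c" and "0 \<le> V" "0 \<le> c"
  shows "tight_monotone T F"
proof (unfold_locales, fact T, fact mono, fact start)
  fix e :: real assume "0 < e"
  have "(\<lambda>q. V * (T / 2 ^ q)) \<longlonglongrightarrow> 0" using tendsto_mult_right[OF mesh_tendsto_0, of V T] by simp
  moreover obtain b where b: "0 < b" "\<And>w :: nat \<Rightarrow> real. w \<longlonglongrightarrow> 0 \<Longrightarrow> \<forall>\<^sub>F q in sequentially. c + exp b * w q < b * (e / 2)"
    using ex_slope_dual_bound_less[OF half_gt_zero[OF \<open>0 < e\<close>] \<open>0 \<le> c\<close>] by blast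
  ultimately obtain q where q: "c + exp b * (V * (T / 2 ^ q)) < b * (e / 2)" unfolding eventually_sequentially by blast
  have "\<forall>\<^sub>F p in sequentially. \<forall>k\<in>{..<2 ^ q}. - (e / 2) < y p q k - incr T (F p) q k"
    using \<open>0 < e\<close> by (intro eventually_ball_finite ballI order_tendstoD(1)[OF count]) auto
  with weight[of q] dual[of q] have "\<forall>\<^sub>F p in sequentially. \<forall>k<2 ^ q. incr T (F p) q k \<le> e"
  proof (eventually_elim, intro allI impI)
    fix p k
    assume bounds: "\<forall>k<2 ^ q. w p q k \<le> V * (T / 2 ^ q)" "\<forall>b. dual_sum q b (y p q) (w p q) \<le> c"
      "\<forall>k\<in>{..<2 ^ q}. - (e / 2) < y p q k - incr T (F p) q k" and k: "k < (2::nat) ^ q"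
    have "b * y p q k - (exp b - 1) * w p q k \<le> c"
      using bounds(2) dual_sum_single[OF k, of b] by metis
    then have "b * y p q k \<le> c + exp b * (V * (T / 2 ^ q))"
      using bounds(1) k b(1) T \<open>0 \<le> V\<close> by (intro mult_le_of_dual_bound) auto
    then have "b * y p q k < b * (e / 2)" using q by linarith
    then have "y p q k < e / 2" using b(1) by simp
    then show "incr T (F p) q k \<le> e" using bounds(3) k by force
  qed
  then show "\<exists>q. \<forall>\<^sub>F p in sequentially. \<forall>k<2 ^ q. incr T (F p) q k \<le> e" by blast
qed

lemma tight_monotone_of_dual_cost:
  assumes "0 < T" "\<And>p. mono_on {0..T} (F p)" "(\<lambda>p. F p 0) \<longlonglongrightarrow> 0"
    and dual: "\<And>q. \<forall>\<^sub>F p in sequentially. \<forall>b. dual_cost T (F p) (\<lambda>_. v) q b \<le> c" and "0 \<le> v" "0 \<le> c"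
  shows "tight_monotone T F"
proof (rule tight_monotone_of_dual_bound[OF assms(1-3) _ _ _ \<open>0 \<le> v\<close> \<open>0 \<le> c\<close>])
  show "\<forall>\<^sub>F p in sequentially. \<forall>b. dual_sum q b (incr T (F p) q) (cell_integral T (\<lambda>_. v) q) \<le> c" for q
    using dual unfolding dual_cost_def .
qed (simp_all add: cell_integral_const[OF \<open>0 < T\<close>])

lemma skorohod_map_net_input_bounds:
  assumes mono: "mono_on {0..T} a" "mono_on {0..T} s" "mono_on {0..T} y" and t: "t \<in> {0..T}" and "0 \<le> x0"
  shows "skorohod_map (net_input x0 a s y) t \<in> {0..x0 + \<bar>a 0\<bar> + \<bar>a t\<bar> + \<bar>s 0\<bar> + \<bar>y 0\<bar>}"
proof -
  have between: "a 0 \<le> a u" "a u \<le> a t" "s 0 \<le> s u" "s u \<le> s t" "y 0 \<le> y u" "y u \<le> y t" if "u \<in> {0..t}" for u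
    using that t by (auto intro!: mono_onD[OF mono(1)] mono_onD[OF mono(2)] mono_onD[OF mono(3)])
  have "0 \<le> skorohod_map (net_input x0 a s y) t"
    using t between by (intro skorohod_map_nonneg[of _ "x0 + a 0 - s t - y t"])
      (auto simp: net_input_def add_mono diff_mono)
  moreover have "skorohod_map (net_input x0 a s y) t \<le> x0 + \<bar>a 0\<bar> + \<bar>a t\<bar> + \<bar>s 0\<bar> + \<bar>y 0\<bar>"
  proof (rule skorohod_map_le)
    fix u assume "u \<in> {0..t}"
    note between_u = between[OF this]
    have "net_input x0 a s y t - net_input x0 a s y u \<le> x0 + \<bar>a 0\<bar> + \<bar>a t\<bar> + \<bar>s 0\<bar> + \<bar>y 0\<bar>"
      unfolding net_input_def using between_u \<open>0 \<le> x0\<close> by linarith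
    moreover have "net_input x0 a s y t \<le> x0 + \<bar>a 0\<bar> + \<bar>a t\<bar> + \<bar>s 0\<bar> + \<bar>y 0\<bar>"
      unfolding net_input_def using between_u by linarith
    ultimately show "net_input x0 a s y t - min (net_input x0 a s y u) 0 \<le> x0 + \<bar>a 0\<bar> + \<bar>a t\<bar> + \<bar>s 0\<bar> + \<bar>y 0\<bar>"
      by (simp add: min_def)
  qed (use t in auto)
  ultimately show ?thesis by simp
qed

text \<open>The sequences \<open>A\<close>, \<open>S\<close>, \<open>Y\<close> are either integrated controls (for compactness of the level sets)
  or rescaled counting processes (for the upper bound); \<open>y\<close> and \<open>w\<close> are the number and the intensity of
  reneging events per dyadic cell.\<close>

locale entropy_bounded = queue_rates +
  fixes x0 c :: real and A S Y X :: "nat \<Rightarrow> real \<Rightarrow> real" and y w :: "nat \<Rightarrow> nat \<Rightarrow> nat \<Rightarrow> real"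
  assumes x0_nonneg: "0 \<le> x0" and bound_nonneg: "0 \<le> c"
    and mono: "\<And>p. mono_on {0..T} (A p)" "\<And>p. mono_on {0..T} (S p)" "\<And>p. mono_on {0..T} (Y p)"
    and start: "(\<lambda>p. A p 0) \<longlonglongrightarrow> 0" "(\<lambda>p. S p 0) \<longlonglongrightarrow> 0" "(\<lambda>p. Y p 0) \<longlonglongrightarrow> 0"
    and reflection: "\<And>e. 0 < e \<Longrightarrow> \<forall>\<^sub>F p in sequentially. \<forall>t\<in>{0..T}.
       \<bar>X p t - skorohod_map (net_input x0 (A p) (S p) (Y p)) t\<bar> \<le> e"
    and joint_cost: "\<And>q e. 0 < e \<Longrightarrow> \<forall>\<^sub>F p in sequentially. \<forall>b1 b2 b3.
       dual_cost T (A p) (\<lambda>_. lam) q b1 + dual_cost T (S p) (\<lambda>_. mu) q b2 + dual_sum q b3 (y p q) (w p q) \<le> c + e"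
    and count: "\<And>q k. k < 2 ^ q \<Longrightarrow> (\<lambda>p. y p q k - incr T (Y p) q k) \<longlonglongrightarrow> 0"
    and weight: "\<And>q k e. k < 2 ^ q \<Longrightarrow> 0 < e \<Longrightarrow> \<forall>\<^sub>F p in sequentially. \<forall>g d. continuous_on {0..T} g \<longrightarrow>
       (\<forall>t\<in>{0..T}. \<bar>X p t - g t\<bar> \<le> d) \<longrightarrow>
       \<bar>w p q k - cell_integral T (\<lambda>t. th * g t) q k\<bar> \<le> th * d * (T / 2 ^ q) + e"
begin

lemma eventually_dual_costs_le:
  shows "\<forall>\<^sub>F p in sequentially. \<forall>b. dual_cost T (A p) (\<lambda>_. lam) q b \<le> c + 1"
    and "\<forall>\<^sub>F p in sequentially. \<forall>b. dual_cost T (S p) (\<lambda>_. mu) q b \<le> c + 1"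
    and "\<forall>\<^sub>F p in sequentially. \<forall>b. dual_sum q b (y p q) (w p q) \<le> c + 1"
proof -
  note joint = joint_cost[OF zero_less_one, of q]
  from joint show "\<forall>\<^sub>F p in sequentially. \<forall>b. dual_cost T (A p) (\<lambda>_. lam) q b \<le> c + 1"
  proof (rule eventually_mono, intro allI)
    fix p b
    assume total_le: "\<forall>b1 b2 b3. dual_cost T (A p) (\<lambda>_. lam) q b1 + dual_cost T (S p) (\<lambda>_. mu) q b2
          + dual_sum q b3 (y p q) (w p q) \<le> c + 1"
    from total_le[rule_format, of b "\<lambda>_. 0" "\<lambda>_. 0"] show "dual_cost T (A p) (\<lambda>_. lam) q b \<le> c + 1" by simp
  qed
  from joint show "\<forall>\<^sub>F p in sequentially. \<forall>b. dual_cost T (S p) (\<lambda>_. mu) q b \<le> c + 1"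
  proof (rule eventually_mono, intro allI)
    fix p b
    assume total_le: "\<forall>b1 b2 b3. dual_cost T (A p) (\<lambda>_. lam) q b1 + dual_cost T (S p) (\<lambda>_. mu) q b2
          + dual_sum q b3 (y p q) (w p q) \<le> c + 1"
    from total_le[rule_format, of "\<lambda>_. 0" b "\<lambda>_. 0"] show "dual_cost T (S p) (\<lambda>_. mu) q b \<le> c + 1" by simp
  qed
  from joint show "\<forall>\<^sub>F p in sequentially. \<forall>b. dual_sum q b (y p q) (w p q) \<le> c + 1"
  proof (rule eventually_mono, intro allI)
    fix p b
    assume total_le: "\<forall>b1 b2 b3. dual_cost T (A p) (\<lambda>_. lam) q b1 + dual_cost T (S p) (\<lambda>_. mu) q b2
          + dual_sum q b3 (y p q) (w p q) \<le> c + 1"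
    from total_le[rule_format, of "\<lambda>_. 0" "\<lambda>_. 0" b] show "dual_sum q b (y p q) (w p q) \<le> c + 1" by simp
  qed
qed

lemma tight_arrivals: "tight_monotone T A"
  by (rule tight_monotone_of_dual_cost[OF T_pos mono(1) start(1) eventually_dual_costs_le(1)])
    (use lam_pos bound_nonneg in auto)

lemma tight_services: "tight_monotone T S"
  by (rule tight_monotone_of_dual_cost[OF T_pos mono(2) start(2) eventually_dual_costs_le(2)])
    (use mu_pos bound_nonneg in auto)

lemma eventually_X_bounded: "\<exists>B\<ge>0. \<forall>\<^sub>F p in sequentially. \<forall>t\<in>{0..T}. \<bar>X p t\<bar> \<le> B"
proof -
  obtain a where "\<forall>\<^sub>F p in sequentially. \<forall>t\<in>{0..T}. \<bar>A p t\<bar> \<le> a"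
    using tight_monotone.eventually_bounded[OF tight_arrivals] by blast
  moreover have "\<forall>\<^sub>F p in sequentially. \<bar>S p 0\<bar> < 1" "\<forall>\<^sub>F p in sequentially. \<bar>Y p 0\<bar> < 1"
    using tendstoD[OF start(2), of 1] tendstoD[OF start(3), of 1] by (simp_all add: dist_real_def)
  moreover have "\<forall>\<^sub>F p in sequentially. \<forall>t\<in>{0..T}. \<bar>X p t - skorohod_map (net_input x0 (A p) (S p) (Y p)) t\<bar> \<le> 1"
    by (rule reflection) simp
  ultimately have "\<forall>\<^sub>F p in sequentially. \<forall>t\<in>{0..T}. \<bar>X p t\<bar> \<le> x0 + 2 * \<bar>a\<bar> + 3"
  proof (eventually_elim, intro ballI)
    fix p t assume bounds: "\<forall>t\<in>{0..T}. \<bar>A p t\<bar> \<le> a" "\<bar>S p 0\<bar> < 1" "\<bar>Y p 0\<bar> < 1"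
      "\<forall>t\<in>{0..T}. \<bar>X p t - skorohod_map (net_input x0 (A p) (S p) (Y p)) t\<bar> \<le> 1" and t: "t \<in> {0..T}"
    let ?x = "skorohod_map (net_input x0 (A p) (S p) (Y p)) t"
    have "?x \<le> x0 + \<bar>A p 0\<bar> + \<bar>A p t\<bar> + \<bar>S p 0\<bar> + \<bar>Y p 0\<bar>" "0 \<le> ?x"
      using skorohod_map_net_input_bounds[OF mono(1,2,3) t x0_nonneg, of p] by auto
    moreover have "x0 + \<bar>A p 0\<bar> + \<bar>A p t\<bar> + \<bar>S p 0\<bar> + \<bar>Y p 0\<bar> \<le> x0 + \<bar>a\<bar> + \<bar>a\<bar> + 1 + 1"
      using bounds(1-3) t T_pos by (intro add_mono order_trans[OF _ abs_ge_self]) auto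
    ultimately show "\<bar>X p t\<bar> \<le> x0 + 2 * \<bar>a\<bar> + 3"
      using bounds(4)[rule_format, OF t] by (simp add: abs_le_iff)
  qed
  then show ?thesis using x0_nonneg by (intro exI[of _ "x0 + 2 * \<bar>a\<bar> + 3"]) auto
qed

lemma tight_reneging: "tight_monotone T Y"
proof -
  obtain B where B: "0 \<le> B" "\<forall>\<^sub>F p in sequentially. \<forall>t\<in>{0..T}. \<bar>X p t\<bar> \<le> B" using eventually_X_bounded by blast
  have "\<forall>\<^sub>F p in sequentially. \<forall>k\<in>{..<2 ^ q}. w p q k \<le> th * (B + 1) * (T / 2 ^ q)" for q
  proof (intro eventually_ball_finite ballI)
    fix k :: nat assume "k \<in> {..<2 ^ q}"
    then have k: "k < 2 ^ q" by simp
    have "0 < th * (T / 2 ^ q)" using th_pos T_pos by simp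
    from weight[OF k this] B(2) show "\<forall>\<^sub>F p in sequentially. w p q k \<le> th * (B + 1) * (T / 2 ^ q)"
    proof (eventually_elim)
      case (elim p)
      have "\<bar>w p q k - cell_integral T (\<lambda>t. th * 0) q k\<bar> \<le> th * B * (T / 2 ^ q) + th * (T / 2 ^ q)"
        using elim by (intro elim(1)[rule_format]) auto
      then have "\<bar>w p q k\<bar> \<le> th * B * (T / 2 ^ q) + th * (T / 2 ^ q)" by (simp add: cell_integral_const T_pos)
      also have "\<dots> = th * (B + 1) * (T / 2 ^ q)" by (simp only: distrib_left distrib_right mult_1_right)
      finally show ?case by simp
    qed
  qed simp
  then have "\<forall>\<^sub>F p in sequentially. \<forall>k<2 ^ q. w p q k \<le> th * (B + 1) * (T / 2 ^ q)" for q
    by (rule eventually_mono) auto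
  then show ?thesis
    using th_pos B(1) bound_nonneg
    by (intro tight_monotone_of_dual_bound[OF T_pos mono(3) start(3) count _ eventually_dual_costs_le(3),
      where V = "th * (B + 1)"]) auto
qed

lemma ex_convergent_subseq:
  obtains r a s \<zeta> where "strict_mono (r :: nat \<Rightarrow> nat)" "uniform_limit {0..T} (\<lambda>i. A (r i)) a sequentially"
    "uniform_limit {0..T} (\<lambda>i. S (r i)) s sequentially" "uniform_limit {0..T} (\<lambda>i. Y (r i)) \<zeta> sequentially"
proof -
  obtain r1 a where r1: "strict_mono (r1 :: nat \<Rightarrow> nat)" "uniform_limit {0..T} (\<lambda>i. A (r1 i)) a sequentially"
    using tight_monotone.ex_uniformly_convergent_subseq[OF tight_arrivals] .
  obtain r2 s where r2: "strict_mono (r2 :: nat \<Rightarrow> nat)" "uniform_limit {0..T} (\<lambda>i. S (r1 (r2 i))) s sequentially"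
    using tight_monotone.ex_uniformly_convergent_subseq[OF tight_monotone.tight_subseq[OF tight_services r1(1)]] .
  have mono_r1_r2: "strict_mono (\<lambda>i. r1 (r2 i))" using r1(1) r2(1) by (auto simp: strict_mono_def)
  obtain r3 \<zeta> where r3: "strict_mono (r3 :: nat \<Rightarrow> nat)" "uniform_limit {0..T} (\<lambda>i. Y (r1 (r2 (r3 i)))) \<zeta> sequentially"
    using tight_monotone.ex_uniformly_convergent_subseq[OF tight_monotone.tight_subseq[OF tight_reneging mono_r1_r2]] .
  have mono_r2_r3: "strict_mono (\<lambda>i. r2 (r3 i))" using r2(1) r3(1) by (auto simp: strict_mono_def)
  show thesis
  proof (rule that)
    show "strict_mono (\<lambda>i. r1 (r2 (r3 i)))" using r1(1) mono_r2_r3 by (auto simp: strict_mono_def)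
    show "uniform_limit {0..T} (\<lambda>i. A (r1 (r2 (r3 i)))) a sequentially"
      by (rule filterlim_compose[OF r1(2) filterlim_subseq[OF mono_r2_r3]])
    show "uniform_limit {0..T} (\<lambda>i. S (r1 (r2 (r3 i)))) s sequentially"
      by (rule filterlim_compose[OF r2(2) filterlim_subseq[OF r3(1)]])
  qed (rule r3(2))
qed

lemma incr_tendsto:
  assumes "uniform_limit {0..T} F f sequentially" "k < 2 ^ q"
  shows "(\<lambda>i. incr T (F i) q k) \<longlonglongrightarrow> incr T f q k"
  unfolding incr_def using tgrid_cell[OF T_pos assms(2)]
  by (intro tendsto_diff tendsto_uniform_limitI[OF assms(1)])

lemma weight_tendsto:
  assumes r: "strict_mono r" and lim: "uniform_limit {0..T} (\<lambda>i. X (r i)) \<xi> sequentially"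
    and cont: "continuous_on {0..T} \<xi>" and k: "k < 2 ^ q"
  shows "(\<lambda>i. w (r i) q k) \<longlonglongrightarrow> cell_integral T (\<lambda>t. th * \<xi> t) q k"
proof (rule tendstoI)
  fix e :: real assume "0 < e"
  define d where "d = e / (4 * (th * (T / 2 ^ q)))"
  have d: "0 < d" "th * d * (T / 2 ^ q) = e / 4" using \<open>0 < e\<close> th_pos T_pos by (auto simp: d_def)
  have "\<forall>\<^sub>F i in sequentially. \<forall>t\<in>{0..T}. dist (X (r i) t) (\<xi> t) < d" by (rule uniform_limitD[OF lim d(1)])
  moreover have "\<forall>\<^sub>F i in sequentially. \<forall>g d. continuous_on {0..T} g \<longrightarrow> (\<forall>t\<in>{0..T}. \<bar>X (r i) t - g t\<bar> \<le> d) \<longrightarrow>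
      \<bar>w (r i) q k - cell_integral T (\<lambda>t. th * g t) q k\<bar> \<le> th * d * (T / 2 ^ q) + e / 4"
    using eventually_subseq[OF r weight[OF k, of "e / 4"]] \<open>0 < e\<close> by simp
  ultimately show "\<forall>\<^sub>F i in sequentially. dist (w (r i) q k) (cell_integral T (\<lambda>t. th * \<xi> t) q k) < e"
  proof eventually_elim
    case (elim i)
    have "\<bar>w (r i) q k - cell_integral T (\<lambda>t. th * \<xi> t) q k\<bar> \<le> th * d * (T / 2 ^ q) + e / 4"
      using elim(1) by (intro elim(2)[rule_format] cont) (auto simp: dist_real_def less_imp_le)
    then show ?case using \<open>0 < e\<close> unfolding d(2) dist_real_def by linarith
  qed
qed

lemma entropy_path_limit:
  assumes r: "strict_mono r" and lim: "uniform_limit {0..T} (\<lambda>i. A (r i)) a sequentially"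
      "uniform_limit {0..T} (\<lambda>i. S (r i)) s sequentially" "uniform_limit {0..T} (\<lambda>i. Y (r i)) \<zeta> sequentially"
    and lim_X: "uniform_limit {0..T} (\<lambda>i. X (r i)) (skorohod_map (net_input x0 a s \<zeta>)) sequentially"
  shows "entropy_path lam mu th T x0 c a s (skorohod_map (net_input x0 a s \<zeta>)) \<zeta>"
proof -
  let ?\<xi> = "skorohod_map (net_input x0 a s \<zeta>)"
  note a = tight_monotone.uniform_limit_properties[OF tight_monotone.tight_subseq[OF tight_arrivals r] lim(1)]
  note s = tight_monotone.uniform_limit_properties[OF tight_monotone.tight_subseq[OF tight_services r] lim(2)]
  note z = tight_monotone.uniform_limit_properties[OF tight_monotone.tight_subseq[OF tight_reneging r] lim(3)]
  have cont_\<xi>: "continuous_on {0..T} ?\<xi>"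
    unfolding net_input_def[abs_def] by (intro continuous_on_skorohod_map continuous_intros a s z)
  have "dual_cost T a (\<lambda>_. lam) q b1 + dual_cost T s (\<lambda>_. mu) q b2 + dual_cost T \<zeta> (\<lambda>t. th * ?\<xi> t) q b3 \<le> c"
      for q b1 b2 b3
  proof (rule field_le_epsilon)
    fix e :: real assume "0 < e"
    have "(\<lambda>i. (y (r i) q k - incr T (Y (r i)) q k) + incr T (Y (r i)) q k) \<longlonglongrightarrow> 0 + incr T \<zeta> q k" if "k < 2 ^ q" for k
      using LIMSEQ_subseq_LIMSEQ[OF count[OF that] r] by (intro tendsto_add incr_tendsto[OF lim(3) that])
        (simp add: comp_def)
    then have count_lim: "(\<lambda>i. y (r i) q k) \<longlonglongrightarrow> incr T \<zeta> q k" if "k < 2 ^ q" for k using that by simp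
    have "(\<lambda>i. dual_cost T (A (r i)) (\<lambda>_. lam) q b1 + dual_cost T (S (r i)) (\<lambda>_. mu) q b2
          + dual_sum q b3 (y (r i) q) (w (r i) q))
        \<longlonglongrightarrow> dual_cost T a (\<lambda>_. lam) q b1 + dual_cost T s (\<lambda>_. mu) q b2 + dual_cost T \<zeta> (\<lambda>t. th * ?\<xi> t) q b3"
      unfolding dual_cost_def
      by (intro tendsto_add tendsto_dual_sum incr_tendsto[OF lim(1)] incr_tendsto[OF lim(2)] count_lim
          weight_tendsto[OF r lim_X cont_\<xi>] tendsto_const)
    then show "dual_cost T a (\<lambda>_. lam) q b1 + dual_cost T s (\<lambda>_. mu) q b2 + dual_cost T \<zeta> (\<lambda>t. th * ?\<xi> t) q b3 \<le> c + e"
      using eventually_subseq[OF r joint_cost[OF \<open>0 < e\<close>, of q]]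
      by (intro tendsto_upperbound[of _ _ sequentially]) (auto elim: eventually_mono)
  qed
  then show ?thesis using a s z by unfold_locales auto
qed

theorem limit_has_control:
  obtains r \<xi> \<zeta> where "strict_mono (r :: nat \<Rightarrow> nat)" "has_control_within lam mu th x0 T \<xi> \<zeta> c"
    "uniform_limit {0..T} (\<lambda>i. X (r i)) \<xi> sequentially" "uniform_limit {0..T} (\<lambda>i. Y (r i)) \<zeta> sequentially"
proof -
  obtain r a s \<zeta> where r: "strict_mono (r :: nat \<Rightarrow> nat)" and lim: "uniform_limit {0..T} (\<lambda>i. A (r i)) a sequentially"
    "uniform_limit {0..T} (\<lambda>i. S (r i)) s sequentially" "uniform_limit {0..T} (\<lambda>i. Y (r i)) \<zeta> sequentially"
    using ex_convergent_subseq .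
  let ?\<psi> = "net_input x0 a s \<zeta>"
  have "uniform_limit {0..T} (\<lambda>i. net_input x0 (A (r i)) (S (r i)) (Y (r i))) ?\<psi> sequentially"
    unfolding net_input_def[abs_def] by (intro uniform_limit_intros lim)
  moreover have "continuous_on {0..T} ?\<psi>"
    unfolding net_input_def[abs_def]
    using tight_monotone.uniform_limit_properties(1)[OF tight_monotone.tight_subseq[OF tight_arrivals r] lim(1)]
      tight_monotone.uniform_limit_properties(1)[OF tight_monotone.tight_subseq[OF tight_services r] lim(2)]
      tight_monotone.uniform_limit_properties(1)[OF tight_monotone.tight_subseq[OF tight_reneging r] lim(3)]
    by (intro continuous_intros)
  ultimately have reflected: "uniform_limit {0..T}
      (\<lambda>i. skorohod_map (net_input x0 (A (r i)) (S (r i)) (Y (r i)))) (skorohod_map ?\<psi>) sequentially"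
    by (rule uniform_limit_skorohod_map)
  have lim_X: "uniform_limit {0..T} (\<lambda>i. X (r i)) (skorohod_map ?\<psi>) sequentially"
  proof (rule uniform_limitI)
    fix e :: real assume "0 < e"
    have "\<forall>\<^sub>F i in sequentially. \<forall>t\<in>{0..T}.
        dist (skorohod_map (net_input x0 (A (r i)) (S (r i)) (Y (r i))) t) (skorohod_map ?\<psi> t) < e / 2"
      using \<open>0 < e\<close> by (intro uniform_limitD[OF reflected]) simp
    moreover have "\<forall>\<^sub>F i in sequentially. \<forall>t\<in>{0..T}.
        \<bar>X (r i) t - skorohod_map (net_input x0 (A (r i)) (S (r i)) (Y (r i))) t\<bar> \<le> e / 2"
      using eventually_subseq[OF r reflection[of "e / 2"]] \<open>0 < e\<close> by simp
    ultimately show "\<forall>\<^sub>F i in sequentially. \<forall>t\<in>{0..T}. dist (X (r i) t) (skorohod_map ?\<psi> t) < e"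
    proof (eventually_elim, intro ballI)
      fix i t
      assume "\<forall>t\<in>{0..T}. dist (skorohod_map (net_input x0 (A (r i)) (S (r i)) (Y (r i))) t) (skorohod_map ?\<psi> t) < e / 2"
        "\<forall>t\<in>{0..T}. \<bar>X (r i) t - skorohod_map (net_input x0 (A (r i)) (S (r i)) (Y (r i))) t\<bar> \<le> e / 2" "t \<in> {0..T}"
      then have "dist (X (r i) t) (skorohod_map (net_input x0 (A (r i)) (S (r i)) (Y (r i))) t) \<le> e / 2"
        "dist (skorohod_map (net_input x0 (A (r i)) (S (r i)) (Y (r i))) t) (skorohod_map ?\<psi> t) < e / 2"
        by (auto simp: dist_real_def)
      then show "dist (X (r i) t) (skorohod_map ?\<psi> t) < e"
        using dist_triangle[of "X (r i) t" "skorohod_map ?\<psi> t"] by (smt (verit) field_sum_of_halves)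
    qed
  qed
  interpret limit: entropy_path lam mu th T x0 c a s "skorohod_map ?\<psi>" \<zeta>
    by (rule entropy_path_limit[OF r lim lim_X])
  show thesis by (rule that[OF r limit.has_control lim_X lim(3)])
qed

end

section \<open>Pathwise analysis of the queue\<close>

locale time_counts =
  fixes T :: real and n :: nat and \<nu> :: "real measure"
  assumes horizon_pos: "0 < T" and scale_pos: "0 < n"
    and sets_eq: "sets \<nu> = sets (restrict_space borel {0..T})"
    and total_finite: "emeasure \<nu> {0..T} < \<infinity>" and null_0: "emeasure \<nu> {0} = 0"
begin

definition cumulative :: "real set \<Rightarrow> real \<Rightarrow> real" where
  "cumulative B t = measure \<nu> ({0..t} \<inter> B) / n"

lemma space_eq: "space \<nu> = {0..T}"
  using sets_eq_imp_space_eq[OF sets_eq] by (simp add: space_restrict_space)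

lemma setsI: "B \<in> sets borel \<Longrightarrow> B \<subseteq> {0..T} \<Longrightarrow> B \<in> sets \<nu>"
  unfolding sets_eq by (subst sets_restrict_space_iff) auto

lemma finite_measure: "finite_measure \<nu>"
  using total_finite by (auto intro!: finite_measureI simp: space_eq)

lemma cumulative_diff:
  assumes B: "{0..T} \<inter> B \<in> sets borel" and ordered: "0 \<le> s" "s \<le> t" "t \<le> T"
  shows "cumulative B t - cumulative B s = measure \<nu> ({s<..t} \<inter> B) / n"
proof -
  interpret finite_measure \<nu> by (rule finite_measure)
  have sets: "{0..u} \<inter> B \<in> sets \<nu>" if "u \<le> T" for u
  proof (rule setsI)
    have "{0..u} \<inter> B = {0..u} \<inter> ({0..T} \<inter> B)" using that by auto
    then show "{0..u} \<inter> B \<in> sets borel" using B by simp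
  qed (use that in auto)
  have "measure \<nu> ({0..t} \<inter> B - {0..s} \<inter> B) = measure \<nu> ({0..t} \<inter> B) - measure \<nu> ({0..s} \<inter> B)"
    using ordered by (intro finite_measure_Diff sets) auto
  moreover have "{0..t} \<inter> B - {0..s} \<inter> B = {s<..t} \<inter> B" using ordered by auto
  ultimately show ?thesis by (simp add: cumulative_def diff_divide_distrib)
qed

lemma mono_cumulative:
  assumes "{0..T} \<inter> B \<in> sets borel"
  shows "mono_on {0..T} (cumulative B)"
proof (rule mono_onI)
  fix s t assume "s \<in> {0..T}" "t \<in> {0..T}" "s \<le> t"
  then have "cumulative B t - cumulative B s = measure \<nu> ({s<..t} \<inter> B) / n"
    by (intro cumulative_diff[OF assms]) auto
  also have "0 \<le> \<dots>" by simp
  finally show "cumulative B s \<le> cumulative B t" by simp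
qed

lemma cumulative_diff_le_UNIV:
  assumes B: "{0..T} \<inter> B \<in> sets borel" and ordered: "0 \<le> s" "s \<le> t" "t \<le> T"
  shows "cumulative B t - cumulative B s \<le> cumulative UNIV t - cumulative UNIV s"
proof -
  interpret finite_measure \<nu> by (rule finite_measure)
  have "measure \<nu> ({s<..t} \<inter> B) \<le> measure \<nu> ({s<..t} \<inter> UNIV)"
    using ordered by (intro finite_measure_mono) (auto intro!: setsI)
  then show ?thesis
    using cumulative_diff[OF B ordered] cumulative_diff[of UNIV, OF _ ordered] by (simp add: divide_right_mono)
qed

lemma cumulative_0: "cumulative B 0 = 0"
proof -
  have "emeasure \<nu> ({0..0} \<inter> B) \<le> emeasure \<nu> {0}"
    using horizon_pos by (intro emeasure_mono) (auto intro!: setsI)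
  then show ?thesis using null_0 by (simp add: cumulative_def measure_def)
qed

lemma mono_counts: "mono_on {0..T} (cumulative UNIV)"
  by (rule mono_cumulative) simp

lemma incr_cumulative: "k < 2 ^ q \<Longrightarrow> incr T (cumulative UNIV) q k = measure \<nu> (time_cell T q k) / n"
  unfolding incr_def time_cell_def using tgrid_cell[OF horizon_pos, of k q]
  by (subst cumulative_diff) auto

lemma dual_cost_le_relent:
  assumes "q \<le> p" "0 < v"
  shows "dual_cost T (cumulative UNIV) (\<lambda>_. v) q \<beta>
        \<le> (\<Sum>k<2 ^ p. relent (measure \<nu> (time_cell T p k) / n) (v * (T / 2 ^ p)))"
proof -
  obtain d where p: "p = q + d" using \<open>q \<le> p\<close> le_Suc_ex by blast
  have "dual_cost T (cumulative UNIV) (\<lambda>_. v) q \<beta> = dual_cost T (cumulative UNIV) (\<lambda>_. v) p (\<lambda>j. \<beta> (j div 2 ^ d))"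
    unfolding p by (simp add: dual_cost_refine[OF horizon_pos])
  also have "\<dots> \<le> (\<Sum>k<2 ^ p. relent (measure \<nu> (time_cell T p k) / n) (v * (T / 2 ^ p)))"
    unfolding dual_cost_def dual_sum_def cell_integral_const[OF horizon_pos]
  proof (intro sum_mono)
    fix k :: nat assume "k \<in> {..<2 ^ p}"
    then have k: "k < 2 ^ p" by simp
    show "\<beta> (k div 2 ^ d) * incr T (cumulative UNIV) p k - (exp (\<beta> (k div 2 ^ d)) - 1) * (v * (T / 2 ^ p))
        \<le> relent (measure \<nu> (time_cell T p k) / n) (v * (T / 2 ^ p))"
      unfolding incr_cumulative[OF k] using horizon_pos \<open>0 < v\<close> by (intro relent_ge_dual) auto
  qed
  finally show ?thesis .
qed

end

lemma left_limit_eq_borel: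
  assumes T: "0 < T" and limits: "\<And>t. t \<in> {0<..T} \<Longrightarrow> (f \<longlongrightarrow> left_limit f t) (at_left t)"
  obtains L where "L \<in> borel_measurable borel" "\<And>t. t \<in> {0..T} \<Longrightarrow> left_limit f t = L t"
proof -
  define l where "l q s = tgrid T q (cell_index T q s)" for q s
  define L where "L s = lim (\<lambda>q. f (l q s))" for s
  have [measurable]: "L \<in> borel_measurable borel"
    unfolding L_def l_def by (rule borel_measurable_lim_metric) measurable
  have "left_limit f s = L s" if s: "s \<in> {0<..T}" for s
  proof -
    have cell: "l q s < s" "s - T / 2 ^ q \<le> l q s" for q
      using mem_time_cell_index[OF T, of s q] s by (auto simp: l_def time_cell_def tgrid_Suc)
    have "(\<lambda>q. l q s) \<longlonglongrightarrow> s"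
    proof (rule real_tendsto_sandwich[of "\<lambda>q. s - T / 2 ^ q" _ _ "\<lambda>_. s"])
      show "(\<lambda>q. s - T / 2 ^ q) \<longlonglongrightarrow> s" using tendsto_diff[OF tendsto_const mesh_tendsto_0, of s T] by simp
    qed (use cell in \<open>auto simp: less_imp_le\<close>)
    moreover have "\<forall>\<^sub>F q in sequentially. l q s \<in> {..<s} \<and> l q s \<noteq> s"
      using cell(1) by (intro always_eventually allI) (metis lessThan_iff less_irrefl)
    ultimately have "filterlim (\<lambda>q. l q s) (at_left s) sequentially" by (simp add: filterlim_at)
    then have "(\<lambda>q. f (l q s)) \<longlonglongrightarrow> left_limit f s" by (rule filterlim_compose[OF limits[OF s]])
    then show ?thesis unfolding L_def by (simp add: limI)
  qed
  then have "left_limit f t = (if t \<le> 0 then f 0 else L t)" if "t \<in> {0..T}" for t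
    using that by (auto simp: left_limit_def)
  moreover have "(\<lambda>t. if t \<le> 0 then f 0 else L t) \<in> borel_measurable borel" by measurable
  ultimately show thesis using that by blast
qed

lemma Times_borel: "A \<in> sets borel \<Longrightarrow> B \<in> sets borel \<Longrightarrow> A \<times> B \<in> sets (borel :: (real \<times> real) measure)"
  unfolding borel_prod[symmetric] by (rule pair_measureI)

locale queue_path = arrivals: time_counts T n \<nu>1 + services: time_counts T n \<nu>2
  for T :: real and n :: nat and \<nu>1 \<nu>2 :: "real measure" +
  fixes xn :: real and \<nu>3 :: "(real \<times> real) measure" and f g :: "real \<Rightarrow> real"
  assumes initial_nonneg: "0 \<le> xn" and equations: "mm1m_equations T n xn \<nu>1 \<nu>2 \<nu>3 f g"
    and sets_reneging: "sets \<nu>3 = sets (restrict_space borel ({0..T} \<times> {0..}))"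
    and null_axis: "emeasure \<nu>3 ({0} \<times> {0..}) = 0"
    and cadlag: "path_pair T f g \<in> cadlag_space T ({0..} \<times> {0..})"
begin

lemmas horizon_pos = arrivals.horizon_pos
lemmas scale_pos = arrivals.scale_pos

abbreviation arr :: "real \<Rightarrow> real" where "arr \<equiv> arrivals.cumulative UNIV"
abbreviation srv :: "real \<Rightarrow> real" where "srv \<equiv> services.cumulative UNIV"
abbreviation idle :: "real \<Rightarrow> real" where "idle \<equiv> services.cumulative {s. left_limit f s = 0}"

definition level :: "real \<Rightarrow> real" where
  "level s = max 0 (left_limit f s - 1 / n)"

definition region :: "real set \<Rightarrow> (real \<times> real) set" where
  "region A = {(s, y). s \<in> A \<and> 0 \<le> y \<and> y \<le> level s}"

lemma space_reneging: "space \<nu>3 = {0..T} \<times> {0..}"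
  using sets_eq_imp_space_eq[OF sets_reneging] by (simp add: space_restrict_space)

lemma sets_renegingI: "B \<in> sets borel \<Longrightarrow> B \<subseteq> {0..T} \<times> {0..} \<Longrightarrow> B \<in> sets \<nu>3"
  unfolding sets_reneging by (subst sets_restrict_space_iff) (auto intro: borel_closed closed_Times)

lemma path_nonneg:
  assumes "t \<in> {0..T}"
  shows "0 \<le> f t" "0 \<le> g t"
proof -
  have "path_pair T f g \<in> {0..T} \<rightarrow>\<^sub>E {0..} \<times> {0..}" using cadlag by (simp add: cadlag_space_def)
  from PiE_mem[OF this assms] have "path_pair T f g t \<in> {0..} \<times> {0..}" .
  then show "0 \<le> f t" "0 \<le> g t" using assms by (auto simp: path_pair_def)
qed

lemma queue_right_continuous:
  assumes t: "t \<in> {0..<T}"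
  shows "(f \<longlongrightarrow> f t) (at_right t)"
proof -
  have "(path_pair T f g \<longlongrightarrow> path_pair T f g t) (at_right t)" using cadlag t by (auto simp: cadlag_space_def)
  then have "((\<lambda>s. fst (path_pair T f g s)) \<longlongrightarrow> fst (path_pair T f g t)) (at_right t)" by (rule tendsto_fst)
  moreover have "\<forall>\<^sub>F s in at_right t. fst (path_pair T f g s) = f s"
    using t unfolding eventually_at_right_field by (intro exI[of _ T]) (auto simp: path_pair_def)
  ultimately show ?thesis using t by (auto simp: path_pair_def dest: tendsto_cong[THEN iffD1, rotated])
qed

lemma queue_tendsto_left_limit:
  assumes t: "t \<in> {0<..T}"
  shows "(f \<longlongrightarrow> left_limit f t) (at_left t)"
proof -
  obtain l where "(path_pair T f g \<longlongrightarrow> l) (at_left t)" using cadlag t unfolding cadlag_space_def by blast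
  then have "((\<lambda>s. fst (path_pair T f g s)) \<longlongrightarrow> fst l) (at_left t)" by (rule tendsto_fst)
  moreover have "\<forall>\<^sub>F s in at_left t. fst (path_pair T f g s) = f s"
    using t unfolding eventually_at_left_field by (intro exI[of _ 0]) (auto simp: path_pair_def)
  ultimately have lim: "(f \<longlongrightarrow> fst l) (at_left t)" by (auto dest: tendsto_cong[THEN iffD1, rotated])
  then have "left_limit f t = fst l" using t unfolding left_limit_def by (auto intro: tendsto_Lim)
  then show ?thesis using lim by simp
qed

lemma left_limit_bounds:
  assumes t: "t \<in> {0<..T}" and "u < t"
    and bounds: "\<And>s. s \<in> {0..T} \<Longrightarrow> u < s \<Longrightarrow> s < t \<Longrightarrow> l \<le> f s \<and> f s \<le> h"
  shows "left_limit f t \<in> {l..h}"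
proof -
  have "\<forall>\<^sub>F s in at_left t. f s \<in> {l..h}"
    using t \<open>u < t\<close> bounds unfolding eventually_at_left_field by (intro exI[of _ "max u 0"]) auto
  then show ?thesis by (intro Lim_in_closed_set[OF _ _ _ queue_tendsto_left_limit[OF t]]) auto
qed

lemma sets_times_empty: "{0..T} \<inter> {s. left_limit f s = 0} \<in> sets borel"
proof -
  obtain L where [measurable]: "L \<in> borel_measurable borel" and L: "\<And>s. s \<in> {0..T} \<Longrightarrow> left_limit f s = L s"
    using left_limit_eq_borel[OF horizon_pos queue_tendsto_left_limit] by blast
  have "{s \<in> space borel. s \<in> {0..T} \<and> L s = 0} \<in> sets borel" by measurable
  also have "{s \<in> space borel. s \<in> {0..T} \<and> L s = 0} = {0..T} \<inter> {s. left_limit f s = 0}" using L by auto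
  finally show ?thesis .
qed

lemma sets_region:
  assumes A: "A \<in> sets borel" "A \<subseteq> {0..T}"
  shows "region A \<in> sets \<nu>3"
proof (rule sets_renegingI)
  obtain L where [measurable]: "L \<in> borel_measurable borel" and L: "\<And>s. s \<in> {0..T} \<Longrightarrow> left_limit f s = L s"
    using left_limit_eq_borel[OF horizon_pos queue_tendsto_left_limit] by blast
  note [measurable] = A(1)
  have "{z \<in> space (borel \<Otimes>\<^sub>M borel). fst z \<in> A \<and> 0 \<le> snd z \<and> snd z \<le> max 0 (L (fst z) - 1 / n)} \<in> sets (borel \<Otimes>\<^sub>M borel)"
    by measurable
  also have "{z \<in> space (borel \<Otimes>\<^sub>M borel). fst z \<in> A \<and> 0 \<le> snd z \<and> snd z \<le> max 0 (L (fst z) - 1 / n)} = region A"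
    using L A(2) by (force simp: region_def level_def space_pair_measure)
  finally show "region A \<in> sets borel" unfolding borel_prod .
qed (use A in \<open>auto simp: region_def\<close>)

lemma reneging_eq:
  assumes t: "t \<in> {0..T}"
  shows "g t = measure \<nu>3 (region {0..t}) / n"
proof -
  have "g t = 1 / real n * (LINT z:{0..t} \<times> {0..}|\<nu>3. indicator {0..level (fst z)} (snd z))"
    using equations t by (simp add: mm1m_equations_def level_def)
  also have "(LINT z:{0..t} \<times> {0..}|\<nu>3. indicator {0..level (fst z)} (snd z))
        = (LINT z|\<nu>3. indicator (region {0..t}) z)"
    unfolding set_lebesgue_integral_def
    by (intro Bochner_Integration.integral_cong refl) (auto simp: region_def indicator_def)
  also have "\<dots> = measure \<nu>3 (region {0..t} \<inter> space \<nu>3)" by simp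
  also have "region {0..t} \<inter> space \<nu>3 = region {0..t}" using t by (auto simp: region_def space_reneging)
  finally show ?thesis by simp
qed

definition reneging_in :: "(real \<times> real) set \<Rightarrow> real \<Rightarrow> real" where
  "reneging_in R t = measure \<nu>3 (R \<inter> {0..t} \<times> UNIV) / n"

lemma sets_reneging_slice:
  assumes R: "R \<in> sets \<nu>3" and B: "B \<in> sets borel"
  shows "R \<inter> B \<times> UNIV \<in> sets \<nu>3"
proof -
  have "({0..T} \<inter> B) \<times> {0..} \<in> sets \<nu>3"
    using B by (intro sets_renegingI Times_borel) auto
  moreover have "R \<inter> B \<times> UNIV = R \<inter> ({0..T} \<inter> B) \<times> {0..}"
    using sets.sets_into_space[OF R] by (auto simp: space_reneging)
  ultimately show ?thesis using R by simp
qed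

lemma reneging_in_diff:
  assumes R: "R \<in> fmeasurable \<nu>3" and "0 \<le> s" "s \<le> t"
  shows "reneging_in R t - reneging_in R s = measure \<nu>3 (R \<inter> {s<..t} \<times> UNIV) / n"
proof -
  have slice: "R \<inter> B \<times> UNIV \<in> fmeasurable \<nu>3" if "B \<in> sets borel" for B
    using sets_reneging_slice[OF fmeasurableD[OF R] that] by (rule fmeasurableI2[OF R Int_lower1])
  have "R \<inter> {0..t} \<times> UNIV = (R \<inter> {0..s} \<times> UNIV) \<union> (R \<inter> {s<..t} \<times> UNIV)"
    "(R \<inter> {s<..t} \<times> UNIV) - (R \<inter> {0..s} \<times> UNIV) = R \<inter> {s<..t} \<times> UNIV"
    using assms by auto
  then have "measure \<nu>3 (R \<inter> {0..t} \<times> UNIV) = measure \<nu>3 (R \<inter> {0..s} \<times> UNIV) + measure \<nu>3 (R \<inter> {s<..t} \<times> UNIV)"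
    using measure_Un2[OF slice[of "{0..s}"] slice[of "{s<..t}"]] by simp
  then show ?thesis by (simp add: reneging_in_def add_divide_distrib)
qed

lemma mono_reneging_in:
  assumes "R \<in> fmeasurable \<nu>3"
  shows "mono_on {0..T} (reneging_in R)"
proof (rule mono_onI)
  fix s t assume "s \<in> {0..T}" "t \<in> {0..T}" "s \<le> t"
  then have "reneging_in R t - reneging_in R s = measure \<nu>3 (R \<inter> {s<..t} \<times> UNIV) / n"
    by (intro reneging_in_diff[OF assms]) auto
  also have "0 \<le> \<dots>" by simp
  finally show "reneging_in R s \<le> reneging_in R t" by simp
qed

lemma incr_reneging_in:
  assumes "R \<in> fmeasurable \<nu>3" "k < 2 ^ p"
  shows "incr T (reneging_in R) p k = measure \<nu>3 (R \<inter> time_cell T p k \<times> UNIV) / n"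
  unfolding incr_def time_cell_def using tgrid_cell[OF horizon_pos assms(2)]
    by (intro reneging_in_diff[OF assms(1)]) auto

lemma reneging_eq_in_region:
  assumes t: "t \<in> {0..T}"
  shows "g t = reneging_in (region {0..T}) t"
proof -
  have "region {0..T} \<inter> {0..t} \<times> UNIV = region {0..t}" using t by (auto simp: region_def)
  then show ?thesis using reneging_eq[OF t] by (simp add: reneging_in_def)
qed

lemma measure_busy_services:
  assumes t: "t \<in> {0..T}"
  shows "(LINT s:{0..t}|\<nu>2. indicator {s. left_limit f s \<noteq> 0} s) / n = srv t - idle t"
proof -
  interpret finite_measure \<nu>2 by (rule services.finite_measure)
  let ?Z = "{s. left_limit f s = 0}"
  have "(LINT s:{0..t}|\<nu>2. indicator {s. left_limit f s \<noteq> 0} s) = (LINT s|\<nu>2. indicator ({0..t} - {0..t} \<inter> ?Z) s)"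
    unfolding set_lebesgue_integral_def
    by (intro Bochner_Integration.integral_cong refl) (auto simp: indicator_def)
  also have "\<dots> = measure \<nu>2 ({0..t} - {0..t} \<inter> ?Z)"
    using t by (simp add: services.space_eq Int_absorb2 subset_iff)
  also have "\<dots> = measure \<nu>2 {0..t} - measure \<nu>2 ({0..t} \<inter> ?Z)"
  proof (rule finite_measure_Diff)
    have "{0..t} \<inter> ?Z = {0..t} \<inter> ({0..T} \<inter> ?Z)" using t by auto
    then show "{0..t} \<inter> ?Z \<in> sets \<nu>2" using t sets_times_empty by (intro services.setsI) auto
  qed (use t in \<open>auto intro!: services.setsI\<close>)
  finally show ?thesis by (simp add: services.cumulative_def diff_divide_distrib)
qed

lemma queue_eq_net_input:
  assumes t: "t \<in> {0..T}"
  shows "f t = net_input xn arr srv g t + idle t"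
proof -
  have "{0..t} \<inter> space \<nu>1 = {0..t}" using t by (auto simp: arrivals.space_eq)
  then have "(LINT s:{0..t}|\<nu>1. 1) = measure \<nu>1 {0..t}" by (simp add: set_lebesgue_integral_def)
  then show ?thesis
    using equations t measure_busy_services[OF t]
    by (simp add: mm1m_equations_def net_input_def arrivals.cumulative_def)
qed

lemma reneging_0: "g 0 = 0"
proof -
  have "emeasure \<nu>3 (region {0..0}) \<le> emeasure \<nu>3 ({0} \<times> {0..})"
    using horizon_pos by (intro emeasure_mono) (auto simp: region_def intro!: sets_renegingI borel_closed closed_Times)
  then show ?thesis using null_axis reneging_eq[of 0] horizon_pos by (simp add: measure_def)
qed

lemmas idle_diff = services.cumulative_diff[OF sets_times_empty]
lemmas mono_idle = services.mono_cumulative[OF sets_times_empty]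
lemmas idle_diff_le = services.cumulative_diff_le_UNIV[OF sets_times_empty]

lemma queue_le_arrivals: "t \<in> {0..T} \<Longrightarrow> f t \<le> xn + arr t"
  using idle_diff_le[of 0 t] queue_eq_net_input[of t] path_nonneg[of t]
  by (simp add: net_input_def services.cumulative_0)

lemma oscillation_le:
  assumes ordered: "s \<in> {0..T}" "t \<in> {0..T}" "s \<le> t" and "g s \<le> g t"
  shows "\<bar>f t - f s\<bar> \<le> (arr t - arr s) + (srv t - srv s) + (g t - g s)"
proof -
  have "idle t - idle s \<le> srv t - srv s" using ordered by (intro idle_diff_le) auto
  moreover have "idle s \<le> idle t" "arr s \<le> arr t"
    using ordered by (auto intro: mono_onD[OF mono_idle] mono_onD[OF arrivals.mono_counts])
  ultimately show ?thesis
    using queue_eq_net_input[OF ordered(1)] queue_eq_net_input[OF ordered(2)] \<open>g s \<le> g t\<close>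
    unfolding net_input_def by linarith
qed

lemma idle_eq_if_busy:
  assumes "0 \<le> s" "s \<le> t" "t \<le> T" and busy: "\<And>u. u \<in> {s<..t} \<Longrightarrow> left_limit f u \<noteq> 0"
  shows "idle t = idle s"
proof -
  have "{s<..t} \<inter> {u. left_limit f u = 0} = {}" using busy by auto
  then show ?thesis using idle_diff[OF assms(1-3)] by simp
qed

lemma nearly_empty_before:
  assumes r: "r \<in> {0..T}" "left_limit f r = 0" and "0 < e" "0 < h"
  obtains u where "u \<in> {0..r}" "r - u < h" "f u < e"
proof (cases "r = 0")
  case True
  then show thesis using that[of 0] assms by (simp add: left_limit_def)
next
  case False
  then have "r \<in> {0<..T}" using r(1) by auto
  from queue_tendsto_left_limit[OF this] have "\<forall>\<^sub>F u in at_left r. f u < e"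
    using r(2) \<open>0 < e\<close> by (intro order_tendstoD(2)) auto
  then obtain b where b: "b < r" "\<And>u. b < u \<Longrightarrow> u < r \<Longrightarrow> f u < e"
    unfolding eventually_at_left_field by blast
  obtain u where "max (max b 0) (r - h) < u" "u < r"
    using dense[of "max (max b 0) (r - h)" r] b(1) \<open>r \<in> {0<..T}\<close> \<open>0 < h\<close> by auto
  then show thesis using b(2) by (intro that[of u]) auto
qed

lemma last_idle_time:
  assumes "0 < d" and small: "\<And>s t. s \<in> {0..T} \<Longrightarrow> t \<in> {0..T} \<Longrightarrow> s \<le> t \<Longrightarrow> t - s < d \<Longrightarrow> srv t - srv s \<le> \<delta>"
    and t: "t \<in> {0..T}" and ex: "\<exists>r\<in>{0..t}. left_limit f r = 0"
  obtains r where "r \<in> {0..t}" "left_limit f r = 0" "\<And>u. u \<in> {0..r} \<Longrightarrow> r - u < d / 2 \<Longrightarrow> idle t \<le> idle u + \<delta>"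
proof -
  define Z where "Z = {r \<in> {0..t}. left_limit f r = 0}"
  define \<tau> where "\<tau> = Sup Z"
  have Z: "Z \<noteq> {}" "bdd_above Z" "Z \<subseteq> {0..t}" using ex by (auto simp: Z_def intro!: bdd_aboveI[of _ t])
  have upper: "r \<le> \<tau>" if "r \<in> Z" for r unfolding \<tau>_def using that Z(2) by (rule cSup_upper)
  have "\<tau> \<le> t" unfolding \<tau>_def using Z by (intro cSup_least) auto
  obtain r where r: "r \<in> Z" "\<tau> - d / 2 < r" using less_cSupD[OF Z(1), of "\<tau> - d / 2"] \<open>0 < d\<close> by (auto simp: \<tau>_def)
  have \<tau>: "\<tau> \<in> {0..t}" using upper[OF r(1)] r(1) Z(3) \<open>\<tau> \<le> t\<close> by auto
  have "idle t \<le> idle u + \<delta>" if u: "u \<in> {0..r}" "r - u < d / 2" for u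
  proof -
    have "left_limit f v \<noteq> 0" if "v \<in> {\<tau><..t}" for v using upper[of v] that \<tau> by (auto simp: Z_def)
    then have "idle t = idle \<tau>" using \<tau> t by (intro idle_eq_if_busy) auto
    also have "\<dots> - idle u \<le> srv \<tau> - srv u" using u \<tau> t upper[OF r(1)] by (intro idle_diff_le) auto
    also have "\<dots> \<le> \<delta>" using u r \<tau> t upper[OF r(1)] by (intro small) auto
    finally show ?thesis by simp
  qed
  then show thesis using r(1) by (intro that[of r]) (auto simp: Z_def)
qed

text \<open>Customers are served at rate \<open>0\<close> only when the queue is empty, so the idle time is, up to one jump, the
  running minimum that defines the Skorohod map.\<close>

lemma reflection:
  assumes "0 < d" and small: "\<And>s t. s \<in> {0..T} \<Longrightarrow> t \<in> {0..T} \<Longrightarrow> s \<le> t \<Longrightarrow> t - s < d \<Longrightarrow> srv t - srv s \<le> \<delta>"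
    and t: "t \<in> {0..T}"
  shows "\<bar>f t - skorohod_map (net_input xn arr srv g) t\<bar> \<le> \<delta>"
proof -
  let ?\<psi> = "net_input xn arr srv g"
  define m where "m = - (INF r\<in>{0..t}. min (?\<psi> r) 0)"
  have "0 \<le> \<delta>" using small[of t t] t \<open>0 < d\<close> by simp
  have "0 \<le> idle t" using mono_onD[OF mono_idle, of 0 t] t services.cumulative_0 by auto
  have lower: "- idle t \<le> ?\<psi> r" if "r \<in> {0..t}" for r
    using that t queue_eq_net_input[of r] path_nonneg(1)[of r] mono_onD[OF mono_idle, of r t] by auto
  have m_upper: "- min (?\<psi> r) 0 \<le> m" if "r \<in> {0..t}" for r
  proof -
    have "(INF r\<in>{0..t}. min (?\<psi> r) 0) \<le> min (?\<psi> r) 0"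
      using that lower by (intro cINF_lower bdd_below_min_0[of _ "- idle t"])
    then show ?thesis by (simp add: m_def)
  qed
  then have "0 \<le> m" using t by (force simp: min_def split: if_splits)
  have "m \<le> idle t"
    unfolding m_def using t lower \<open>0 \<le> idle t\<close> by (subst minus_le_iff, intro cINF_greatest) auto
  moreover have "idle t \<le> m + \<delta>"
  proof (cases "\<exists>r\<in>{0..t}. left_limit f r = 0")
    case False
    then have "idle t = idle 0" using t by (intro idle_eq_if_busy) auto
    then show ?thesis using services.cumulative_0 \<open>0 \<le> m\<close> \<open>0 \<le> \<delta>\<close> by simp
  next
    case True
    obtain r where r: "r \<in> {0..t}" "left_limit f r = 0" "\<And>u. u \<in> {0..r} \<Longrightarrow> r - u < d / 2 \<Longrightarrow> idle t \<le> idle u + \<delta>"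
      using last_idle_time[OF \<open>0 < d\<close> small t True] by blast
    show ?thesis
    proof (rule field_le_epsilon)
      fix e :: real assume "0 < e"
      obtain u where u: "u \<in> {0..r}" "r - u < d / 2" "f u < e"
        using nearly_empty_before[OF _ r(2) \<open>0 < e\<close>, of "d / 2"] r(1) t \<open>0 < d\<close> by auto
      have "idle u < m + e" using u r(1) t queue_eq_net_input[of u] m_upper[of u] by auto
      then show "idle t \<le> m + \<delta> + e" using r(3)[OF u(1,2)] by simp
    qed
  qed
  moreover have "f t - skorohod_map ?\<psi> t = idle t - m"
    using queue_eq_net_input[OF t] by (simp add: skorohod_map_def m_def)
  ultimately show ?thesis by simp
qed

end

section \<open>Paths and the rate function\<close>

lemma path_pair_cadlag:
  assumes cont: "continuous_on {0..T} \<xi>" "continuous_on {0..T} \<zeta>"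
    and nonneg: "\<And>t. t \<in> {0..T} \<Longrightarrow> 0 \<le> \<xi> t" "\<And>t. t \<in> {0..T} \<Longrightarrow> 0 \<le> \<zeta> t"
  shows "path_pair T \<xi> \<zeta> \<in> cadlag_space T ({0..} \<times> {0..})"
proof -
  let ?z = "path_pair T \<xi> \<zeta>"
  have "continuous_on {0..T} (\<lambda>t. (\<xi> t, \<zeta> t))" by (intro continuous_on_Pair cont)
  then have cont_pair: "continuous_on {0..T} ?z" by (rule continuous_on_eq) (simp add: path_pair_def)
  show ?thesis
    unfolding cadlag_space_def
  proof (intro CollectI conjI ballI)
    show "?z \<in> {0..T} \<rightarrow>\<^sub>E {0..} \<times> {0..}" using nonneg by (auto simp: path_pair_def)
    fix t assume t: "t \<in> {0..<T}"
    then have "(?z \<longlongrightarrow> ?z t) (at t within {0..T})" using cont_pair by (auto simp: continuous_on_def)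
    then have "(?z \<longlongrightarrow> ?z t) (at t within {t..T})" by (rule tendsto_within_subset) (use t in auto)
    then show "(?z \<longlongrightarrow> ?z t) (at_right t)" using t by (simp add: at_within_Icc_at_right)
  next
    fix t assume t: "t \<in> {0<..T}"
    then have "(?z \<longlongrightarrow> ?z t) (at t within {0..T})" using cont_pair by (auto simp: continuous_on_def)
    then have "(?z \<longlongrightarrow> ?z t) (at t within {0..t})" by (rule tendsto_within_subset) (use t in auto)
    then have "(?z \<longlongrightarrow> ?z t) (at_left t)" using t by (simp add: at_within_Icc_at_left)
    moreover have "?z t \<in> {0..} \<times> {0..}" using nonneg[of t] t by (auto simp: path_pair_def)
    ultimately show "\<exists>l\<in>{0..} \<times> {0..}. (?z \<longlongrightarrow> l) (at_left t)" by (rule bexI)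
  qed
qed

lemma skorohod_dist_le:
  assumes "0 \<le> e" "\<And>t. t \<in> {0..T} \<Longrightarrow> dist (f t) (g t) \<le> e"
  shows "skorohod_dist T f g \<le> e"
  unfolding skorohod_dist_def
proof (rule enn2real_leI)
  show "skorohod_edist T f g \<le> ennreal e"
    using assms by (intro skorohod_edist_leI[OF id_time_change]) auto
qed (use assms in auto)

lemma skorohod_dist_le_components:
  fixes z :: "real \<Rightarrow> real \<times> real"
  assumes "0 \<le> d" "0 \<le> e" and close: "\<And>t. t \<in> {0..T} \<Longrightarrow> \<bar>fst (z t) - \<xi> t\<bar> \<le> d" "\<And>t. t \<in> {0..T} \<Longrightarrow> \<bar>snd (z t) - \<zeta> t\<bar> \<le> e"
  shows "skorohod_dist T z (path_pair T \<xi> \<zeta>) \<le> d + e"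
proof (rule skorohod_dist_le)
  fix t assume t: "t \<in> {0..T}"
  have "dist (z t) (\<xi> t, \<zeta> t) \<le> \<bar>fst (z t) - \<xi> t\<bar> + \<bar>snd (z t) - \<zeta> t\<bar>"
    using sqrt_sum_squares_le_sum_abs[of "dist (fst (z t)) (\<xi> t)" "dist (snd (z t)) (\<zeta> t)"]
    by (cases "z t") (simp add: dist_Pair_Pair dist_real_def)
  then show "dist (z t) (path_pair T \<xi> \<zeta> t) \<le> d + e" using close[OF t] t by (simp add: path_pair_def)
qed (use assms in simp)

lemma topspace_skorohod: "0 \<le> T \<Longrightarrow> topspace (skorohod_topology T S) = cadlag_space T S"
  unfolding skorohod_topology_def by (rule Metric_space.topspace_mtopology[OF Metric_space_skorohod])

lemma limitin_skorohod_of_uniform_limit: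
  fixes Z :: "nat \<Rightarrow> real \<Rightarrow> real \<times> real"
  assumes T: "0 \<le> T" and Z: "\<And>i. Z i \<in> cadlag_space T S" and limit: "path_pair T \<xi> \<zeta> \<in> cadlag_space T S"
    and lim: "uniform_limit {0..T} (\<lambda>i t. fst (Z i t)) \<xi> sequentially"
        "uniform_limit {0..T} (\<lambda>i t. snd (Z i t)) \<zeta> sequentially"
  shows "limitin (skorohod_topology T S) Z (path_pair T \<xi> \<zeta>) sequentially"
proof -
  interpret Metric_space "cadlag_space T S" "skorohod_dist T" by (rule Metric_space_skorohod[OF T])
  have "\<forall>\<^sub>F i in sequentially. skorohod_dist T (Z i) (path_pair T \<xi> \<zeta>) < e" if "0 < e" for e
  proof -
    have "\<forall>\<^sub>F i in sequentially. \<forall>t\<in>{0..T}. dist (fst (Z i t)) (\<xi> t) < e / 3"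
      "\<forall>\<^sub>F i in sequentially. \<forall>t\<in>{0..T}. dist (snd (Z i t)) (\<zeta> t) < e / 3"
      using that by (intro uniform_limitD[OF lim(1)] uniform_limitD[OF lim(2)]; simp)+
    then show ?thesis
    proof eventually_elim
      case (elim i)
      then have "skorohod_dist T (Z i) (path_pair T \<xi> \<zeta>) \<le> e / 3 + e / 3"
        using that by (intro skorohod_dist_le_components) (auto simp: dist_real_def less_imp_le)
      then show ?case using that by simp
    qed
  qed
  then show ?thesis
    unfolding skorohod_topology_def limitin_metric using Z limit by simp
qed

context entropy_path
begin

lemma path_cadlag: "path_pair T \<xi> \<zeta> \<in> cadlag_space T ({0..} \<times> {0..})"
  by (rule path_pair_cadlag[OF cont_\<xi> cont_\<zeta> \<xi>_nonneg \<zeta>_nonneg])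

lemma entropy_path_cong:
  assumes \<xi>': "\<And>t. t \<in> {0..T} \<Longrightarrow> \<xi>' t = \<xi> t" and \<zeta>': "\<And>t. t \<in> {0..T} \<Longrightarrow> \<zeta>' t = \<zeta> t"
  shows "entropy_path lam mu th T x0 c a s \<xi>' \<zeta>'"
proof unfold_locales
  show "mono_on {0..T} \<zeta>'" using mono_\<zeta> by (simp add: mono_on_def \<zeta>')
  show "continuous_on {0..T} \<zeta>'" using cont_\<zeta> by (rule continuous_on_eq) (simp add: \<zeta>')
  show "\<xi>' t = skorohod_map (net_input x0 a s \<zeta>') t" if t: "t \<in> {0..T}" for t
    unfolding \<xi>'[OF t] reflected[OF t] using t by (intro skorohod_map_cong) (auto simp: net_input_def \<zeta>')
  fix q b1 b2 b3
  have "dual_cost T \<zeta>' (\<lambda>t. th * \<xi>' t) q b3 = dual_cost T \<zeta> (\<lambda>t. th * \<xi> t) q b3"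
    unfolding dual_cost_def
  proof (rule dual_sum_cong)
    fix k :: nat assume "k < 2 ^ q"
    note cell = tgrid_cell[OF T_pos this]
    show "incr T \<zeta>' q k = incr T \<zeta> q k" using cell by (simp add: incr_def \<zeta>')
    show "cell_integral T (\<lambda>t. th * \<xi>' t) q k = cell_integral T (\<lambda>t. th * \<xi> t) q k"
      unfolding cell_integral_def
      using cell by (intro Henstock_Kurzweil_Integration.integral_cong) (simp add: \<xi>')
  qed
  then show "dual_cost T a (\<lambda>_. lam) q b1 + dual_cost T s (\<lambda>_. mu) q b2 + dual_cost T \<zeta>' (\<lambda>t. th * \<xi>' t) q b3 \<le> c"
    using joint_cost by simp
qed (use T_pos mono_a mono_s cont_a cont_s start \<zeta>' in auto)

lemma mm1m_rate_path_pair_le: "mm1m_rate lam mu th x0 T (path_pair T \<xi> \<zeta>) \<le> ennreal c"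
proof -
  let ?z = "path_pair T \<xi> \<zeta>"
  interpret pair: entropy_path lam mu th T x0 c a s "\<lambda>t. fst (?z t)" "\<lambda>t. snd (?z t)"
    by (rule entropy_path_cong) (auto simp: path_pair_def)
  have "continuous_on {0..T} ?z" using continuous_on_Pair[OF pair.cont_\<xi> pair.cont_\<zeta>] by simp
  then show ?thesis
    using pair.has_control by (auto simp: mm1m_rate_def has_control_within_def Let_def intro: INF_lower2)
qed

end

lemma mm1m_rate_leD:
  assumes rate: "mm1m_rate lam mu th x0 T z \<le> ennreal c" and "0 \<le> c" "0 < e"
  shows "has_control_within lam mu th x0 T (\<lambda>t. fst (z t)) (\<lambda>t. snd (z t)) (c + e)"
proof -
  have "ennreal c < ennreal (c + e)" using assms by (simp add: ennreal_less_iff)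
  then have "(INF \<phi>\<in>controls lam mu th x0 T (\<lambda>t. fst (z t)) (\<lambda>t. snd (z t)).
      control_cost lam mu th T (\<lambda>t. fst (z t)) \<phi>) < ennreal (c + e)"
    using rate by (auto simp: mm1m_rate_def Let_def top_unique split: if_splits)
  then show ?thesis unfolding INF_less_iff has_control_within_def by (auto intro: less_imp_le)
qed

lemma cadlag_space_ext:
  assumes "z \<in> cadlag_space T S" "\<And>t. t \<in> {0..T} \<Longrightarrow> z t = (\<xi> t, \<zeta> t)"
  shows "z = path_pair T \<xi> \<zeta>"
  using assms by (intro extensionalityI[of _ "{0..T}"]) (auto simp: cadlag_space_def path_pair_def PiE_def)

context queue_rates
begin

lemma entropy_bounded_of_entropy_paths:
  assumes "0 \<le> x0" "0 \<le> c" and paths: "\<And>p. entropy_path lam mu th T x0 (c + d p) (A p) (S p) (X p) (Y p)" and "d \<longlonglongrightarrow> 0"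
  shows "entropy_bounded lam mu th T x0 c A S Y X (\<lambda>p. incr T (Y p)) (\<lambda>p. cell_integral T (\<lambda>t. th * X p t))"
proof unfold_locales
  show "\<forall>\<^sub>F p in sequentially. \<forall>b1 b2 b3. dual_cost T (A p) (\<lambda>_. lam) q b1 + dual_cost T (S p) (\<lambda>_. mu) q b2
      + dual_sum q b3 (incr T (Y p) q) (cell_integral T (\<lambda>t. th * X p t) q) \<le> c + e" if "0 < e" for q e
  proof -
    have "\<forall>\<^sub>F p in sequentially. d p < e" using \<open>d \<longlonglongrightarrow> 0\<close> that by (rule order_tendstoD)
    then show ?thesis
    proof (eventually_elim, intro allI)
      fix p b1 b2 b3 assume "d p < e"
      then show "dual_cost T (A p) (\<lambda>_. lam) q b1 + dual_cost T (S p) (\<lambda>_. mu) q b2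
          + dual_sum q b3 (incr T (Y p) q) (cell_integral T (\<lambda>t. th * X p t) q) \<le> c + e"
        using entropy_path.joint_cost[OF paths[of p], of q b1 b2 b3] unfolding dual_cost_def by linarith
    qed
  qed
  show "\<forall>\<^sub>F p in sequentially. \<forall>g d'. continuous_on {0..T} g \<longrightarrow> (\<forall>t\<in>{0..T}. \<bar>X p t - g t\<bar> \<le> d') \<longrightarrow>
      \<bar>cell_integral T (\<lambda>t. th * X p t) q k - cell_integral T (\<lambda>t. th * g t) q k\<bar> \<le> th * d' * (T / 2 ^ q) + e"
    if k: "k < 2 ^ q" and "0 < e" for q k e
  proof (intro always_eventually allI impI)
    fix p g d' assume g: "continuous_on {0..T} g" "\<forall>t\<in>{0..T}. \<bar>X p t - g t\<bar> \<le> d'"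
    have "\<bar>cell_integral T (\<lambda>t. th * X p t) q k - cell_integral T (\<lambda>t. th * g t) q k\<bar> \<le> th * d' * (T / 2 ^ q)"
    proof (rule cell_integral_dist_le[OF T_pos k])
      fix t assume "t \<in> {tgrid T q k..tgrid T q (Suc k)}"
      then have "\<bar>X p t - g t\<bar> \<le> d'" using g(2) tgrid_cell[OF T_pos k] by auto
      then show "\<bar>th * X p t - th * g t\<bar> \<le> th * d'"
        using th_pos by (simp add: abs_mult flip: right_diff_distrib)
    qed (use g entropy_path.cont_\<xi>[OF paths] in \<open>auto intro!: continuous_intros\<close>)
    then show "\<bar>cell_integral T (\<lambda>t. th * X p t) q k - cell_integral T (\<lambda>t. th * g t) q k\<bar> \<le> th * d' * (T / 2 ^ q) + e"
      using \<open>0 < e\<close> by simp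
  qed
  show "mono_on {0..T} (A p)" "mono_on {0..T} (S p)" "mono_on {0..T} (Y p)" for p
    using paths[of p] by (simp_all add: entropy_path_def entropy_path_axioms_def)
  show "(\<lambda>p. A p 0) \<longlonglongrightarrow> 0" "(\<lambda>p. S p 0) \<longlonglongrightarrow> 0" "(\<lambda>p. Y p 0) \<longlonglongrightarrow> 0"
    using entropy_path.start[OF paths] by simp_all
  show "\<forall>\<^sub>F p in sequentially. \<forall>t\<in>{0..T}. \<bar>X p t - skorohod_map (net_input x0 (A p) (S p) (Y p)) t\<bar> \<le> e" if "0 < e" for e
    using entropy_path.reflected[OF paths] that by simp
qed (use assms in simp_all)

theorem rate_function_mm1m_rate:
  assumes "0 \<le> x0"
  shows "rate_function (skorohod_topology T ({0..} \<times> {0..})) (mm1m_rate lam mu th x0 T)"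
  unfolding rate_function_def
proof (intro allI impI)
  let ?S = "{0..} \<times> {0..} :: (real \<times> real) set"
  interpret Metric_space "cadlag_space T ?S" "skorohod_dist T" using T_pos by (intro Metric_space_skorohod) simp
  fix M :: ennreal assume "M < \<infinity>"
  then obtain m where m: "M = ennreal m" "0 \<le> m" by (cases M) auto
  let ?L = "{z \<in> topspace (skorohod_topology T ?S). mm1m_rate lam mu th x0 T z \<le> M}"
  have top: "topspace (skorohod_topology T ?S) = cadlag_space T ?S" using T_pos by (simp add: topspace_skorohod)
  have "\<exists>l r. l \<in> ?L \<and> strict_mono r \<and> limitin (skorohod_topology T ?S) (\<sigma> \<circ> r) l sequentially"
    if "range \<sigma> \<subseteq> ?L" for \<sigma> :: "nat \<Rightarrow> real \<Rightarrow> real \<times> real"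
  proof -
    have \<sigma>: "\<sigma> p \<in> cadlag_space T ?S" "mm1m_rate lam mu th x0 T (\<sigma> p) \<le> ennreal m" for p
      using that by (auto simp: top m)
    have "\<exists>a s. entropy_path lam mu th T x0 (m + inverse (real (Suc p))) a s (\<lambda>t. fst (\<sigma> p t)) (\<lambda>t. snd (\<sigma> p t))" for p
    proof -
      have "has_control_within lam mu th x0 T (\<lambda>t. fst (\<sigma> p t)) (\<lambda>t. snd (\<sigma> p t)) (m + inverse (real (Suc p)))"
        by (rule mm1m_rate_leD[OF \<sigma>(2) m(2)]) simp
      then show ?thesis by (rule has_control_within_imp_entropy_path) (use m(2) in auto)
    qed
    then obtain A S where AS: "\<And>p. entropy_path lam mu th T x0 (m + inverse (real (Suc p))) (A p) (S p)
        (\<lambda>t. fst (\<sigma> p t)) (\<lambda>t. snd (\<sigma> p t))"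
      by metis
    interpret entropy_bounded lam mu th T x0 m A S "\<lambda>p t. snd (\<sigma> p t)" "\<lambda>p t. fst (\<sigma> p t)"
      "\<lambda>p. incr T (\<lambda>t. snd (\<sigma> p t))" "\<lambda>p. cell_integral T (\<lambda>t. th * fst (\<sigma> p t))"
      by (rule entropy_bounded_of_entropy_paths[OF \<open>0 \<le> x0\<close> m(2) AS LIMSEQ_inverse_real_of_nat])
    obtain r \<xi> \<zeta> where r: "strict_mono r" and control: "has_control_within lam mu th x0 T \<xi> \<zeta> m"
      and lim: "uniform_limit {0..T} (\<lambda>i t. fst (\<sigma> (r i) t)) \<xi> sequentially"
          "uniform_limit {0..T} (\<lambda>i t. snd (\<sigma> (r i) t)) \<zeta> sequentially"
      by (rule limit_has_control)
    obtain a s where "entropy_path lam mu th T x0 m a s \<xi> \<zeta>"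
      using has_control_within_imp_entropy_path[OF control m(2)] .
    then interpret limit: entropy_path lam mu th T x0 m a s \<xi> \<zeta> .
    have "limitin (skorohod_topology T ?S) (\<sigma> \<circ> r) (path_pair T \<xi> \<zeta>) sequentially"
      using T_pos \<sigma>(1) limit.path_cadlag lim by (intro limitin_skorohod_of_uniform_limit) auto
    moreover have "path_pair T \<xi> \<zeta> \<in> ?L"
      using limit.path_cadlag limit.mm1m_rate_path_pair_le by (simp add: top m)
    ultimately show ?thesis using r by blast
  qed
  moreover have "?L \<subseteq> cadlag_space T ?S" by (auto simp: top)
  ultimately show "compactin (skorohod_topology T ?S) ?L"
    unfolding skorohod_topology_def compactin_sequentially by blast
qed

end

section \<open>Counting on a dyadic space-time grid\<close>

definition mark_cell :: "nat \<Rightarrow> nat \<Rightarrow> real set" where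
  "mark_cell p i = {real i / 2 ^ p..<real (Suc i) / 2 ^ p}"

definition grid_box :: "real \<Rightarrow> nat \<Rightarrow> nat \<Rightarrow> nat \<Rightarrow> (real \<times> real) set" where
  "grid_box T p k i = time_cell T p k \<times> mark_cell p i"

lemma mark_cell_disjoint: "i \<noteq> j \<Longrightarrow> mark_cell p i \<inter> mark_cell p j = {}"
proof (induction i j rule: linorder_wlog)
  case (le i j)
  then have "real (Suc i) / 2 ^ p \<le> real j / 2 ^ p" by (intro divide_right_mono) auto
  then show ?case by (auto simp: mark_cell_def)
qed (simp add: Int_commute)

lemma UN_mark_cell: "(\<Union>i<j. mark_cell p i) = {0..<real j / 2 ^ p}"
proof (induction j)
  case (Suc j)
  have "real j / 2 ^ p \<le> real (Suc j) / 2 ^ p" by (intro divide_right_mono) auto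
  then have "{real j / 2 ^ p..<real (Suc j) / 2 ^ p} \<union> {0..<real j / 2 ^ p} = {0..<real (Suc j) / 2 ^ p}"
    by (subst Un_commute, intro ivl_disj_un_two(3)) simp
  then show ?case unfolding lessThan_Suc UN_insert Suc.IH by (simp only: mark_cell_def)
qed simp

lemma grid_box_disjoint: "0 < T \<Longrightarrow> (k, i) \<noteq> (k', i') \<Longrightarrow> grid_box T p k i \<inter> grid_box T p k' i' = {}"
  using time_cell_disjoint[of T k k' p] mark_cell_disjoint[of i i' p] unfolding grid_box_def by blast

lemma grid_box_borel [measurable]: "grid_box T p k i \<in> sets borel"
  unfolding grid_box_def by (intro Times_borel) (auto simp: time_cell_def mark_cell_def)

lemma grid_box_subset: "0 < T \<Longrightarrow> k < 2 ^ p \<Longrightarrow> grid_box T p k i \<subseteq> {0..T} \<times> {0..}"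
  unfolding grid_box_def mark_cell_def using time_cell_subset[of T k p]
  by (intro Sigma_mono) (auto intro: order_trans[of 0 "real i / 2 ^ p"])

locale good_path = queue_path T n \<nu>1 \<nu>2 xn \<nu>3 f g + queue_rates lam mu th T
  for T :: real and n :: nat and \<nu>1 \<nu>2 :: "real measure" and xn :: real and \<nu>3 :: "(real \<times> real) measure"
    and f g :: "real \<Rightarrow> real" and lam mu th :: real +
  fixes m :: real and p :: nat
  assumes fine_grid: "xn + m + 2 * lam * T + 1 \<le> real p"
    and finite_boxes: "\<And>k i. k < 2 ^ p \<Longrightarrow> i < p * 2 ^ p \<Longrightarrow> emeasure \<nu>3 (grid_box T p k i) < \<infinity>"
    and cost_le: "(\<Sum>k<2 ^ p. relent (measure \<nu>1 (time_cell T p k) / n) (lam * (T / 2 ^ p)))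
       + (\<Sum>k<2 ^ p. relent (measure \<nu>2 (time_cell T p k) / n) (mu * (T / 2 ^ p)))
       + (\<Sum>k<2 ^ p. \<Sum>i<p * 2 ^ p. relent (measure \<nu>3 (grid_box T p k i) / n) (th * (T / 2 ^ p) / 2 ^ p)) \<le> m"
begin

definition box_count :: "nat \<Rightarrow> nat \<Rightarrow> real" where
  "box_count k i = measure \<nu>3 (grid_box T p k i) / n"

definition box_weight :: real where
  "box_weight = th * (T / 2 ^ p) / 2 ^ p"

definition reneging_cost :: real where
  "reneging_cost = (\<Sum>k<2 ^ p. \<Sum>i<p * 2 ^ p. relent (box_count k i) box_weight)"

lemma box_count_nonneg: "0 \<le> box_count k i"
  by (simp add: box_count_def)

lemma box_weight_pos: "0 < box_weight"
  using th_pos T_pos by (simp add: box_weight_def)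

lemma dual_sum_boxes_le:
  assumes I: "\<And>k. k < 2 ^ p \<Longrightarrow> I k \<subseteq> {..<p * 2 ^ p}"
  shows "dual_sum p b (\<lambda>k. \<Sum>i\<in>I k. box_count k i) (\<lambda>k. box_weight * card (I k)) \<le> reneging_cost"
  unfolding dual_sum_def reneging_cost_def
proof (intro sum_mono)
  fix k :: nat assume "k \<in> {..<2 ^ p}"
  then have k: "k < 2 ^ p" by simp
  have "b k * (\<Sum>i\<in>I k. box_count k i) - (exp (b k) - 1) * (box_weight * card (I k))
      = (\<Sum>i\<in>I k. b k * box_count k i - (exp (b k) - 1) * box_weight)"
    by (simp add: sum_subtractf sum_distrib_left)
  also have "\<dots> \<le> (\<Sum>i\<in>I k. relent (box_count k i) box_weight)"
    using box_weight_pos by (intro sum_mono relent_ge_dual box_count_nonneg) auto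
  also have "\<dots> \<le> (\<Sum>i<p * 2 ^ p. relent (box_count k i) box_weight)"
    using I[OF k] box_weight_pos by (intro sum_mono2) (auto intro!: relent_nonneg box_count_nonneg)
  finally show "b k * (\<Sum>i\<in>I k. box_count k i) - (exp (b k) - 1) * (box_weight * card (I k))
      \<le> (\<Sum>i<p * 2 ^ p. relent (box_count k i) box_weight)" .
qed

lemma joint_cost_boxes_le:
  assumes "q \<le> p" and "\<And>k. k < 2 ^ p \<Longrightarrow> I k \<subseteq> {..<p * 2 ^ p}"
  shows "dual_cost T arr (\<lambda>_. lam) q b1 + dual_cost T srv (\<lambda>_. mu) q b2
     + dual_sum p b3 (\<lambda>k. \<Sum>i\<in>I k. box_count k i) (\<lambda>k. box_weight * card (I k)) \<le> m"
  using arrivals.dual_cost_le_relent[OF assms(1) lam_pos, of b1] services.dual_cost_le_relent[OF assms(1) mu_pos, of b2]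
    dual_sum_boxes_le[of I b3, OF assms(2)] cost_le
  unfolding reneging_cost_def box_count_def box_weight_def by linarith

lemma queue_bounded:
  assumes t: "t \<in> {0..T}"
  shows "f t \<le> real p - 1"
proof -
  have "dual_cost T arr (\<lambda>_. lam) 0 (\<lambda>_. 1) = arr T - (exp 1 - 1) * (lam * T)"
    using cell_integral_const[OF T_pos, of lam 0 0] arrivals.cumulative_0
    by (simp add: dual_cost_def dual_sum_def incr_def tgrid_def)
  then have "arr T \<le> m + (exp 1 - 1) * (lam * T)"
    using joint_cost_boxes_le[of 0 "\<lambda>_. {}" "\<lambda>_. 1" "\<lambda>_. 0" "\<lambda>_. 0"] by simp
  also have "(exp 1 - 1) * (lam * T) \<le> 2 * (lam * T)" using exp_le lam_pos T_pos by (intro mult_right_mono) auto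
  finally have "arr T \<le> m + 2 * lam * T" by simp
  moreover have "arr t \<le> arr T" using t by (intro mono_onD[OF arrivals.mono_counts]) auto
  ultimately show ?thesis using queue_le_arrivals[OF t] fine_grid by simp
qed

lemma level_bounded:
  assumes t: "t \<in> {0<..T}"
  shows "level t \<le> real p - 1"
proof -
  have "left_limit f t \<le> real p - 1"
    using left_limit_bounds[OF t, of 0 0 "real p - 1"] queue_bounded path_nonneg(1) t by auto
  moreover have "0 \<le> real p - 1" using queue_bounded[of 0] path_nonneg(1)[of 0] T_pos by simp
  moreover have "0 \<le> 1 / real n" by simp
  ultimately show ?thesis unfolding level_def by (intro max.boundedI) linarith+
qed

lemma sets_box: "k < 2 ^ p \<Longrightarrow> grid_box T p k i \<in> sets \<nu>3"
  using grid_box_subset[OF T_pos] by (intro sets_renegingI) auto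

lemma sets_initial_axis: "{0} \<times> {0..} \<in> sets \<nu>3"
  using T_pos by (intro sets_renegingI borel_closed closed_Times) auto

lemma UN_grid_box: "(\<Union>i<j. grid_box T p k i) = time_cell T p k \<times> {0..<real j / 2 ^ p}"
  unfolding grid_box_def UN_mark_cell[symmetric] by auto

lemma region_fmeasurable:
  assumes A: "A \<in> sets borel" "A \<subseteq> {0..T}"
  shows "region A \<in> fmeasurable \<nu>3"
proof (rule fmeasurableI)
  show "region A \<in> sets \<nu>3" using A by (rule sets_region)
  define strip where "strip = (\<Union>k<2 ^ p. \<Union>i<p * 2 ^ p. grid_box T p k i)"
  have strip: "strip = {0<..T} \<times> {0..<real p}"
    unfolding strip_def UN_grid_box using UN_time_cell[OF T_pos, of p] by auto
  have "(s, y) \<in> {0} \<times> {0..} \<union> strip" if "(s, y) \<in> region A" for s y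
    using that A(2) level_bounded[of s] unfolding strip region_def by (cases "s = 0") auto
  then have "emeasure \<nu>3 (region A) \<le> emeasure \<nu>3 ({0} \<times> {0..} \<union> strip)"
    unfolding strip_def by (intro emeasure_mono sets.Un sets.finite_UN sets_initial_axis) (auto intro: sets_box)
  also have "\<dots> \<le> emeasure \<nu>3 ({0} \<times> {0..}) + emeasure \<nu>3 strip"
    unfolding strip_def by (intro emeasure_subadditive sets.finite_UN sets_initial_axis) (auto intro: sets_box)
  also have "\<dots> = emeasure \<nu>3 strip" using null_axis by simp
  also have "\<dots> \<le> (\<Sum>k<2 ^ p. emeasure \<nu>3 (\<Union>i<p * 2 ^ p. grid_box T p k i))"
    unfolding strip_def by (intro emeasure_subadditive_finite) (auto intro!: sets.finite_UN sets_box)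
  also have "\<dots> \<le> (\<Sum>k<2 ^ p. \<Sum>i<p * 2 ^ p. emeasure \<nu>3 (grid_box T p k i))"
    by (intro sum_mono emeasure_subadditive_finite) (auto intro!: sets_box)
  also have "\<dots> < \<infinity>" using finite_boxes by (auto simp: less_top[symmetric] sum_Pinfty)
  finally show "emeasure \<nu>3 (region A) < \<infinity>" .
qed

lemma mono_reneging: "mono_on {0..T} g"
  using mono_reneging_in[OF region_fmeasurable[of "{0..T}"]] by (simp add: mono_on_def reneging_eq_in_region)

lemma incr_reneging:
  assumes k: "k < 2 ^ p"
  shows "incr T g p k = measure \<nu>3 (region (time_cell T p k)) / n"
proof -
  have "region {0..T} \<inter> time_cell T p k \<times> UNIV = region (time_cell T p k)"
    using time_cell_subset[OF T_pos k] by (auto simp: region_def)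
  then show ?thesis
    using incr_reneging_in[OF region_fmeasurable[of "{0..T}"] k] tgrid_cell[OF T_pos k]
    by (simp add: incr_def reneging_eq_in_region)
qed

lemma measure_column:
  assumes k: "k < 2 ^ p" and j: "j \<le> p * 2 ^ p"
  shows "time_cell T p k \<times> {0..<real j / 2 ^ p} \<in> fmeasurable \<nu>3"
    and "measure \<nu>3 (time_cell T p k \<times> {0..<real j / 2 ^ p}) / n = (\<Sum>i<j. box_count k i)"
proof -
  have box: "grid_box T p k i \<in> fmeasurable \<nu>3" if "i < j" for i
    using that k j finite_boxes[OF k, of i] by (intro fmeasurableI sets_box) auto
  then show "time_cell T p k \<times> {0..<real j / 2 ^ p} \<in> fmeasurable \<nu>3"
    unfolding UN_grid_box[symmetric] by (intro fmeasurable.finite_UN) auto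
  have "measure \<nu>3 (\<Union>i<j. grid_box T p k i) = (\<Sum>i<j. measure \<nu>3 (grid_box T p k i))"
    using box grid_box_disjoint[OF T_pos, of k _ k _ p]
    by (intro measure_finite_Union)
      (auto simp: disjoint_family_on_def fmeasurable_def less_top[symmetric])
  then show "measure \<nu>3 (time_cell T p k \<times> {0..<real j / 2 ^ p}) / n = (\<Sum>i<j. box_count k i)"
    unfolding UN_grid_box by (simp add: box_count_def sum_divide_distrib)
qed

definition oscillation :: real where
  "oscillation = (MAX k\<in>{..<2 ^ p}. incr T arr p k + incr T srv p k + incr T g p k)"

lemma incr_sum_le_oscillation: "k < 2 ^ p \<Longrightarrow> incr T arr p k + incr T srv p k + incr T g p k \<le> oscillation"
  unfolding oscillation_def by (intro Max_ge) auto

lemma incrs_nonneg: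
  assumes "k < 2 ^ p"
  shows "0 \<le> incr T arr p k" "0 \<le> incr T srv p k" "0 \<le> incr T g p k"
  using incr_nonneg[OF _ T_pos assms] arrivals.mono_counts services.mono_counts mono_reneging by auto

lemma oscillation_nonneg: "0 \<le> oscillation"
  using incr_sum_le_oscillation[of 0] incrs_nonneg[of 0] by simp

lemma queue_near_grid:
  assumes k: "k < 2 ^ p" and t: "t \<in> {tgrid T p k..tgrid T p (Suc k)}"
  shows "\<bar>f t - f (tgrid T p k)\<bar> \<le> oscillation"
proof -
  note cell = tgrid_cell[OF T_pos k]
  have mem: "t \<in> {0..T}" using cell t by auto
  have "\<bar>f t - f (tgrid T p k)\<bar> \<le> (arr t - arr (tgrid T p k)) + (srv t - srv (tgrid T p k)) + (g t - g (tgrid T p k))"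
    using cell t mem by (intro oscillation_le mono_onD[OF mono_reneging]) auto
  also have "\<dots> \<le> incr T arr p k + incr T srv p k + incr T g p k"
    unfolding incr_def using cell t mem
    by (intro add_mono diff_right_mono mono_onD[OF arrivals.mono_counts] mono_onD[OF services.mono_counts]
        mono_onD[OF mono_reneging]) auto
  finally show ?thesis using incr_sum_le_oscillation[OF k] by simp
qed

definition low :: "nat \<Rightarrow> real" where
  "low k = max 0 (f (tgrid T p k) - oscillation - 1 / n)"

definition high :: "nat \<Rightarrow> real" where
  "high k = min (real p - 1) (f (tgrid T p k) + oscillation)"

definition lower_index :: "nat \<Rightarrow> nat" where
  "lower_index k = nat \<lfloor>low k * 2 ^ p\<rfloor>"

definition upper_index :: "nat \<Rightarrow> nat" where
  "upper_index k = Suc (nat \<lfloor>high k * 2 ^ p\<rfloor>)"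

lemma level_between:
  assumes k: "k < 2 ^ p" and t: "t \<in> time_cell T p k"
  shows "low k \<le> level t" "level t \<le> high k"
proof -
  have mem: "t \<in> {0<..T}" "tgrid T p k < t" using time_cell_subset[OF T_pos k] t by (auto simp: time_cell_def)
  have "left_limit f t \<in> {f (tgrid T p k) - oscillation..f (tgrid T p k) + oscillation}"
  proof (rule left_limit_bounds[OF mem])
    fix s assume "s \<in> {0..T}" "tgrid T p k < s" "s < t"
    then show "f (tgrid T p k) - oscillation \<le> f s \<and> f s \<le> f (tgrid T p k) + oscillation"
      using queue_near_grid[OF k, of s] t by (auto simp: time_cell_def)
  qed
  moreover have "0 \<le> f (tgrid T p k) + oscillation"
    using path_nonneg(1)[of "tgrid T p k"] tgrid_cell[OF T_pos k] oscillation_nonneg by simp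
  moreover have "0 \<le> 1 / real n" by simp
  ultimately have "level t \<le> f (tgrid T p k) + oscillation" "low k \<le> level t"
    unfolding level_def low_def atLeastAtMost_iff by linarith+
  then show "low k \<le> level t" "level t \<le> high k"
    using level_bounded[OF mem(1)] by (auto simp: high_def)
qed

lemma low_high:
  assumes k: "k < 2 ^ p"
  shows "0 \<le> low k" "low k \<le> high k" "high k \<le> real p - 1" "high k - low k \<le> 2 * oscillation + 1 / n"
proof -
  have "0 \<le> f (tgrid T p k)" "f (tgrid T p k) \<le> real p - 1"
    using tgrid_cell[OF T_pos k] path_nonneg(1) queue_bounded by auto
  moreover have "0 \<le> 1 / real n" by simp
  ultimately show "0 \<le> low k" "low k \<le> high k" "high k \<le> real p - 1" "high k - low k \<le> 2 * oscillation + 1 / n"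
    using oscillation_nonneg unfolding low_def high_def by linarith+
qed

lemma lower_index_bounds:
  assumes k: "k < 2 ^ p"
  shows "real (lower_index k) \<le> low k * 2 ^ p" "low k * 2 ^ p < real (lower_index k) + 1"
proof -
  have "0 \<le> low k * 2 ^ p" using low_high(1)[OF k] by simp
  then show "real (lower_index k) \<le> low k * 2 ^ p" "low k * 2 ^ p < real (lower_index k) + 1"
    unfolding lower_index_def by linarith+
qed

lemma upper_index_bounds:
  assumes k: "k < 2 ^ p"
  shows "high k * 2 ^ p < real (upper_index k)" "real (upper_index k) \<le> high k * 2 ^ p + 1"
proof -
  have "0 \<le> high k * 2 ^ p" using low_high(1,2)[OF k] by simp
  then show "high k * 2 ^ p < real (upper_index k)" "real (upper_index k) \<le> high k * 2 ^ p + 1"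
    unfolding upper_index_def by linarith+
qed

lemma index_order:
  assumes k: "k < 2 ^ p"
  shows "lower_index k \<le> upper_index k" "upper_index k \<le> p * 2 ^ p"
proof -
  have "low k * 2 ^ p \<le> high k * 2 ^ p" using low_high(2)[OF k] by simp
  then have "real (lower_index k) \<le> real (upper_index k)"
    using lower_index_bounds(1)[OF k] upper_index_bounds(1)[OF k] by linarith
  then show "lower_index k \<le> upper_index k" by simp
  have "high k * 2 ^ p \<le> (real p - 1) * 2 ^ p" using low_high(3)[OF k] by (intro mult_right_mono) auto
  then have "real (upper_index k) \<le> real p * 2 ^ p - 2 ^ p + 1"
    using upper_index_bounds(2)[OF k] by (simp add: left_diff_distrib)
  also have "\<dots> \<le> real (p * 2 ^ p)" by simp
  finally show "upper_index k \<le> p * 2 ^ p" by (simp only: of_nat_le_iff)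
qed

lemma incr_reneging_between:
  assumes k: "k < 2 ^ p"
  shows "(\<Sum>i<lower_index k. box_count k i) \<le> incr T g p k" "incr T g p k \<le> (\<Sum>i<upper_index k. box_count k i)"
proof -
  let ?C = "time_cell T p k"
  have region: "region ?C \<in> fmeasurable \<nu>3"
    using time_cell_subset[OF T_pos k] by (intro region_fmeasurable) (auto simp: time_cell_def)
  have "real (lower_index k) / 2 ^ p \<le> low k" "high k < real (upper_index k) / 2 ^ p"
    using lower_index_bounds(1)[OF k] upper_index_bounds(1)[OF k] by (auto simp: field_simps)
  then have "?C \<times> {0..<real (lower_index k) / 2 ^ p} \<subseteq> region ?C" "region ?C \<subseteq> ?C \<times> {0..<real (upper_index k) / 2 ^ p}"
    using level_between[OF k] by (fastforce simp: region_def)+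
  then have "measure \<nu>3 (?C \<times> {0..<real (lower_index k) / 2 ^ p}) \<le> measure \<nu>3 (region ?C)"
    "measure \<nu>3 (region ?C) \<le> measure \<nu>3 (?C \<times> {0..<real (upper_index k) / 2 ^ p})"
    using region measure_column(1)[OF k] index_order[OF k] by (auto intro!: measure_mono_fmeasurable)
  then show "(\<Sum>i<lower_index k. box_count k i) \<le> incr T g p k" "incr T g p k \<le> (\<Sum>i<upper_index k. box_count k i)"
    unfolding incr_reneging[OF k] using index_order[OF k]
    by (auto simp: measure_column(2)[OF k, symmetric] divide_right_mono)
qed

definition strip_count :: real where
  "strip_count = (\<Sum>k<2 ^ p. \<Sum>i\<in>{lower_index k..<upper_index k}. box_count k i)"

lemma strip_count_nonneg: "0 \<le> strip_count"
  unfolding strip_count_def by (intro sum_nonneg box_count_nonneg)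

lemma oscillation_dual_bound:
  assumes "0 < b"
  shows "b * oscillation \<le> 3 * m + exp b * ((lam + mu + th * real p) * (T / 2 ^ p))"
proof -
  have "oscillation \<in> (\<lambda>k. incr T arr p k + incr T srv p k + incr T g p k) ` {..<2 ^ p}"
    unfolding oscillation_def by (intro Max_in) (auto simp: lessThan_empty_iff)
  then obtain k where k: "k < 2 ^ p" and osc: "oscillation = incr T arr p k + incr T srv p k + incr T g p k" by auto
  define \<beta> :: "nat \<Rightarrow> real" where "\<beta> j = (if j = k then b else 0)" for j
  have at_k: "dual_sum p \<beta> y w = b * y k - (exp b - 1) * w k" for y w
    unfolding \<beta>_def by (rule dual_sum_single[OF k])
  note joint = joint_cost_boxes_le[of p "\<lambda>_. {..<p * 2 ^ p}"]
  have "b * incr T arr p k - (exp b - 1) * (lam * (T / 2 ^ p)) \<le> m"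
    using joint[of \<beta> "\<lambda>_. 0" "\<lambda>_. 0"] by (simp add: dual_cost_def at_k cell_integral_const[OF T_pos])
  then have "b * incr T arr p k \<le> m + exp b * (lam * (T / 2 ^ p))"
    using assms lam_pos T_pos by (intro mult_le_of_dual_bound) auto
  moreover have "b * incr T srv p k - (exp b - 1) * (mu * (T / 2 ^ p)) \<le> m"
    using joint[of "\<lambda>_. 0" \<beta> "\<lambda>_. 0"] by (simp add: dual_cost_def at_k cell_integral_const[OF T_pos])
  then have "b * incr T srv p k \<le> m + exp b * (mu * (T / 2 ^ p))"
    using assms mu_pos T_pos by (intro mult_le_of_dual_bound) auto
  moreover have "box_weight * real (p * 2 ^ p) = th * real p * (T / 2 ^ p)" by (simp add: box_weight_def)
  then have "b * (\<Sum>i<p * 2 ^ p. box_count k i) - (exp b - 1) * (th * real p * (T / 2 ^ p)) \<le> m"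
    using joint[of "\<lambda>_. 0" "\<lambda>_. 0" \<beta>] by (simp add: at_k)
  then have "b * (\<Sum>i<p * 2 ^ p. box_count k i) \<le> m + exp b * (th * real p * (T / 2 ^ p))"
    using assms th_pos T_pos by (intro mult_le_of_dual_bound) auto
  moreover have "b * incr T g p k \<le> b * (\<Sum>i<p * 2 ^ p. box_count k i)"
    using incr_reneging_between(2)[OF k] index_order(2)[OF k] assms
    by (intro mult_left_mono order_trans[OF _ sum_mono2[of "{..<p * 2 ^ p}" "{..<upper_index k}"]])
      (auto intro: box_count_nonneg)
  ultimately show ?thesis unfolding osc by (simp add: algebra_simps add_divide_distrib)
qed

lemma strip_count_dual_bound:
  assumes "0 < b"
  shows "b * strip_count \<le> m + exp b * (th * T * (2 * oscillation + 1 / n + 2 / 2 ^ p))"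
proof -
  define width where "width = 2 * oscillation + 1 / n + 2 / 2 ^ p"
  let ?I = "\<lambda>k. {lower_index k..<upper_index k}"
  have card_le: "box_weight * card (?I k) \<le> th * width * (T / 2 ^ p)" if k: "k < 2 ^ p" for k
  proof -
    have "real (card (?I k)) = real (upper_index k) - real (lower_index k)"
      using index_order(1)[OF k] by (simp add: of_nat_diff)
    also have "\<dots> \<le> (high k - low k) * 2 ^ p + 2"
      using lower_index_bounds(2)[OF k] upper_index_bounds(2)[OF k] by (simp add: left_diff_distrib)
    also have "\<dots> \<le> (2 * oscillation + 1 / n) * 2 ^ p + 2"
      using low_high(4)[OF k] by (intro add_right_mono mult_right_mono) auto
    also have "\<dots> = width * 2 ^ p" by (simp add: width_def distrib_right)
    finally have "box_weight * card (?I k) \<le> box_weight * (width * 2 ^ p)"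
      using box_weight_pos by (intro mult_left_mono) auto
    then show ?thesis by (simp add: box_weight_def mult_ac)
  qed
  have "dual_sum p (\<lambda>_. b) (\<lambda>k. \<Sum>i\<in>?I k. box_count k i) (\<lambda>k. box_weight * card (?I k)) \<le> m"
    using joint_cost_boxes_le[of p ?I "\<lambda>_. 0" "\<lambda>_. 0" "\<lambda>_. b"] index_order(2) by fastforce
  then have "b * strip_count - (exp b - 1) * (\<Sum>k<2 ^ p. box_weight * card (?I k)) \<le> m"
    by (simp only: dual_sum_def strip_count_def sum_subtractf sum_distrib_left)
  moreover have "(\<Sum>k<2 ^ p. box_weight * card (?I k)) \<le> (\<Sum>k<(2::nat) ^ p. th * width * (T / 2 ^ p))"
    using card_le by (intro sum_mono) auto
  moreover have "0 \<le> width" using oscillation_nonneg by (simp add: width_def)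
  ultimately show ?thesis
    unfolding width_def[symmetric] using assms th_pos T_pos by (intro mult_le_of_dual_bound) (auto simp: mult_ac)
qed

lemma reflection_oscillation:
  assumes t: "t \<in> {0..T}"
  shows "\<bar>f t - skorohod_map (net_input xn arr srv g) t\<bar> \<le> 2 * oscillation"
proof (rule reflection[OF _ _ t])
  show "0 < T / 2 ^ p" using T_pos by simp
  fix s t assume ordered: "s \<in> {0..T}" "t \<in> {0..T}" "s \<le> t" "t - s < T / 2 ^ p"
  have "incr T srv p k \<le> oscillation" if "k < 2 ^ p" for k
    using incr_sum_le_oscillation[OF that] incrs_nonneg[OF that] by simp
  then have "\<bar>srv t - srv s\<bar> \<le> 2 * oscillation" using ordered
      by (intro mono_modulus_of_incr[OF T_pos services.mono_counts]) auto
  then show "srv t - srv s \<le> 2 * oscillation" by simp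
qed

definition renege_count :: "nat \<Rightarrow> nat \<Rightarrow> real" where
  "renege_count q = block_sum (p - q) (\<lambda>j. \<Sum>i<lower_index j. box_count j i)"

definition renege_weight :: "nat \<Rightarrow> nat \<Rightarrow> real" where
  "renege_weight q = block_sum (p - q) (\<lambda>j. box_weight * lower_index j)"

lemma joint_cost_le:
  assumes "q \<le> p"
  shows "dual_cost T arr (\<lambda>_. lam) q b1 + dual_cost T srv (\<lambda>_. mu) q b2
     + dual_sum q b3 (renege_count q) (renege_weight q) \<le> m"
proof -
  have "{..<lower_index k} \<subseteq> {..<p * 2 ^ p}" if "k < 2 ^ p" for k using index_order[OF that] by auto
  with joint_cost_boxes_le[of q "\<lambda>k. {..<lower_index k}" b1 b2 "\<lambda>j. b3 (j div 2 ^ (p - q))", OF assms]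
  show ?thesis
    unfolding renege_count_def renege_weight_def using dual_sum_refine[of q "p - q" b3] assms by simp
qed

lemma renege_count_near:
  assumes q: "q \<le> p" and k: "k < 2 ^ q"
  shows "\<bar>renege_count q k - incr T g q k\<bar> \<le> strip_count"
proof -
  obtain d where p: "p = q + d" using q le_Suc_ex by blast
  let ?strip = "\<lambda>j. \<Sum>i\<in>{lower_index j..<upper_index j}. box_count j i"
  have "\<bar>(\<Sum>i<lower_index j. box_count j i) - incr T g p j\<bar> \<le> ?strip j" if j: "j < 2 ^ p" for j
  proof -
    have "(\<Sum>i<lower_index j. box_count j i) + ?strip j = (\<Sum>i<upper_index j. box_count j i)"
      using sum.atLeastLessThan_concat[of 0 "lower_index j" "upper_index j" "box_count j"] index_order(1)[OF j]
      by (simp add: atLeast0LessThan)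
    then show ?thesis using incr_reneging_between[OF j] by simp
  qed
  then have "\<bar>renege_count q k - incr T g q k\<bar> \<le> block_sum d ?strip k"
    unfolding renege_count_def incr_block[of d T g q k, symmetric] using k by (simp add: p block_sum_dist_le)
  also have "\<dots> \<le> strip_count"
    unfolding strip_count_def using k by (subst p) (auto intro!: block_sum_le_sum sum_nonneg box_count_nonneg)
  finally show ?thesis .
qed

lemma renege_weight_near:
  assumes q: "q \<le> p" and k: "k < 2 ^ q" and h: "continuous_on {0..T} h" "\<And>t. t \<in> {0..T} \<Longrightarrow> \<bar>f t - h t\<bar> \<le> d"
  shows "\<bar>renege_weight q k - cell_integral T (\<lambda>t. th * h t) q k\<bar>
        \<le> th * (d + (2 * oscillation + 1 / n + 1 / 2 ^ p)) * (T / 2 ^ q)"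
proof -
  define e where "e = d + (2 * oscillation + 1 / n + 1 / 2 ^ p)"
  define a where "a j = real (lower_index j) / 2 ^ p" for j
  have cont: "continuous_on {0..T} (\<lambda>t. th * h t)" by (intro continuous_intros h)
  have cell_near: "\<bar>cell_integral T (\<lambda>t. th * h t) p j - th * a j * (T / 2 ^ p)\<bar> \<le> th * e * (T / 2 ^ p)"
      if j: "j < 2 ^ p" for j
  proof (rule cell_integral_approx[OF T_pos j cont])
    fix t assume t: "t \<in> {tgrid T p j..tgrid T p (Suc j)}"
    note cell = tgrid_cell[OF T_pos j]
    have "a j \<le> low j" "low j \<le> (real (lower_index j) + 1) / 2 ^ p"
      using lower_index_bounds[OF j] by (auto simp: a_def field_simps)
    then have "\<bar>a j - low j\<bar> \<le> 1 / 2 ^ p" by (simp add: a_def add_divide_distrib)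
    moreover have "\<bar>low j - f (tgrid T p j)\<bar> \<le> oscillation + 1 / n"
      using path_nonneg(1)[OF cell(1)] oscillation_nonneg zero_le_divide_1_iff[of "real n"] unfolding low_def
        by linarith
    moreover have "\<bar>f t - f (tgrid T p j)\<bar> \<le> oscillation" by (rule queue_near_grid[OF j t])
    moreover have "\<bar>f t - h t\<bar> \<le> d" using cell t by (intro h) auto
    ultimately have "\<bar>h t - a j\<bar> \<le> e" unfolding e_def by linarith
    then have "th * \<bar>h t - a j\<bar> \<le> th * e" using th_pos by (intro mult_left_mono) auto
    then show "\<bar>th * h t - th * a j\<bar> \<le> th * e" using th_pos by (simp add: right_diff_distrib[symmetric] abs_mult)
  qed
  have "\<bar>renege_weight q k - cell_integral T (\<lambda>t. th * h t) q k\<bar> \<le> block_sum (p - q) (\<lambda>_. th * e * (T / 2 ^ p)) k"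
    unfolding renege_weight_def cell_integral_block[OF T_pos cont k, of "p - q", symmetric]
  proof (rule block_sum_dist_le[OF k])
    fix j :: nat assume "j < 2 ^ (q + (p - q))"
    then have j: "j < 2 ^ p" using q by simp
    have "box_weight * lower_index j = th * a j * (T / 2 ^ p)" by (simp add: box_weight_def a_def)
    then show "\<bar>box_weight * lower_index j - cell_integral T (\<lambda>t. th * h t) (q + (p - q)) j\<bar> \<le> th * e * (T / 2 ^ p)"
      using cell_near[OF j] q by (simp add: abs_minus_commute)
  qed
  also have "\<dots> = th * e * (T / 2 ^ q)" using block_sum_mesh[of "p - q" "th * e" T q k] q by simp
  finally show ?thesis by (simp only: e_def)
qed

end

section \<open>Counts of the driving noise\<close>

lemma sets_time_intensity: "sets (time_intensity c T) = sets (restrict_space borel {0..T})"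
  by (simp add: time_intensity_def cong: sets_restrict_space_cong)

lemma sets_time_mark_intensity: "sets (time_mark_intensity c T) = sets (restrict_space borel ({0..T} \<times> {0..}))"
  by (simp add: time_mark_intensity_def cong: sets_restrict_space_cong)

lemma time_intensity_setsI: "B \<in> sets borel \<Longrightarrow> B \<subseteq> {0..T} \<Longrightarrow> B \<in> sets (time_intensity c T)"
  unfolding sets_time_intensity by (subst sets_restrict_space_iff) auto

lemma time_mark_intensity_setsI: "B \<in> sets borel \<Longrightarrow> B \<subseteq> {0..T} \<times> {0..} \<Longrightarrow> B \<in> sets (time_mark_intensity c T)"
  unfolding sets_time_mark_intensity by (subst sets_restrict_space_iff) (auto intro: borel_closed closed_Times)

lemma emeasure_time_intensity:
  "B \<in> sets borel \<Longrightarrow> B \<subseteq> {0..T} \<Longrightarrow> emeasure (time_intensity c T) B = ennreal c * emeasure lborel B"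
  by (simp add: time_intensity_def emeasure_restrict_space)

lemma emeasure_time_mark_intensity:
  "B \<in> sets borel \<Longrightarrow> B \<subseteq> {0..T} \<times> {0..} \<Longrightarrow> emeasure (time_mark_intensity c T) B = ennreal c * emeasure lborel B"
  by (simp add: time_mark_intensity_def emeasure_restrict_space borel_closed closed_Times)

lemma emeasure_lborel_Times:
  "A \<in> sets borel \<Longrightarrow> B \<in> sets borel \<Longrightarrow> emeasure lborel (A \<times> B :: (real \<times> real) set)
        = emeasure lborel A * emeasure lborel B"
  unfolding lborel_prod[symmetric] by (intro lborel.emeasure_pair_measure_Times) auto

lemma emeasure_time_cell: "0 < T \<Longrightarrow> emeasure lborel (time_cell T p k) = ennreal (T / 2 ^ p)"
  by (simp add: time_cell_def tgrid_Suc)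

lemma time_cell_intensity:
  assumes "0 < T" "k < 2 ^ p" "0 \<le> c"
  shows "time_cell T p k \<in> sets (time_intensity c T)" "emeasure (time_intensity c T) (time_cell T p k) < \<infinity>"
    "measure (time_intensity c T) (time_cell T p k) = c * (T / 2 ^ p)"
proof -
  have subset: "time_cell T p k \<in> sets borel" "time_cell T p k \<subseteq> {0..T}"
    using time_cell_subset[OF assms(1,2)] by (auto simp: time_cell_def)
  then show "time_cell T p k \<in> sets (time_intensity c T)" by (rule time_intensity_setsI)
  have "emeasure (time_intensity c T) (time_cell T p k) = ennreal (c * (T / 2 ^ p))"
    using assms ennreal_mult[of c "T / 2 ^ p"] by (simp add: emeasure_time_intensity[OF subset] emeasure_time_cell)
  then show "emeasure (time_intensity c T) (time_cell T p k) < \<infinity>"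
    "measure (time_intensity c T) (time_cell T p k) = c * (T / 2 ^ p)" using assms by (auto simp: measure_def)
qed

lemma time_mark_intensity_area:
  assumes A: "A \<in> sets borel" "A \<subseteq> {0..T} \<times> {0..}" and area: "emeasure lborel A = ennreal v" "0 \<le> v" and "0 \<le> c"
  shows "emeasure (time_mark_intensity c T) A < \<infinity>" "measure (time_mark_intensity c T) A = c * v"
proof -
  have "emeasure (time_mark_intensity c T) A = ennreal (c * v)"
    using area \<open>0 \<le> c\<close> by (simp add: emeasure_time_mark_intensity[OF A] ennreal_mult)
  then show "emeasure (time_mark_intensity c T) A < \<infinity>" "measure (time_mark_intensity c T) A = c * v"
    using area(2) \<open>0 \<le> c\<close> by (auto simp: measure_def)
qed

text \<open>The value \<open>- 1\<close> keeps an infinite count apart from all numbers of points.\<close>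

definition point_count :: "'b measure \<Rightarrow> 'b set \<Rightarrow> real" where
  "point_count \<nu> A = (if emeasure \<nu> A = \<infinity> then - 1 else measure \<nu> A)"

lemma point_count_eq_iff: "point_count \<nu> A = real k \<longleftrightarrow> emeasure \<nu> A = of_nat k"
proof (cases "emeasure \<nu> A")
  case (real r)
  then show ?thesis by (simp add: point_count_def measure_def ennreal_of_nat_eq_real_of_nat)
next
  case top
  moreover have "of_nat k \<noteq> (top :: ennreal)" by (simp add: ennreal_of_nat_eq_real_of_nat)
  ultimately show ?thesis by (simp add: point_count_def)
qed

datatype 'j count_index = Arrivals nat | Services nat | Renegings 'j

definition count_indices :: "nat \<Rightarrow> 'j set \<Rightarrow> 'j count_index set" where
  "count_indices p J = Arrivals ` {..<2 ^ p} \<union> Services ` {..<2 ^ p} \<union> Renegings ` J"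

lemma finite_count_indices: "finite J \<Longrightarrow> finite (count_indices p J)"
  by (simp add: count_indices_def)

lemma (in comm_monoid_set) count_index:
  assumes "finite I"
  shows "F g I = f (f (F (\<lambda>k. g (Arrivals k)) (Arrivals -` I)) (F (\<lambda>k. g (Services k)) (Services -` I)))
    (F (\<lambda>j. g (Renegings j)) (Renegings -` I))"
proof -
  have inj: "inj Arrivals" "inj Services" "inj Renegings" by (auto simp: inj_def)
  have finite: "finite (Arrivals -` I)" "finite (Services -` I)" "finite (Renegings -` I)"
    using assms inj by (auto intro: finite_vimageI)
  let ?a = "Arrivals ` (Arrivals -` I)" and ?s = "Services ` (Services -` I)" and ?r = "Renegings ` (Renegings -` I)"
  have "i \<in> ?a \<union> ?s \<union> ?r" if "i \<in> I" for i using that by (cases i) auto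
  then have "I = ?a \<union> ?s \<union> ?r" by blast
  then have "F g I = F g (?a \<union> ?s \<union> ?r)" by simp
  also have "\<dots> = f (F g (?a \<union> ?s)) (F g ?r)"
    using finite by (intro union_disjoint finite_UnI finite_imageI) auto
  also have "F g (?a \<union> ?s) = f (F g ?a) (F g ?s)"
    using finite by (intro union_disjoint finite_imageI) auto
  finally have "F g I = f (f (F g ?a) (F g ?s)) (F g ?r)" .
  moreover have "F g ?a = F (\<lambda>k. g (Arrivals k)) (Arrivals -` I)" "F g ?s = F (\<lambda>k. g (Services k)) (Services -` I)"
    "F g ?r = F (\<lambda>j. g (Renegings j)) (Renegings -` I)"
    using inj by (subst reindex; auto intro: inj_on_subset simp: comp_def)+
  ultimately show ?thesis by simp
qed

lemma vimage_count_indices [simp]: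
  "Arrivals -` count_indices p J = {..<2 ^ p}" "Services -` count_indices p J = {..<2 ^ p}"
      "Renegings -` count_indices p J = J"
  by (auto simp: count_indices_def)

definition noise_count :: "real \<Rightarrow> nat \<Rightarrow> ('j \<Rightarrow> (real \<times> real) set) \<Rightarrow> real measure \<Rightarrow> real measure \<Rightarrow>
    (real \<times> real) measure \<Rightarrow> 'j count_index \<Rightarrow> real" where
  "noise_count T p A \<nu>1 \<nu>2 \<nu>3 i = (case i of Arrivals k \<Rightarrow> point_count \<nu>1 (time_cell T p k)
     | Services k \<Rightarrow> point_count \<nu>2 (time_cell T p k) | Renegings j \<Rightarrow> point_count \<nu>3 (A j))"

definition noise_mean :: "real \<Rightarrow> real \<Rightarrow> real \<Rightarrow> real \<Rightarrow> nat \<Rightarrow> ('j \<Rightarrow> real) \<Rightarrow> 'j count_index \<Rightarrow> real" where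
  "noise_mean lam mu th T p v i =
     (case i of Arrivals k \<Rightarrow> lam * (T / 2 ^ p) | Services k \<Rightarrow> mu * (T / 2 ^ p) | Renegings j \<Rightarrow> th * v j)"

locale queue_noise = prob_space M + queue_rates lam mu th T
  for M :: "'w measure" and lam mu th T :: real +
  fixes n :: nat and N1 N2 :: "'w \<Rightarrow> real measure" and N3 :: "'w \<Rightarrow> (real \<times> real) measure"
  assumes scale_pos: "0 < n" and noise: "mm1m_noise M lam mu th T n N1 N2 N3"
begin

lemma poisson_random_measures:
  "poisson_random_measure M (time_intensity (real n * lam) T) N1"
  "poisson_random_measure M (time_intensity (real n * mu) T) N2"
  "poisson_random_measure M (time_mark_intensity (real n * th) T) N3"
  using noise by (auto simp: mm1m_noise_def)

lemma AE_time_counts: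
  assumes N: "poisson_random_measure M (time_intensity c T) N"
  shows "AE \<omega> in M. time_counts T n (N \<omega>)"
proof -
  have sets: "{0..T} \<in> sets (time_intensity c T)" "{0} \<in> sets (time_intensity c T)"
    using T_pos by (auto intro: time_intensity_setsI)
  have "emeasure (time_intensity c T) {0..T} < \<infinity>" "emeasure (time_intensity c T) {0} = 0"
    using T_pos by (auto simp: emeasure_time_intensity ennreal_mult_less_top)
  from AE_random_measure_nat[OF N sets(1) this(1)] AE_random_measure_null[OF N sets(2) this(2)] AE_space
  show ?thesis
  proof eventually_elim
    case (elim \<omega>)
    then show ?case
      using N T_pos scale_pos
      by unfold_locales (auto simp: poisson_random_measure_def sets_time_intensity ennreal_of_nat_eq_real_of_nat)
  qed
qed

lemma AE_null_axis: "AE \<omega> in M. emeasure (N3 \<omega>) ({0} \<times> {0..}) = 0"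
proof (rule AE_random_measure_null[OF poisson_random_measures(3)])
  have axis: "{0::real} \<times> {0::real..} \<in> sets borel" "{0} \<times> {0..} \<subseteq> {0..T} \<times> {0::real..}"
    using T_pos by (auto intro: Times_borel)
  then show "{0} \<times> {0..} \<in> sets (time_mark_intensity (real n * th) T)" by (rule time_mark_intensity_setsI)
  have "emeasure lborel ({0::real} \<times> {0::real..}) = 0" by (simp add: emeasure_lborel_Times)
  then show "emeasure (time_mark_intensity (real n * th) T) ({0} \<times> {0..}) = 0"
    by (simp only: emeasure_time_mark_intensity[OF axis] mult_zero_right)
qed

lemma AE_queue_path:
  assumes "0 \<le> xn" and cadlag: "\<And>\<omega>. \<omega> \<in> space M \<Longrightarrow> path_pair T (X \<omega>) (Y \<omega>) \<in> cadlag_space T ({0..} \<times> {0..})"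
    and equations: "AE \<omega> in M. mm1m_equations T n xn (N1 \<omega>) (N2 \<omega>) (N3 \<omega>) (X \<omega>) (Y \<omega>)"
  shows "AE \<omega> in M. queue_path T n (N1 \<omega>) (N2 \<omega>) xn (N3 \<omega>) (X \<omega>) (Y \<omega>)"
  using AE_time_counts[OF poisson_random_measures(1)] AE_time_counts[OF poisson_random_measures(2)]
    AE_null_axis equations AE_space
proof eventually_elim
  case (elim \<omega>)
  have "sets (N3 \<omega>) = sets (restrict_space borel ({0..T} \<times> {0..}))"
    using poisson_random_measures(3) elim(5) by (simp add: poisson_random_measure_def sets_time_mark_intensity)
  then show ?case
    using elim \<open>0 \<le> xn\<close> cadlag by (simp add: queue_path_def queue_path_axioms_def)
qed

end

locale noise_boxes = queue_noise M lam mu th T n N1 N2 N3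
  for M :: "'w measure" and lam mu th T :: real and n :: nat
    and N1 N2 :: "'w \<Rightarrow> real measure" and N3 :: "'w \<Rightarrow> (real \<times> real) measure" +
  fixes p :: nat and J :: "'j set" and A :: "'j \<Rightarrow> (real \<times> real) set" and v :: "'j \<Rightarrow> real"
  assumes finite_boxes: "finite J" and disjoint_boxes: "disjoint_family_on A J"
    and box_borel: "\<And>j. j \<in> J \<Longrightarrow> A j \<in> sets borel" and box_subset: "\<And>j. j \<in> J \<Longrightarrow> A j \<subseteq> {0..T} \<times> {0..}"
    and area: "\<And>j. j \<in> J \<Longrightarrow> emeasure lborel (A j) = ennreal (v j)" and area_pos: "\<And>j. j \<in> J \<Longrightarrow> 0 < v j"
begin

abbreviation count :: "'j count_index \<Rightarrow> 'w \<Rightarrow> real" where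
  "count i \<omega> \<equiv> noise_count T p A (N1 \<omega>) (N2 \<omega>) (N3 \<omega>) i"

abbreviation mean_count :: "'j count_index \<Rightarrow> real" where
  "mean_count \<equiv> noise_mean lam mu th T p v"

lemma rates_nonneg: "0 \<le> real n * lam" "0 \<le> real n * mu" "0 \<le> real n * th"
  using lam_pos mu_pos th_pos by auto

lemma box_sets: "j \<in> J \<Longrightarrow> A j \<in> sets (time_mark_intensity (real n * th) T)"
  by (intro time_mark_intensity_setsI box_borel box_subset)

lemma box_intensity:
  assumes "j \<in> J"
  shows "emeasure (time_mark_intensity (real n * th) T) (A j) < \<infinity>"
    "measure (time_mark_intensity (real n * th) T) (A j) = real n * th * v j"
  using time_mark_intensity_area[OF box_borel box_subset area _ rates_nonneg(3)] assms area_pos[OF assms] by auto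

lemma measurable_count:
  assumes "i \<in> count_indices p J"
  shows "count i \<in> borel_measurable M"
proof -
  have measurable_point_count: "(\<lambda>\<omega>. point_count (N \<omega>) B) \<in> borel_measurable M"
    if "poisson_random_measure M \<nu> N" "B \<in> sets \<nu>" for N :: "'w \<Rightarrow> 'b measure" and \<nu> B
  proof -
    note [measurable] = measurable_random_measure[OF that]
    show ?thesis unfolding point_count_def measure_def by measurable
  qed
  note cells = time_cell_intensity(1)[OF T_pos _ rates_nonneg(1)] time_cell_intensity(1)[OF T_pos _ rates_nonneg(2)]
  show ?thesis
    using assms poisson_random_measures cells box_sets
    by (cases i) (auto simp: noise_count_def count_indices_def intro!: measurable_point_count)
qed

lemma joint_law:
  assumes I: "I \<subseteq> count_indices p J"
  shows "prob {\<omega> \<in> space M. \<forall>i\<in>I. count i \<omega> = real (\<kappa> i)} = (\<Prod>i\<in>I. poisson_weight (real n * mean_count i) (\<kappa> i))"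
proof -
  have vimage: "Arrivals -` I \<subseteq> {..<2 ^ p}" "Services -` I \<subseteq> {..<2 ^ p}" "Renegings -` I \<subseteq> J"
    using I by (auto simp: count_indices_def)
  have "finite (count_indices p J)" using finite_boxes by (rule finite_count_indices)
  then have "finite I" using I by (rule finite_subset[rotated])
  note cells = time_cell_intensity[OF T_pos _ rates_nonneg(1)] time_cell_intensity[OF T_pos _ rates_nonneg(2)]
  have "(\<forall>i\<in>I. Q i) \<longleftrightarrow> (\<forall>k\<in>Arrivals -` I. Q (Arrivals k)) \<and> (\<forall>k\<in>Services -` I. Q (Services k)) \<and>
      (\<forall>j\<in>Renegings -` I. Q (Renegings j))" for Q
    by (metis count_index.exhaust vimageE vimageI2)
  then have "prob {\<omega> \<in> space M. \<forall>i\<in>I. count i \<omega> = real (\<kappa> i)} =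
      prob {\<omega> \<in> space M. (\<forall>k\<in>Arrivals -` I. emeasure (N1 \<omega>) (time_cell T p k) = of_nat (\<kappa> (Arrivals k))) \<and>
        (\<forall>k\<in>Services -` I. emeasure (N2 \<omega>) (time_cell T p k) = of_nat (\<kappa> (Services k))) \<and>
        (\<forall>j\<in>Renegings -` I. emeasure (N3 \<omega>) (A j) = of_nat (\<kappa> (Renegings j)))}"
    by (simp add: noise_count_def point_count_eq_iff)
  also have "\<dots> =
      (\<Prod>k\<in>Arrivals -` I. poisson_weight (measure (time_intensity (real n * lam) T) (time_cell T p k)) (\<kappa> (Arrivals k))) *
      (\<Prod>k\<in>Services -` I. poisson_weight (measure (time_intensity (real n * mu) T) (time_cell T p k)) (\<kappa> (Services k))) *
      (\<Prod>j\<in>Renegings -` I. poisson_weight (measure (time_mark_intensity (real n * th) T) (A j)) (\<kappa> (Renegings j)))"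
  proof (rule mm1m_noise_joint[OF noise])
    show "disjoint_family_on (time_cell T p) K" for K
      using time_cell_disjoint[OF T_pos] by (auto simp: disjoint_family_on_def)
    then show "disjoint_family_on (time_cell T p) (Services -` I)" .
    show "disjoint_family_on A (Renegings -` I)" using disjoint_boxes vimage(3)
        by (rule disjoint_family_on_mono[rotated])
    show "finite (Arrivals -` I)" "finite (Services -` I)" "finite (Renegings -` I)"
      using vimage finite_boxes by (auto intro: finite_subset)
  qed (use vimage cells box_sets box_intensity in auto)
  also have "\<dots> = (\<Prod>i\<in>I. poisson_weight (real n * mean_count i) (\<kappa> i))"
    unfolding prod.count_index[OF \<open>finite I\<close>] noise_mean_def count_index.case
    using vimage cells box_intensity by (intro arg_cong2[where f="(*)"] prod.cong refl)
      (auto simp: mult.assoc subset_iff)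
  finally show ?thesis .
qed

sublocale counts: poisson_counts M "count_indices p J" count n mean_count
proof
  show "finite (count_indices p J)" using finite_boxes by (rule finite_count_indices)
  show "0 < mean_count i" if "i \<in> count_indices p J" for i
    using that lam_pos mu_pos th_pos T_pos area_pos by (auto simp: noise_mean_def count_indices_def)
qed (fact scale_pos measurable_count joint_law)+

lemma AE_finite_boxes: "AE \<omega> in M. \<forall>j\<in>J. emeasure (N3 \<omega>) (A j) < \<infinity>"
proof (rule AE_finite_allI[OF finite_boxes])
  fix j assume j: "j \<in> J"
  from AE_random_measure_nat[OF poisson_random_measures(3) box_sets[OF j] box_intensity(1)[OF j]]
  show "AE \<omega> in M. emeasure (N3 \<omega>) (A j) < \<infinity>" by eventually_elim (auto simp: ennreal_of_nat_eq_real_of_nat)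
qed

lemma total_relent_count:
  assumes times: "time_counts T n (N1 \<omega>)" "time_counts T n (N2 \<omega>)" and boxes: "\<And>j. j \<in> J \<Longrightarrow> emeasure (N3 \<omega>) (A j) < \<infinity>"
  shows "counts.total_relent (\<lambda>i. count i \<omega>) =
    (\<Sum>k<2 ^ p. relent (measure (N1 \<omega>) (time_cell T p k) / n) (lam * (T / 2 ^ p)))
    + (\<Sum>k<2 ^ p. relent (measure (N2 \<omega>) (time_cell T p k) / n) (mu * (T / 2 ^ p)))
    + (\<Sum>j\<in>J. relent (measure (N3 \<omega>) (A j) / n) (th * v j))"
proof -
  have "point_count \<nu> B = measure \<nu> B" if "time_counts T n \<nu>" for \<nu> B
    using finite_measure.emeasure_finite[OF time_counts.finite_measure[OF that]] by (simp add: point_count_def)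
  moreover have "point_count (N3 \<omega>) (A j) = measure (N3 \<omega>) (A j)" if "j \<in> J" for j
    using boxes[OF that] by (auto simp: point_count_def)
  ultimately show ?thesis
    unfolding sum.count_index[OF counts.finite_index] vimage_count_indices noise_count_def noise_mean_def
      count_index.case
    using times by simp
qed

end

section \<open>The upper bound\<close>

locale good_path_sequence = queue_rates lam mu th T for lam mu th T :: real +
  fixes m x0 :: real and n L :: "nat \<Rightarrow> nat" and \<nu>1 \<nu>2 :: "nat \<Rightarrow> real measure" and xs :: "nat \<Rightarrow> real"
    and \<nu>3 :: "nat \<Rightarrow> (real \<times> real) measure" and f g :: "nat \<Rightarrow> real \<Rightarrow> real"
  assumes good: "\<And>p. good_path T (n p) (\<nu>1 p) (\<nu>2 p) (xs p) (\<nu>3 p) (f p) (g p) lam mu th m (L p)"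
    and level_at_top: "filterlim L at_top sequentially" and scale_at_top: "filterlim n at_top sequentially"
    and initial_lim: "xs \<longlonglongrightarrow> x0"
begin

sublocale path: good_path T "n p" "\<nu>1 p" "\<nu>2 p" "xs p" "\<nu>3 p" "f p" "g p" lam mu th m "L p" for p
  by (rule good)

abbreviation arr :: "nat \<Rightarrow> real \<Rightarrow> real" where "arr p \<equiv> path.arrivals.cumulative p UNIV"
abbreviation srv :: "nat \<Rightarrow> real \<Rightarrow> real" where "srv p \<equiv> path.services.cumulative p UNIV"

lemma cost_nonneg: "0 \<le> m"
  using path.joint_cost_le[of 0 0 "\<lambda>_. 0" "\<lambda>_. 0" "\<lambda>_. 0"] by simp

lemma x0_nonneg: "0 \<le> x0"
  using path.initial_nonneg by (intro LIMSEQ_le_const[OF initial_lim]) auto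

lemma jump_tendsto_0: "(\<lambda>p. 1 / real (n p)) \<longlonglongrightarrow> 0"
  by (rule filterlim_compose[OF lim_1_over_n scale_at_top])

lemma mark_mesh_tendsto_0: "(\<lambda>p. 1 / 2 ^ L p) \<longlonglongrightarrow> (0::real)"
  by (rule filterlim_compose[OF mesh_tendsto_0 level_at_top])

lemma eventually_level_ge: "\<forall>\<^sub>F p in sequentially. q \<le> L p"
  using level_at_top by (simp add: filterlim_at_top)

lemma oscillation_tendsto_0: "path.oscillation \<longlonglongrightarrow> 0"
proof (rule tendsto_0_of_dual_bound)
  show "b * path.oscillation p \<le> 3 * m + exp b * ((lam + mu + th * real (L p)) * (T / 2 ^ L p))" if "0 < b" for p b
    using that by (rule path.oscillation_dual_bound)
  have "(\<lambda>p. (lam + mu + th * real p) * (T / 2 ^ p)) \<longlonglongrightarrow> 0" by real_asymp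
  then show "(\<lambda>p. (lam + mu + th * real (L p)) * (T / 2 ^ L p)) \<longlonglongrightarrow> 0" by (rule filterlim_compose[OF _ level_at_top])
qed (use cost_nonneg path.oscillation_nonneg in auto)

lemma strip_count_tendsto_0: "path.strip_count \<longlonglongrightarrow> 0"
proof (rule tendsto_0_of_dual_bound)
  show "b * path.strip_count p \<le> m + exp b * (th * T * (2 * path.oscillation p + 1 / n p + 2 / 2 ^ L p))" if "0 < b"
      for p b
    using that by (rule path.strip_count_dual_bound)
  have "(\<lambda>p. th * T * (2 * path.oscillation p + 1 / n p + 2 * (1 / 2 ^ L p))) \<longlonglongrightarrow> th * T * (2 * 0 + 0 + 2 * 0)"
    by (intro tendsto_intros oscillation_tendsto_0 jump_tendsto_0 mark_mesh_tendsto_0)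
  then show "(\<lambda>p. th * T * (2 * path.oscillation p + 1 / n p + 2 / 2 ^ L p)) \<longlonglongrightarrow> 0" by simp
qed (use cost_nonneg path.strip_count_nonneg in auto)

lemma eventually_reflection:
  assumes "0 < e"
  shows "\<forall>\<^sub>F p in sequentially. \<forall>t\<in>{0..T}. \<bar>f p t - skorohod_map (net_input x0 (arr p) (srv p) (g p)) t\<bar> \<le> e"
proof -
  have "\<forall>\<^sub>F p in sequentially. path.oscillation p < e / 4"
    using oscillation_tendsto_0 \<open>0 < e\<close> by (intro order_tendstoD) auto
  moreover have "\<forall>\<^sub>F p in sequentially. dist (xs p) x0 < e / 4" using initial_lim \<open>0 < e\<close> by (intro tendstoD) auto
  ultimately show ?thesis
  proof (eventually_elim, intro ballI)
    fix p t assume small: "path.oscillation p < e / 4" "dist (xs p) x0 < e / 4" and t: "t \<in> {0..T}"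
    have "\<bar>skorohod_map (net_input (xs p) (arr p) (srv p) (g p)) t
        - skorohod_map (net_input x0 (arr p) (srv p) (g p)) t\<bar> \<le> 2 * (e / 4)"
    proof (rule skorohod_map_lipschitz)
      fix s assume "s \<in> {0..t}"
      then have s: "s \<in> {0..T}" using t by auto
      have "0 \<le> arr p s" "srv p s \<le> srv p T" "g p s \<le> g p T"
        using mono_onD[OF path.arrivals.mono_counts, of 0 s p] mono_onD[OF path.services.mono_counts, of s T p]
          mono_onD[OF path.mono_reneging, of s T p] path.arrivals.cumulative_0 s T_pos by auto
      then show "- srv p T - g p T \<le> net_input (xs p) (arr p) (srv p) (g p) s"
        using path.initial_nonneg[of p] by (simp add: net_input_def)
      show "\<bar>net_input (xs p) (arr p) (srv p) (g p) s - net_input x0 (arr p) (srv p) (g p) s\<bar> \<le> e / 4"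
        using small(2) by (simp add: net_input_def dist_real_def)
    qed (use t in auto)
    then show "\<bar>f p t - skorohod_map (net_input x0 (arr p) (srv p) (g p)) t\<bar> \<le> e"
      using path.reflection_oscillation[OF t, of p] small(1) by linarith
  qed
qed

lemma eventually_renege_weight:
  assumes k: "k < 2 ^ q" and "0 < e"
  shows "\<forall>\<^sub>F p in sequentially. \<forall>h d. continuous_on {0..T} h \<longrightarrow> (\<forall>t\<in>{0..T}. \<bar>f p t - h t\<bar> \<le> d) \<longrightarrow>
    \<bar>path.renege_weight p q k - cell_integral T (\<lambda>t. th * h t) q k\<bar> \<le> th * d * (T / 2 ^ q) + e"
proof -
  have "(\<lambda>p. th * (2 * path.oscillation p + 1 / n p + 1 / 2 ^ L p) * (T / 2 ^ q)) \<longlonglongrightarrow> th * (2 * 0 + 0 + 0) * (T / 2 ^ q)"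
    by (intro tendsto_intros oscillation_tendsto_0 jump_tendsto_0 mark_mesh_tendsto_0)
  then have "\<forall>\<^sub>F p in sequentially. th * (2 * path.oscillation p + 1 / n p + 1 / 2 ^ L p) * (T / 2 ^ q) < e"
    using \<open>0 < e\<close> by (intro order_tendstoD(2)) auto
  then show ?thesis using eventually_level_ge[of q]
  proof (eventually_elim, intro allI impI)
    fix p h d
    assume small: "th * (2 * path.oscillation p + 1 / n p + 1 / 2 ^ L p) * (T / 2 ^ q) < e" and "q \<le> L p"
      and h: "continuous_on {0..T} h" "\<forall>t\<in>{0..T}. \<bar>f p t - h t\<bar> \<le> d"
    then have "\<bar>path.renege_weight p q k - cell_integral T (\<lambda>t. th * h t) q k\<bar>
        \<le> th * (d + (2 * path.oscillation p + 1 / n p + 1 / 2 ^ L p)) * (T / 2 ^ q)"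
      using k by (intro path.renege_weight_near) auto
    also have "\<dots> = th * d * (T / 2 ^ q) + th * (2 * path.oscillation p + 1 / n p + 1 / 2 ^ L p) * (T / 2 ^ q)"
      by (simp only: distrib_left distrib_right)
    finally show "\<bar>path.renege_weight p q k - cell_integral T (\<lambda>t. th * h t) q k\<bar> \<le> th * d * (T / 2 ^ q) + e"
      using small by linarith
  qed
qed

sublocale entropy_bounded lam mu th T x0 m arr srv g f path.renege_count path.renege_weight
proof unfold_locales
  show "(\<lambda>p. path.renege_count p q k - incr T (g p) q k) \<longlonglongrightarrow> 0" if k: "k < 2 ^ q" for q k
  proof (rule Lim_null_comparison[OF _ strip_count_tendsto_0])
    show "\<forall>\<^sub>F p in sequentially. norm (path.renege_count p q k - incr T (g p) q k) \<le> path.strip_count p"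
      using eventually_level_ge[of q] by eventually_elim (simp add: path.renege_count_near[OF _ k])
  qed
  show "\<forall>\<^sub>F p in sequentially. \<forall>b1 b2 b3. dual_cost T (arr p) (\<lambda>_. lam) q b1 + dual_cost T (srv p) (\<lambda>_. mu) q b2
      + dual_sum q b3 (path.renege_count p q) (path.renege_weight p q) \<le> m + e" if "0 < e" for q e
    using eventually_level_ge[of q]
    by eventually_elim (use that in \<open>auto intro!: order_trans[OF path.joint_cost_le]\<close>)
qed (fact x0_nonneg cost_nonneg path.arrivals.mono_counts path.services.mono_counts path.mono_reneging
    eventually_reflection eventually_renege_weight
  | simp add: path.arrivals.cumulative_0 path.services.cumulative_0 path.reneging_0)+

end

lemma space_borel_of: "space (borel_of X) = topspace X"
  unfolding borel_of_def by (intro space_measure_of) (auto dest: openin_subset)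

lemma borel_of_open: "openin X U \<Longrightarrow> U \<in> sets (borel_of X)"
  unfolding borel_of_def by (subst sets_measure_of) (auto dest: openin_subset)

lemma add_power_le_power_Suc:
  fixes a d :: real
  assumes "1 \<le> a" "0 \<le> d"
  shows "d + a ^ D \<le> (a + d) ^ Suc D"
proof -
  have "d * 1 + 1 * a ^ D \<le> d * (a + d) ^ D + a * (a + d) ^ D"
    using assms by (intro add_mono mult_mono power_mono one_le_power) auto
  then show ?thesis by (simp add: distrib_right)
qed

lemma limsup_elog_le:
  fixes P :: "nat \<Rightarrow> real" and C :: real
  assumes "0 \<le> C"
      and bound: "\<forall>\<^sub>F n in sequentially. 0 \<le> P n \<and> P n \<le> (real D + (real n * C + 2) ^ D) * exp (- (real n * m))"
  shows "limsup (\<lambda>n. ereal (1 / real n) * elog (P n)) \<le> - ereal m"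
proof -
  define E where "E = C + 2 + real D"
  define h where "h n = real (D + 1) * (ln (real n) + ln E) / real n - m" for n
  have "2 \<le> E" using \<open>0 \<le> C\<close> by (simp add: E_def)
  have "(\<lambda>n. real (D + 1) * (ln (real n) + ln E) / real n) \<longlonglongrightarrow> 0" by real_asymp
  then have "h \<longlonglongrightarrow> 0 - m" unfolding h_def by (intro tendsto_intros)
  then have lim: "(\<lambda>n. ereal (h n)) \<longlonglongrightarrow> ereal (- m)" by simp
  have "\<forall>\<^sub>F n in sequentially. ereal (1 / real n) * elog (P n) \<le> ereal (h n)"
    using bound eventually_gt_at_top[of 0]
  proof eventually_elim
    case (elim n)
    show ?case
    proof (cases "P n = 0")
      case True
      then show ?thesis using elim by (simp add: elog_def)
    next
      case False
      then have "0 < P n" using elim by simp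
      have "1 \<le> real n" using elim by simp
      define a where "a = real n * C + 2"
      have "2 \<le> a" using \<open>0 \<le> C\<close> by (simp add: a_def)
      have "a + real D \<le> real n * E"
        using mult_right_mono[OF \<open>1 \<le> real n\<close>, of "2 + real D"] by (simp add: a_def E_def algebra_simps)
      have "real D + a ^ D \<le> (a + real D) ^ (D + 1)"
        using \<open>2 \<le> a\<close> add_power_le_power_Suc[of a "real D" D] by simp
      also have "\<dots> \<le> (real n * E) ^ (D + 1)" using \<open>a + real D \<le> real n * E\<close> \<open>2 \<le> a\<close> by (intro power_mono) auto
      finally have "P n \<le> (real n * E) ^ (D + 1) * exp (- (real n * m))"
        using elim(1) unfolding a_def by (simp add: mult_right_mono order_trans[OF conjunct2])
      then have "ln (P n) \<le> ln ((real n * E) ^ (D + 1) * exp (- (real n * m)))" using \<open>0 < P n\<close> by (simp add: ln_mono)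
      also have "\<dots> = real (D + 1) * (ln (real n) + ln E) - real n * m"
        using elim(2) \<open>2 \<le> E\<close> by (simp add: ln_mult ln_realpow distrib_right)
      finally have "ln (P n) / real n \<le> (real (D + 1) * (ln (real n) + ln E) - real n * m) / real n"
        by (intro divide_right_mono) auto
      then show ?thesis using False elim(2) by (simp add: elog_def h_def diff_divide_distrib)
    qed
  qed
  then have "limsup (\<lambda>n. ereal (1 / real n) * elog (P n)) \<le> limsup (\<lambda>n. ereal (h n))" by (rule Limsup_mono)
  also have "\<dots> = ereal (- m)" by (rule lim_imp_Limsup[OF sequentially_bot lim])
  finally show ?thesis by simp
qed

lemma elog_nonpos: "0 \<le> p \<Longrightarrow> p \<le> 1 \<Longrightarrow> elog p \<le> 0"
  by (auto simp: elog_def)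

locale mm1m_system = queue_rates lam mu th T for lam mu th T :: real +
  fixes x0 :: real and x :: "nat \<Rightarrow> real" and M :: "nat \<Rightarrow> 'w measure" and N1 N2 :: "nat \<Rightarrow> 'w \<Rightarrow> real measure"
    and N3 :: "nat \<Rightarrow> 'w \<Rightarrow> (real \<times> real) measure" and X Y :: "nat \<Rightarrow> 'w \<Rightarrow> real \<Rightarrow> real"
  assumes initial_nonneg: "\<And>n. 0 < n \<Longrightarrow> 0 \<le> x n" and initial_lim: "x \<longlonglongrightarrow> x0"
    and prob: "\<And>n. 0 < n \<Longrightarrow> prob_space (M n)"
    and noise: "\<And>n. 0 < n \<Longrightarrow> mm1m_noise (M n) lam mu th T n (N1 n) (N2 n) (N3 n)"
    and measurable_path: "\<And>n. 0 < n \<Longrightarrow>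
      (\<lambda>\<omega>. path_pair T (X n \<omega>) (Y n \<omega>)) \<in> M n \<rightarrow>\<^sub>M borel_of (skorohod_topology T ({0..} \<times> {0..}))"
    and equations: "\<And>n. 0 < n \<Longrightarrow>
      AE \<omega> in M n. mm1m_equations T n (x n) (N1 n \<omega>) (N2 n \<omega>) (N3 n \<omega>) (X n \<omega>) (Y n \<omega>)"
begin

abbreviation path :: "nat \<Rightarrow> 'w \<Rightarrow> real \<Rightarrow> real \<times> real" where
  "path n \<omega> \<equiv> path_pair T (X n \<omega>) (Y n \<omega>)"

abbreviation path_space :: "(real \<Rightarrow> real \<times> real) topology" where
  "path_space \<equiv> skorohod_topology T ({0..} \<times> {0..})"

abbreviation log_prob :: "(real \<Rightarrow> real \<times> real) set \<Rightarrow> nat \<Rightarrow> ereal" where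
  "log_prob F n \<equiv> ereal (1 / real n) * elog (measure (M n) {\<omega> \<in> space (M n). path n \<omega> \<in> F})"

lemma x0_nonneg: "0 \<le> x0"
  using initial_nonneg by (intro LIMSEQ_le_const[OF initial_lim]) (auto intro!: exI[of _ 1])

lemma topspace_path_space: "topspace path_space = cadlag_space T ({0..} \<times> {0..})"
  using T_pos by (simp add: topspace_skorohod)

lemma sample_path_cadlag: "0 < n \<Longrightarrow> \<omega> \<in> space (M n) \<Longrightarrow> path n \<omega> \<in> cadlag_space T ({0..} \<times> {0..})"
  using measurable_space[OF measurable_path] by (simp add: space_borel_of topspace_path_space)

lemma sets_path_event:
  assumes "0 < n" and F: "F \<in> sets (borel_of path_space)"
  shows "{\<omega> \<in> space (M n). path n \<omega> \<in> F} \<in> sets (M n)"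
proof -
  have "(\<lambda>\<omega>. path n \<omega>) -` F \<inter> space (M n) \<in> sets (M n)" using measurable_path[OF \<open>0 < n\<close>] F by (rule measurable_sets)
  also have "(\<lambda>\<omega>. path n \<omega>) -` F \<inter> space (M n) = {\<omega> \<in> space (M n). path n \<omega> \<in> F}" by auto
  finally show ?thesis .
qed

lemma queue_noise: "0 < n \<Longrightarrow> queue_noise (M n) lam mu th T n (N1 n) (N2 n) (N3 n)"
  using prob noise queue_rates_axioms by (simp add: queue_noise_def queue_noise_axioms_def)

lemma AE_queue_path:
  assumes "0 < n"
  shows "AE \<omega> in M n. queue_path T n (N1 n \<omega>) (N2 n \<omega>) (x n) (N3 n \<omega>) (X n \<omega>) (Y n \<omega>)"
proof -
  interpret queue_noise "M n" lam mu th T n "N1 n" "N2 n" "N3 n" using assms by (rule queue_noise)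
  show ?thesis using assms initial_nonneg sample_path_cadlag equations by (intro AE_queue_path) auto
qed

abbreviation grid_index :: "nat \<Rightarrow> (nat \<times> nat) set" where
  "grid_index p \<equiv> {..<2 ^ p} \<times> {..<p * 2 ^ p}"

abbreviation indexed_box :: "nat \<Rightarrow> nat \<times> nat \<Rightarrow> (real \<times> real) set" where
  "indexed_box p \<equiv> \<lambda>(k, i). grid_box T p k i"

lemma noise_grid_boxes:
  assumes "0 < n"
  shows "noise_boxes (M n) lam mu th T n (N1 n) (N2 n) (N3 n) (grid_index p) (indexed_box p) (\<lambda>_. T / 2 ^ p / 2 ^ p)"
proof -
  interpret queue_noise "M n" lam mu th T n "N1 n" "N2 n" "N3 n" using assms by (rule queue_noise)
  show ?thesis
  proof
    show "disjoint_family_on (indexed_box p) (grid_index p)"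
      using grid_box_disjoint[OF T_pos] by (fastforce simp: disjoint_family_on_def)
    show "indexed_box p j \<subseteq> {0..T} \<times> {0..}" if "j \<in> grid_index p" for j
      using that by (cases j) (simp add: grid_box_subset[OF T_pos])
    show "emeasure lborel (indexed_box p j) = ennreal (T / 2 ^ p / 2 ^ p)" if "j \<in> grid_index p" for j
    proof -
      have "real i / 2 ^ p \<le> real (Suc i) / 2 ^ p" for i by (intro divide_right_mono) auto
      then have "emeasure lborel (mark_cell p i) = ennreal (1 / 2 ^ p)" for i
        by (simp add: mark_cell_def diff_divide_distrib[symmetric])
      moreover have "time_cell T p k \<in> sets borel" "mark_cell p i \<in> sets borel" for k i
        by (auto simp: time_cell_def mark_cell_def)
      ultimately show ?thesis
        using T_pos
          by (auto simp: grid_box_def emeasure_lborel_Times emeasure_time_cell ennreal_mult[symmetric]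
            split: prod.splits)
    qed
  qed (use T_pos in \<open>auto split: prod.splits\<close>)
qed

definition grid_cost :: "nat \<Rightarrow> nat \<Rightarrow> 'w \<Rightarrow> real" where
  "grid_cost n p \<omega> = (\<Sum>i\<in>count_indices p (grid_index p).
     relent (noise_count T p (indexed_box p) (N1 n \<omega>) (N2 n \<omega>) (N3 n \<omega>) i / real n)
       (noise_mean lam mu th T p (\<lambda>_. T / 2 ^ p / 2 ^ p) i))"

lemma AE_good_path:
  assumes n: "0 < n" and "x n + m + 2 * lam * T + 1 \<le> real p"
  shows "AE \<omega> in M n. grid_cost n p \<omega> \<le> m \<longrightarrow>
    good_path T n (N1 n \<omega>) (N2 n \<omega>) (x n) (N3 n \<omega>) (X n \<omega>) (Y n \<omega>) lam mu th m p"
proof -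
  interpret boxes: noise_boxes "M n" lam mu th T n "N1 n" "N2 n" "N3 n" p "grid_index p" "indexed_box p"
      "\<lambda>_. T / 2 ^ p / 2 ^ p"
    by (rule noise_grid_boxes[OF n])
  show ?thesis
    using AE_queue_path[OF n] boxes.AE_finite_boxes
  proof (eventually_elim, intro impI)
    fix \<omega> assume queue: "queue_path T n (N1 n \<omega>) (N2 n \<omega>) (x n) (N3 n \<omega>) (X n \<omega>) (Y n \<omega>)"
      and finite: "\<forall>j\<in>grid_index p. emeasure (N3 n \<omega>) (indexed_box p j) < \<infinity>" and cost: "grid_cost n p \<omega> \<le> m"
    interpret queue_path T n "N1 n \<omega>" "N2 n \<omega>" "x n" "N3 n \<omega>" "X n \<omega>" "Y n \<omega>" by (rule queue)
    show "good_path T n (N1 n \<omega>) (N2 n \<omega>) (x n) (N3 n \<omega>) (X n \<omega>) (Y n \<omega>) lam mu th m p"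
    proof
      have "grid_cost n p \<omega> = (\<Sum>k<2 ^ p. relent (measure (N1 n \<omega>) (time_cell T p k) / n) (lam * (T / 2 ^ p)))
        + (\<Sum>k<2 ^ p. relent (measure (N2 n \<omega>) (time_cell T p k) / n) (mu * (T / 2 ^ p)))
        + (\<Sum>j\<in>grid_index p. relent (measure (N3 n \<omega>) (indexed_box p j) / n) (th * (T / 2 ^ p / 2 ^ p)))"
        unfolding grid_cost_def
        using finite by (intro boxes.total_relent_count arrivals.time_counts_axioms services.time_counts_axioms) auto
      then show "(\<Sum>k<2 ^ p. relent (measure (N1 n \<omega>) (time_cell T p k) / n) (lam * (T / 2 ^ p)))
        + (\<Sum>k<2 ^ p. relent (measure (N2 n \<omega>) (time_cell T p k) / n) (mu * (T / 2 ^ p)))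
        + (\<Sum>k<2 ^ p. \<Sum>i<p * 2 ^ p. relent (measure (N3 n \<omega>) (grid_box T p k i) / n) (th * (T / 2 ^ p) / 2 ^ p)) \<le> m"
        using cost by (simp add: sum.cartesian_product case_prod_beta)
    qed (use assms finite in \<open>auto split: prod.splits\<close>)
  qed
qed

lemma ex_good_path:
  assumes small: "\<exists>\<^sub>F n in sequentially. \<not> (AE \<omega> in M n. path n \<omega> \<in> F \<longrightarrow> m \<le> grid_cost n p \<omega>)"
    and fine: "\<And>n. x n + m + 2 * lam * T + 1 \<le> real p"
  shows "\<exists>n\<ge>q. \<exists>\<omega>. path n \<omega> \<in> F \<and>
    good_path T n (N1 n \<omega>) (N2 n \<omega>) (x n) (N3 n \<omega>) (X n \<omega>) (Y n \<omega>) lam mu th m p"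
proof (rule ccontr)
  assume none: "\<not> ?thesis"
  obtain n where n: "max 1 q \<le> n" and not_AE: "\<not> (AE \<omega> in M n. path n \<omega> \<in> F \<longrightarrow> m \<le> grid_cost n p \<omega>)"
    using small unfolding frequently_sequentially by blast
  then have "0 < n" "q \<le> n" by simp_all
  have "AE \<omega> in M n. path n \<omega> \<in> F \<longrightarrow> m \<le> grid_cost n p \<omega>"
    using AE_good_path[OF \<open>0 < n\<close> fine]
  proof eventually_elim
    case (elim \<omega>)
    then show ?case using none \<open>q \<le> n\<close> by (meson linear)
  qed
  then show False using not_AE by contradiction
qed

lemma rate_le_of_grid_costs:
  assumes F: "closedin path_space F" and "0 \<le> m"
    and small: "\<And>p. \<exists>\<^sub>F n in sequentially. \<not> (AE \<omega> in M n. path n \<omega> \<in> F \<longrightarrow> m \<le> grid_cost n p \<omega>)"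
  shows "\<exists>z\<in>F. mm1m_rate lam mu th x0 T z \<le> ennreal m"
proof -
  obtain b where b: "\<And>n. x n \<le> b"
    using convergent_imp_Bseq[OF convergentI[OF initial_lim]] unfolding Bseq_def by (auto simp: abs_le_iff)
  define L where "L p = nat \<lceil>b + m + 2 * lam * T + 1\<rceil> + p" for p
  have fine: "x n + m + 2 * lam * T + 1 \<le> real (L p)" for n p
  proof -
    have "b + m + 2 * lam * T + 1 \<le> real (L p)" unfolding L_def by linarith
    then show ?thesis using b[of n] by simp
  qed
  have "\<exists>n \<omega>. p \<le> n \<and> path n \<omega> \<in> F \<and>
      good_path T n (N1 n \<omega>) (N2 n \<omega>) (x n) (N3 n \<omega>) (X n \<omega>) (Y n \<omega>) lam mu th m (L p)" for p
    using ex_good_path[OF small fine] by blast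
  then obtain n \<omega> where seq: "\<And>p. p \<le> n p" "\<And>p. path (n p) (\<omega> p) \<in> F"
    and good: "\<And>p. good_path T (n p) (N1 (n p) (\<omega> p)) (N2 (n p) (\<omega> p)) (x (n p)) (N3 (n p) (\<omega> p)) (X (n p) (\<omega> p))
          (Y (n p) (\<omega> p)) lam mu th m (L p)"
    by metis
  have n_lim: "filterlim n at_top sequentially"
    using seq(1) by (intro filterlim_at_top_mono[OF filterlim_ident]) auto
  interpret good_path_sequence lam mu th T m x0 n L "\<lambda>p. N1 (n p) (\<omega> p)" "\<lambda>p. N2 (n p) (\<omega> p)" "\<lambda>p. x (n p)"
    "\<lambda>p. N3 (n p) (\<omega> p)" "\<lambda>p. X (n p) (\<omega> p)" "\<lambda>p. Y (n p) (\<omega> p)"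
  proof (intro good_path_sequence.intro good_path_sequence_axioms.intro)
    show "filterlim L at_top sequentially"
      unfolding L_def by (intro filterlim_at_top_mono[OF filterlim_ident]) auto
  qed (fact queue_rates_axioms good n_lim filterlim_compose[OF initial_lim n_lim])+
  obtain r \<xi> \<zeta> where control: "has_control_within lam mu th x0 T \<xi> \<zeta> m"
    and lim: "uniform_limit {0..T} (\<lambda>i. X (n (r i)) (\<omega> (r i))) \<xi> sequentially"
        "uniform_limit {0..T} (\<lambda>i. Y (n (r i)) (\<omega> (r i))) \<zeta> sequentially"
    by (rule limit_has_control)
  obtain a s where "entropy_path lam mu th T x0 m a s \<xi> \<zeta>"
    using has_control_within_imp_entropy_path[OF control \<open>0 \<le> m\<close>] .
  then interpret limit: entropy_path lam mu th T x0 m a s \<xi> \<zeta> .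
  have "limitin path_space (\<lambda>i. path (n (r i)) (\<omega> (r i))) (path_pair T \<xi> \<zeta>) sequentially"
  proof (rule limitin_skorohod_of_uniform_limit[OF _ _ limit.path_cadlag])
    show "path (n (r i)) (\<omega> (r i)) \<in> cadlag_space T ({0..} \<times> {0..})" for i
      using seq(2) closedin_subset[OF F] topspace_path_space by blast
    show "uniform_limit {0..T} (\<lambda>i t. fst (path (n (r i)) (\<omega> (r i)) t)) \<xi> sequentially"
      using lim(1) by (rule uniform_limit_cong'[THEN iffD1, rotated -1]) (auto simp: path_pair_def)
    show "uniform_limit {0..T} (\<lambda>i t. snd (path (n (r i)) (\<omega> (r i)) t)) \<zeta> sequentially"
      using lim(2) by (rule uniform_limit_cong'[THEN iffD1, rotated -1]) (auto simp: path_pair_def)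
  qed (use T_pos in simp)
  then have "path_pair T \<xi> \<zeta> \<in> F" using F seq(2) by (intro limitin_closedin) auto
  then show ?thesis using limit.mm1m_rate_path_pair_le by blast
qed

lemma eventually_grid_cost_ge:
  assumes F: "closedin path_space F" and "0 \<le> m" and "\<And>z. z \<in> F \<Longrightarrow> ennreal m < mm1m_rate lam mu th x0 T z"
  obtains p where "\<forall>\<^sub>F n in sequentially. AE \<omega> in M n. path n \<omega> \<in> F \<longrightarrow> m \<le> grid_cost n p \<omega>"
proof -
  have "\<not> (\<exists>z\<in>F. mm1m_rate lam mu th x0 T z \<le> ennreal m)" using assms(3) by (auto simp: not_le)
  then have "\<exists>p. \<not> (\<exists>\<^sub>F n in sequentially. \<not> (AE \<omega> in M n. path n \<omega> \<in> F \<longrightarrow> m \<le> grid_cost n p \<omega>))"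
    using rate_le_of_grid_costs[OF F \<open>0 \<le> m\<close>] by blast
  then show thesis using that by (auto simp: not_frequently)
qed

lemma limsup_log_prob_le:
  assumes F: "closedin path_space F" and "0 \<le> m" and rate: "\<And>z. z \<in> F \<Longrightarrow> ennreal m < mm1m_rate lam mu th x0 T z"
  shows "limsup (log_prob F) \<le> - ereal m"
proof -
  obtain p where p: "\<forall>\<^sub>F n in sequentially. AE \<omega> in M n. path n \<omega> \<in> F \<longrightarrow> m \<le> grid_cost n p \<omega>"
    using eventually_grid_cost_ge[OF assms] .
  define \<nu> :: "(nat \<times> nat) count_index \<Rightarrow> real" where "\<nu> = noise_mean lam mu th T p (\<lambda>_. T / 2 ^ p / 2 ^ p)"
  let ?J = "count_indices p (grid_index p)"
  have intensities_nonneg: "0 \<le> sum \<nu> ?J"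
  proof -
    interpret boxes: noise_boxes "M 1" lam mu th T 1 "N1 1" "N2 1" "N3 1" p "grid_index p" "indexed_box p"
        "\<lambda>_. T / 2 ^ p / 2 ^ p"
      by (rule noise_grid_boxes) simp
    show ?thesis using boxes.counts.intensity_pos unfolding \<nu>_def by (intro sum_nonneg) (auto intro: less_imp_le)
  qed
  show ?thesis
  proof (rule limsup_elog_le)
    show "0 \<le> \<bar>m\<bar> + 2 * sum \<nu> ?J" using intensities_nonneg by simp
    show "\<forall>\<^sub>F n in sequentially. 0 \<le> measure (M n) {\<omega> \<in> space (M n). path n \<omega> \<in> F} \<and>
        measure (M n) {\<omega> \<in> space (M n). path n \<omega> \<in> F}
          \<le> (real (card ?J) + (real n * (\<bar>m\<bar> + 2 * sum \<nu> ?J) + 2) ^ card ?J) * exp (- (real n * m))"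
      using p eventually_gt_at_top[of 0]
    proof eventually_elim
      case (elim n)
      interpret boxes: noise_boxes "M n" lam mu th T n "N1 n" "N2 n" "N3 n" p "grid_index p" "indexed_box p"
          "\<lambda>_. T / 2 ^ p / 2 ^ p"
        using elim(2) by (rule noise_grid_boxes)
      have "grid_cost n p \<in> borel_measurable (M n)"
        unfolding grid_cost_def[abs_def] relent_def using boxes.measurable_count
        by (intro borel_measurable_sum borel_measurable_add borel_measurable_diff borel_measurable_times
            borel_measurable_ln borel_measurable_divide) auto
      then have "measure (M n) {\<omega> \<in> space (M n). path n \<omega> \<in> F} \<le> measure (M n) {\<omega> \<in> space (M n). m \<le> grid_cost n p \<omega>}"
        using elim(1) by (intro boxes.finite_measure_mono_AE) auto
      also have "\<dots> \<le> (real (card ?J) + (real n * (\<bar>m\<bar> + 2 * sum \<nu> ?J) + 2) ^ card ?J) * exp (- (real n * m))"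
        unfolding grid_cost_def \<nu>_def by (rule boxes.counts.prob_total_relent_ge_le)
      finally show ?case by simp
    qed
  qed
qed

lemma limsup_log_prob_nonpos: "limsup (log_prob F) \<le> 0"
proof -
  have "\<forall>\<^sub>F n in sequentially. log_prob F n \<le> 0"
    using eventually_gt_at_top[of 0]
  proof eventually_elim
    case (elim n)
    interpret prob_space "M n" using elim by (rule prob)
    have "elog (prob {\<omega> \<in> space (M n). path n \<omega> \<in> F}) \<le> 0" by (intro elog_nonpos) auto
    then show ?case by (simp add: ereal_mult_le_0_iff)
  qed
  then show ?thesis by (rule Limsup_bounded)
qed

theorem ldp_upper_bound:
  assumes F: "closedin path_space F"
  shows "limsup (log_prob F) \<le> - (INF z\<in>F. enn2ereal (mm1m_rate lam mu th x0 T z))"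
proof -
  define I where "I = (INF z\<in>F. enn2ereal (mm1m_rate lam mu th x0 T z))"
  have "ereal m \<le> - limsup (log_prob F)" if m: "ereal m < I" for m
  proof (cases "0 \<le> m")
    case True
    have "ennreal m < mm1m_rate lam mu th x0 T z" if "z \<in> F" for z
    proof -
      have "ereal m < enn2ereal (mm1m_rate lam mu th x0 T z)" using m that unfolding I_def
          by (meson INF_lower less_le_trans)
      then show ?thesis using True
        by (cases "mm1m_rate lam mu th x0 T z") (auto simp: ennreal_less_iff enn2ereal_ennreal)
    qed
    from limsup_log_prob_le[OF F True this] show ?thesis
      using ereal_minus_le_minus[of "- limsup (log_prob F)" "ereal m"] by simp
  next
    case False
    then have "ereal m \<le> - 0" by simp
    also have "\<dots> \<le> - limsup (log_prob F)" using limsup_log_prob_nonpos by (simp only: ereal_minus_le_minus)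
    finally show ?thesis .
  qed
  then have "\<not> - limsup (log_prob F) < I" using ereal_dense2 by (force simp: not_le[symmetric])
  then show ?thesis unfolding I_def[symmetric] using ereal_minus_le_minus[of "- limsup (log_prob F)" I] by simp
qed

end

section \<open>Tracking a path of finite cost\<close>

locale tracking_grid = entropy_path lam mu th T x0 c a s \<xi> \<zeta>
  for lam mu th T x0 c :: real and a s \<xi> \<zeta> :: "real \<Rightarrow> real" +
  fixes p :: nat and \<eta> \<delta> \<epsilon> z :: real
  assumes margin_pos: "0 < \<eta>" and threshold: "3 * \<eta> < \<delta>" and small_jumps: "8 * \<epsilon> < \<eta>"
    and \<xi>_near_grid: "\<And>k t. k < 2 ^ p \<Longrightarrow> t \<in> {tgrid T p k..tgrid T p (Suc k)} \<Longrightarrow> \<bar>\<xi> t - \<xi> (tgrid T p k)\<bar> \<le> \<eta>"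
    and incr_a_le: "\<And>k. k < 2 ^ p \<Longrightarrow> incr T a p k \<le> \<epsilon>" and incr_s_le: "\<And>k. k < 2 ^ p \<Longrightarrow> incr T s p k \<le> \<epsilon>"
    and incr_\<zeta>_le: "\<And>k. k < 2 ^ p \<Longrightarrow> incr T \<zeta> p k \<le> \<epsilon>"
    and skipped_sum_le: "(\<Sum>k<2 ^ p. if \<delta> \<le> \<xi> (tgrid T p k) then 0 else incr T \<zeta> p k) \<le> z"
begin

text \<open>Reneging is only imitated on the cells where \<open>\<xi>\<close> is at least \<open>\<delta>\<close>; the remaining reneging, at most \<open>z\<close>,
  is skipped, so that the queue may exceed \<open>\<xi>\<close> by \<open>2 z + \<eta>\<close>.  All required reneging comes from marks below
  \<open>renege_level\<close>, and there are no points between \<open>renege_level\<close> and \<open>top_level\<close>.\<close>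

definition renege_level :: "nat \<Rightarrow> real" where
  "renege_level k = (if \<delta> \<le> \<xi> (tgrid T p k) then \<xi> (tgrid T p k) - 3 * \<eta> else 0)"

definition top_level :: "nat \<Rightarrow> real" where
  "top_level k = \<xi> (tgrid T p k) + \<eta> + (2 * z + \<eta>)"

definition renege_box :: "nat \<Rightarrow> (real \<times> real) set" where
  "renege_box k = time_cell T p k \<times> {0..<renege_level k}"

definition void_box :: "nat \<Rightarrow> (real \<times> real) set" where
  "void_box k = time_cell T p k \<times> {renege_level k..top_level k}"

definition imitated :: "nat \<Rightarrow> real" where
  "imitated k = (if \<delta> \<le> \<xi> (tgrid T p k) then incr T \<zeta> p k else 0)"

definition skipped :: "nat \<Rightarrow> real" where
  "skipped k = (if \<delta> \<le> \<xi> (tgrid T p k) then 0 else incr T \<zeta> p k)"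

definition cells_until :: "real \<Rightarrow> nat" where
  "cells_until t = nat \<lfloor>t * 2 ^ p / T\<rfloor>"

definition skipped_until :: "real \<Rightarrow> real" where
  "skipped_until t = (\<Sum>k<cells_until t. skipped k)"

lemma skipped_nonneg: "k < 2 ^ p \<Longrightarrow> 0 \<le> skipped k"
  using incr_nonneg[OF mono_\<zeta> T_pos] by (simp add: skipped_def)

lemma skipped_total_nonneg: "0 \<le> z"
proof -
  have "0 \<le> (\<Sum>k<2 ^ p. skipped k)" by (intro sum_nonneg skipped_nonneg) simp
  then show ?thesis using skipped_sum_le by (simp add: skipped_def)
qed

lemma jump_nonneg: "0 \<le> \<epsilon>"
  using incr_nonneg[OF mono_a T_pos, of 0 p] incr_a_le[of 0] by simp

lemma \<xi>_grid_nonneg: "k < 2 ^ p \<Longrightarrow> 0 \<le> \<xi> (tgrid T p k)"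
  using tgrid_cell[OF T_pos] by (intro \<xi>_nonneg)

lemma levels:
  assumes "k < 2 ^ p"
  shows "0 \<le> renege_level k" "renege_level k < top_level k"
  using \<xi>_grid_nonneg[OF assms] margin_pos threshold skipped_total_nonneg
  by (auto simp: renege_level_def top_level_def)

lemma cells_until_le:
  assumes "t \<in> {0..T}"
  shows "cells_until t \<le> 2 ^ p"
proof -
  have "t * 2 ^ p / T \<le> 2 ^ p" using assms T_pos by (simp add: field_simps)
  then have "\<lfloor>t * 2 ^ p / T\<rfloor> \<le> 2 ^ p" using floor_mono[of "t * 2 ^ p / T" "2 ^ p"] by simp
  then show ?thesis by (simp add: cells_until_def nat_le_iff)
qed

lemma cells_until_tgrid: "cells_until (tgrid T p k) = k"
  using T_pos by (simp add: cells_until_def tgrid_def)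

lemma mono_skipped_until: "mono_on {0..T} skipped_until"
proof (rule mono_onI)
  fix r t assume rt: "r \<in> {0..T}" "t \<in> {0..T}" "r \<le> t"
  have "cells_until r \<le> cells_until t"
    unfolding cells_until_def using rt T_pos by (intro nat_mono floor_mono divide_right_mono mult_right_mono) auto
  then show "skipped_until r \<le> skipped_until t"
    unfolding skipped_until_def using cells_until_le[OF rt(2)] by (intro sum_mono2) (auto intro: skipped_nonneg)
qed

lemma skipped_until_bounds:
  assumes "t \<in> {0..T}"
  shows "0 \<le> skipped_until t" "skipped_until t \<le> z"
proof -
  show "0 \<le> skipped_until t"
    unfolding skipped_until_def using cells_until_le[OF assms] by (intro sum_nonneg skipped_nonneg) auto
  have "skipped_until t \<le> (\<Sum>k<2 ^ p. skipped k)"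
    unfolding skipped_until_def using cells_until_le[OF assms] by (intro sum_mono2) (auto intro: skipped_nonneg)
  then show "skipped_until t \<le> z" using skipped_sum_le by (simp add: skipped_def)
qed

lemma skipped_until_0: "skipped_until 0 = 0"
  by (simp add: skipped_until_def cells_until_def)

lemma incr_skipped_until: "incr T skipped_until p k = skipped k"
  by (simp add: incr_def skipped_until_def cells_until_tgrid)

lemma net_input_ge:
  assumes t: "t \<in> {0..T}"
  shows "x0 - s T - \<zeta> T \<le> net_input x0 a s \<zeta> t"
  using mono_onD[OF mono_a, of 0 t] mono_onD[OF mono_s, of t T] mono_onD[OF mono_\<zeta>, of t T] t start T_pos
  by (auto simp: net_input_def)

lemma skorohod_map_skipped:
  assumes t: "t \<in> {0..T}"
  shows "\<xi> t \<le> skorohod_map (\<lambda>r. net_input x0 a s \<zeta> r + skipped_until r) t"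
    "skorohod_map (\<lambda>r. net_input x0 a s \<zeta> r + skipped_until r) t \<le> \<xi> t + 2 * z"
proof -
  have mem: "u \<in> {0..T}" if "u \<in> {0..t}" for u using that t by auto
  show "\<xi> t \<le> skorohod_map (\<lambda>r. net_input x0 a s \<zeta> r + skipped_until r) t"
    unfolding reflected[OF t]
    using t mem
    by (intro skorohod_map_add_mono[where b="x0 - s T - \<zeta> T"] net_input_ge skipped_until_bounds
      mono_onD[OF mono_skipped_until]) auto
  have "\<bar>skorohod_map (net_input x0 a s \<zeta>) t - skorohod_map (\<lambda>r. net_input x0 a s \<zeta> r + skipped_until r) t\<bar> \<le> 2 * z"
    using t mem skipped_until_bounds by (intro skorohod_map_lipschitz[where b="x0 - s T - \<zeta> T"] net_input_ge) auto
  then show "skorohod_map (\<lambda>r. net_input x0 a s \<zeta> r + skipped_until r) t \<le> \<xi> t + 2 * z"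
    unfolding reflected[OF t] by linarith
qed

end

text \<open>Continuous induction: the first exit from the closed strip would happen at a time when the path is in the
  interior of the strip.\<close>

lemma right_continuous_barrier:
  fixes h :: "real \<Rightarrow> real"
  assumes right_cont: "\<And>t. t \<in> {0..<T} \<Longrightarrow> (h \<longlongrightarrow> h t) (at_right t)"
    and interior: "\<And>t. t \<in> {0..T} \<Longrightarrow> (\<And>u. u \<in> {0..<t} \<Longrightarrow> h u \<in> {l..r}) \<Longrightarrow> h t \<in> {l<..<r}"
    and t: "t \<in> {0..T}"
  shows "h t \<in> {l..r}"
proof -
  define exits where "exits = {t \<in> {0..T}. h t \<notin> {l..r}}"
  have "exits = {}"
  proof (rule ccontr)
    assume nonempty: "exits \<noteq> {}"
    define \<tau> where "\<tau> = Inf exits"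
    have bdd: "bdd_below exits" by (rule bdd_belowI[of _ 0]) (auto simp: exits_def)
    have lower: "\<tau> \<le> u" if "u \<in> exits" for u unfolding \<tau>_def using that bdd by (rule cInf_lower)
    have "0 \<le> \<tau>" unfolding \<tau>_def using nonempty by (intro cInf_greatest) (auto simp: exits_def)
    obtain b where b: "b \<in> exits" using nonempty by blast
    have \<tau>: "\<tau> \<in> {0..T}" using b lower[OF b] \<open>0 \<le> \<tau>\<close> by (auto simp: exits_def)
    have at_\<tau>: "h \<tau> \<in> {l<..<r}"
    proof (rule interior[OF \<tau>])
      fix u assume u: "u \<in> {0..<\<tau>}"
      then have "u \<notin> exits" using lower by force
      then show "h u \<in> {l..r}" using u \<tau> by (auto simp: exits_def)
    qed
    then have "\<tau> \<notin> exits" by (auto simp: exits_def)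
    then have "\<tau> < b" using lower[OF b] b by (cases "\<tau> = b") auto
    then have "\<tau> \<in> {0..<T}" using b \<tau> by (auto simp: exits_def)
    then have "\<forall>\<^sub>F u in at_right \<tau>. h u \<in> {l<..<r}" using right_cont at_\<tau> by (intro topological_tendstoD) auto
    then obtain v where v: "\<tau> < v" "\<And>u. \<tau> < u \<Longrightarrow> u < v \<Longrightarrow> h u \<in> {l<..<r}"
      unfolding eventually_at_right_field by blast
    have "v \<le> u" if "u \<in> exits" for u
    proof (rule ccontr)
      assume "\<not> v \<le> u"
      moreover have "\<tau> < u" using that lower[OF that] \<open>\<tau> \<notin> exits\<close> by (cases "\<tau> = u") auto
      ultimately have "h u \<in> {l<..<r}" using v(2) by simp
      then show False using that by (auto simp: exits_def)
    qed
    then have "v \<le> \<tau>" unfolding \<tau>_def using nonempty by (intro cInf_greatest)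
    then show False using v(1) by simp
  qed
  then show ?thesis using t by (auto simp: exits_def)
qed

locale tracking_path = tracking_grid lam mu th T x0 c a s \<xi> \<zeta> p \<eta> \<delta> \<epsilon> z + queue_path T n \<nu>1 \<nu>2 xn \<nu>3 f g
  for lam mu th T x0 c :: real and a s \<xi> \<zeta> :: "real \<Rightarrow> real" and p :: nat and \<eta> \<delta> \<epsilon> z :: real
    and n :: nat and \<nu>1 \<nu>2 :: "real measure" and xn :: real and \<nu>3 :: "(real \<times> real) measure" and f g :: "real \<Rightarrow> real" +
  assumes jump_le: "1 / n \<le> \<eta>"
    and tracking_error: "2 * (\<bar>xn - x0\<bar> + 3 * (2 ^ p / n + \<epsilon>)) + 2 * (\<epsilon> + 1 / n) < \<eta>"
    and arrivals_close: "\<And>k. k < 2 ^ p \<Longrightarrow> \<bar>measure \<nu>1 (time_cell T p k) / n - incr T a p k\<bar> \<le> 1 / n"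
    and services_close: "\<And>k. k < 2 ^ p \<Longrightarrow> \<bar>measure \<nu>2 (time_cell T p k) / n - incr T s p k\<bar> \<le> 1 / n"
    and renege_box_finite: "\<And>k. k < 2 ^ p \<Longrightarrow> emeasure \<nu>3 (renege_box k) < \<infinity>"
    and reneging_close: "\<And>k. k < 2 ^ p \<Longrightarrow> \<bar>measure \<nu>3 (renege_box k) / n - imitated k\<bar> \<le> 1 / n"
    and void_box_null: "\<And>k. k < 2 ^ p \<Longrightarrow> emeasure \<nu>3 (void_box k) = 0"
begin

definition planned :: "(real \<times> real) set" where
  "planned = (\<Union>k<2 ^ p. renege_box k)"

lemma sets_renege_box: "k < 2 ^ p \<Longrightarrow> renege_box k \<in> sets \<nu>3"
  using time_cell_subset[OF T_pos, of k p] unfolding renege_box_def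
  by (intro sets_renegingI Times_borel) (auto simp: time_cell_def)

lemma sets_void_box: "k < 2 ^ p \<Longrightarrow> void_box k \<in> sets \<nu>3"
  using time_cell_subset[OF T_pos, of k p] levels(1)[of k] unfolding void_box_def
  by (intro sets_renegingI Times_borel) (auto simp: time_cell_def)

lemma planned_fmeasurable: "planned \<in> fmeasurable \<nu>3"
  unfolding planned_def using renege_box_finite
  by (intro fmeasurable.finite_UN) (auto intro: fmeasurableI sets_renege_box)

lemma planned_slice: "k < 2 ^ p \<Longrightarrow> planned \<inter> time_cell T p k \<times> UNIV = renege_box k"
  using time_cell_disjoint[OF T_pos, of _ k p] unfolding planned_def renege_box_def by fastforce

lemma arrivals_near: "t \<in> {0..T} \<Longrightarrow> \<bar>arr t - a t\<bar> \<le> 2 ^ p / n + \<epsilon>"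
  using grid_dist_le_of_incr[of arr a p T "1 / n"] arrivals.cumulative_0 start(1) arrivals_close
  by (intro mono_dist_le_of_grid[OF T_pos arrivals.mono_counts mono_a _ incr_a_le])
    (auto simp: arrivals.incr_cumulative)

lemma services_near: "t \<in> {0..T} \<Longrightarrow> \<bar>srv t - s t\<bar> \<le> 2 ^ p / n + \<epsilon>"
  using grid_dist_le_of_incr[of srv s p T "1 / n"] services.cumulative_0 start(2) services_close
  by (intro mono_dist_le_of_grid[OF T_pos services.mono_counts mono_s _ incr_s_le])
    (auto simp: services.incr_cumulative)

lemma planned_near:
  assumes t: "t \<in> {0..T}"
  shows "\<bar>reneging_in planned t + skipped_until t - \<zeta> t\<bar> \<le> 2 ^ p / n + \<epsilon>"
proof -
  let ?h = "\<lambda>t. reneging_in planned t + skipped_until t"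
  have mono: "mono_on {0..T} ?h"
    using mono_reneging_in[OF planned_fmeasurable] mono_skipped_until by (auto simp: mono_on_def intro: add_mono)
  have "planned \<inter> {0..0} \<times> UNIV = {}"
    using time_cell_subset[OF T_pos] by (force simp: planned_def renege_box_def)
  then have "?h 0 = 0" by (simp add: reneging_in_def skipped_until_0)
  moreover have "\<bar>incr T ?h p k - incr T \<zeta> p k\<bar> \<le> 1 / n" if k: "k < 2 ^ p" for k
  proof -
    have "incr T ?h p k = incr T (reneging_in planned) p k + incr T skipped_until p k" by (simp add: incr_def)
    also have "\<dots> = measure \<nu>3 (renege_box k) / n + skipped k"
      by (simp add: incr_reneging_in[OF planned_fmeasurable k] planned_slice[OF k] incr_skipped_until)
    finally show ?thesis using reneging_close[OF k] by (simp add: imitated_def skipped_def split: if_splits)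
  qed
  ultimately have "\<bar>?h (tgrid T p k) - \<zeta> (tgrid T p k)\<bar> \<le> 2 ^ p * (1 / n)" if "k \<le> 2 ^ p" for k
    using that start(3) by (intro grid_dist_le_of_incr) auto
  then show ?thesis
    using mono_dist_le_of_grid[OF T_pos mono mono_\<zeta> _ incr_\<zeta>_le t, of "2 ^ p * (1 / n)"] by simp
qed

lemma level_between:
  assumes tracked: "\<And>u. u \<in> {0..<t} \<Longrightarrow> f u - \<xi> u \<in> {- \<eta>..2 * z + \<eta>}" and k: "k < 2 ^ p"
    and u: "u \<in> time_cell T p k" "u \<le> t"
  shows "renege_level k \<le> level u" "level u \<le> top_level k"
proof -
  have mem: "u \<in> {0<..T}" "tgrid T p k < u" using time_cell_subset[OF T_pos k] u by (auto simp: time_cell_def)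
  have left: "left_limit f u \<in> {\<xi> (tgrid T p k) - 2 * \<eta>..top_level k}"
  proof (rule left_limit_bounds[OF mem])
    fix v assume v: "v \<in> {0..T}" "tgrid T p k < v" "v < u"
    then have "\<bar>\<xi> v - \<xi> (tgrid T p k)\<bar> \<le> \<eta>" using u by (intro \<xi>_near_grid[OF k]) (auto simp: time_cell_def)
    then show "\<xi> (tgrid T p k) - 2 * \<eta> \<le> f v \<and> f v \<le> top_level k"
      using tracked[of v] v u by (auto simp: top_level_def)
  qed
  have "0 \<le> top_level k" using levels[OF k] by simp
  moreover have "0 \<le> 1 / real n" by simp
  ultimately show "level u \<le> top_level k" using left unfolding level_def atLeastAtMost_iff by linarith
  show "renege_level k \<le> level u" using left jump_le by (auto simp: level_def renege_level_def)
qed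

lemma void_null: "{0} \<times> {0..} \<union> (\<Union>k<2 ^ p. void_box k) \<in> null_sets \<nu>3"
proof (intro null_sets.Un null_sets_UN')
  show "{0} \<times> {0..} \<in> null_sets \<nu>3"
    using null_axis T_pos by (intro null_setsI sets_renegingI Times_borel) auto
  show "void_box k \<in> null_sets \<nu>3" if "k \<in> {..<2 ^ p}" for k
    using that void_box_null sets_void_box by (intro null_setsI) auto
qed simp

lemma reneging_eq_planned:
  assumes t: "t \<in> {0..T}" and tracked: "\<And>u. u \<in> {0..<t} \<Longrightarrow> f u - \<xi> u \<in> {- \<eta>..2 * z + \<eta>}"
  shows "g t = reneging_in planned t"
proof -
  let ?void = "{0} \<times> {0..} \<union> (\<Union>k<2 ^ p. void_box k)"
  have outside_void: "z' \<in> region {0..t} \<longleftrightarrow> z' \<in> planned \<inter> {0..t} \<times> UNIV" if "z' \<notin> ?void" for z'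
  proof
    assume "z' \<in> region {0..t}"
    then obtain u y where z': "z' = (u, y)" "u \<in> {0..t}" "0 \<le> y" "y \<le> level u" by (auto simp: region_def)
    then have "u \<in> {0<..T}" using that t by auto
    then obtain k where k: "k < 2 ^ p" "u \<in> time_cell T p k" by (rule time_cellE[OF T_pos])
    then have "y \<le> top_level k" using level_between(2)[of t k u] tracked k z' by auto
    then have "y < renege_level k" using that k z' by (auto simp: void_box_def not_le)
    then show "z' \<in> planned \<inter> {0..t} \<times> UNIV" using k z' by (auto simp: planned_def renege_box_def)
  next
    assume "z' \<in> planned \<inter> {0..t} \<times> UNIV"
    then obtain k u y where k: "k < 2 ^ p" "u \<in> time_cell T p k"
      and z': "z' = (u, y)" "u \<in> {0..t}" "0 \<le> y" "y < renege_level k"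
      by (auto simp: planned_def renege_box_def)
    then show "z' \<in> region {0..t}" using level_between(1)[of t k u] tracked by (auto simp: region_def)
  qed
  have "AE z' in \<nu>3. z' \<in> region {0..t} \<longleftrightarrow> z' \<in> planned \<inter> {0..t} \<times> UNIV"
    using AE_not_in[OF void_null] by eventually_elim (rule outside_void)
  then have "measure \<nu>3 (region {0..t}) = measure \<nu>3 (planned \<inter> {0..t} \<times> UNIV)"
    using t planned_fmeasurable by (intro measure_eq_AE sets_region sets_reneging_slice) auto
  then show ?thesis using reneging_eq[OF t] by (simp add: reneging_in_def)
qed

lemma reflection_near:
  assumes t: "t \<in> {0..T}"
  shows "\<bar>f t - skorohod_map (net_input xn arr srv g) t\<bar> \<le> 2 * (\<epsilon> + 1 / n)"
proof (rule reflection[OF _ _ t])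
  show "0 < T / 2 ^ p" using T_pos by simp
  fix u v assume uv: "u \<in> {0..T}" "v \<in> {0..T}" "u \<le> v" "v - u < T / 2 ^ p"
  have "incr T srv p k \<le> \<epsilon> + 1 / n" if "k < 2 ^ p" for k
    using services_close[OF that] incr_s_le[OF that] services.incr_cumulative[OF that] by simp
  then have "\<bar>srv v - srv u\<bar> \<le> 2 * (\<epsilon> + 1 / n)"
    using uv by (intro mono_modulus_of_incr[OF T_pos services.mono_counts]) auto
  then show "srv v - srv u \<le> 2 * (\<epsilon> + 1 / n)" by simp
qed

lemma queue_tracks:
  assumes t: "t \<in> {0..T}" and tracked: "\<And>u. u \<in> {0..<t} \<Longrightarrow> f u - \<xi> u \<in> {- \<eta>..2 * z + \<eta>}"
  shows "f t - \<xi> t \<in> {- \<eta><..<2 * z + \<eta>}"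
proof -
  define e where "e = 2 ^ p / n + \<epsilon>"
  let ?\<psi> = "\<lambda>r. net_input x0 a s \<zeta> r + skipped_until r"
  have "\<bar>skorohod_map ?\<psi> t - skorohod_map (net_input xn arr srv g) t\<bar> \<le> 2 * (\<bar>xn - x0\<bar> + 3 * e)"
  proof (rule skorohod_map_lipschitz)
    fix u assume u: "u \<in> {0..t}"
    then have mem: "u \<in> {0..T}" using t by auto
    show "x0 - s T - \<zeta> T \<le> ?\<psi> u" using net_input_ge[OF mem] skipped_until_bounds(1)[OF mem] by linarith
    have "g u = reneging_in planned u" using u t tracked by (intro reneging_eq_planned) auto
    then have "?\<psi> u - net_input xn arr srv g u
        = (x0 - xn) - (arr u - a u) + (srv u - s u) + (reneging_in planned u + skipped_until u - \<zeta> u)"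
      by (simp add: net_input_def)
    then show "\<bar>?\<psi> u - net_input xn arr srv g u\<bar> \<le> \<bar>xn - x0\<bar> + 3 * e"
      using arrivals_near[OF mem] services_near[OF mem] planned_near[OF mem] unfolding e_def[symmetric] by linarith
  qed (use t in auto)
  then show ?thesis
    using reflection_near[OF t] skorohod_map_skipped[OF t] tracking_error unfolding e_def[symmetric] by auto
qed

theorem stays_close:
  assumes t: "t \<in> {0..T}"
  shows "\<bar>f t - \<xi> t\<bar> \<le> 2 * z + \<eta>" "\<bar>g t - \<zeta> t\<bar> \<le> z + \<eta>"
proof -
  have right_cont: "((\<lambda>u. f u - \<xi> u) \<longlongrightarrow> f t - \<xi> t) (at_right t)" if t: "t \<in> {0..<T}" for t
  proof -
    have "(\<xi> \<longlongrightarrow> \<xi> t) (at t within {0..T})" using cont_\<xi> t by (auto simp: continuous_on_def)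
    then have "(\<xi> \<longlongrightarrow> \<xi> t) (at t within {t..T})" by (rule tendsto_within_subset) (use t in auto)
    then have "(\<xi> \<longlongrightarrow> \<xi> t) (at_right t)" using t by (simp add: at_within_Icc_at_right)
    then show ?thesis by (intro tendsto_diff queue_right_continuous t)
  qed
  have tracked: "f u - \<xi> u \<in> {- \<eta>..2 * z + \<eta>}" if "u \<in> {0..T}" for u
    using right_continuous_barrier[of T "\<lambda>u. f u - \<xi> u", OF right_cont queue_tracks that] by blast
  then show "\<bar>f t - \<xi> t\<bar> \<le> 2 * z + \<eta>" using t skipped_total_nonneg by (force simp: abs_le_iff)
  have "g t = reneging_in planned t" using t tracked by (intro reneging_eq_planned) auto
  moreover have "2 ^ p / n + \<epsilon> \<le> \<eta>"
  proof -
    define e where "e = 2 ^ p / n + \<epsilon>"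
    have "0 \<le> e" "0 \<le> \<epsilon> + 1 / n" "0 \<le> \<bar>xn - x0\<bar>" using jump_nonneg by (auto simp: e_def)
    then show ?thesis using tracking_error unfolding e_def[symmetric] by argo
  qed
  ultimately show "\<bar>g t - \<zeta> t\<bar> \<le> z + \<eta>"
    using planned_near[OF t] skipped_until_bounds[OF t] by linarith
qed

end

section \<open>The cost of tracking\<close>

text \<open>The slope that is optimal in \<open>relent_ge_dual\<close>, with \<open>- N\<close> in place of \<open>- \<infinity>\<close>.\<close>

definition opt_slope :: "real \<Rightarrow> real \<Rightarrow> real \<Rightarrow> real" where
  "opt_slope N x w = (if 0 < x then ln (x / w) else - N)"

lemma relent_le_opt_slope:
  assumes x: "0 \<le> x" and w: "0 < w" "w \<le> w'" and ratio: "w' - w \<le> \<rho> * w"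
  shows "relent x w \<le> opt_slope N x w * x - (exp (opt_slope N x w) - 1) * w' + \<rho> * x + exp (- N) * w'"
proof (cases "0 < x")
  case True
  have "(w' - w) * (x / w) \<le> \<rho> * w * (x / w)" using ratio True w by (intro mult_right_mono) auto
  then have "w' * (x / w) \<le> x + \<rho> * x" using w by (simp add: left_diff_distrib diff_divide_distrib)
  moreover have "(exp (ln (x / w)) - 1) * w' = w' * (x / w) - w'" using True w
      by (simp add: right_diff_distrib mult.commute)
  moreover have "0 \<le> exp (- N) * w'" using w by simp
  moreover have slope: "opt_slope N x w = ln (x / w)" using True by (simp add: opt_slope_def)
  ultimately show ?thesis unfolding relent_def slope mult.commute[of x "ln (x / w)"] using w by linarith
next
  case False
  then have "x = 0" using x by simp
  then show ?thesis using w by (simp add: opt_slope_def relent_def right_diff_distrib mult.commute)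
qed

lemma ex_dual_sum_ge_relent:
  fixes y w w' :: "nat \<Rightarrow> real"
  assumes B: "B \<subseteq> {..<2 ^ p}" and "0 \<le> \<rho>" and y: "\<And>k. k < 2 ^ p \<Longrightarrow> 0 \<le> y k" and w': "\<And>k. k < 2 ^ p \<Longrightarrow> 0 \<le> w' k"
    and w: "\<And>k. k \<in> B \<Longrightarrow> 0 < w k" "\<And>k. k \<in> B \<Longrightarrow> w k \<le> w' k" "\<And>k. k \<in> B \<Longrightarrow> w' k - w k \<le> \<rho> * w k"
  shows "\<exists>\<beta>. (\<Sum>k\<in>B. relent (y k) (w k)) \<le> dual_sum p \<beta> y w' + \<rho> * (\<Sum>k<2 ^ p. y k) + exp (- N) * (\<Sum>k<2 ^ p. w' k)"
proof
  define \<beta> where "\<beta> k = (if k \<in> B then opt_slope N (y k) (w k) else 0)" for k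
  define bound where "bound k = \<beta> k * y k - (exp (\<beta> k) - 1) * w' k + \<rho> * y k + exp (- N) * w' k" for k
  have "(\<Sum>k\<in>B. relent (y k) (w k)) \<le> (\<Sum>k\<in>B. bound k)"
  proof (rule sum_mono)
    fix k assume k: "k \<in> B"
    then have "0 \<le> y k" using B y by auto
    from relent_le_opt_slope[OF this w[OF k], of N] show "relent (y k) (w k) \<le> bound k" using k
        by (simp add: bound_def \<beta>_def)
  qed
  also have "\<dots> \<le> (\<Sum>k<2 ^ p. bound k)"
    using B y w' \<open>0 \<le> \<rho>\<close> by (intro sum_mono2) (auto simp: bound_def \<beta>_def)
  also have "\<dots> = dual_sum p \<beta> y w' + \<rho> * (\<Sum>k<2 ^ p. y k) + exp (- N) * (\<Sum>k<2 ^ p. w' k)"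
    by (simp add: bound_def dual_sum_def sum.distrib sum_distrib_left)
  finally show "(\<Sum>k\<in>B. relent (y k) (w k)) \<le> dual_sum p \<beta> y w' + \<rho> * (\<Sum>k<2 ^ p. y k) + exp (- N) * (\<Sum>k<2 ^ p. w' k)" .
qed

context entropy_path
begin

lemma cell_integral_near_grid:
  assumes k: "k < 2 ^ p" and near: "\<And>t. t \<in> {tgrid T p k..tgrid T p (Suc k)} \<Longrightarrow> \<bar>\<xi> t - \<xi> (tgrid T p k)\<bar> \<le> \<eta>"
  shows "th * (\<xi> (tgrid T p k) - \<eta>) * (T / 2 ^ p) \<le> cell_integral T (\<lambda>t. th * \<xi> t) p k"
    "cell_integral T (\<lambda>t. th * \<xi> t) p k \<le> th * (\<xi> (tgrid T p k) + \<eta>) * (T / 2 ^ p)"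
proof -
  have "\<bar>cell_integral T \<xi> p k - \<xi> (tgrid T p k) * (T / 2 ^ p)\<bar> \<le> \<eta> * (T / 2 ^ p)"
    by (rule cell_integral_approx[OF T_pos k cont_\<xi> near])
  then have "(\<xi> (tgrid T p k) - \<eta>) * (T / 2 ^ p) \<le> cell_integral T \<xi> p k"
    "cell_integral T \<xi> p k \<le> (\<xi> (tgrid T p k) + \<eta>) * (T / 2 ^ p)"
    unfolding left_diff_distrib distrib_right by linarith+
  then show "th * (\<xi> (tgrid T p k) - \<eta>) * (T / 2 ^ p) \<le> cell_integral T (\<lambda>t. th * \<xi> t) p k"
    "cell_integral T (\<lambda>t. th * \<xi> t) p k \<le> th * (\<xi> (tgrid T p k) + \<eta>) * (T / 2 ^ p)"
    using th_pos unfolding cell_integral_cmult mult.assoc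
      by (auto intro!: mult_left_mono simp del: times_divide_eq_right)
qed

lemma low_cells_incr_le:
  assumes near: "\<And>k t. k < 2 ^ p \<Longrightarrow> t \<in> {tgrid T p k..tgrid T p (Suc k)} \<Longrightarrow> \<bar>\<xi> t - \<xi> (tgrid T p k)\<bar> \<le> \<eta>"
    and "0 \<le> \<delta> + \<eta>"
  shows "b * (\<Sum>k<2 ^ p. if \<delta> \<le> \<xi> (tgrid T p k) then 0 else incr T \<zeta> p k) \<le> c + exp b * (th * T * (\<delta> + \<eta>))"
proof -
  define \<beta> where "\<beta> k = (if \<delta> \<le> \<xi> (tgrid T p k) then 0 else b)" for k
  let ?w = "cell_integral T (\<lambda>t. th * \<xi> t) p"
  have w_le: "(exp (\<beta> k) - 1) * ?w k \<le> exp b * (th * (\<delta> + \<eta>) * (T / 2 ^ p))" if k: "k < 2 ^ p" for k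
  proof (cases "\<delta> \<le> \<xi> (tgrid T p k)")
    case True
    then show ?thesis using th_pos T_pos \<open>0 \<le> \<delta> + \<eta>\<close> by (simp add: \<beta>_def)
  next
    case False
    have "?w k \<le> th * (\<xi> (tgrid T p k) + \<eta>) * (T / 2 ^ p)" by (rule cell_integral_near_grid(2)[OF k near[OF k]])
    also have "\<dots> \<le> th * (\<delta> + \<eta>) * (T / 2 ^ p)"
      using False th_pos T_pos by (intro mult_right_mono mult_left_mono) auto
    finally have "exp b * ?w k \<le> exp b * (th * (\<delta> + \<eta>) * (T / 2 ^ p))" by (rule mult_left_mono) simp
    moreover have "0 \<le> ?w k" using th_pos \<xi>_nonneg by (intro cell_integral_nonneg[OF T_pos k]) auto
    ultimately show ?thesis using False by (simp add: \<beta>_def left_diff_distrib)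
  qed
  have "dual_sum p \<beta> (incr T \<zeta> p) ?w \<le> c"
    using joint_cost[of p "\<lambda>_. 0" "\<lambda>_. 0" \<beta>] by (simp add: dual_cost_def)
  then have "(\<Sum>k<2 ^ p. \<beta> k * incr T \<zeta> p k) \<le> c + (\<Sum>k<2 ^ p. (exp (\<beta> k) - 1) * ?w k)"
    by (simp add: dual_sum_def sum_subtractf)
  also have "(\<Sum>k<2 ^ p. (exp (\<beta> k) - 1) * ?w k) \<le> (\<Sum>k<(2::nat) ^ p. exp b * (th * (\<delta> + \<eta>) * (T / 2 ^ p)))"
    using w_le by (intro sum_mono) auto
  finally have "(\<Sum>k<2 ^ p. \<beta> k * incr T \<zeta> p k) \<le> c + exp b * (th * T * (\<delta> + \<eta>))" by (simp add: mult_ac)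
  moreover have "b * (\<Sum>k<2 ^ p. if \<delta> \<le> \<xi> (tgrid T p k) then 0 else incr T \<zeta> p k) = (\<Sum>k<2 ^ p. \<beta> k * incr T \<zeta> p k)"
    unfolding sum_distrib_left by (intro sum.cong) (auto simp: \<beta>_def)
  ultimately show ?thesis by simp
qed

lemma eventually_fine_grid:
  assumes "0 < \<eta>" "0 < \<epsilon>"
  shows "\<forall>\<^sub>F p in sequentially. \<forall>k<2 ^ p. incr T a p k \<le> \<epsilon> \<and> incr T s p k \<le> \<epsilon> \<and> incr T \<zeta> p k \<le> \<epsilon> \<and>
    (\<forall>t\<in>{tgrid T p k..tgrid T p (Suc k)}. \<bar>\<xi> t - \<xi> (tgrid T p k)\<bar> \<le> \<eta>)"
  using cell_oscillation_le[OF T_pos cont_a \<open>0 < \<epsilon>\<close>] cell_oscillation_le[OF T_pos cont_s \<open>0 < \<epsilon>\<close>]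
    cell_oscillation_le[OF T_pos cont_\<zeta> \<open>0 < \<epsilon>\<close>] cell_oscillation_le[OF T_pos cont_\<xi> \<open>0 < \<eta>\<close>]
proof eventually_elim
  case (elim p)
  show ?case
  proof (intro allI impI)
    fix k :: nat assume "k < 2 ^ p"
    note cell = tgrid_cell[OF T_pos this]
    have step: "\<bar>tgrid T p (Suc k) - tgrid T p k\<bar> \<le> T / 2 ^ p" using T_pos by (simp add: tgrid_Suc)
    have "incr T F p k \<le> \<epsilon>"
      if "\<forall>u\<in>{0..T}. \<forall>t\<in>{0..T}. \<bar>t - u\<bar> \<le> T / 2 ^ p \<longrightarrow> dist (F t) (F u) < \<epsilon>" for F :: "real \<Rightarrow> real"
      using that[rule_format, OF cell(1,2) step] by (simp add: incr_def dist_real_def)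
    moreover have "\<bar>\<xi> t - \<xi> (tgrid T p k)\<bar> \<le> \<eta>" if t: "t \<in> {tgrid T p k..tgrid T p (Suc k)}" for t
    proof -
      have "t \<in> {0..T}" "\<bar>t - tgrid T p k\<bar> \<le> T / 2 ^ p" using t cell by (auto simp: tgrid_Suc)
      then show ?thesis using elim(4)[rule_format, OF cell(1)] by (force simp: dist_real_def)
    qed
    ultimately show "incr T a p k \<le> \<epsilon> \<and> incr T s p k \<le> \<epsilon> \<and> incr T \<zeta> p k \<le> \<epsilon> \<and>
        (\<forall>t\<in>{tgrid T p k..tgrid T p (Suc k)}. \<bar>\<xi> t - \<xi> (tgrid T p k)\<bar> \<le> \<eta>)"
      using elim(1-3) by blast
  qed
qed

lemma obtain_tracking_grid:
  assumes "0 < r" "0 < e" "0 < K"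
  obtains p \<eta> \<epsilon> z where "tracking_grid lam mu th T x0 c a s \<xi> \<zeta> p \<eta> ((3 + K) * \<eta>) \<epsilon> z"
    "3 * z + 2 * \<eta> < r" "th * T * ((3 + K) * \<eta> + 5 * \<eta> + 2 * z) < e"
proof -
  have "0 \<le> c" using joint_cost[of 0 "\<lambda>_. 0" "\<lambda>_. 0" "\<lambda>_. 0"] by simp
  have small: "\<forall>\<^sub>F \<eta> in at_right 0. k * \<eta> < d" if "0 < d" for k d :: real
  proof -
    have "((\<lambda>\<eta>. k * \<eta>) \<longlongrightarrow> k * 0) (at_right 0)" by (intro tendsto_intros)
    then show ?thesis using that by (intro order_tendstoD(2)) auto
  qed
  have "\<forall>\<^sub>F z in at_right 0. 0 < z \<and> 3 * z < r / 2 \<and> th * T * 2 * z < e / 2"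
    using assms by (intro eventually_conj small eventually_at_right_less) auto
  then obtain z where z: "0 < z" "3 * z < r / 2" "th * T * 2 * z < e / 2"
    using eventually_happens' trivial_limit_at_right_real by blast
  define b where "b = (c + 1) / z"
  have b: "0 < b" "b * z = c + 1" using z \<open>0 \<le> c\<close> by (auto simp: b_def)
  have "\<forall>\<^sub>F \<eta> in at_right 0. 0 < \<eta> \<and> 2 * \<eta> < r / 2 \<and> th * T * (8 + K) * \<eta> < e / 2 \<and> exp b * (th * T * (4 + K)) * \<eta> < 1"
    using assms by (intro eventually_conj small eventually_at_right_less) auto
  then obtain \<eta> where \<eta>: "0 < \<eta>" "2 * \<eta> < r / 2" "th * T * (8 + K) * \<eta> < e / 2" "exp b * (th * T * (4 + K)) * \<eta> < 1"
    using eventually_happens' trivial_limit_at_right_real by blast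
  obtain p where fine: "\<forall>k<2 ^ p. incr T a p k \<le> \<eta> / 16 \<and> incr T s p k \<le> \<eta> / 16 \<and> incr T \<zeta> p k \<le> \<eta> / 16 \<and>
      (\<forall>t\<in>{tgrid T p k..tgrid T p (Suc k)}. \<bar>\<xi> t - \<xi> (tgrid T p k)\<bar> \<le> \<eta>)"
    using eventually_happens'[OF sequentially_bot eventually_fine_grid[of \<eta> "\<eta> / 16"]] \<eta>(1) by auto
  have "b * (\<Sum>k<2 ^ p. if (3 + K) * \<eta> \<le> \<xi> (tgrid T p k) then 0 else incr T \<zeta> p k)
      \<le> c + exp b * (th * T * ((3 + K) * \<eta> + \<eta>))"
    using fine \<eta>(1) \<open>0 < K\<close> by (intro low_cells_incr_le) auto
  also have "\<dots> \<le> b * z" using \<eta>(4) unfolding b(2) by (simp add: algebra_simps)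
  finally have "(\<Sum>k<2 ^ p. if (3 + K) * \<eta> \<le> \<xi> (tgrid T p k) then 0 else incr T \<zeta> p k) \<le> z"
    using b(1) by simp
  then have "tracking_grid lam mu th T x0 c a s \<xi> \<zeta> p \<eta> ((3 + K) * \<eta>) (\<eta> / 16) z"
    using fine \<eta>(1) \<open>0 < K\<close> by unfold_locales (auto simp: distrib_right)
  moreover have "3 * z + 2 * \<eta> < r" using z(2) \<eta>(2) by simp
  moreover have "th * T * ((3 + K) * \<eta> + 5 * \<eta> + 2 * z) < e" using z(3) \<eta>(3) by (simp add: algebra_simps)
  ultimately show thesis by (rule that)
qed

end

context tracking_grid
begin

definition busy_cells :: "nat set" where
  "busy_cells = {k. k < 2 ^ p \<and> \<delta> \<le> \<xi> (tgrid T p k)}"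

lemma busy_cell_weight:
  assumes k: "k \<in> busy_cells" and "0 \<le> \<rho>" and ratio: "4 * \<eta> \<le> \<rho> * (\<delta> - 3 * \<eta>)"
  shows "0 < th * renege_level k * (T / 2 ^ p)"
    "th * renege_level k * (T / 2 ^ p) \<le> cell_integral T (\<lambda>t. th * \<xi> t) p k"
    "cell_integral T (\<lambda>t. th * \<xi> t) p k - th * renege_level k * (T / 2 ^ p) \<le> \<rho> * (th * renege_level k * (T / 2 ^ p))"
proof -
  have k': "k < 2 ^ p" and level: "\<delta> \<le> \<xi> (tgrid T p k)" "renege_level k = \<xi> (tgrid T p k) - 3 * \<eta>"
    using k by (auto simp: busy_cells_def renege_level_def)
  define h where "h = th * (T / 2 ^ p)"
  have "0 < h" using th_pos T_pos by (simp add: h_def)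
  have as_h: "th * x * (T / 2 ^ p) = h * x" for x by (simp add: h_def)
  note near = cell_integral_near_grid[OF k' \<xi>_near_grid[OF k'], unfolded as_h]
  show "0 < th * renege_level k * (T / 2 ^ p)"
    unfolding as_h using \<open>0 < h\<close> level threshold by simp
  have "h * renege_level k \<le> h * (\<xi> (tgrid T p k) - \<eta>)"
    using \<open>0 < h\<close> level margin_pos by (intro mult_left_mono) auto
  then show "th * renege_level k * (T / 2 ^ p) \<le> cell_integral T (\<lambda>t. th * \<xi> t) p k"
    unfolding as_h using near(1) by simp
  have "4 * \<eta> \<le> \<rho> * renege_level k"
    using ratio level mult_left_mono[of "\<delta> - 3 * \<eta>" "renege_level k" \<rho>] \<open>0 \<le> \<rho>\<close> by simp
  then have "h * (4 * \<eta>) \<le> h * (\<rho> * renege_level k)" using \<open>0 < h\<close> by (intro mult_left_mono) auto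
  moreover have "h * (\<xi> (tgrid T p k) + \<eta>) - h * renege_level k = h * (4 * \<eta>)"
    unfolding right_diff_distrib[symmetric] by (simp add: level)
  ultimately show "cell_integral T (\<lambda>t. th * \<xi> t) p k - th * renege_level k * (T / 2 ^ p)
        \<le> \<rho> * (th * renege_level k * (T / 2 ^ p))"
    unfolding as_h using near(2) by (simp add: mult.left_commute)
qed

lemma imitation_cost_le:
  assumes "0 \<le> \<rho>" and ratio: "4 * \<eta> \<le> \<rho> * (\<delta> - 3 * \<eta>)" and "0 < e"
  shows "(\<Sum>k<2 ^ p. relent (incr T a p k) (lam * (T / 2 ^ p))) + (\<Sum>k<2 ^ p. relent (incr T s p k) (mu * (T / 2 ^ p)))
     + (\<Sum>k\<in>busy_cells. relent (incr T \<zeta> p k) (th * renege_level k * (T / 2 ^ p))) \<le> c + \<rho> * \<zeta> T + e"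
proof -
  let ?w = "cell_integral T (\<lambda>t. th * \<xi> t) p"
  define W where "W = lam * T + mu * T + (\<Sum>k<2 ^ p. ?w k)"
  have w_nonneg: "0 \<le> ?w k" if "k < 2 ^ p" for k
    using th_pos \<xi>_nonneg by (intro cell_integral_nonneg[OF T_pos that]) auto
  have "0 < W" unfolding W_def using lam_pos mu_pos T_pos w_nonneg by (intro add_pos_nonneg sum_nonneg) auto
  define N where "N = ln (W / e)"
  have N: "exp (- N) * W = e" using \<open>0 < W\<close> \<open>0 < e\<close> by (simp add: N_def exp_minus)
  have full_cells: "\<exists>\<beta>. (\<Sum>k<2 ^ p. relent (incr T F p k) (v * (T / 2 ^ p)))
        \<le> dual_cost T F (\<lambda>_. v) p \<beta> + exp (- N) * (v * T)"
    if "mono_on {0..T} F" "0 < v" for F v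
  proof -
    have "\<exists>\<beta>. (\<Sum>k<2 ^ p. relent (incr T F p k) (v * (T / 2 ^ p)))
        \<le> dual_sum p \<beta> (incr T F p) (\<lambda>_. v * (T / 2 ^ p)) + 0 * (\<Sum>k<2 ^ p. incr T F p k)
          + exp (- N) * (\<Sum>k<(2::nat) ^ p. v * (T / 2 ^ p))"
      using that T_pos incr_nonneg[OF that(1) T_pos] by (intro ex_dual_sum_ge_relent) auto
    then show ?thesis unfolding dual_cost_def by (simp add: cell_integral_const[OF T_pos] cong: dual_sum_cong)
  qed
  obtain \<beta>1 where \<beta>1: "(\<Sum>k<2 ^ p. relent (incr T a p k) (lam * (T / 2 ^ p)))
        \<le> dual_cost T a (\<lambda>_. lam) p \<beta>1 + exp (- N) * (lam * T)"
    using full_cells[OF mono_a lam_pos] by blast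
  obtain \<beta>2 where \<beta>2: "(\<Sum>k<2 ^ p. relent (incr T s p k) (mu * (T / 2 ^ p)))
        \<le> dual_cost T s (\<lambda>_. mu) p \<beta>2 + exp (- N) * (mu * T)"
    using full_cells[OF mono_s mu_pos] by blast
  have "\<exists>\<beta>. (\<Sum>k\<in>busy_cells. relent (incr T \<zeta> p k) (th * renege_level k * (T / 2 ^ p)))
      \<le> dual_sum p \<beta> (incr T \<zeta> p) ?w + \<rho> * (\<Sum>k<2 ^ p. incr T \<zeta> p k) + exp (- N) * (\<Sum>k<2 ^ p. ?w k)"
    using w_nonneg incr_nonneg[OF mono_\<zeta> T_pos] \<open>0 \<le> \<rho>\<close> ratio
    by (intro ex_dual_sum_ge_relent busy_cell_weight ratio) (auto simp: busy_cells_def)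
  then obtain \<beta>3 where "(\<Sum>k\<in>busy_cells. relent (incr T \<zeta> p k) (th * renege_level k * (T / 2 ^ p)))
      \<le> dual_sum p \<beta>3 (incr T \<zeta> p) ?w + \<rho> * (\<Sum>k<2 ^ p. incr T \<zeta> p k) + exp (- N) * (\<Sum>k<2 ^ p. ?w k)"
    by blast
  moreover have "(\<Sum>k<2 ^ p. incr T \<zeta> p k) = \<zeta> T" using sum_incr[of T \<zeta> p "2 ^ p"] start(3) by simp
  moreover have "exp (- N) * (lam * T) + exp (- N) * (mu * T) + exp (- N) * (\<Sum>k<2 ^ p. ?w k) = e"
    unfolding N[symmetric] W_def by (simp only: distrib_left)
  ultimately show ?thesis
    using \<beta>1 \<beta>2 joint_cost[of p \<beta>1 \<beta>2 \<beta>3] unfolding dual_cost_def[of T \<zeta>] by simp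
qed

end

section \<open>The lower bound\<close>

lemma floor_mult_div_near:
  assumes "0 \<le> y" "0 < n"
  shows "\<bar>real (nat \<lfloor>real n * y\<rfloor>) / n - y\<bar> \<le> 1 / n"
proof -
  have "0 \<le> real n * y" using assms by simp
  then have "\<bar>real (nat \<lfloor>real n * y\<rfloor>) - real n * y\<bar> \<le> 1" by linarith
  then have "\<bar>real (nat \<lfloor>real n * y\<rfloor>) - real n * y\<bar> / n \<le> 1 / n" by (rule divide_right_mono) simp
  moreover have "real (nat \<lfloor>real n * y\<rfloor>) / n - y = (real (nat \<lfloor>real n * y\<rfloor>) - real n * y) / n"
    using assms by (simp add: diff_divide_distrib)
  ultimately show ?thesis by (simp add: abs_divide)
qed

lemma tendsto_floor_mult_div:
  assumes "0 \<le> y"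
  shows "(\<lambda>n. real (nat \<lfloor>real n * y\<rfloor>) / real n) \<longlonglongrightarrow> y"
proof (rule Lim_transform[OF tendsto_const])
  show "(\<lambda>n. real (nat \<lfloor>real n * y\<rfloor>) / real n - y) \<longlonglongrightarrow> 0"
  proof (rule Lim_null_comparison[OF _ lim_1_over_n])
    show "\<forall>\<^sub>F n in sequentially. norm (real (nat \<lfloor>real n * y\<rfloor>) / real n - y) \<le> 1 / real n"
      using eventually_gt_at_top[of 0] by eventually_elim (simp add: floor_mult_div_near[OF assms])
  qed
qed

lemma tendsto_relent_floor:
  assumes "0 \<le> y" "0 < w"
  shows "(\<lambda>n. relent (real (nat \<lfloor>real n * y\<rfloor>) / real n) w) \<longlonglongrightarrow> relent y w"
proof (cases "y = 0")
  case False
  then show ?thesis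
    unfolding relent_def using assms by (intro tendsto_intros tendsto_floor_mult_div) auto
qed simp

lemma tendsto_ln_floor_div:
  assumes "0 \<le> y"
  shows "(\<lambda>n. (ln (real (nat \<lfloor>real n * y\<rfloor>)) + 1) / real n) \<longlonglongrightarrow> 0"
proof (rule real_tendsto_sandwich[of "\<lambda>_. 0" _ _ "\<lambda>n. (ln (real n) + ln (y + 1) + 1) / real n"])
  show "\<forall>\<^sub>F n in sequentially. (0::real) \<le> (ln (real (nat \<lfloor>real n * y\<rfloor>)) + 1) / real n"
  proof (intro always_eventually allI divide_nonneg_nonneg)
    fix n show "0 \<le> ln (real (nat \<lfloor>real n * y\<rfloor>)) + 1"
      by (cases "nat \<lfloor>real n * y\<rfloor> = 0") (auto intro: add_nonneg_nonneg)
  qed simp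
  show "\<forall>\<^sub>F n in sequentially. (ln (real (nat \<lfloor>real n * y\<rfloor>)) + 1) / real n \<le> (ln (real n) + ln (y + 1) + 1) / real n"
    using eventually_gt_at_top[of 0]
  proof eventually_elim
    case (elim n)
    have "ln (real (nat \<lfloor>real n * y\<rfloor>)) \<le> ln (real n) + ln (y + 1)"
    proof (cases "nat \<lfloor>real n * y\<rfloor> = 0")
      case True
      then show ?thesis using elim assms by (simp add: add_nonneg_nonneg)
    next
      case False
      have "real (nat \<lfloor>real n * y\<rfloor>) \<le> real n * y" using assms by simp
      also have "\<dots> \<le> real n * (y + 1)" by (intro mult_left_mono) auto
      finally have "ln (real (nat \<lfloor>real n * y\<rfloor>)) \<le> ln (real n * (y + 1))" using False by (intro ln_mono) auto
      also have "\<dots> = ln (real n) + ln (y + 1)" using elim assms by (simp add: ln_mult)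
      finally show ?thesis .
    qed
    then show ?case by (intro divide_right_mono) auto
  qed
  show "(\<lambda>n. (ln (real n) + ln (y + 1) + 1) / real n) \<longlonglongrightarrow> 0" by real_asymp
qed simp

lemma liminf_elog_ge:
  fixes P :: "nat \<Rightarrow> real"
  assumes l: "l \<longlonglongrightarrow> c" and P: "\<forall>\<^sub>F n in sequentially. exp (real n * l n) \<le> P n"
  shows "ereal c \<le> liminf (\<lambda>n. ereal (1 / real n) * elog (P n))"
proof -
  have "(\<lambda>n. ereal (l n)) \<longlonglongrightarrow> ereal c" using l by simp
  then have "ereal c = liminf (\<lambda>n. ereal (l n))" by (intro lim_imp_Liminf[symmetric]) auto
  also have "\<dots> \<le> liminf (\<lambda>n. ereal (1 / real n) * elog (P n))"
  proof (rule Liminf_mono)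
    show "\<forall>\<^sub>F n in sequentially. ereal (l n) \<le> ereal (1 / real n) * elog (P n)"
      using P eventually_gt_at_top[of 0]
    proof eventually_elim
      case (elim n)
      have "0 < P n" using elim(1) exp_gt_zero[of "real n * l n"] by linarith
      then have "real n * l n \<le> ln (P n)" using elim(1) by (simp add: ln_ge_iff)
      then have "l n \<le> ln (P n) / real n" using elim(2) by (simp add: field_simps)
      then show ?case using \<open>0 < P n\<close> by (simp add: elog_def)
    qed
  qed
  finally show ?thesis .
qed

context tracking_grid
begin

text \<open>Boxes are indexed by a cell and by whether the box is a \<open>renege_box\<close> or a \<open>void_box\<close>; the empty
  \<open>renege_box\<close> of a cell that is not busy is left out.\<close>

definition box_index :: "(nat \<times> bool) set" where
  "box_index = busy_cells \<times> {True} \<union> {..<2 ^ p} \<times> {False}"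

definition tracking_box :: "nat \<times> bool \<Rightarrow> (real \<times> real) set" where
  "tracking_box = (\<lambda>(k, b). if b then renege_box k else void_box k)"

definition box_area :: "nat \<times> bool \<Rightarrow> real" where
  "box_area = (\<lambda>(k, b). (if b then renege_level k else top_level k - renege_level k) * (T / 2 ^ p))"

definition target :: "(nat \<times> bool) count_index \<Rightarrow> real" where
  "target i = (case i of Arrivals k \<Rightarrow> incr T a p k | Services k \<Rightarrow> incr T s p k
     | Renegings (k, b) \<Rightarrow> if b then incr T \<zeta> p k else 0)"

definition target_mean :: "(nat \<times> bool) count_index \<Rightarrow> real" where
  "target_mean = noise_mean lam mu th T p box_area"

definition tracking_cost :: real where
  "tracking_cost = (\<Sum>i\<in>count_indices p box_index. relent (target i) (target_mean i))"

lemma busy_cells_subset: "busy_cells \<subseteq> {..<2 ^ p}"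
  by (auto simp: busy_cells_def)

lemma finite_box_index: "finite box_index"
  using finite_subset[OF busy_cells_subset] by (simp add: box_index_def)

lemma target_nonneg: "i \<in> count_indices p box_index \<Longrightarrow> 0 \<le> target i"
  using incr_nonneg[OF mono_a T_pos] incr_nonneg[OF mono_s T_pos] incr_nonneg[OF mono_\<zeta> T_pos] busy_cells_subset
  by (auto simp: target_def count_indices_def box_index_def)

lemma tracking_cost_le:
  assumes "0 \<le> \<rho>" "4 * \<eta> \<le> \<rho> * (\<delta> - 3 * \<eta>)" "0 < e" "0 \<le> \<delta> + 5 * \<eta> + 2 * z"
  shows "tracking_cost \<le> c + \<rho> * \<zeta> T + e + th * T * (\<delta> + 5 * \<eta> + 2 * z)"
proof -
  have void: "th * box_area (k, False) \<le> th * (\<delta> + 5 * \<eta> + 2 * z) * (T / 2 ^ p)" if "k < 2 ^ p" for k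
  proof -
    have "top_level k - renege_level k \<le> \<delta> + 5 * \<eta> + 2 * z"
      using margin_pos threshold by (auto simp: top_level_def renege_level_def)
    then show ?thesis using th_pos T_pos
        by (simp add: box_area_def divide_right_mono mult_right_mono mult_left_mono mult.assoc)
  qed
  have "tracking_cost = (\<Sum>k<2 ^ p. relent (incr T a p k) (lam * (T / 2 ^ p)))
        + (\<Sum>k<2 ^ p. relent (incr T s p k) (mu * (T / 2 ^ p)))
      + (\<Sum>j\<in>box_index. relent (target (Renegings j)) (th * box_area j))"
    unfolding tracking_cost_def target_mean_def noise_mean_def
    using finite_box_index by (subst sum.count_index) (simp_all add: finite_count_indices target_def)
  also have "(\<Sum>j\<in>box_index. relent (target (Renegings j)) (th * box_area j))
      = (\<Sum>k\<in>busy_cells. relent (incr T \<zeta> p k) (th * renege_level k * (T / 2 ^ p)))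
          + (\<Sum>k<2 ^ p. th * box_area (k, False))"
    unfolding box_index_def using finite_subset[OF busy_cells_subset]
    by (subst sum.union_disjoint; fastforce simp: sum.cartesian_product' target_def box_area_def relent_def mult.assoc)
  also have "(\<Sum>k<2 ^ p. th * box_area (k, False)) \<le> (\<Sum>k<(2::nat) ^ p. th * (\<delta> + 5 * \<eta> + 2 * z) * (T / 2 ^ p))"
    using void by (intro sum_mono) auto
  also have "\<dots> = th * T * (\<delta> + 5 * \<eta> + 2 * z)" by simp
  finally show ?thesis using imitation_cost_le[OF assms(1-3)] by linarith
qed

end

locale tracked_system = mm1m_system lam mu th T x0 x M N1 N2 N3 X Y + tracking_grid lam mu th T x0 c a s \<xi> \<zeta> p \<eta> \<delta> \<epsilon> z
  for lam mu th T x0 :: real and x :: "nat \<Rightarrow> real" and M :: "nat \<Rightarrow> 'w measure" and N1 N2 :: "nat \<Rightarrow> 'w \<Rightarrow> real measure"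
    and N3 :: "nat \<Rightarrow> 'w \<Rightarrow> (real \<times> real) measure" and X Y :: "nat \<Rightarrow> 'w \<Rightarrow> real \<Rightarrow> real"
    and c :: real and a s \<xi> \<zeta> :: "real \<Rightarrow> real" and p :: nat and \<eta> \<delta> \<epsilon> z :: real
begin

lemma noise_tracking_boxes:
  assumes "0 < n"
  shows "noise_boxes (M n) lam mu th T n (N1 n) (N2 n) (N3 n) box_index tracking_box box_area"
proof -
  interpret queue_noise "M n" lam mu th T n "N1 n" "N2 n" "N3 n" using assms by (rule queue_noise)
  have cell: "k < 2 ^ p" if "(k, b) \<in> box_index" for k b using that busy_cells_subset by (auto simp: box_index_def)
  show ?thesis
  proof
    show "finite box_index" by (rule finite_box_index)
    have "tracking_box i \<inter> tracking_box j = {}" if "i \<noteq> j" for i j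
    proof (cases "fst i = fst j")
      case True
      then show ?thesis
        using that by (cases i, cases j) (auto simp: tracking_box_def renege_box_def void_box_def)
    next
      case False
      then show ?thesis using time_cell_disjoint[OF T_pos False, of p]
        by (cases i, cases j) (auto simp: tracking_box_def renege_box_def void_box_def)
    qed
    then show "disjoint_family_on tracking_box box_index" by (simp add: disjoint_family_on_def)
    fix j assume "j \<in> box_index"
    then obtain k b where j: "j = (k, b)" "(k, b) \<in> box_index" "k < 2 ^ p" using cell by (cases j) auto
    note marks = levels[OF j(3)] and times = time_cell_subset[OF T_pos j(3)]
    show "tracking_box j \<in> sets borel"
      unfolding j(1) tracking_box_def renege_box_def void_box_def
      by (auto simp: time_cell_def intro!: Times_borel)
    show "tracking_box j \<subseteq> {0..T} \<times> {0..}"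
      using times marks by (auto simp: j(1) tracking_box_def renege_box_def void_box_def)
    show "0 < box_area j"
      using j marks threshold margin_pos T_pos
        by (auto simp: box_area_def box_index_def busy_cells_def renege_level_def)
    have "time_cell T p k \<in> sets borel" by (simp add: time_cell_def)
    then show "emeasure lborel (tracking_box j) = ennreal (box_area j)"
      using marks T_pos unfolding j(1) tracking_box_def renege_box_def void_box_def box_area_def
      by (auto simp: emeasure_lborel_Times emeasure_time_cell ennreal_mult[symmetric] mult.commute)
  qed
qed

lemma tracking_path_of_counts:
  assumes queue: "queue_path T n (N1 n \<omega>) (N2 n \<omega>) (x n) (N3 n \<omega>) (X n \<omega>) (Y n \<omega>)"
    and counts: "\<And>i. i \<in> count_indices p box_index \<Longrightarrow>
      noise_count T p tracking_box (N1 n \<omega>) (N2 n \<omega>) (N3 n \<omega>) i = real (nat \<lfloor>real n * target i\<rfloor>)"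
    and small: "1 / n \<le> \<eta>" "2 * (\<bar>x n - x0\<bar> + 3 * (2 ^ p / n + \<epsilon>)) + 2 * (\<epsilon> + 1 / n) < \<eta>"
  shows "tracking_path lam mu th T x0 c a s \<xi> \<zeta> p \<eta> \<delta> \<epsilon> z n (N1 n \<omega>) (N2 n \<omega>) (x n) (N3 n \<omega>) (X n \<omega>) (Y n \<omega>)"
proof -
  interpret queue_path T n "N1 n \<omega>" "N2 n \<omega>" "x n" "N3 n \<omega>" "X n \<omega>" "Y n \<omega>" by (rule queue)
  have near: "\<bar>measure \<nu> A / n - target i\<bar> \<le> 1 / n"
    if "i \<in> count_indices p box_index" "emeasure \<nu> A = of_nat (nat \<lfloor>real n * target i\<rfloor>)"
    for i and \<nu> :: "'b measure" and A
    using floor_mult_div_near[OF target_nonneg[OF that(1)] scale_pos] that(2)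
      by (simp add: measure_def ennreal_of_nat_eq_real_of_nat)
  note count_simps = noise_count_def count_index.case point_count_eq_iff
  have index: "Arrivals k \<in> count_indices p box_index" "Services k \<in> count_indices p box_index"
    "Renegings (k, False) \<in> count_indices p box_index" if "k < 2 ^ p" for k
    using that by (auto simp: count_indices_def box_index_def)
  have busy_index: "Renegings (k, True) \<in> count_indices p box_index" if "k \<in> busy_cells" for k
    using that by (auto simp: count_indices_def box_index_def)
  have busy: "emeasure (N3 n \<omega>) (renege_box k) = of_nat (nat \<lfloor>real n * target (Renegings (k, True))\<rfloor>)"
      if "k \<in> busy_cells" for k
    using counts[OF busy_index[OF that], unfolded count_simps] by (simp add: tracking_box_def)
  have idle: "renege_box k = {}" "imitated k = 0" if "k < 2 ^ p" "k \<notin> busy_cells" for k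
    using that by (auto simp: renege_box_def renege_level_def imitated_def busy_cells_def)
  show ?thesis
  proof
    fix k :: nat assume k: "k < 2 ^ p"
    show "\<bar>measure (N1 n \<omega>) (time_cell T p k) / n - incr T a p k\<bar> \<le> 1 / n"
      using near[OF index(1)[OF k] counts[OF index(1)[OF k], unfolded count_simps]] by (simp add: target_def)
    show "\<bar>measure (N2 n \<omega>) (time_cell T p k) / n - incr T s p k\<bar> \<le> 1 / n"
      using near[OF index(2)[OF k] counts[OF index(2)[OF k], unfolded count_simps]] by (simp add: target_def)
    show "emeasure (N3 n \<omega>) (renege_box k) < \<infinity>"
      using busy idle(1)[OF k] by (cases "k \<in> busy_cells") (simp_all add: ennreal_of_nat_eq_real_of_nat)
    show "\<bar>measure (N3 n \<omega>) (renege_box k) / n - imitated k\<bar> \<le> 1 / n"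
    proof (cases "k \<in> busy_cells")
      case True
      then show ?thesis
        using near[OF busy_index busy, OF True True] by (simp add: target_def imitated_def busy_cells_def)
    qed (use idle[OF k] in simp)
    show "emeasure (N3 n \<omega>) (void_box k) = 0"
      using counts[OF index(3)[OF k], unfolded count_simps] by (simp add: tracking_box_def target_def)
  qed (use small in auto)
qed

lemma path_in_open:
  assumes ball: "\<And>w. w \<in> cadlag_space T ({0..} \<times> {0..}) \<Longrightarrow> skorohod_dist T w (path_pair T \<xi> \<zeta>) \<le> 3 * z + 2 * \<eta> \<Longrightarrow> w \<in> G"
    and tracking: "tracking_path lam mu th T x0 c a s \<xi> \<zeta> p \<eta> \<delta> \<epsilon> z n (N1 n \<omega>) (N2 n \<omega>) (x n) (N3 n \<omega>) (X n \<omega>) (Y n \<omega>)"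
  shows "path n \<omega> \<in> G"
proof (rule ball)
  interpret tracking_path lam mu th T x0 c a s \<xi> \<zeta> p \<eta> \<delta> \<epsilon> z n "N1 n \<omega>" "N2 n \<omega>" "x n" "N3 n \<omega>" "X n \<omega>" "Y n \<omega>"
    by (rule tracking)
  show "path n \<omega> \<in> cadlag_space T ({0..} \<times> {0..})" by (rule cadlag)
  have "skorohod_dist T (path n \<omega>) (path_pair T \<xi> \<zeta>) \<le> (2 * z + \<eta>) + (z + \<eta>)"
    using stays_close skipped_total_nonneg margin_pos by (intro skorohod_dist_le_components) (auto simp: path_pair_def)
  then show "skorohod_dist T (path n \<omega>) (path_pair T \<xi> \<zeta>) \<le> 3 * z + 2 * \<eta>" by simp
qed

lemma eventually_small_error:
  "\<forall>\<^sub>F n in sequentially. 1 / real n \<le> \<eta> \<and> 2 * (\<bar>x n - x0\<bar> + 3 * (2 ^ p / n + \<epsilon>)) + 2 * (\<epsilon> + 1 / n) < \<eta>"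
proof -
  have "(\<lambda>n. 2 * (\<bar>x n - x0\<bar> + 3 * (2 ^ p * (1 / real n) + \<epsilon>)) + 2 * (\<epsilon> + 1 / n))
      \<longlonglongrightarrow> 2 * (\<bar>x0 - x0\<bar> + 3 * (2 ^ p * 0 + \<epsilon>)) + 2 * (\<epsilon> + 0)"
    by (intro tendsto_intros initial_lim lim_1_over_n)
  then have "\<forall>\<^sub>F n in sequentially. 2 * (\<bar>x n - x0\<bar> + 3 * (2 ^ p * (1 / real n) + \<epsilon>)) + 2 * (\<epsilon> + 1 / n) < \<eta>"
    using small_jumps by (intro order_tendstoD(2)) auto
  moreover have "\<forall>\<^sub>F n in sequentially. 1 / real n < \<eta>" using lim_1_over_n margin_pos by (rule order_tendstoD)
  ultimately show ?thesis by eventually_elim auto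
qed

definition log_weight :: "nat \<Rightarrow> real" where
  "log_weight n = - (\<Sum>i\<in>count_indices p box_index. relent (real (nat \<lfloor>real n * target i\<rfloor>) / n) (target_mean i))
     - (\<Sum>i\<in>count_indices p box_index. (ln (real (nat \<lfloor>real n * target i\<rfloor>)) + 1) / n)"

lemma tendsto_log_weight: "log_weight \<longlonglongrightarrow> - tracking_cost"
proof -
  interpret boxes: noise_boxes "M 1" lam mu th T 1 "N1 1" "N2 1" "N3 1" p box_index tracking_box box_area
    by (rule noise_tracking_boxes) simp
  have "log_weight \<longlonglongrightarrow> - tracking_cost - (\<Sum>i\<in>count_indices p box_index. 0)"
    unfolding log_weight_def tracking_cost_def target_mean_def
    by (intro tendsto_intros tendsto_relent_floor tendsto_ln_floor_div target_nonneg boxes.counts.intensity_pos)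
  then show ?thesis by simp
qed

theorem liminf_log_prob_ge:
  assumes G: "openin path_space G"
    and ball: "\<And>w. w \<in> cadlag_space T ({0..} \<times> {0..}) \<Longrightarrow> skorohod_dist T w (path_pair T \<xi> \<zeta>) \<le> 3 * z + 2 * \<eta> \<Longrightarrow> w \<in> G"
  shows "ereal (- tracking_cost) \<le> liminf (log_prob G)"
proof (rule liminf_elog_ge[OF tendsto_log_weight])
  show "\<forall>\<^sub>F n in sequentially. exp (real n * log_weight n) \<le> measure (M n) {\<omega> \<in> space (M n). path n \<omega> \<in> G}"
    using eventually_small_error eventually_gt_at_top[of 0]
  proof eventually_elim
    case (elim n)
    interpret boxes: noise_boxes "M n" lam mu th T n "N1 n" "N2 n" "N3 n" p box_index tracking_box box_area
      using elim(2) by (rule noise_tracking_boxes)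
    define \<kappa> where "\<kappa> i = nat \<lfloor>real n * target i\<rfloor>" for i
    have "real n * log_weight n
          = - (real n * (\<Sum>i\<in>count_indices p box_index. relent (real (\<kappa> i) / n) (boxes.mean_count i)))
        - (\<Sum>i\<in>count_indices p box_index. ln (real (\<kappa> i)) + 1)"
      using elim(2) by (simp add: log_weight_def target_mean_def \<kappa>_def right_diff_distrib flip: sum_divide_distrib)
    then have "exp (real n * log_weight n) \<le> measure (M n) (boxes.counts.counts_event \<kappa>)"
      using boxes.counts.prob_counts_event_ge[of \<kappa>] by simp
    also have "\<dots> \<le> measure (M n) {\<omega> \<in> space (M n). path n \<omega> \<in> G}"
    proof (rule boxes.finite_measure_mono_AE)
      show "{\<omega> \<in> space (M n). path n \<omega> \<in> G} \<in> sets (M n)" using elim(2) borel_of_open[OF G] by (rule sets_path_event)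
      show "AE \<omega> in M n. \<omega> \<in> boxes.counts.counts_event \<kappa> \<longrightarrow> \<omega> \<in> {\<omega> \<in> space (M n). path n \<omega> \<in> G}"
        using AE_queue_path[OF elim(2)]
      proof (eventually_elim, intro impI)
        fix \<omega> assume "queue_path T n (N1 n \<omega>) (N2 n \<omega>) (x n) (N3 n \<omega>) (X n \<omega>) (Y n \<omega>)"
          and counts: "\<omega> \<in> boxes.counts.counts_event \<kappa>"
        then have "path n \<omega> \<in> G"
          using elim(1) by (intro path_in_open[OF ball tracking_path_of_counts])
            (auto simp: boxes.counts.counts_event_def \<kappa>_def)
        then show "\<omega> \<in> {\<omega> \<in> space (M n). path n \<omega> \<in> G}" using counts by (simp add: boxes.counts.counts_event_def)
      qed
    qed
    finally show ?case .
  qed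
qed

end

context mm1m_system
begin

lemma liminf_log_prob_ge_rate:
  assumes G: "openin path_space G" and w: "w \<in> G" and rate: "mm1m_rate lam mu th x0 T w \<le> ennreal m" "0 \<le> m" and "0 < e"
  shows "ereal (- (m + 4 * e)) \<le> liminf (log_prob G)"
proof -
  interpret S: Metric_space "cadlag_space T ({0..} \<times> {0..} :: (real \<times> real) set)" "skorohod_dist T"
    using T_pos by (intro Metric_space_skorohod) simp
  define \<xi> where "\<xi> = (\<lambda>t. fst (w t))"
  define \<zeta> where "\<zeta> = (\<lambda>t. snd (w t))"
  have w_cadlag: "w \<in> cadlag_space T ({0..} \<times> {0..})" using w openin_subset[OF G] topspace_path_space by blast
  then have w_eq: "w = path_pair T \<xi> \<zeta>" by (rule cadlag_space_ext) (simp add: \<xi>_def \<zeta>_def)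
  obtain r where r: "0 < r" "S.mball w r \<subseteq> G"
    using G w unfolding skorohod_topology_def S.openin_mtopology by blast
  have "has_control_within lam mu th x0 T \<xi> \<zeta> (m + e)"
    unfolding \<xi>_def \<zeta>_def using rate \<open>0 < e\<close> by (rule mm1m_rate_leD)
  then obtain a s where "entropy_path lam mu th T x0 (m + e) a s \<xi> \<zeta>"
    by (rule has_control_within_imp_entropy_path) (use rate \<open>0 < e\<close> in auto)
  then interpret entropy_path lam mu th T x0 "m + e" a s \<xi> \<zeta> .
  define \<rho> where "\<rho> = e / (\<zeta> T + 1)"
  have "0 \<le> \<zeta> T" using \<zeta>_nonneg T_pos by simp
  then have \<rho>: "0 < \<rho>" "\<rho> * \<zeta> T \<le> e" using \<open>0 < e\<close> by (auto simp: \<rho>_def field_simps)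
  then have "0 < 4 / \<rho>" by simp
  obtain p \<eta> \<epsilon> z where grid: "tracking_grid lam mu th T x0 (m + e) a s \<xi> \<zeta> p \<eta> ((3 + 4 / \<rho>) * \<eta>) \<epsilon> z"
    and near: "3 * z + 2 * \<eta> < r" and void: "th * T * ((3 + 4 / \<rho>) * \<eta> + 5 * \<eta> + 2 * z) < e"
    by (rule obtain_tracking_grid[OF r(1) \<open>0 < e\<close> \<open>0 < 4 / \<rho>\<close>])
  interpret tracking_grid lam mu th T x0 "m + e" a s \<xi> \<zeta> p \<eta> "(3 + 4 / \<rho>) * \<eta>" \<epsilon> z by (rule grid)
  interpret tracked_system lam mu th T x0 x M N1 N2 N3 X Y "m + e" a s \<xi> \<zeta> p \<eta> "(3 + 4 / \<rho>) * \<eta>" \<epsilon> z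
    by unfold_locales
  have "\<rho> * ((3 + 4 / \<rho>) * \<eta> - 3 * \<eta>) = 4 * \<eta>" using \<rho>(1) by (simp add: field_simps)
  then have "tracking_cost \<le> (m + e) + \<rho> * \<zeta> T + e + th * T * ((3 + 4 / \<rho>) * \<eta> + 5 * \<eta> + 2 * z)"
    using \<rho>(1) \<open>0 < e\<close> margin_pos threshold skipped_total_nonneg by (intro tracking_cost_le) auto
  then have "ereal (- (m + 4 * e)) \<le> ereal (- tracking_cost)" using \<rho>(2) void by simp
  also have "\<dots> \<le> liminf (log_prob G)"
  proof (rule liminf_log_prob_ge[OF G])
    fix v assume "v \<in> cadlag_space T ({0..} \<times> {0..})" "skorohod_dist T v (path_pair T \<xi> \<zeta>) \<le> 3 * z + 2 * \<eta>"
    then have "v \<in> S.mball w r" using near w_cadlag by (simp add: w_eq S.in_mball S.commute)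
    then show "v \<in> G" using r(2) by blast
  qed
  finally show ?thesis .
qed

theorem ldp_lower_bound:
  assumes G: "openin path_space G"
  shows "- (INF w\<in>G. enn2ereal (mm1m_rate lam mu th x0 T w)) \<le> liminf (log_prob G)"
proof -
  have "- liminf (log_prob G) \<le> enn2ereal (mm1m_rate lam mu th x0 T w)" if w: "w \<in> G" for w
  proof (cases "mm1m_rate lam mu th x0 T w")
    case (real m)
    have "- ereal m \<le> liminf (log_prob G)"
    proof (rule ereal_le_epsilon2)
      fix e :: real assume "0 < e"
      then have "ereal (- (m + 4 * (e / 4))) \<le> liminf (log_prob G)"
        using real by (intro liminf_log_prob_ge_rate[OF G w]) auto
      then have "ereal (- m - e) + ereal e \<le> liminf (log_prob G) + ereal e" by (intro add_right_mono) simp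
      then show "- ereal m \<le> liminf (log_prob G) + ereal e" by simp
    qed
    then have "- liminf (log_prob G) \<le> ereal m" by (rule ereal_uminus_le_reorder[THEN iffD1])
    then show ?thesis using real by (simp add: enn2ereal_ennreal)
  qed simp
  then have "- liminf (log_prob G) \<le> (INF w\<in>G. enn2ereal (mm1m_rate lam mu th x0 T w))" by (rule INF_greatest)
  then show ?thesis by (rule ereal_uminus_le_reorder[THEN iffD1])
qed

end

theorem theorem2p1:
  fixes lam mu th T x0 :: real
    and x :: "nat \<Rightarrow> real"
    and M :: "nat \<Rightarrow> 'w measure"
    and N1 N2 :: "nat \<Rightarrow> 'w \<Rightarrow> real measure"
    and N3 :: "nat \<Rightarrow> 'w \<Rightarrow> (real \<times> real) measure"
    and X Y :: "nat \<Rightarrow> 'w \<Rightarrow> real \<Rightarrow> real"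
  assumes "0 < lam" "0 < mu" "0 < th" "0 < T"
    and "\<And>n. 0 < n \<Longrightarrow> 0 \<le> x n \<and> real n * x n \<in> \<nat>"
    and "x \<longlonglongrightarrow> x0"
    and "\<And>n. 0 < n \<Longrightarrow> prob_space (M n)"
    and "\<And>n. 0 < n \<Longrightarrow> mm1m_noise (M n) lam mu th T n (N1 n) (N2 n) (N3 n)"
    and "\<And>n. 0 < n \<Longrightarrow>
           (\<lambda>\<omega>. path_pair T (X n \<omega>) (Y n \<omega>)) \<in> M n \<rightarrow>\<^sub>M borel_of (skorohod_topology T ({0..} \<times> {0..}))"
    and "\<And>n. 0 < n \<Longrightarrow>
           AE \<omega> in M n. mm1m_equations T n (x n) (N1 n \<omega>) (N2 n \<omega>) (N3 n \<omega>) (X n \<omega>) (Y n \<omega>)"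
  shows "large_deviation_principle (skorohod_topology T ({0..} \<times> {0..})) M
           (\<lambda>n \<omega>. path_pair T (X n \<omega>) (Y n \<omega>)) (mm1m_rate lam mu th x0 T)"
proof -
  interpret mm1m_system lam mu th T x0 x M N1 N2 N3 X Y
  proof (intro mm1m_system.intro mm1m_system_axioms.intro queue_rates.intro)
    show "0 \<le> x n" if "0 < n" for n using assms(5)[OF that] by (rule conjunct1)
  qed (fact assms)+
  show ?thesis
    unfolding large_deviation_principle_def
    by (intro conjI allI impI rate_function_mm1m_rate x0_nonneg ldp_upper_bound ldp_lower_bound)
qed

end
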